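(* Let $m\in(0,1)$, $\gamma\in(0,\infty)$, $\alpha\in(\tfrac12,1]$, and set $s(\gamma)=\min\{\tfrac{2-m}4+\tfrac{m(1-2\alpha)}{4\gamma},\ \tfrac12(1-\tfrac{m\alpha}\gamma)^+\}$. For every admissible curve $\Gamma$ with Hölder exponent $\alpha$ and every $s>s(\gamma)$, $\lim_{t\to0^+}P^m_\gamma f(\Gamma(x,t),t)=f(x)$ for a.e. $x\in\mathbb{R}$, for all $f\in H^s(\mathbb{R})$. Conversely, there exists an admissible curve $\Gamma$ with Hölder exponent $\alpha$ such that for every $s<s(\gamma)$ there is $f\in H^s(\mathbb{R})$ for which this a.e. convergence fails.
   Context: For $m>0$, $\gamma>0$, $f\in H^s(\mathbb{R})$, $\Gamma:\mathbb{R}\times[-1,1]\to\mathbb{R}$ and $t\in[0,1]$, define $$P^m_\gamma f(\Gamma(x,t),t)=\frac1{2\pi}\int_{\mathbb{R}}e^{i(\Gamma(x,t)\xi+t|\xi|^m)}e^{-t^\gamma|\xi|^m}\hat f(\xi)\,d\xi,$$ where $\hat f(\xi)=\int e^{-ix\xi}f(x)\,dx$. An admissible curve with Hölder exponent $\alpha\in(0,1]$ is a continuous $\Gamma:\mathbb{R}\times[-1,1]\to\mathbb{R}$ with $\Gamma(x,0)=x$, bilipschitz in $x$: $C_1|x-x'|\le|\Gamma(x,t)-\Gamma(x',t)|\le C_2|x-x'|$ for all $t\in[-1,1]$, $x,x'\in\mathbb{R}$, and $\alpha$-Hölder in $t$: $|\Gamma(x,t)-\Gamma(x,t')|\le C_3|t-t'|^\alpha$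 for all $x\in\mathbb{R}$, $t,t'\in[-1,1]$, with constants $C_1,C_2,C_3>0$. $a^+=\max\{a,0\}$.
   Formalization: For s<0, H^s(R) contains distributions, for which f(x) is undefined: f is taken in L^2(R), and the converse is stated for 0≤s<s(γ). If γ≤mα then s(γ)≤0, every f in L^2 converges, and the converse is empty; if γ>mα then s(γ)>0 and nothing is lost. *)

theory Defs
  imports "HOL-Analysis.Analysis"
begin

definition L2_fun :: "(real \<Rightarrow> complex) \<Rightarrow> bool" where
  "L2_fun f \<longleftrightarrow> f \<in> borel_measurable lborel \<and> integrable lborel (\<lambda>x. (cmod (f x))\<^sup>2)"

definition fourier_L2 :: "(real \<Rightarrow> complex) \<Rightarrow> (real \<Rightarrow> complex) \<Rightarrow> bool" where
  "fourier_L2 f g \<longleftrightarrow> L2_fun f \<and> L2_fun g \<and>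
     ((\<lambda>R. \<integral>\<xi>. (cmod ((LINT x:{-R..R}|lborel. exp (- \<i> * complex_of_real (x * \<xi>)) * f x) - g \<xi>))\<^sup>2 \<partial>lborel)
        \<longlongrightarrow> 0) at_top"

definition fourier_hat :: "(real \<Rightarrow> complex) \<Rightarrow> real \<Rightarrow> complex" where
  "fourier_hat f = (SOME g. fourier_L2 f g)"

definition sobolev :: "real \<Rightarrow> (real \<Rightarrow> complex) \<Rightarrow> bool" where
  "sobolev s f \<longleftrightarrow> L2_fun f \<and> (\<exists>g. fourier_L2 f g \<and>
      integrable lborel (\<lambda>\<xi>. (1 + \<xi>\<^sup>2) powr s * (cmod (g \<xi>))\<^sup>2))"

definition Pop :: "real \<Rightarrow> real \<Rightarrow> (real \<Rightarrow> complex) \<Rightarrow> real \<Rightarrow> real \<Rightarrow> complex" where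
  "Pop m \<gamma> f y t = complex_of_real (1 / (2 * pi)) *
     (\<integral>\<xi>. exp (\<i> * complex_of_real (y * \<xi> + t * \<bar>\<xi>\<bar> powr m))
            * complex_of_real (exp (- (t powr \<gamma>) * \<bar>\<xi>\<bar> powr m)) * fourier_hat f \<xi> \<partial>lborel)"

definition admissible :: "real \<Rightarrow> (real \<Rightarrow> real \<Rightarrow> real) \<Rightarrow> bool" where
  "admissible \<alpha> \<Gamma> \<longleftrightarrow>
     continuous_on (UNIV \<times> {-1..1}) (\<lambda>(x, t). \<Gamma> x t) \<and>
     (\<forall>x. \<Gamma> x 0 = x) \<and>
     (\<exists>C1 C2 C3. C1 > 0 \<and> C2 > 0 \<and> C3 > 0 \<and>
        (\<forall>t\<in>{-1..1}. \<forall>x x'. C1 * \<bar>x - x'\<bar> \<le> \<bar>\<Gamma> x t - \<Gamma> x' t\<bar> \<and>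
                               \<bar>\<Gamma> x t - \<Gamma> x' t\<bar> \<le> C2 * \<bar>x - x'\<bar>) \<and>
        (\<forall>x. \<forall>t\<in>{-1..1}. \<forall>t'\<in>{-1..1}. \<bar>\<Gamma> x t - \<Gamma> x t'\<bar> \<le> C3 * \<bar>t - t'\<bar> powr \<alpha>))"

definition s_crit :: "real \<Rightarrow> real \<Rightarrow> real \<Rightarrow> real" where
  "s_crit m \<alpha> \<gamma> = min ((2 - m) / 4 + m * (1 - 2 * \<alpha>) / (4 * \<gamma>))
                         (1/2 * max (1 - m * \<alpha> / \<gamma>) 0)"

definition converges_ae :: "real \<Rightarrow> real \<Rightarrow> (real \<Rightarrow> real \<Rightarrow> real) \<Rightarrow> (real \<Rightarrow> complex) \<Rightarrow> bool" where
  "converges_ae m \<gamma> \<Gamma> f \<longleftrightarrow>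
     (AE x in lborel. ((\<lambda>t. Pop m \<gamma> f (\<Gamma> x t) t) \<longlongrightarrow> f x) (at_right 0))"

end

theory Submission
  imports Defs "HOL-Probability.Probability"
begin

text \<open>For convergence, a frequency piece \<open>\<bar>\<xi>\<bar> \<sim> L\<close> of the maximal function along the curve is linearised by
  choosing a time \<open>t(x)\<close> for every \<open>x\<close> and estimated by the \<open>T T*\<close> method. The kernel is the oscillatory integral
  with phase \<open>(\<Gamma> x t - \<Gamma> x' t') \<xi> + (t - t') \<xi> powr m\<close> and damping \<open>exp (- (t powr \<gamma> + t' powr \<gamma>) \<xi> powr m)\<close>. If
  \<open>\<bar>x - x'\<bar>\<close> dominates \<open>\<bar>t - t'\<bar> powr \<alpha>\<close> the phase has no stationary point; otherwise van der Corput's second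
  derivative estimate is played against the damping. Both give \<open>C L powr (2 \<sigma>) \<bar>x - x'\<bar> powr (- p)\<close> with
  \<open>p < 1\<close> for \<open>\<sigma>\<close> above the critical exponent, so Schur's test sums the pieces, and the operator is compared with
  the purely dissipative one on the line, which converges at Lebesgue points. If \<open>\<gamma> \<le> m \<alpha>\<close> the curve
  moves by at most the width \<open>t powr (\<gamma> / m)\<close> of the damped kernel and Lebesgue points suffice for all of \<open>L\<^sup>2\<close>.

  For divergence, take \<open>\<Gamma> x t = x - \<bar>t\<bar> powr \<alpha>\<close>. At frequency \<open>L\<close> one superposes wave packets focusing at equally
  spaced points, so dense that for every \<open>x\<close> in \<open>[1, 2]\<close> some time \<open>t\<close> of order \<open>L powr (- m / \<gamma>)\<close> carries \<open>x\<close>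
  onto one of them, where the solution is large. A gliding hump over rapidly increasing frequencies gives
  unboundedness at every such \<open>x\<close>.\<close>

section \<open>Plancherel's theorem\<close>

text \<open>The two entries of the minimum are two ways of paying for the singularity of the kernel.
  For close points the damping is bounded below by a power of \<open>|x - x'|\<close>, so decay in
  \<open>L\<close> can be bought with negative powers of \<open>|x - x'|\<close>, but only as long
  as the total power stays locally integrable. Starting from the trivial bound \<open>L\<close>,
  this budget ends at the second entry; starting from van der Corput's bound it ends at the first,
  and \<alpha> > 1/2 is what leaves anything to spend there. The counterexample meets the same
  alternative: its frequency window is limited either by \<open>L\<close> itself or by the
  dispersion at the time when the damping sets in, and the exponent of the window minus that of the
  number of focusing points is exactly twice the critical index. Comparison with the dissipative
  flow serves to identify the limit: the maximal bounds then only have to make high-frequency tails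
  small uniformly in time. Since \<open>fourier_hat\<close> is a choice, everything is proved for an
  arbitrary transform of \<open>f\<close> and transported by uniqueness up to null sets.\<close>

lemma borel_measurable_cis [measurable (raw)]:
  assumes "f \<in> borel_measurable M"
  shows "(\<lambda>x. cis (f x)) \<in> borel_measurable M"
proof -
  have "continuous_on UNIV cis" by (intro continuous_intros)
  then have "cis \<in> borel_measurable borel" by (rule borel_measurable_continuous_onI)
  then show ?thesis using assms by (rule measurable_compose[rotated])
qed

lemma borel_measurable_cnj [measurable (raw)]:
  assumes "f \<in> borel_measurable M"
  shows "(\<lambda>x. cnj (f x)) \<in> borel_measurable M"
proof -
  have "continuous_on UNIV cnj" by (intro continuous_intros)
  then have "cnj \<in> borel_measurable borel" by (rule borel_measurable_continuous_onI)
  then show ?thesis using assms by (rule measurable_compose[rotated])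
qed

lemma integrable_gauss:
  assumes "\<epsilon> > 0" shows "integrable lborel (\<lambda>x::real. exp (- (\<epsilon> * x)\<^sup>2 / 2))"
proof -
  have "integrable lborel (\<lambda>x::real. sqrt (2*pi) * std_normal_density x)"
    by (intro integrable_mult_right integrable_normal_density) auto
  then have "integrable lborel (\<lambda>x::real. exp (- x\<^sup>2 / 2))"
    by (simp add: std_normal_density_def)
  from lborel_integrable_real_affine[OF this, of \<epsilon> 0] show ?thesis using assms by simp
qed

text \<open>Obtained from the characteristic function of the standard normal law by clearing the
  density's constant and rescaling, so no contour shift is involved.\<close>

lemma gauss_fourier:
  assumes "\<epsilon> > 0"
  shows "(\<integral>x. complex_of_real (exp (- (\<epsilon> * x)\<^sup>2 / 2)) * cis (v * x) \<partial>lborel)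
     = complex_of_real (sqrt (2 * pi) / \<epsilon> * exp (- (v / \<epsilon>)\<^sup>2 / 2))"
proof -
  have "(\<integral>x. complex_of_real (exp (- x\<^sup>2 / 2)) * cis (t * x) \<partial>lborel)
      = complex_of_real (sqrt (2 * pi) * exp (- t\<^sup>2 / 2))" for t
  proof -
    have "complex_of_real (exp (- t\<^sup>2 / 2)) = char std_normal_distribution t"
      by (simp add: char_std_normal_distribution)
    also have "\<dots> = (\<integral>x. std_normal_density x *\<^sub>R exp (\<i> * complex_of_real (t * x)) \<partial>lborel)"
      unfolding char_def by (subst integral_density) auto
    also have "\<dots> = (\<integral>x. complex_of_real (1 / sqrt (2 * pi)) * (complex_of_real (exp (- x\<^sup>2 / 2)) * cis (t * x)) \<partial>lborel)"
      by (intro Bochner_Integration.integral_cong) (auto simp: std_normal_density_def scaleR_conv_of_real cis_conv_exp)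
    also have "\<dots> = complex_of_real (1 / sqrt (2 * pi)) * (\<integral>x. complex_of_real (exp (- x\<^sup>2 / 2)) * cis (t * x) \<partial>lborel)"
      by simp
    finally show ?thesis by (simp add: field_simps)
  qed
  from this[of "v/\<epsilon>"] show ?thesis
    using assms
    by (subst (asm) lborel_integral_real_affine[where c=\<epsilon> and t=0])
       (auto simp: field_simps scaleR_conv_of_real)
qed

lemma gauss_integral:
  assumes "\<epsilon> > 0"
  shows "(\<integral>v. 1 / \<epsilon> * exp (- (v / \<epsilon>)\<^sup>2 / 2) \<partial>lborel) = sqrt (2 * pi)"
proof -
  have "complex_of_real (\<integral>v. exp (- ((1/\<epsilon>) * v)\<^sup>2 / 2) \<partial>lborel) = complex_of_real (sqrt (2 * pi) * \<epsilon>)"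
    using gauss_fourier[of "1/\<epsilon>" 0] assms unfolding integral_complex_of_real[symmetric] by simp
  then have "(\<integral>v. exp (- ((1/\<epsilon>) * v)\<^sup>2 / 2) \<partial>lborel) = sqrt (2 * pi) * \<epsilon>"
    using of_real_eq_iff by blast
  then show ?thesis using assms by (simp add: field_simps)
qed

text \<open>Neither normalised nor with the sign of \<open>fourier_hat\<close>: the forward
  transform is \<open>FT\<close> at \<open>- \<xi>\<close>, the inverse one is \<open>FT\<close>
  divided by \<open>2 * pi\<close>.\<close>

definition FT :: "(real \<Rightarrow> complex) \<Rightarrow> real \<Rightarrow> complex" where
  "FT G x = (\<integral>\<xi>. cis (x * \<xi>) * G \<xi> \<partial>lborel)"

lemma integrable_cis_mult:
  assumes "integrable M G" "h \<in> borel_measurable M"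
  shows "integrable M (\<lambda>x. cis (h x) * G x)"
  by (rule Bochner_Integration.integrable_bound[OF assms(1)]) (use assms in \<open>auto simp: norm_mult\<close>)

lemma FT_measurable [measurable]:
  assumes [measurable]: "G \<in> borel_measurable lborel"
  shows "FT G \<in> borel_measurable lborel"
  unfolding FT_def by measurable

lemma FT_bound:
  assumes "integrable lborel G"
  shows "cmod (FT G x) \<le> (\<integral>\<xi>. cmod (G \<xi>) \<partial>lborel)"
  unfolding FT_def
  by (rule order_trans[OF integral_norm_bound]) (simp add: norm_mult)

text \<open>Gaussian regularisation avoids any a priori integrability of the transform.\<close>

lemma FT_gauss:
  assumes G: "integrable lborel G" and e: "\<epsilon> > 0"
  shows "complex_of_real (\<integral>x. exp (- (\<epsilon> * x)\<^sup>2 / 2) * (cmod (FT G x))\<^sup>2 \<partial>lborel) =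
    (\<integral>p. G (fst p) * cnj (G (snd p)) * complex_of_real (sqrt (2 * pi) / \<epsilon> * exp (- ((fst p - snd p) / \<epsilon>)\<^sup>2 / 2)) \<partial>(lborel \<Otimes>\<^sub>M lborel))"
proof -
  have [measurable]: "G \<in> borel_measurable borel" using G by auto
  let ?w = "\<lambda>x. complex_of_real (exp (- (\<epsilon> * x)\<^sup>2 / 2))"
  have w: "integrable lborel ?w" using integrable_gauss[OF e] by (rule integrable_of_real)
  have GG: "integrable (lborel \<Otimes>\<^sub>M lborel) (\<lambda>p. G (fst p) * cnj (G (snd p)))"
  proof (rule lborel_pair.Fubini_integrable)
    show "integrable lborel (\<lambda>x. \<integral>y. cmod (G (fst (x, y)) * cnj (G (snd (x, y)))) \<partial>lborel)"
      using G by (simp add: norm_mult)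
    show "AE x in lborel. integrable lborel (\<lambda>y. G (fst (x, y)) * cnj (G (snd (x, y))))"
      using G by (intro AE_I2) simp
  qed measurable
  have "complex_of_real (exp (- (\<epsilon> * x)\<^sup>2 / 2) * (cmod (FT G x))\<^sup>2)
     = ?w x * (\<integral>p. cis (x * fst p) * G (fst p) * cnj (cis (x * snd p) * G (snd p)) \<partial>(lborel \<Otimes>\<^sub>M lborel))" for x
  proof -
    have i: "integrable lborel (\<lambda>\<xi>. cis (x * \<xi>) * G \<xi>)" using G by (intro integrable_cis_mult) auto
    have "integrable (lborel \<Otimes>\<^sub>M lborel) (\<lambda>p. cis (x * fst p) * G (fst p) * cnj (cis (x * snd p) * G (snd p)))"
      by (rule Bochner_Integration.integrable_bound[OF GG]) (auto simp: norm_mult)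
    from lborel_pair.integral_fst'[OF this]
    have "(\<integral>p. cis (x * fst p) * G (fst p) * cnj (cis (x * snd p) * G (snd p)) \<partial>(lborel \<Otimes>\<^sub>M lborel))
       = FT G x * cnj (FT G x)"
      by (simp add: FT_def del: complex_cnj_mult flip: integral_cnj)
    then show ?thesis
      using complex_norm_square[of "FT G x"] by simp
  qed
  then have "complex_of_real (\<integral>x. exp (- (\<epsilon> * x)\<^sup>2 / 2) * (cmod (FT G x))\<^sup>2 \<partial>lborel)
     = (\<integral>x. (\<integral>p. ?w x * (cis (x * fst p) * G (fst p) * cnj (cis (x * snd p) * G (snd p))) \<partial>(lborel \<Otimes>\<^sub>M lborel)) \<partial>lborel)"
    by (simp flip: integral_complex_of_real)
  also have "\<dots> = (\<integral>p. (\<integral>x. ?w x * (cis (x * fst p) * G (fst p) * cnj (cis (x * snd p) * G (snd p))) \<partial>lborel) \<partial>(lborel \<Otimes>\<^sub>M lborel))"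
  proof -
    interpret Q: pair_sigma_finite "lborel \<Otimes>\<^sub>M lborel :: (real \<times> real) measure" "lborel :: real measure"
      by (simp add: lborel_prod pair_sigma_finite_def sigma_finite_lborel)
    have "integrable ((lborel \<Otimes>\<^sub>M lborel) \<Otimes>\<^sub>M lborel) (\<lambda>q. G (fst (fst q)) * cnj (G (snd (fst q))) * ?w (snd q))"
    proof (intro Q.Fubini_integrable)
      show "integrable (lborel \<Otimes>\<^sub>M lborel) (\<lambda>x. \<integral>y. cmod (G (fst (fst (x, y))) * cnj (G (snd (fst (x, y)))) * ?w (snd (x, y))) \<partial>lborel)"
        using integrable_norm[OF GG] by (simp add: norm_mult)
      show "AE x in lborel \<Otimes>\<^sub>M lborel. integrable lborel (\<lambda>y. G (fst (fst (x, y))) * cnj (G (snd (fst (x, y)))) * ?w (snd (x, y)))"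
        using w by (intro AE_I2) simp
    qed measurable
    then have "integrable ((lborel \<Otimes>\<^sub>M lborel) \<Otimes>\<^sub>M lborel)
       (\<lambda>(p,x). ?w x * (cis (x * fst p) * G (fst p) * cnj (cis (x * snd p) * G (snd p))))"
      by (rule Bochner_Integration.integrable_bound) (auto simp: norm_mult)
    from Q.Fubini_integral[OF this] show ?thesis .
  qed
  also have "\<dots> = (\<integral>p. G (fst p) * cnj (G (snd p)) * (\<integral>x. ?w x * cis ((fst p - snd p) * x) \<partial>lborel) \<partial>(lborel \<Otimes>\<^sub>M lborel))"
  proof -
    have "?w x * (cis (x * a) * A * cnj (cis (x * b) * B)) = A * cnj B * (?w x * cis ((a - b) * x))" for x a b A B
    proof -
      have "cis ((a - b) * x) = cis (x * a) * cnj (cis (x * b))"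
        by (simp add: cis_cnj cis_mult algebra_simps)
      then show ?thesis by simp
    qed
    then show ?thesis by (simp only: integral_mult_right_zero)
  qed
  finally show ?thesis by (simp only: gauss_fourier[OF e])
qed

text \<open>The inequality \<open>2 u x u y \<le> (u x)^2 + (u y)^2\<close> splits the form into two
  halves, and symmetry with Fubini reduces both to a row integral of \<open>\<kappa>\<close>.
  Working in \<open>ennreal\<close> spares every integrability check. It serves the Gaussian kernel
  here and the kernel of \<open>T T*\<close> later.\<close>

lemma schur_test:
  fixes u :: "real \<Rightarrow> real" and \<kappa> :: "real \<Rightarrow> real \<Rightarrow> ennreal"
  assumes [measurable]: "u \<in> borel_measurable borel"
      "(\<lambda>p. \<kappa> (fst p) (snd p)) \<in> borel_measurable (borel \<Otimes>\<^sub>M borel)"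
    and u0: "\<And>x. u x \<ge> 0" and sym: "\<And>x y. \<kappa> x y = \<kappa> y x"
    and bd: "\<And>x. (\<integral>\<^sup>+y. \<kappa> x y \<partial>lborel) \<le> M"
  shows "(\<integral>\<^sup>+x. \<integral>\<^sup>+y. ennreal (u x * u y) * \<kappa> x y \<partial>lborel \<partial>lborel) \<le> M * (\<integral>\<^sup>+x. ennreal ((u x)\<^sup>2) \<partial>lborel)"
proof -
  have [measurable]: "(\<lambda>y. \<kappa> x y) \<in> borel_measurable borel" for x
    using measurable_compose[OF measurable_Pair1'[of x borel borel] assms(2)] by simp
  have le: "ennreal (u x * u y) * \<kappa> x y \<le> ennreal ((u x)\<^sup>2 / 2) * \<kappa> x y + ennreal ((u y)\<^sup>2 / 2) * \<kappa> x y" for x y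
  proof -
    have "u x * u y \<le> (u x)\<^sup>2 / 2 + (u y)\<^sup>2 / 2"
      using sum_squares_bound[of "u x" "u y"] by simp
    then have "ennreal (u x * u y) \<le> ennreal ((u x)\<^sup>2 / 2) + ennreal ((u y)\<^sup>2 / 2)"
      by (subst ennreal_plus[symmetric]) (simp_all only: ennreal_leI zero_le_power2 divide_nonneg_nonneg zero_le_numeral)
    then show ?thesis
      by (metis distrib_right mult_right_mono zero_le)
  qed
  let ?I = "\<integral>\<^sup>+x. ennreal ((u x)\<^sup>2 / 2) * (\<integral>\<^sup>+y. \<kappa> x y \<partial>lborel) \<partial>lborel"
  have "(\<integral>\<^sup>+x. \<integral>\<^sup>+y. ennreal (u x * u y) * \<kappa> x y \<partial>lborel \<partial>lborel)
      \<le> (\<integral>\<^sup>+x. \<integral>\<^sup>+y. ennreal ((u x)\<^sup>2 / 2) * \<kappa> x y + ennreal ((u y)\<^sup>2 / 2) * \<kappa> x y \<partial>lborel \<partial>lborel)"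
    by (intro nn_integral_mono le)
  also have "\<dots> = ?I + (\<integral>\<^sup>+x. \<integral>\<^sup>+y. ennreal ((u y)\<^sup>2 / 2) * \<kappa> x y \<partial>lborel \<partial>lborel)"
    by (subst nn_integral_add, measurable, subst nn_integral_add, measurable, simp add: nn_integral_cmult)
  also have "(\<integral>\<^sup>+x. \<integral>\<^sup>+y. ennreal ((u y)\<^sup>2 / 2) * \<kappa> x y \<partial>lborel \<partial>lborel)
     = (\<integral>\<^sup>+y. \<integral>\<^sup>+x. ennreal ((u y)\<^sup>2 / 2) * \<kappa> x y \<partial>lborel \<partial>lborel)"
  proof (rule lborel_pair.Fubini')
    have "(\<lambda>p. \<kappa> (snd p) (fst p)) \<in> borel_measurable (borel \<Otimes>\<^sub>M borel)"
      using assms(2) by (subst sym)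
    then show "(\<lambda>(y, x). ennreal ((u y)\<^sup>2 / 2) * \<kappa> x y) \<in> borel_measurable (lborel \<Otimes>\<^sub>M lborel)"
      unfolding case_prod_beta' by measurable
  qed
  also have "\<dots> = ?I"
    by (subst sym) (simp add: nn_integral_cmult)
  also have "?I + ?I \<le> (\<integral>\<^sup>+x. ennreal ((u x)\<^sup>2 / 2) * M \<partial>lborel) + (\<integral>\<^sup>+x. ennreal ((u x)\<^sup>2 / 2) * M \<partial>lborel)"
    by (intro add_mono nn_integral_mono mult_left_mono bd) auto
  also have "\<dots> = (\<integral>\<^sup>+x. M * ennreal ((u x)\<^sup>2) \<partial>lborel)"
  proof (subst nn_integral_add[symmetric], measurable, intro nn_integral_cong)
    fix x
    have "ennreal ((u x)\<^sup>2 / 2) + ennreal ((u x)\<^sup>2 / 2) = ennreal ((u x)\<^sup>2)"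
      by (subst ennreal_plus[symmetric]) simp_all
    then show "ennreal ((u x)\<^sup>2 / 2) * M + ennreal ((u x)\<^sup>2 / 2) * M = M * ennreal ((u x)\<^sup>2)"
      by (metis distrib_right mult.commute)
  qed
  also have "\<dots> = M * (\<integral>\<^sup>+x. ennreal ((u x)\<^sup>2) \<partial>lborel)"
    by (simp add: nn_integral_cmult)
  finally show ?thesis .
qed

lemma nn_integral_gauss_kernel:
  assumes "\<epsilon> > 0"
  shows "(\<integral>\<^sup>+y. ennreal (sqrt (2 * pi) / \<epsilon> * exp (- ((x - y) / \<epsilon>)\<^sup>2 / 2)) \<partial>lborel) = ennreal (2 * pi)"
proof -
  let ?k = "\<lambda>v. sqrt (2 * pi) / \<epsilon> * exp (- (v / \<epsilon>)\<^sup>2 / 2)"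
  have "(\<integral>\<^sup>+y. ennreal (?k (x - y)) \<partial>lborel) = (\<integral>\<^sup>+v. ennreal (?k v) \<partial>lborel)"
    by (subst (2) nn_integral_real_affine[where c="-1" and t=x]) auto
  also have "\<dots> = ennreal (\<integral>v. ?k v \<partial>lborel)"
    using integrable_gauss[of "1/\<epsilon>"] assms by (intro nn_integral_eq_integral) auto
  also have "(\<integral>v. ?k v \<partial>lborel) = (\<integral>v. sqrt (2 * pi) * (1 / \<epsilon> * exp (- (v / \<epsilon>)\<^sup>2 / 2)) \<partial>lborel)"
    by simp
  also have "\<dots> = 2 * pi"
    using gauss_integral[OF assms] by (subst integral_mult_right_zero) simp
  finally show ?thesis .
qed

lemma integrable_gauss_FT:
  assumes G: "integrable lborel G" and e: "\<epsilon> > 0"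
  shows "integrable lborel (\<lambda>x. exp (- (\<epsilon> * x)\<^sup>2 / 2) * (cmod (FT G x))\<^sup>2)"
proof (rule Bochner_Integration.integrable_bound)
  show "integrable lborel (\<lambda>x. (\<integral>\<xi>. cmod (G \<xi>) \<partial>lborel)\<^sup>2 * exp (- (\<epsilon> * x)\<^sup>2 / 2))"
    using integrable_gauss[OF e] by simp
  have [measurable]: "G \<in> borel_measurable borel" using G by auto
  show "(\<lambda>x. exp (- (\<epsilon> * x)\<^sup>2 / 2) * (cmod (FT G x))\<^sup>2) \<in> borel_measurable lborel"
    by measurable
  show "AE x in lborel. norm (exp (- (\<epsilon> * x)\<^sup>2 / 2) * (cmod (FT G x))\<^sup>2)
      \<le> norm ((\<integral>\<xi>. cmod (G \<xi>) \<partial>lborel)\<^sup>2 * exp (- (\<epsilon> * x)\<^sup>2 / 2))"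
    using FT_bound[OF G] by (intro AE_I2) (auto simp: mult.commute intro!: mult_right_mono power_mono)
qed

text \<open>The regularised square norm is a quadratic form of \<open>G\<close> in a Gaussian kernel
  whose rows have mass \<open>2 * pi\<close>, whatever \<epsilon> is; Schur's test therefore gives a
  bound uniform in \<epsilon>.\<close>

lemma FT_gauss_le:
  assumes G: "integrable lborel G" and e: "\<epsilon> > 0"
  shows "(\<integral>\<^sup>+x. ennreal (exp (- (\<epsilon> * x)\<^sup>2 / 2) * (cmod (FT G x))\<^sup>2) \<partial>lborel)
     \<le> ennreal (2 * pi) * (\<integral>\<^sup>+x. ennreal ((cmod (G x))\<^sup>2) \<partial>lborel)"
proof -
  have [measurable]: "G \<in> borel_measurable borel" using G by auto
  let ?k = "\<lambda>v. sqrt (2 * pi) / \<epsilon> * exp (- (v / \<epsilon>)\<^sup>2 / 2)"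
  let ?Q = "\<lambda>p. G (fst p) * cnj (G (snd p)) * complex_of_real (?k (fst p - snd p))"
  have Q[measurable]: "?Q \<in> borel_measurable (lborel \<Otimes>\<^sub>M lborel)" by measurable
  let ?L = "\<integral>x. exp (- (\<epsilon> * x)\<^sup>2 / 2) * (cmod (FT G x))\<^sup>2 \<partial>lborel"
  have "(\<integral>\<^sup>+x. ennreal (exp (- (\<epsilon> * x)\<^sup>2 / 2) * (cmod (FT G x))\<^sup>2) \<partial>lborel) = ennreal ?L"
    by (intro nn_integral_eq_integral integrable_gauss_FT G e) auto
  also have "?L = cmod (complex_of_real ?L)"
    by simp
  also have "ennreal \<dots> \<le> (\<integral>\<^sup>+p. ennreal (cmod (?Q p)) \<partial>(lborel \<Otimes>\<^sub>M lborel))"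
    unfolding FT_gauss[OF G e]
  proof (cases "integrable (lborel \<Otimes>\<^sub>M lborel) ?Q")
    case True then show "ennreal (cmod (\<integral>p. ?Q p \<partial>(lborel \<Otimes>\<^sub>M lborel))) \<le> (\<integral>\<^sup>+p. ennreal (cmod (?Q p)) \<partial>(lborel \<Otimes>\<^sub>M lborel))"
      by (rule integral_norm_bound_ennreal)
  next
    \<comment> \<open>A Bochner integral that does not exist has the value 0, so the estimate is
      trivial in this case.\<close>
    case False
    then have "(\<integral>p. ?Q p \<partial>(lborel \<Otimes>\<^sub>M lborel)) = 0" by (rule not_integrable_integral_eq)
    then show "ennreal (cmod (\<integral>p. ?Q p \<partial>(lborel \<Otimes>\<^sub>M lborel))) \<le> (\<integral>\<^sup>+p. ennreal (cmod (?Q p)) \<partial>(lborel \<Otimes>\<^sub>M lborel))"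
      by (simp only: norm_zero ennreal_0 zero_le)
  qed
  also have "\<dots> = (\<integral>\<^sup>+x. \<integral>\<^sup>+y. ennreal (cmod (G x) * cmod (G y)) * ennreal (?k (x - y)) \<partial>lborel \<partial>lborel)"
  proof -
    have *: "ennreal (cmod (?Q (x, y))) = ennreal (cmod (G x) * cmod (G y)) * ennreal (?k (x - y))" for x y
    proof -
      have "cmod (?Q (x, y)) = cmod (G x) * cmod (G y) * ?k (x - y)"
        using e by (simp only: norm_mult norm_of_real fst_conv snd_conv complex_mod_cnj abs_of_nonneg
              mult_nonneg_nonneg exp_ge_zero divide_nonneg_pos real_sqrt_ge_zero pi_ge_zero zero_le_numeral)
      then show ?thesis by (metis ennreal_mult' norm_ge_zero mult_nonneg_nonneg)
    qed
    have "(\<integral>\<^sup>+p. ennreal (cmod (?Q p)) \<partial>(lborel \<Otimes>\<^sub>M lborel)) = (\<integral>\<^sup>+x. \<integral>\<^sup>+y. ennreal (cmod (?Q (x, y))) \<partial>lborel \<partial>lborel)"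
      by (rule lborel.nn_integral_fst[symmetric]) measurable
    then show ?thesis by (simp only: *)
  qed
  also have "\<dots> \<le> ennreal (2 * pi) * (\<integral>\<^sup>+x. ennreal ((cmod (G x))\<^sup>2) \<partial>lborel)"
  proof (rule schur_test)
    show "ennreal (?k (x - y)) = ennreal (?k (y - x))" for x y
      by (simp add: power2_commute[of x y] power_divide)
    show "(\<integral>\<^sup>+y. ennreal (?k (x - y)) \<partial>lborel) \<le> ennreal (2 * pi)" for x
      using nn_integral_gauss_kernel[OF e] by simp
  qed auto
  finally show ?thesis .
qed

lemma gauss_seq_tendsto: "(\<lambda>n. exp (- (x / real (Suc n))\<^sup>2 / 2)) \<longlonglongrightarrow> 1"
proof -
  have "(\<lambda>n. x / real (Suc n)) \<longlonglongrightarrow> 0"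
    by (rule LIMSEQ_Suc[OF lim_const_over_n])
  then have "(\<lambda>n. exp (- (x / real (Suc n))\<^sup>2 / 2)) \<longlonglongrightarrow> exp (- 0\<^sup>2 / 2)"
    by (intro tendsto_intros) auto
  then show ?thesis by simp
qed

text \<open>Fatou's lemma removes the Gaussian weight. The right-hand side may be infinite, so the
  inequality covers every integrable \<open>G\<close>.\<close>

lemma plancherel_le_nn:
  assumes G: "integrable lborel G"
  shows "(\<integral>\<^sup>+x. ennreal ((cmod (FT G x))\<^sup>2) \<partial>lborel) \<le> ennreal (2 * pi) * (\<integral>\<^sup>+x. ennreal ((cmod (G x))\<^sup>2) \<partial>lborel)"
proof -
  have [measurable]: "G \<in> borel_measurable borel" using G by auto
  let ?f = "\<lambda>n x. ennreal (exp (- (x / real (Suc n))\<^sup>2 / 2) * (cmod (FT G x))\<^sup>2)"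
  have lim: "(\<lambda>n. ?f n x) \<longlonglongrightarrow> ennreal (1 * (cmod (FT G x))\<^sup>2)" for x
    by (intro tendsto_ennrealI tendsto_mult gauss_seq_tendsto tendsto_const)
  have "ennreal ((cmod (FT G x))\<^sup>2) = liminf (\<lambda>n. ?f n x)" for x
    using lim_imp_Liminf[OF sequentially_bot lim[of x], symmetric] by (simp only: mult_1)
  then have "(\<integral>\<^sup>+x. ennreal ((cmod (FT G x))\<^sup>2) \<partial>lborel) = (\<integral>\<^sup>+x. liminf (\<lambda>n. ?f n x) \<partial>lborel)"
    by (intro nn_integral_cong)
  also have "\<dots> \<le> liminf (\<lambda>n. \<integral>\<^sup>+x. ?f n x \<partial>lborel)"
    by (intro nn_integral_liminf) measurable
  also have "\<dots> \<le> limsup (\<lambda>n. \<integral>\<^sup>+x. ?f n x \<partial>lborel)"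
    by (intro Liminf_le_Limsup) auto
  also have "\<dots> \<le> ennreal (2 * pi) * (\<integral>\<^sup>+x. ennreal ((cmod (G x))\<^sup>2) \<partial>lborel)"
  proof (intro Limsup_bounded always_eventually allI)
    fix n
    show "(\<integral>\<^sup>+x. ?f n x \<partial>lborel) \<le> ennreal (2 * pi) * (\<integral>\<^sup>+x. ennreal ((cmod (G x))\<^sup>2) \<partial>lborel)"
      using FT_gauss_le[OF G, of "1 / real (Suc n)"] by simp
  qed
  finally show ?thesis .
qed

lemma plancherel_le:
  assumes G: "integrable lborel G" and G2: "integrable lborel (\<lambda>x. (cmod (G x))\<^sup>2)"
  shows "integrable lborel (\<lambda>x. (cmod (FT G x))\<^sup>2)"
    and "(\<integral>x. (cmod (FT G x))\<^sup>2 \<partial>lborel) \<le> 2 * pi * (\<integral>x. (cmod (G x))\<^sup>2 \<partial>lborel)"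
proof -
  have [measurable]: "G \<in> borel_measurable borel" using G by auto
  have "(\<integral>\<^sup>+x. ennreal ((cmod (G x))\<^sup>2) \<partial>lborel) = ennreal (\<integral>x. (cmod (G x))\<^sup>2 \<partial>lborel)"
    using G2 by (intro nn_integral_eq_integral) auto
  then have le: "(\<integral>\<^sup>+x. ennreal ((cmod (FT G x))\<^sup>2) \<partial>lborel) \<le> ennreal (2 * pi * (\<integral>x. (cmod (G x))\<^sup>2 \<partial>lborel))"
    using plancherel_le_nn[OF G] by (simp add: ennreal_mult)
  show i: "integrable lborel (\<lambda>x. (cmod (FT G x))\<^sup>2)"
    by (rule integrableI_bounded) (use le_less_trans[OF le] in auto)
  have "(\<integral>\<^sup>+x. ennreal ((cmod (FT G x))\<^sup>2) \<partial>lborel) = ennreal (\<integral>x. (cmod (FT G x))\<^sup>2 \<partial>lborel)"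
    using i by (intro nn_integral_eq_integral) auto
  with le show "(\<integral>x. (cmod (FT G x))\<^sup>2 \<partial>lborel) \<le> 2 * pi * (\<integral>x. (cmod (G x))\<^sup>2 \<partial>lborel)"
    by (simp add: ennreal_le_iff)
qed

text \<open>For equality the Gaussian kernel has to act as an approximate identity: almost every
  point is a continuity point of \<open>G\<close>, and there the inner integral tends to
  \<open>2 * pi * cnj (G x)\<close>. Boundedness and integrability of \<open>G\<close> give the
  dominating functions.\<close>

lemma FT_plancherel_gauss_limit:
  assumes G: "integrable lborel G" and bd: "\<And>x. cmod (G x) \<le> B" and cont: "AE x in lborel. isCont G x"
  shows "(\<lambda>n. \<integral>x. exp (- (x / real (Suc n))\<^sup>2 / 2) * (cmod (FT G x))\<^sup>2 \<partial>lborel) \<longlonglongrightarrow> 2 * pi * (\<integral>x. (cmod (G x))\<^sup>2 \<partial>lborel)"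
proof -
  have [measurable]: "G \<in> borel_measurable borel" using G by auto
  have B0: "B \<ge> 0" using bd[of 0] norm_ge_zero order_trans by blast
  define k where "k u = sqrt (2 * pi) * exp (- u\<^sup>2 / 2)" for u :: real
  have k[measurable]: "k \<in> borel_measurable borel" unfolding k_def by measurable
  have k0: "k u \<ge> 0" for u by (simp add: k_def)
  have ki: "integrable lborel k" and kI: "(\<integral>u. k u \<partial>lborel) = 2 * pi"
    using integrable_gauss[of 1] gauss_integral[of 1] unfolding k_def by auto
  have kc: "integrable lborel (\<lambda>u. complex_of_real (k u))" and kIc: "(\<integral>u. complex_of_real (k u) \<partial>lborel) = 2 * pi"
    using ki kI by auto
  \<comment> \<open>The inner integral after the substitution \<open>y = x - u / Suc n\<close>: the
    weight \<open>k\<close> no longer depends on \<open>n\<close>, only the point at which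
    \<open>G\<close> is evaluated does.\<close>
  define H where "H n x = (\<integral>u. cnj (G (x - u / real (Suc n))) * complex_of_real (k u) \<partial>lborel)" for n x
  have Hm[measurable]: "H n \<in> borel_measurable borel" for n
    unfolding H_def by measurable
  have Hi: "integrable lborel (\<lambda>u. cnj (G (x - u / real (Suc n))) * complex_of_real (k u))" for n x
    by (rule Bochner_Integration.integrable_bound[OF integrable_mult_right[OF ki, of B]])
       (use k0 B0 bd in \<open>auto simp: norm_mult intro!: mult_right_mono\<close>)
  have Hb: "cmod (H n x) \<le> B * (2 * pi)" for n x
  proof -
    have "cmod (H n x) \<le> (\<integral>u. cmod (cnj (G (x - u / real (Suc n))) * complex_of_real (k u)) \<partial>lborel)"
      unfolding H_def by (rule integral_norm_bound)
    also have "\<dots> \<le> (\<integral>u. B * k u \<partial>lborel)"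
      by (intro integral_mono integrable_norm Hi integrable_mult_right ki)
         (use k0 bd in \<open>auto simp: norm_mult intro!: mult_right_mono\<close>)
    finally show ?thesis using kI by simp
  qed
  have conv: "(\<lambda>n. H n x) \<longlonglongrightarrow> cnj (G x) * complex_of_real (2 * pi)" if x: "isCont G x" for x
  proof -
    have "(\<lambda>n. H n x) \<longlonglongrightarrow> (\<integral>u. cnj (G x) * complex_of_real (k u) \<partial>lborel)"
      unfolding H_def
    proof (rule integral_dominated_convergence[where w="\<lambda>u. B * k u"])
      show "AE u in lborel. (\<lambda>n. cnj (G (x - u / real (Suc n))) * complex_of_real (k u)) \<longlonglongrightarrow> cnj (G x) * complex_of_real (k u)"
      proof (rule AE_I2)
        fix u
        have "(\<lambda>n. x - u / real (Suc n)) \<longlonglongrightarrow> x - 0"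
          by (intro tendsto_intros LIMSEQ_Suc[OF lim_const_over_n])
        then have "(\<lambda>n. G (x - u / real (Suc n))) \<longlonglongrightarrow> G x"
          using isCont_tendsto_compose[OF x] by simp
        then show "(\<lambda>n. cnj (G (x - u / real (Suc n))) * complex_of_real (k u)) \<longlonglongrightarrow> cnj (G x) * complex_of_real (k u)"
          by (intro tendsto_intros)
      qed
      show "integrable lborel (\<lambda>u. B * k u)" using ki by simp
      show "AE u in lborel. cmod (cnj (G (x - u / real (Suc n))) * complex_of_real (k u)) \<le> B * k u" for n
        using k0 bd by (auto simp: norm_mult intro!: mult_right_mono)
    qed measurable
    then show ?thesis using kIc by simp
  qed
  have "(\<lambda>n. \<integral>x. G x * H n x \<partial>lborel) \<longlonglongrightarrow> (\<integral>x. G x * (cnj (G x) * complex_of_real (2 * pi)) \<partial>lborel)"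
  proof (rule integral_dominated_convergence[where w="\<lambda>x. cmod (G x) * (B * (2 * pi))"])
    show "AE x in lborel. (\<lambda>n. G x * H n x) \<longlonglongrightarrow> G x * (cnj (G x) * complex_of_real (2 * pi))"
      using cont by eventually_elim (intro tendsto_intros conv)
    show "integrable lborel (\<lambda>x. cmod (G x) * (B * (2 * pi)))" using G by simp
    show "AE x in lborel. cmod (G x * H n x) \<le> cmod (G x) * (B * (2 * pi))" for n
      using Hb by (auto simp: norm_mult intro!: mult_left_mono)
  qed measurable
  moreover have "(\<integral>x. G x * H n x \<partial>lborel) = complex_of_real (\<integral>x. exp (- (x / real (Suc n))\<^sup>2 / 2) * (cmod (FT G x))\<^sup>2 \<partial>lborel)" for n
  proof -
    define e where "e = 1 / real (Suc n)"
    have e: "e > 0" by (simp add: e_def)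
    let ?K = "\<lambda>v. complex_of_real (sqrt (2 * pi) / e * exp (- (v / e)\<^sup>2 / 2))"
    have sub: "(\<integral>y. cnj (G y) * ?K (x - y) \<partial>lborel) = H n x" for x
    proof -
      have "(\<integral>y. cnj (G y) * ?K (x - y) \<partial>lborel) = \<bar>- e\<bar> *\<^sub>R (\<integral>u. cnj (G (x + (- e) * u)) * ?K (x - (x + (- e) * u)) \<partial>lborel)"
        using e by (intro lborel_integral_real_affine) auto
      also have "\<dots> = (\<integral>u. \<bar>- e\<bar> *\<^sub>R (cnj (G (x + (- e) * u)) * ?K (x - (x + (- e) * u))) \<partial>lborel)"
        by simp
      also have "\<dots> = H n x"
        unfolding H_def using e
        by (intro Bochner_Integration.integral_cong) (auto simp: k_def scaleR_conv_of_real e_def simp del: of_nat_Suc)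
      finally show ?thesis .
    qed
    have "integrable (lborel \<Otimes>\<^sub>M lborel) (\<lambda>p. G (fst p) * cnj (G (snd p)) * ?K (fst p - snd p))"
    proof (rule Bochner_Integration.integrable_bound)
      show "integrable (lborel \<Otimes>\<^sub>M lborel) (\<lambda>p. (sqrt (2 * pi) / e) *\<^sub>R (G (fst p) * cnj (G (snd p))))"
      proof (intro integrable_scaleR_right lborel_pair.Fubini_integrable)
        show "integrable lborel (\<lambda>x. \<integral>y. cmod (G (fst (x, y)) * cnj (G (snd (x, y)))) \<partial>lborel)"
          using G by (simp add: norm_mult)
        show "AE x in lborel. integrable lborel (\<lambda>y. G (fst (x, y)) * cnj (G (snd (x, y))))"
          using G by (intro AE_I2) simp
      qed measurable
      show "AE p in lborel \<Otimes>\<^sub>M lborel. cmod (G (fst p) * cnj (G (snd p)) * ?K (fst p - snd p))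
          \<le> cmod ((sqrt (2 * pi) / e) *\<^sub>R (G (fst p) * cnj (G (snd p))))"
      proof (rule AE_I2)
        fix p :: "real \<times> real"
        have "cmod (G (fst p) * cnj (G (snd p)) * ?K (fst p - snd p))
           = cmod (G (fst p)) * cmod (G (snd p)) * (sqrt (2 * pi) / e * exp (- ((fst p - snd p) / e)\<^sup>2 / 2))"
          using e by (simp only: norm_mult norm_of_real complex_mod_cnj abs_of_nonneg
              mult_nonneg_nonneg exp_ge_zero divide_nonneg_pos real_sqrt_ge_zero pi_ge_zero zero_le_numeral)
        also have "\<dots> \<le> cmod (G (fst p)) * cmod (G (snd p)) * (sqrt (2 * pi) / e * 1)"
          using e by (intro mult_left_mono) auto
        also have "\<dots> = cmod ((sqrt (2 * pi) / e) *\<^sub>R (G (fst p) * cnj (G (snd p))))"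
          using e by (simp add: norm_mult)
        finally show "cmod (G (fst p) * cnj (G (snd p)) * ?K (fst p - snd p))
          \<le> cmod ((sqrt (2 * pi) / e) *\<^sub>R (G (fst p) * cnj (G (snd p))))" .
      qed
    qed measurable
    from lborel_pair.integral_fst'[OF this]
    have "(\<integral>p. G (fst p) * cnj (G (snd p)) * ?K (fst p - snd p) \<partial>(lborel \<Otimes>\<^sub>M lborel))
       = (\<integral>x. (\<integral>y. G x * (cnj (G y) * ?K (x - y)) \<partial>lborel) \<partial>lborel)"
      by (simp only: fst_conv snd_conv mult.assoc)
    also have "\<dots> = (\<integral>x. G x * H n x \<partial>lborel)"
      by (simp only: integral_mult_right_zero sub)
    finally show ?thesis
      using FT_gauss[OF G e] by (simp add: e_def)
  qed
  moreover have "(\<integral>x. G x * (cnj (G x) * complex_of_real (2 * pi)) \<partial>lborel) = complex_of_real (2 * pi * (\<integral>x. (cmod (G x))\<^sup>2 \<partial>lborel))"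
  proof -
    have "G x * (cnj (G x) * complex_of_real (2 * pi)) = complex_of_real (2 * pi * (cmod (G x))\<^sup>2)" for x
      using complex_norm_square[of "G x"] by simp
    then have "(\<integral>x. G x * (cnj (G x) * complex_of_real (2 * pi)) \<partial>lborel) = (\<integral>x. complex_of_real (2 * pi * (cmod (G x))\<^sup>2) \<partial>lborel)"
      by (simp only:)
    also have "\<dots> = complex_of_real (\<integral>x. 2 * pi * (cmod (G x))\<^sup>2 \<partial>lborel)"
      by (rule integral_complex_of_real)
    finally show ?thesis by simp
  qed
  ultimately show ?thesis
    by (simp only: tendsto_of_real_iff)
qed

text \<open>The Gaussian limit is computed a second time by dominated convergence, which the
  Plancherel inequality permits. The class of functions is chosen for the counterexample, whose
  pieces are trigonometric sums cut off by an interval.\<close>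

lemma plancherel_eq:
  assumes G: "integrable lborel G" and bd: "\<And>x. cmod (G x) \<le> B" and cont: "AE x in lborel. isCont G x"
  shows "integrable lborel (\<lambda>x. (cmod (G x))\<^sup>2)"
    and "(\<integral>x. (cmod (FT G x))\<^sup>2 \<partial>lborel) = 2 * pi * (\<integral>x. (cmod (G x))\<^sup>2 \<partial>lborel)"
proof -
  have [measurable]: "G \<in> borel_measurable borel" using G by auto
  show G2: "integrable lborel (\<lambda>x. (cmod (G x))\<^sup>2)"
  proof (rule Bochner_Integration.integrable_bound)
    show "integrable lborel (\<lambda>x. B * cmod (G x))" using G by simp
    show "AE x in lborel. norm ((cmod (G x))\<^sup>2) \<le> norm (B * cmod (G x))"
      using bd by (intro AE_I2) (auto simp: power2_eq_square abs_mult intro!: mult_right_mono order_trans[OF bd])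
  qed measurable
  have "(\<lambda>n. \<integral>x. exp (- (x / real (Suc n))\<^sup>2 / 2) * (cmod (FT G x))\<^sup>2 \<partial>lborel) \<longlonglongrightarrow> (\<integral>x. 1 * (cmod (FT G x))\<^sup>2 \<partial>lborel)"
  proof (rule integral_dominated_convergence[where w="\<lambda>x. (cmod (FT G x))\<^sup>2"])
    show "AE x in lborel. (\<lambda>n. exp (- (x / real (Suc n))\<^sup>2 / 2) * (cmod (FT G x))\<^sup>2) \<longlonglongrightarrow> 1 * (cmod (FT G x))\<^sup>2"
      by (intro AE_I2 tendsto_intros gauss_seq_tendsto)
    show "integrable lborel (\<lambda>x. (cmod (FT G x))\<^sup>2)" by (rule plancherel_le[OF G G2])
    show "AE x in lborel. norm (exp (- (x / real (Suc n))\<^sup>2 / 2) * (cmod (FT G x))\<^sup>2) \<le> (cmod (FT G x))\<^sup>2" for n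
      by (intro AE_I2) (simp add: mult_left_le_one_le)
  qed measurable
  with FT_plancherel_gauss_limit[OF G bd cont]
  show "(\<integral>x. (cmod (FT G x))\<^sup>2 \<partial>lborel) = 2 * pi * (\<integral>x. (cmod (G x))\<^sup>2 \<partial>lborel)"
    using LIMSEQ_unique by fastforce
qed

text \<open>Symmetry of the kernel \<open>cis (x * \<xi>)\<close> plus Fubini. The formula moves a
  transform from one factor to the other without any inversion theorem.\<close>

lemma FT_multiplication:
  assumes H: "integrable lborel H" and G: "integrable lborel G"
  shows "(\<integral>\<xi>. FT H \<xi> * G \<xi> \<partial>lborel) = (\<integral>x. H x * FT G x \<partial>lborel)"
proof -
  have [measurable]: "G \<in> borel_measurable borel" "H \<in> borel_measurable borel" using G H by auto
  have "integrable (lborel \<Otimes>\<^sub>M lborel) (\<lambda>p. cis (fst p * snd p) * (H (fst p) * G (snd p)))"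
  proof (rule integrable_cis_mult)
    show "integrable (lborel \<Otimes>\<^sub>M lborel) (\<lambda>p. H (fst p) * G (snd p))"
    proof (intro lborel_pair.Fubini_integrable)
      show "integrable lborel (\<lambda>x. \<integral>y. cmod (H (fst (x, y)) * G (snd (x, y))) \<partial>lborel)"
        using H by (simp add: norm_mult)
      show "AE x in lborel. integrable lborel (\<lambda>y. H (fst (x, y)) * G (snd (x, y)))"
        using G by (intro AE_I2) simp
    qed measurable
  qed measurable
  then have i: "integrable (lborel \<Otimes>\<^sub>M lborel) (\<lambda>(x, \<xi>). cis (x * \<xi>) * (H x * G \<xi>))"
    by (simp add: case_prod_beta')
  have "(\<integral>\<xi>. FT H \<xi> * G \<xi> \<partial>lborel) = (\<integral>\<xi>. \<integral>x. cis (x * \<xi>) * (H x * G \<xi>) \<partial>lborel \<partial>lborel)"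
    unfolding FT_def by (subst integral_mult_left_zero[symmetric]) (simp add: mult.assoc mult.commute[of _ "_ :: real"])
  also have "\<dots> = (\<integral>x. \<integral>\<xi>. cis (x * \<xi>) * (H x * G \<xi>) \<partial>lborel \<partial>lborel)"
    using lborel_pair.Fubini_integral[OF i] .
  also have "\<dots> = (\<integral>x. H x * FT G x \<partial>lborel)"
    unfolding FT_def by (subst integral_mult_right_zero[symmetric]) (simp add: mult.left_commute)
  finally show ?thesis .
qed

section \<open>The Fourier transform on \<open>L\<^sup>2\<close>\<close>

lemma integrable_mult_L2:
  fixes u v :: "real \<Rightarrow> complex"
  assumes [measurable]: "u \<in> borel_measurable M" "v \<in> borel_measurable M"
    and u: "integrable M (\<lambda>x. (cmod (u x))\<^sup>2)" and v: "integrable M (\<lambda>x. (cmod (v x))\<^sup>2)"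
  shows "integrable M (\<lambda>x. u x * v x)"
proof (rule Bochner_Integration.integrable_bound)
  show "integrable M (\<lambda>x. (cmod (u x))\<^sup>2 + (cmod (v x))\<^sup>2)"
    using u v by simp
  show "AE x in M. cmod (u x * v x) \<le> norm ((cmod (u x))\<^sup>2 + (cmod (v x))\<^sup>2)"
  proof (rule AE_I2)
    fix x
    have "2 * (cmod (u x) * cmod (v x)) \<le> (cmod (u x))\<^sup>2 + (cmod (v x))\<^sup>2"
      using sum_squares_bound[of "cmod (u x)" "cmod (v x)"] by (simp add: mult.assoc)
    moreover have "0 \<le> cmod (u x) * cmod (v x)" by simp
    ultimately have "cmod (u x) * cmod (v x) \<le> (cmod (u x))\<^sup>2 + (cmod (v x))\<^sup>2"
      by linarith
    then show "cmod (u x * v x) \<le> norm ((cmod (u x))\<^sup>2 + (cmod (v x))\<^sup>2)"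
      by (simp add: norm_mult)
  qed
qed measurable

text \<open>The integral of \<open>(s |u| - |v|)^2\<close> is a nonnegative quadratic polynomial in
  \<open>s\<close>; its value at the minimiser is the inequality.\<close>

lemma integral_Cauchy_Schwarz:
  fixes u v :: "real \<Rightarrow> complex"
  assumes [measurable]: "u \<in> borel_measurable M" "v \<in> borel_measurable M"
    and u: "integrable M (\<lambda>x. (cmod (u x))\<^sup>2)" and v: "integrable M (\<lambda>x. (cmod (v x))\<^sup>2)"
  shows "(\<integral>x. cmod (u x) * cmod (v x) \<partial>M)\<^sup>2 \<le> (\<integral>x. (cmod (u x))\<^sup>2 \<partial>M) * (\<integral>x. (cmod (v x))\<^sup>2 \<partial>M)"
proof -
  let ?A = "\<integral>x. (cmod (u x))\<^sup>2 \<partial>M" and ?B = "\<integral>x. (cmod (v x))\<^sup>2 \<partial>M" and ?P = "\<integral>x. cmod (u x) * cmod (v x) \<partial>M"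
  have i: "integrable M (\<lambda>x. cmod (u x) * cmod (v x))"
    using integrable_norm[OF integrable_mult_L2[OF assms]] by (simp add: norm_mult)
  have q: "0 \<le> s\<^sup>2 * ?A - 2 * s * ?P + ?B" for s
  proof -
    have "0 \<le> (\<integral>x. (s * cmod (u x) - cmod (v x))\<^sup>2 \<partial>M)" by simp
    also have "\<dots> = (\<integral>x. (s\<^sup>2 * (cmod (u x))\<^sup>2 - 2 * s * (cmod (u x) * cmod (v x))) + (cmod (v x))\<^sup>2 \<partial>M)"
      by (intro Bochner_Integration.integral_cong) (auto simp: power2_eq_square algebra_simps)
    also have "\<dots> = s\<^sup>2 * ?A - 2 * s * ?P + ?B"
      using u v i by simp
    finally show ?thesis .
  qed
  have P0: "?P \<ge> 0" by simp
  have A0: "?A \<ge> 0" by simp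
  show ?thesis
  proof (cases "?A = 0")
    case True
    have "?P = 0"
    proof (rule ccontr)
      assume "?P \<noteq> 0"
      \<comment> \<open>If the square norm of \<open>u\<close> vanishes, the polynomial is affine in
        \<open>s\<close>, and at this \<open>s\<close> it would take the value -1.\<close>
      then have "2 * ((?B + 1) / (2 * ?P)) * ?P = ?B + 1" by (simp add: field_simps)
      then show False using q[of "(?B + 1) / (2 * ?P)"] True by simp
    qed
    then show ?thesis using True by simp
  next
    case False
    then have A: "?A > 0" using A0 by (metis order_le_less)
    have "0 \<le> ?A * ((?P / ?A)\<^sup>2 * ?A - 2 * (?P / ?A) * ?P + ?B)"
      using q[of "?P / ?A"] A by (intro mult_nonneg_nonneg) auto
    also have "\<dots> = ?A * ?B - ?P\<^sup>2"
      using A by (simp add: field_simps power2_eq_square)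
    finally show ?thesis by simp
  qed
qed

section \<open>Series of square-integrable functions\<close>

lemma AE_summable_norm:
  fixes f :: "nat \<Rightarrow> 'a \<Rightarrow> 'b::{banach, second_countable_topology}"
  assumes f: "\<And>i. integrable M (f i)" and s: "summable (\<lambda>i. \<integral>x. norm (f i x) \<partial>M)"
  shows "AE x in M. summable (\<lambda>i. norm (f i x))"
proof -
  have [measurable]: "\<And>i. f i \<in> borel_measurable M" using f by auto
  have "(\<integral>\<^sup>+x. (\<Sum>i. ennreal (norm (f i x))) \<partial>M) = (\<Sum>i. \<integral>\<^sup>+x. ennreal (norm (f i x)) \<partial>M)"
    by (rule nn_integral_suminf) measurable
  also have "\<dots> = (\<Sum>i. ennreal (\<integral>x. norm (f i x) \<partial>M))"
    using f by (intro suminf_cong nn_integral_eq_integral) auto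
  also have "\<dots> = ennreal (\<Sum>i. \<integral>x. norm (f i x) \<partial>M)"
    using s by (intro suminf_ennreal2) auto
  finally have "(\<integral>\<^sup>+x. (\<Sum>i. ennreal (norm (f i x))) \<partial>M) \<noteq> \<infinity>" by simp
  then have "AE x in M. (\<Sum>i. ennreal (norm (f i x))) \<noteq> \<infinity>"
    by (intro nn_integral_noteq_infinite) measurable
  then show ?thesis
    by eventually_elim (auto intro: summable_suminf_not_top)
qed

text \<open>Weights \<open>2 ^ j\<close> against norms decaying like \<open>(1/4) ^ j\<close> make
  \<open>D0\<close>, the sum of \<open>2 ^ j |h j|^2\<close>, integrable. Pointwise
  \<open>|h j|\<close> is then at most \<open>sqrt D0\<close> times the \<open>j\<close>-th power of
  \<open>sqrt (1/2)\<close>, which yields convergence almost everywhere and one majorant for the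
  squares of all tails.\<close>

lemma L2_series:
  fixes h :: "nat \<Rightarrow> real \<Rightarrow> complex"
  assumes [measurable]: "\<And>j. h j \<in> borel_measurable lborel"
    and i: "\<And>j. integrable lborel (\<lambda>x. (cmod (h j x))\<^sup>2)"
    and bd: "\<And>j. (\<integral>x. (cmod (h j x))\<^sup>2 \<partial>lborel) \<le> C * (1/4) ^ j"
  obtains D where "integrable lborel D" "AE x in lborel. summable (\<lambda>j. cmod (h j x))"
    "\<And>n. AE x in lborel. (cmod ((\<Sum>j. h j x) - (\<Sum>j<n. h j x)))\<^sup>2 \<le> (1/2) ^ n * D x"
proof -
  define r where "r = sqrt (1/2::real)"
  have r: "0 < r" "r < 1" "r\<^sup>2 = 1/2" unfolding r_def by (auto simp: real_sqrt_lt_1_iff)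
  define D0 where "D0 x = (\<Sum>j. 2 ^ j * (cmod (h j x))\<^sup>2)" for x
  have s: "summable (\<lambda>j. \<integral>x. norm (2 ^ j * (cmod (h j x))\<^sup>2) \<partial>lborel)"
  proof (rule summable_comparison_test')
    show "summable (\<lambda>j. C * (1/2::real) ^ j)" by (intro summable_mult summable_geometric) auto
    show "norm (\<integral>x. norm (2 ^ j * (cmod (h j x))\<^sup>2) \<partial>lborel) \<le> C * (1/2) ^ j" if "j \<ge> 0" for j
    proof -
      have "(\<integral>x. norm (2 ^ j * (cmod (h j x))\<^sup>2) \<partial>lborel) = 2 ^ j * (\<integral>x. (cmod (h j x))\<^sup>2 \<partial>lborel)"
        by simp
      also have "\<dots> \<le> 2 ^ j * (C * (1/4) ^ j)"
        by (intro mult_left_mono bd) auto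
      also have "\<dots> = C * (2 * (1/4)) ^ j" by (simp only: power_mult_distrib mult_ac)
      finally show ?thesis by simp
    qed
  qed
  have i2: "\<And>j. integrable lborel (\<lambda>x. 2 ^ j * (cmod (h j x))\<^sup>2)" using i by simp
  have ae: "AE x in lborel. summable (\<lambda>j. 2 ^ j * (cmod (h j x))\<^sup>2)"
    using AE_summable_norm[OF i2 s] by simp
  have D0: "integrable lborel D0"
    unfolding D0_def by (rule integrable_suminf[OF i2 _ s]) (use ae in simp)
  have key: "cmod (h j x) \<le> sqrt (D0 x) * r ^ j" if "summable (\<lambda>j. 2 ^ j * (cmod (h j x))\<^sup>2)" for j x
  proof (rule power2_le_imp_le)
    have "2 ^ j * (cmod (h j x))\<^sup>2 \<le> D0 x"
      unfolding D0_def using sum_le_suminf[OF that, of "{j}"] by simp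
    then have "(cmod (h j x))\<^sup>2 \<le> D0 x * (1/2) ^ j" by (simp add: field_simps)
    moreover have "D0 x \<ge> 0" unfolding D0_def by (intro suminf_nonneg that) auto
    moreover have "(r ^ j)\<^sup>2 = (1/2) ^ j" using r(3) by (metis power_even_eq power_mult mult.commute)
    ultimately show "(cmod (h j x))\<^sup>2 \<le> (sqrt (D0 x) * r ^ j)\<^sup>2" by (simp add: power_mult_distrib)
    show "0 \<le> sqrt (D0 x) * r ^ j" using r \<open>D0 x \<ge> 0\<close> by simp
  qed
  have sm: "summable (\<lambda>j. cmod (h j x))" if "summable (\<lambda>j. 2 ^ j * (cmod (h j x))\<^sup>2)" for x
    by (rule summable_comparison_test'[of "\<lambda>j. sqrt (D0 x) * r ^ j" 0])
       (use r key[OF that] in \<open>auto intro!: summable_mult summable_geometric\<close>)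
  have tail: "(cmod ((\<Sum>j. h j x) - (\<Sum>j<n. h j x)))\<^sup>2 \<le> (1/2) ^ n * (D0 x * (1 / (1 - r))\<^sup>2)"
    if x: "summable (\<lambda>j. 2 ^ j * (cmod (h j x))\<^sup>2)" for n x
  proof -
    have "(\<Sum>j. h j x) - (\<Sum>j<n. h j x) = (\<Sum>j. h (j + n) x)"
      using suminf_minus_initial_segment[OF summable_norm_cancel[OF sm[OF x]]] by simp
    also have "cmod \<dots> \<le> (\<Sum>j. sqrt (D0 x) * r ^ n * r ^ j)"
    proof (rule norm_suminf_le)
      show "cmod (h (j + n) x) \<le> sqrt (D0 x) * r ^ n * r ^ j" for j
        using key[OF x, of "j + n"] by (simp add: power_add mult_ac)
      show "summable (\<lambda>j. sqrt (D0 x) * r ^ n * r ^ j)"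
        using r by (intro summable_mult summable_geometric) auto
    qed
    also have "\<dots> = sqrt (D0 x) * r ^ n * (1 / (1 - r))"
      using r by (subst suminf_mult) (auto simp: suminf_geometric)
    finally have "(cmod ((\<Sum>j. h j x) - (\<Sum>j<n. h j x)))\<^sup>2 \<le> (sqrt (D0 x) * r ^ n * (1 / (1 - r)))\<^sup>2"
      by (intro power_mono) auto
    also have "\<dots> = (1/2) ^ n * (D0 x * (1 / (1 - r))\<^sup>2)"
    proof -
      have "D0 x \<ge> 0" unfolding D0_def by (intro suminf_nonneg x) auto
      moreover have "(r ^ n)\<^sup>2 = (1/2) ^ n" using r(3) by (metis power_even_eq power_mult mult.commute)
      ultimately show ?thesis by (simp only: power_mult_distrib real_sqrt_pow2 mult_ac)
    qed
    finally show ?thesis .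
  qed
  show ?thesis
  proof
    show "integrable lborel (\<lambda>x. D0 x * (1 / (1 - r))\<^sup>2)" using D0 by simp
    show "AE x in lborel. summable (\<lambda>j. cmod (h j x))" using ae by eventually_elim (rule sm)
    show "AE x in lborel. (cmod ((\<Sum>j. h j x) - (\<Sum>j<n. h j x)))\<^sup>2 \<le> (1/2) ^ n * (D0 x * (1 / (1 - r))\<^sup>2)" for n
      using ae by eventually_elim (rule tail)
  qed
qed

section \<open>Truncated transforms and their limits\<close>

definition trunc :: "real \<Rightarrow> (real \<Rightarrow> complex) \<Rightarrow> real \<Rightarrow> complex" where
  "trunc R f x = indicator {-R..R} x *\<^sub>R f x"

lemma trunc_FT: "(LINT x:{-R..R}|lborel. exp (- \<i> * complex_of_real (x * \<xi>)) * f x) = FT (trunc R f) (- \<xi>)"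
  unfolding set_lebesgue_integral_def FT_def trunc_def
  by (intro Bochner_Integration.integral_cong) (auto simp: cis_conv_exp mult_ac split: split_indicator)

lemma L2_fun_measurable: "L2_fun f \<Longrightarrow> f \<in> borel_measurable borel"
  by (simp add: L2_fun_def)

lemma trunc_measurable [measurable]:
  assumes [measurable]: "f \<in> borel_measurable borel"
  shows "trunc R f \<in> borel_measurable borel"
  unfolding trunc_def by measurable

lemma trunc_integrable:
  assumes f: "L2_fun f"
  shows "integrable lborel (trunc R f)" "integrable lborel (\<lambda>x. (cmod (trunc R f x))\<^sup>2)"
proof -
  have [measurable]: "f \<in> borel_measurable borel" by (rule L2_fun_measurable[OF f])
  have i: "integrable lborel (\<lambda>x. (cmod (f x))\<^sup>2)" using f by (simp add: L2_fun_def)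
  show "integrable lborel (\<lambda>x. (cmod (trunc R f x))\<^sup>2)"
    by (rule Bochner_Integration.integrable_bound[OF i]) (auto simp: trunc_def split: split_indicator)
  have "integrable lborel (\<lambda>x. indicator {-R..R} x * f x)"
  proof (rule integrable_mult_L2)
    have "(\<lambda>x. (cmod (indicator {-R..R} x :: complex))\<^sup>2) = indicat_real {-R..R}"
      by (auto simp: fun_eq_iff split: split_indicator)
    then show "integrable lborel (\<lambda>x. (cmod (indicator {-R..R} x :: complex))\<^sup>2)"
      by (auto intro!: integrable_real_indicator simp: emeasure_lborel_Icc_eq)
  qed (use i in auto)
  then show "integrable lborel (trunc R f)"
    unfolding trunc_def by (rule Bochner_Integration.integrable_cong[THEN iffD1, rotated 2]) (auto split: split_indicator)
qed

lemma integrable_neg: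
  fixes f :: "real \<Rightarrow> 'a::{banach, second_countable_topology}"
  assumes "integrable lborel f" shows "integrable lborel (\<lambda>x. f (- x))"
  using lborel_integrable_real_affine[OF assms, of "-1" 0] by simp

lemma integral_neg:
  fixes f :: "real \<Rightarrow> 'a::{banach, second_countable_topology}"
  shows "(\<integral>x. f (- x) \<partial>lborel) = (\<integral>x. f x \<partial>lborel)"
  using lborel_integral_real_affine[of "-1" f 0] by simp

lemma fourier_L2_iff:
  "fourier_L2 f g \<longleftrightarrow> L2_fun f \<and> L2_fun g \<and>
     ((\<lambda>R. \<integral>\<xi>. (cmod (FT (trunc R f) (- \<xi>) - g \<xi>))\<^sup>2 \<partial>lborel) \<longlongrightarrow> 0) at_top"
  unfolding fourier_L2_def trunc_FT ..

lemma L2_fun_add: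
  assumes f: "L2_fun f" and g: "L2_fun g" shows "L2_fun (\<lambda>x. f x + g x)"
proof -
  have [measurable]: "f \<in> borel_measurable borel" "g \<in> borel_measurable borel" using f g by (auto simp: L2_fun_def)
  have "integrable lborel (\<lambda>x. (cmod (f x + g x))\<^sup>2)"
  proof (rule Bochner_Integration.integrable_bound)
    show "integrable lborel (\<lambda>x. 2 * (cmod (f x))\<^sup>2 + 2 * (cmod (g x))\<^sup>2)"
      using f g by (auto simp: L2_fun_def)
    show "AE x in lborel. norm ((cmod (f x + g x))\<^sup>2) \<le> norm (2 * (cmod (f x))\<^sup>2 + 2 * (cmod (g x))\<^sup>2)"
    proof (rule AE_I2)
      fix x
      have "(cmod (f x + g x))\<^sup>2 \<le> (cmod (f x) + cmod (g x))\<^sup>2"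
        by (intro power_mono norm_triangle_ineq) auto
      also have "\<dots> \<le> 2 * (cmod (f x))\<^sup>2 + 2 * (cmod (g x))\<^sup>2"
        using sum_squares_bound[of "cmod (f x)" "cmod (g x)"] by (simp add: power2_sum)
      finally show "norm ((cmod (f x + g x))\<^sup>2) \<le> norm (2 * (cmod (f x))\<^sup>2 + 2 * (cmod (g x))\<^sup>2)" by simp
    qed
  qed measurable
  then show ?thesis by (simp add: L2_fun_def)
qed

lemma L2_fun_uminus: "L2_fun f \<Longrightarrow> L2_fun (\<lambda>x. - f x)"
  by (auto simp: L2_fun_def)

lemma L2_fun_diff: "L2_fun f \<Longrightarrow> L2_fun g \<Longrightarrow> L2_fun (\<lambda>x. f x - g x)"
  using L2_fun_add[of f "\<lambda>x. - g x"] L2_fun_uminus[of g] by simp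

lemma L2_fun_FT_trunc:
  assumes "L2_fun f" shows "L2_fun (\<lambda>\<xi>. FT (trunc R f) (- \<xi>))"
proof -
  have [measurable]: "f \<in> borel_measurable borel" by (rule L2_fun_measurable[OF assms])
  show ?thesis
    unfolding L2_fun_def using integrable_neg[OF plancherel_le(1)[OF trunc_integrable[OF assms, of R]]] by simp
qed

text \<open>Stands in for the triangle inequality wherever a norm only has to tend to 0, so that
  everything can be phrased with squared norms.\<close>

lemma L2_norm_add3:
  assumes "L2_fun u" "L2_fun v" "L2_fun w"
  shows "(\<integral>x. (cmod (u x + v x + w x))\<^sup>2 \<partial>lborel) \<le> 3 * ((\<integral>x. (cmod (u x))\<^sup>2 \<partial>lborel) + (\<integral>x. (cmod (v x))\<^sup>2 \<partial>lborel) + (\<integral>x. (cmod (w x))\<^sup>2 \<partial>lborel))"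
proof -
  have "(\<integral>x. (cmod (u x + v x + w x))\<^sup>2 \<partial>lborel) \<le> (\<integral>x. 3 * ((cmod (u x))\<^sup>2 + (cmod (v x))\<^sup>2 + (cmod (w x))\<^sup>2) \<partial>lborel)"
  proof (rule integral_mono)
    show "integrable lborel (\<lambda>x. (cmod (u x + v x + w x))\<^sup>2)"
      using L2_fun_add[OF L2_fun_add[OF assms(1,2)] assms(3)] by (simp add: L2_fun_def)
    show "integrable lborel (\<lambda>x. 3 * ((cmod (u x))\<^sup>2 + (cmod (v x))\<^sup>2 + (cmod (w x))\<^sup>2))"
      using assms by (auto simp: L2_fun_def)
    fix x
    have "cmod (u x + v x + w x) \<le> cmod (u x) + cmod (v x) + cmod (w x)"
      by (meson add_right_mono norm_triangle_ineq norm_triangle_le order_trans)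
    then have "(cmod (u x + v x + w x))\<^sup>2 \<le> (cmod (u x) + cmod (v x) + cmod (w x))\<^sup>2"
      by (intro power_mono) auto
    also have "\<dots> \<le> 3 * ((cmod (u x))\<^sup>2 + (cmod (v x))\<^sup>2 + (cmod (w x))\<^sup>2)"
      using sum_squares_bound[of "cmod (u x)" "cmod (v x)"] sum_squares_bound[of "cmod (u x)" "cmod (w x)"]
        sum_squares_bound[of "cmod (v x)" "cmod (w x)"] by (simp add: power2_eq_square algebra_simps)
    finally show "(cmod (u x + v x + w x))\<^sup>2 \<le> 3 * ((cmod (u x))\<^sup>2 + (cmod (v x))\<^sup>2 + (cmod (w x))\<^sup>2)" .
  qed
  also have "\<dots> = 3 * ((\<integral>x. (cmod (u x))\<^sup>2 \<partial>lborel) + (\<integral>x. (cmod (v x))\<^sup>2 \<partial>lborel) + (\<integral>x. (cmod (w x))\<^sup>2 \<partial>lborel))"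
    using assms by (simp add: L2_fun_def)
  finally show ?thesis .
qed

text \<open>Both functions are square-mean limits of the same truncated transforms. This is what
  gives \<open>fourier_hat\<close>, a mere choice, a meaning up to null sets.\<close>

lemma fourier_L2_unique:
  assumes g: "fourier_L2 f g" and h: "fourier_L2 f h"
  shows "AE \<xi> in lborel. g \<xi> = h \<xi>"
proof -
  let ?F = "\<lambda>R \<xi>. FT (trunc R f) (- \<xi>)"
  have f: "L2_fun f" and gg: "L2_fun g" and hh: "L2_fun h" using g h by (auto simp: fourier_L2_iff)
  have gh: "L2_fun (\<lambda>\<xi>. g \<xi> - h \<xi>)" by (rule L2_fun_diff[OF gg hh])
  let ?I = "\<integral>\<xi>. (cmod (g \<xi> - h \<xi>))\<^sup>2 \<partial>lborel"
  have "?I \<le> 3 * ((\<integral>\<xi>. (cmod (?F R \<xi> - g \<xi>))\<^sup>2 \<partial>lborel) + (\<integral>\<xi>. (cmod (?F R \<xi> - h \<xi>))\<^sup>2 \<partial>lborel) + 0)" for R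
  proof -
    have F: "L2_fun (?F R)" by (rule L2_fun_FT_trunc[OF f])
    have "L2_fun (\<lambda>x. 0)" by (simp add: L2_fun_def)
    from L2_norm_add3[OF L2_fun_uminus[OF L2_fun_diff[OF F gg]] L2_fun_diff[OF F hh] this]
    show ?thesis by (simp only: norm_minus_cancel) simp
  qed
  moreover have "((\<lambda>R. 3 * ((\<integral>\<xi>. (cmod (?F R \<xi> - g \<xi>))\<^sup>2 \<partial>lborel) + (\<integral>\<xi>. (cmod (?F R \<xi> - h \<xi>))\<^sup>2 \<partial>lborel) + 0)) \<longlongrightarrow> 3 * (0 + 0 + 0)) at_top"
    using g h by (intro tendsto_intros) (auto simp: fourier_L2_iff)
  ultimately have "?I \<le> 3 * (0 + 0 + 0)"
    by (intro tendsto_lowerbound) (auto intro!: always_eventually)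
  moreover have "?I \<ge> 0" by simp
  ultimately have "?I = 0" by (intro antisym) simp_all
  then have "AE \<xi> in lborel. (cmod (g \<xi> - h \<xi>))\<^sup>2 = 0"
    using gh by (subst (asm) integral_nonneg_eq_0_iff_AE) (auto simp: L2_fun_def)
  then show ?thesis by eventually_elim simp
qed

lemma fourier_hat_AE:
  assumes "fourier_L2 f g" shows "AE \<xi> in lborel. fourier_hat f \<xi> = g \<xi>" "fourier_L2 f (fourier_hat f)"
proof -
  show "fourier_L2 f (fourier_hat f)" unfolding fourier_hat_def using assms by (rule someI[where P="fourier_L2 f" and x=g])
  then show "AE \<xi> in lborel. fourier_hat f \<xi> = g \<xi>" using assms by (rule fourier_L2_unique)
qed

lemma L2_tendsto_integral_mult:
  fixes F :: "real \<Rightarrow> real \<Rightarrow> complex"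
  assumes F: "\<And>R. L2_fun (F R)" and g: "L2_fun g" and v: "L2_fun v"
    and lim: "((\<lambda>R. \<integral>x. (cmod (F R x - g x))\<^sup>2 \<partial>lborel) \<longlongrightarrow> 0) A"
  shows "((\<lambda>R. \<integral>x. F R x * v x \<partial>lborel) \<longlongrightarrow> (\<integral>x. g x * v x \<partial>lborel)) A"
proof (rule iffD2[OF Lim_null], rule Lim_null_comparison)
  have Fm [measurable]: "\<And>R. F R \<in> borel_measurable borel" and [measurable]: "g \<in> borel_measurable borel" "v \<in> borel_measurable borel"
    using F g v by (auto simp: L2_fun_def)
  have v2: "integrable lborel (\<lambda>x. (cmod (v x))\<^sup>2)" using v by (simp add: L2_fun_def)
  have d2: "integrable lborel (\<lambda>x. (cmod (F R x - g x))\<^sup>2)" for R using L2_fun_diff[OF F g] by (simp add: L2_fun_def)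
  have i1: "integrable lborel (\<lambda>x. F R x * v x)" "integrable lborel (\<lambda>x. g x * v x)" for R
    using F g v by (auto intro!: integrable_mult_L2 simp: L2_fun_def)
  let ?b = "\<lambda>R. sqrt ((\<integral>x. (cmod (F R x - g x))\<^sup>2 \<partial>lborel) * (\<integral>x. (cmod (v x))\<^sup>2 \<partial>lborel))"
  have "norm ((\<integral>x. F R x * v x \<partial>lborel) - (\<integral>x. g x * v x \<partial>lborel)) \<le> ?b R" for R
  proof -
    have "(\<integral>x. F R x * v x \<partial>lborel) - (\<integral>x. g x * v x \<partial>lborel) = (\<integral>x. (F R x - g x) * v x \<partial>lborel)"
      using i1 by (subst Bochner_Integration.integral_diff[symmetric]) (auto simp: algebra_simps)
    also have "cmod \<dots> \<le> (\<integral>x. cmod (F R x - g x) * cmod (v x) \<partial>lborel)"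
      by (rule order_trans[OF integral_norm_bound]) (simp add: norm_mult)
    also have "\<dots> \<le> ?b R"
      by (intro real_le_rsqrt integral_Cauchy_Schwarz d2 v2) measurable
    finally show ?thesis .
  qed
  then show "\<forall>\<^sub>F R in A. norm ((\<integral>x. F R x * v x \<partial>lborel) - (\<integral>x. g x * v x \<partial>lborel)) \<le> ?b R"
    by simp
  show "(?b \<longlongrightarrow> 0) A"
    using tendsto_real_sqrt[OF tendsto_mult[OF lim tendsto_const]] by simp
qed

text \<open>The bridge from frequency to space: an integral of the transform against a symbol
  becomes an integral of \<open>f\<close> itself against a kernel, to which Lebesgue points apply.
  The multiplication formula holds for the truncations of \<open>f\<close>; on the left their
  transforms converge in the mean, on the right dominated convergence applies.\<close>

lemma fourier_L2_test:
  assumes fg: "fourier_L2 f g" and \<phi>: "integrable lborel \<phi>" "integrable lborel (\<lambda>x. (cmod (\<phi> x))\<^sup>2)"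
  shows "(\<integral>\<xi>. g \<xi> * \<phi> \<xi> \<partial>lborel) = (\<integral>x. f x * FT \<phi> (- x) \<partial>lborel)"
proof -
  have f: "L2_fun f" and g: "L2_fun g" using fg by (auto simp: fourier_L2_iff)
  have [measurable]: "f \<in> borel_measurable borel" "\<phi> \<in> borel_measurable borel" using f \<phi> by (auto simp: L2_fun_def)
  have p: "L2_fun \<phi>" using \<phi> by (simp add: L2_fun_def)
  have FT2: "integrable lborel (\<lambda>x. (cmod (FT \<phi> (- x)))\<^sup>2)"
    using integrable_neg[OF plancherel_le(1)[OF \<phi>]] by simp
  have fF: "integrable lborel (\<lambda>x. f x * FT \<phi> (- x))"
    using f FT2 by (intro integrable_mult_L2) (auto simp: L2_fun_def)
  have FTn: "FT (\<lambda>\<xi>. \<phi> (- \<xi>)) x = FT \<phi> (- x)" for x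
    unfolding FT_def using integral_neg[of "\<lambda>\<xi>. cis (x * \<xi>) * \<phi> (- \<xi>)"] by simp
  have eq: "(\<integral>\<xi>. FT (trunc R f) (- \<xi>) * \<phi> \<xi> \<partial>lborel) = (\<integral>x. trunc R f x * FT \<phi> (- x) \<partial>lborel)" for R
    using FT_multiplication[OF trunc_integrable(1)[OF f, of R] integrable_neg[OF \<phi>(1)]]
      integral_neg[of "\<lambda>\<xi>. FT (trunc R f) \<xi> * \<phi> (- \<xi>)"]
    by (simp add: FTn)
  have "((\<lambda>R. \<integral>\<xi>. FT (trunc R f) (- \<xi>) * \<phi> \<xi> \<partial>lborel) \<longlongrightarrow> (\<integral>\<xi>. g \<xi> * \<phi> \<xi> \<partial>lborel)) at_top"
    by (rule L2_tendsto_integral_mult[OF L2_fun_FT_trunc[OF f] g p]) (use fg in \<open>auto simp: fourier_L2_iff\<close>)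
  moreover have "((\<lambda>R. \<integral>x. trunc R f x * FT \<phi> (- x) \<partial>lborel) \<longlongrightarrow> (\<integral>x. f x * FT \<phi> (- x) \<partial>lborel)) at_top"
  proof (rule integral_dominated_convergence_at_top[where w="\<lambda>x. cmod (f x * FT \<phi> (- x))"])
    show "AE x in lborel. ((\<lambda>R. trunc R f x * FT \<phi> (- x)) \<longlongrightarrow> f x * FT \<phi> (- x)) at_top"
    proof (rule AE_I2)
      fix x
      have "\<forall>\<^sub>F R in at_top. trunc R f x * FT \<phi> (- x) = f x * FT \<phi> (- x)"
        using eventually_ge_at_top[of "\<bar>x\<bar>"] by eventually_elim (auto simp: trunc_def split: split_indicator)
      then show "((\<lambda>R. trunc R f x * FT \<phi> (- x)) \<longlongrightarrow> f x * FT \<phi> (- x)) at_top"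
        by (rule tendsto_eventually)
    qed
    show "\<forall>\<^sub>F R in at_top. AE x in lborel. norm (trunc R f x * FT \<phi> (- x)) \<le> cmod (f x * FT \<phi> (- x))"
      by (intro always_eventually allI AE_I2) (auto simp: trunc_def norm_mult split: split_indicator)
    show "integrable lborel (\<lambda>x. cmod (f x * FT \<phi> (- x)))" using fF by simp
  qed measurable
  ultimately show ?thesis
    unfolding eq by (rule tendsto_unique[OF trivial_limit_at_top_linorder])
qed

text \<open>The explicit candidate is checked against the definition by truncation. When the square
  is expanded, the multiplication formula computes the cross term and the Plancherel inequality
  bounds the square of the truncated transform. What is left is the square norm of \<open>G\<close>
  minus \<open>2 * pi * n R\<close>, which tends to 0 by Plancherel's equality.\<close>

lemma fourier_L2_inverse_FT:
  assumes G: "integrable lborel G" and bd: "\<And>x. cmod (G x) \<le> B" and cont: "AE x in lborel. isCont G x"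
  shows "fourier_L2 (\<lambda>x. FT G x / (2 * pi)) G"
    and "(\<integral>x. (cmod (FT G x / (2 * pi)))\<^sup>2 \<partial>lborel) = (\<integral>x. (cmod (G x))\<^sup>2 \<partial>lborel) / (2 * pi)"
proof -
  have [measurable]: "G \<in> borel_measurable borel" using G by auto
  define F where "F x = FT G x / (2 * pi)" for x
  have [measurable]: "F \<in> borel_measurable borel" unfolding F_def by measurable
  have G2: "integrable lborel (\<lambda>x. (cmod (G x))\<^sup>2)" by (rule plancherel_eq[OF G bd cont])
  have F2: "integrable lborel (\<lambda>x. (cmod (F x))\<^sup>2)"
    unfolding F_def using plancherel_le(1)[OF G G2] by (simp add: norm_divide power_divide)
  have F: "L2_fun F" and LG: "L2_fun G" using F2 G2 by (auto simp: L2_fun_def)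
  have nF: "(\<integral>x. (cmod (F x))\<^sup>2 \<partial>lborel) = (\<integral>x. (cmod (G x))\<^sup>2 \<partial>lborel) / (2 * pi)"
    unfolding F_def using plancherel_eq(2)[OF G bd cont] by (simp add: norm_divide power_divide power2_eq_square)
  then show "(\<integral>x. (cmod (FT G x / (2 * pi)))\<^sup>2 \<partial>lborel) = (\<integral>x. (cmod (G x))\<^sup>2 \<partial>lborel) / (2 * pi)"
    by (simp add: F_def)
  define n where "n R = (\<integral>x. (cmod (trunc R F x))\<^sup>2 \<partial>lborel)" for R
  have bound: "(\<integral>\<xi>. (cmod (FT (trunc R F) (- \<xi>) - G \<xi>))\<^sup>2 \<partial>lborel) \<le> (\<integral>x. (cmod (G x))\<^sup>2 \<partial>lborel) - 2 * pi * n R" for R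
  proof -
    let ?H = "\<lambda>\<xi>. FT (trunc R F) (- \<xi>)"
    have H: "L2_fun ?H" by (rule L2_fun_FT_trunc[OF F])
    have [measurable]: "?H \<in> borel_measurable borel" using H by (rule L2_fun_measurable)
    have H2: "integrable lborel (\<lambda>\<xi>. (cmod (?H \<xi>))\<^sup>2)" using H by (simp add: L2_fun_def)
    have HG: "integrable lborel (\<lambda>\<xi>. ?H \<xi> * cnj (G \<xi>))"
      using H2 G2 by (intro integrable_mult_L2) auto
    have "(\<integral>\<xi>. ?H \<xi> * cnj (G \<xi>) \<partial>lborel) = (\<integral>\<xi>. FT (trunc R F) \<xi> * cnj (G (- \<xi>)) \<partial>lborel)"
      using integral_neg[of "\<lambda>\<xi>. FT (trunc R F) \<xi> * cnj (G (- \<xi>))"] by simp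
    also have "\<dots> = (\<integral>x. trunc R F x * FT (\<lambda>\<xi>. cnj (G (- \<xi>))) x \<partial>lborel)"
      using integrable_neg[OF G] by (intro FT_multiplication trunc_integrable F) simp
    also have "\<dots> = (\<integral>x. complex_of_real (2 * pi * (cmod (trunc R F x))\<^sup>2) \<partial>lborel)"
    proof (intro Bochner_Integration.integral_cong refl)
      fix x
      have "FT (\<lambda>\<xi>. cnj (G (- \<xi>))) x = cnj (FT G x)"
      proof -
        have "(\<integral>\<xi>. cis (x * \<xi>) * cnj (G (- \<xi>)) \<partial>lborel) = (\<integral>\<xi>. cis (x * (- \<xi>)) * cnj (G (- (- \<xi>))) \<partial>lborel)"
          by (rule integral_neg[symmetric])
        also have "\<dots> = (\<integral>\<xi>. cnj (cis (x * \<xi>) * G \<xi>) \<partial>lborel)"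
          by (simp add: cis_cnj)
        also have "\<dots> = cnj (\<integral>\<xi>. cis (x * \<xi>) * G \<xi> \<partial>lborel)"
          by (rule Bochner_Integration.integral_cnj)
        finally show ?thesis unfolding FT_def .
      qed
      also have "\<dots> = 2 * pi * cnj (F x)" by (simp add: F_def)
      finally show "trunc R F x * FT (\<lambda>\<xi>. cnj (G (- \<xi>))) x = complex_of_real (2 * pi * (cmod (trunc R F x))\<^sup>2)"
        using complex_norm_square[of "F x"] by (simp add: trunc_def split: split_indicator)
    qed
    also have "\<dots> = complex_of_real (2 * pi * n R)"
      unfolding integral_complex_of_real n_def by simp
    finally have e: "(\<integral>\<xi>. ?H \<xi> * cnj (G \<xi>) \<partial>lborel) = complex_of_real (2 * pi * n R)" .
    have r: "(\<integral>\<xi>. Re (?H \<xi> * cnj (G \<xi>)) \<partial>lborel) = 2 * pi * n R"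
      using integral_Re[OF HG] e by simp
    have "(\<integral>\<xi>. (cmod (?H \<xi> - G \<xi>))\<^sup>2 \<partial>lborel)
       = (\<integral>\<xi>. ((cmod (?H \<xi>))\<^sup>2 + (cmod (G \<xi>))\<^sup>2) - 2 * Re (?H \<xi> * cnj (G \<xi>)) \<partial>lborel)"
    proof -
      have "(cmod (a - b))\<^sup>2 = ((cmod a)\<^sup>2 + (cmod b)\<^sup>2) - 2 * Re (a * cnj b)" for a b
        by (simp only: cmod_power2) (simp add: power2_eq_square algebra_simps)
      then show ?thesis by (simp only:)
    qed
    also have "\<dots> = (\<integral>\<xi>. (cmod (?H \<xi>))\<^sup>2 + (cmod (G \<xi>))\<^sup>2 \<partial>lborel) - (\<integral>\<xi>. 2 * Re (?H \<xi> * cnj (G \<xi>)) \<partial>lborel)"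
      by (rule Bochner_Integration.integral_diff[OF Bochner_Integration.integrable_add[OF H2 G2] integrable_mult_right[OF integrable_Re[OF HG]]])
    also have "\<dots> = (\<integral>\<xi>. (cmod (?H \<xi>))\<^sup>2 \<partial>lborel) + (\<integral>\<xi>. (cmod (G \<xi>))\<^sup>2 \<partial>lborel) - 2 * (2 * pi * n R)"
      unfolding Bochner_Integration.integral_add[OF H2 G2] integral_mult_right_zero r ..
    also have "(\<integral>\<xi>. (cmod (?H \<xi>))\<^sup>2 \<partial>lborel) \<le> 2 * pi * n R"
      using plancherel_le(2)[OF trunc_integrable[OF F, of R]] integral_neg[of "\<lambda>\<xi>. (cmod (FT (trunc R F) \<xi>))\<^sup>2"]
      by (simp add: n_def)
    finally show ?thesis by simp
  qed
  have "(n \<longlongrightarrow> (\<integral>x. (cmod (F x))\<^sup>2 \<partial>lborel)) at_top"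
    unfolding n_def
  proof (rule integral_dominated_convergence_at_top[where w="\<lambda>x. (cmod (F x))\<^sup>2"])
    show "AE x in lborel. ((\<lambda>R. (cmod (trunc R F x))\<^sup>2) \<longlongrightarrow> (cmod (F x))\<^sup>2) at_top"
    proof (rule AE_I2)
      fix x
      have "\<forall>\<^sub>F R in at_top. (cmod (trunc R F x))\<^sup>2 = (cmod (F x))\<^sup>2"
        using eventually_ge_at_top[of "\<bar>x\<bar>"] by eventually_elim (auto simp: trunc_def split: split_indicator)
      then show "((\<lambda>R. (cmod (trunc R F x))\<^sup>2) \<longlongrightarrow> (cmod (F x))\<^sup>2) at_top"
        by (rule tendsto_eventually)
    qed
    show "\<forall>\<^sub>F R in at_top. AE x in lborel. norm ((cmod (trunc R F x))\<^sup>2) \<le> (cmod (F x))\<^sup>2"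
      by (intro always_eventually allI AE_I2) (auto simp: trunc_def split: split_indicator)
    show "integrable lborel (\<lambda>x. (cmod (F x))\<^sup>2)" by (rule F2)
  qed measurable
  then have "((\<lambda>R. (\<integral>x. (cmod (G x))\<^sup>2 \<partial>lborel) - 2 * pi * n R) \<longlongrightarrow>
      (\<integral>x. (cmod (G x))\<^sup>2 \<partial>lborel) - 2 * pi * ((\<integral>x. (cmod (G x))\<^sup>2 \<partial>lborel) / (2 * pi))) at_top"
    unfolding nF by (intro tendsto_intros)
  then have "((\<lambda>R. (\<integral>x. (cmod (G x))\<^sup>2 \<partial>lborel) - 2 * pi * n R) \<longlongrightarrow> 0) at_top"
    by simp
  then have "((\<lambda>R. \<integral>\<xi>. (cmod (FT (trunc R F) (- \<xi>) - G \<xi>))\<^sup>2 \<partial>lborel) \<longlongrightarrow> 0) at_top"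
    by (rule tendsto_sandwich[rotated 2, OF tendsto_const]) (auto intro!: always_eventually bound)
  then show "fourier_L2 (\<lambda>x. FT G x / (2 * pi)) G"
    using F LG unfolding fourier_L2_iff F_def by simp
qed

section \<open>Linearity and closedness of the transform\<close>

lemma FT_add: "integrable lborel u \<Longrightarrow> integrable lborel v \<Longrightarrow> FT (\<lambda>x. u x + v x) \<xi> = FT u \<xi> + FT v \<xi>"
  unfolding FT_def
  by (subst Bochner_Integration.integral_add[symmetric])
     (auto intro!: integrable_cis_mult simp: distrib_left)

lemma FT_diff: "integrable lborel u \<Longrightarrow> integrable lborel v \<Longrightarrow> FT (\<lambda>x. u x - v x) \<xi> = FT u \<xi> - FT v \<xi>"
  unfolding FT_def
  by (subst Bochner_Integration.integral_diff[symmetric])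
     (auto intro!: integrable_cis_mult simp: right_diff_distrib)

lemma fourier_L2_add:
  assumes a: "fourier_L2 f g" and b: "fourier_L2 f' g'"
  shows "fourier_L2 (\<lambda>x. f x + f' x) (\<lambda>x. g x + g' x)"
proof -
  have f: "L2_fun f" "L2_fun f'" and g: "L2_fun g" "L2_fun g'" using a b by (auto simp: fourier_L2_iff)
  have FTadd: "FT (trunc R (\<lambda>x. f x + f' x)) \<xi> = FT (trunc R f) \<xi> + FT (trunc R f') \<xi>" for R \<xi>
  proof -
    have "trunc R (\<lambda>x. f x + f' x) = (\<lambda>x. trunc R f x + trunc R f' x)"
      by (auto simp: trunc_def algebra_simps)
    then show ?thesis by (simp only: FT_add trunc_integrable f)
  qed
  let ?D = "\<lambda>f g R \<xi>. FT (trunc R f) (- \<xi>) - g \<xi>"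
  let ?N = "\<lambda>f g R. \<integral>\<xi>. (cmod (?D f g R \<xi>))\<^sup>2 \<partial>lborel"
  have z: "L2_fun (\<lambda>x. 0)" by (simp add: L2_fun_def)
  have "?N (\<lambda>x. f x + f' x) (\<lambda>x. g x + g' x) R \<le> 3 * (?N f g R + ?N f' g' R + 0)" for R
    using L2_norm_add3[OF L2_fun_diff[OF L2_fun_FT_trunc[OF f(1)] g(1)] L2_fun_diff[OF L2_fun_FT_trunc[OF f(2)] g(2)] z, of R R]
    by (simp add: FTadd algebra_simps)
  then have le: "\<forall>\<^sub>F R in at_top. ?N (\<lambda>x. f x + f' x) (\<lambda>x. g x + g' x) R \<le> 3 * (?N f g R + ?N f' g' R + 0)"
    by simp
  have "((\<lambda>R. 3 * (?N f g R + ?N f' g' R + 0)) \<longlongrightarrow> 3 * (0 + 0 + 0)) at_top"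
    using a b by (intro tendsto_intros) (auto simp: fourier_L2_iff)
  then have lim: "((\<lambda>R. 3 * (?N f g R + ?N f' g' R + 0)) \<longlongrightarrow> 0) at_top"
    by simp
  have "((\<lambda>R. ?N (\<lambda>x. f x + f' x) (\<lambda>x. g x + g' x) R) \<longlongrightarrow> 0) at_top"
    by (rule tendsto_sandwich[OF _ le tendsto_const lim]) simp
  then show ?thesis
    unfolding fourier_L2_iff using L2_fun_add[OF f] L2_fun_add[OF g] by simp
qed

lemma fourier_L2_zero: "fourier_L2 (\<lambda>x. 0) (\<lambda>x. 0)"
  unfolding fourier_L2_iff by (auto simp: L2_fun_def trunc_def FT_def)

lemma fourier_L2_sum:
  assumes "\<And>j. fourier_L2 (f j) (g j)"
  shows "fourier_L2 (\<lambda>x. \<Sum>j<(n::nat). f j x) (\<lambda>x. \<Sum>j<n. g j x)"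
  by (induction n) (auto intro!: fourier_L2_zero fourier_L2_add assms)

text \<open>The transform is a closed operator. Replacing \<open>f\<close> by \<open>F n\<close>
  costs an error that the Plancherel inequality bounds independently of the truncation radius
  \<open>R\<close>, so \<open>n\<close> can be fixed before \<open>R\<close> tends to
  infinity.\<close>

lemma fourier_L2_limit:
  assumes fn: "\<And>n. fourier_L2 (F n) (G n)" and f: "L2_fun f" and g: "L2_fun g"
    and limf: "(\<lambda>n. \<integral>x. (cmod (f x - F n x))\<^sup>2 \<partial>lborel) \<longlonglongrightarrow> 0"
    and limg: "(\<lambda>n. \<integral>x. (cmod (g x - G n x))\<^sup>2 \<partial>lborel) \<longlonglongrightarrow> 0"
  shows "fourier_L2 f g"
proof -
  have F: "L2_fun (F n)" and G: "L2_fun (G n)" for n using fn[of n] by (auto simp: fourier_L2_iff)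
  let ?n = "\<lambda>u. \<integral>x. (cmod (u x))\<^sup>2 \<partial>lborel"
  have key: "?n (\<lambda>\<xi>. FT (trunc R f) (- \<xi>) - g \<xi>) \<le>
     3 * (2 * pi * ?n (\<lambda>x. f x - F n x) + ?n (\<lambda>\<xi>. FT (trunc R (F n)) (- \<xi>) - G n \<xi>) + ?n (\<lambda>x. g x - G n x))" for R n
  proof -
    have d: "L2_fun (\<lambda>x. f x - F n x)" by (rule L2_fun_diff[OF f F])
    have FTd: "FT (trunc R (\<lambda>x. f x - F n x)) \<xi> = FT (trunc R f) \<xi> - FT (trunc R (F n)) \<xi>" for \<xi>
    proof -
      have "trunc R (\<lambda>x. f x - F n x) = (\<lambda>x. trunc R f x - trunc R (F n) x)"
        by (auto simp: trunc_def algebra_simps)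
      then show ?thesis by (simp only: FT_diff trunc_integrable f F)
    qed
    have "?n (\<lambda>\<xi>. FT (trunc R (\<lambda>x. f x - F n x)) (- \<xi>)) = ?n (FT (trunc R (\<lambda>x. f x - F n x)))"
      by (rule integral_neg)
    also have "\<dots> \<le> 2 * pi * ?n (trunc R (\<lambda>x. f x - F n x))"
      by (rule plancherel_le(2)[OF trunc_integrable[OF d]])
    also have "?n (trunc R (\<lambda>x. f x - F n x)) \<le> ?n (\<lambda>x. f x - F n x)"
      using d trunc_integrable(2)[OF d] by (intro integral_mono) (auto simp: L2_fun_def trunc_def split: split_indicator)
    finally have 1: "?n (\<lambda>\<xi>. FT (trunc R (\<lambda>x. f x - F n x)) (- \<xi>)) \<le> 2 * pi * ?n (\<lambda>x. f x - F n x)"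
      by simp
    have "?n (\<lambda>\<xi>. FT (trunc R f) (- \<xi>) - g \<xi>) =
      ?n (\<lambda>\<xi>. FT (trunc R (\<lambda>x. f x - F n x)) (- \<xi>) + (FT (trunc R (F n)) (- \<xi>) - G n \<xi>) + - (g \<xi> - G n \<xi>))"
      by (simp add: FTd)
    also have "\<dots> \<le> 3 * (?n (\<lambda>\<xi>. FT (trunc R (\<lambda>x. f x - F n x)) (- \<xi>)) + ?n (\<lambda>\<xi>. FT (trunc R (F n)) (- \<xi>) - G n \<xi>) + ?n (\<lambda>\<xi>. - (g \<xi> - G n \<xi>)))"
      by (intro L2_norm_add3 L2_fun_FT_trunc L2_fun_diff L2_fun_uminus f F g G)
    also have "?n (\<lambda>\<xi>. - (g \<xi> - G n \<xi>)) = ?n (\<lambda>\<xi>. g \<xi> - G n \<xi>)"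
      by (simp only: norm_minus_cancel)
    finally show ?thesis using 1 by (meson add_right_mono mult_left_mono order_trans zero_le_numeral)
  qed
  have "((\<lambda>R. ?n (\<lambda>\<xi>. FT (trunc R f) (- \<xi>) - g \<xi>)) \<longlongrightarrow> 0) at_top"
  proof (rule tendstoI)
    fix e :: real assume e: "e > 0"
    have "(\<lambda>n. 3 * (2 * pi * ?n (\<lambda>x. f x - F n x) + ?n (\<lambda>x. g x - G n x))) \<longlonglongrightarrow> 3 * (2 * pi * 0 + 0)"
      by (intro tendsto_intros limf limg)
    then have "\<forall>\<^sub>F n in sequentially. 3 * (2 * pi * ?n (\<lambda>x. f x - F n x) + ?n (\<lambda>x. g x - G n x)) < e / 2"
      using e by (intro order_tendstoD(2)) auto
    then obtain n where n: "3 * (2 * pi * ?n (\<lambda>x. f x - F n x) + ?n (\<lambda>x. g x - G n x)) < e / 2"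
      by (auto dest: eventually_happens)
    have "((\<lambda>R. 3 * ?n (\<lambda>\<xi>. FT (trunc R (F n)) (- \<xi>) - G n \<xi>)) \<longlongrightarrow> 3 * 0) at_top"
      using fn[of n] by (intro tendsto_intros) (auto simp: fourier_L2_iff)
    then have "\<forall>\<^sub>F R in at_top. 3 * ?n (\<lambda>\<xi>. FT (trunc R (F n)) (- \<xi>) - G n \<xi>) < e / 2"
      using e by (intro order_tendstoD(2)) auto
    then show "\<forall>\<^sub>F R in at_top. dist (?n (\<lambda>\<xi>. FT (trunc R f) (- \<xi>) - g \<xi>)) 0 < e"
    proof eventually_elim
      case (elim R)
      have "?n (\<lambda>\<xi>. FT (trunc R f) (- \<xi>) - g \<xi>) \<ge> 0" by simp
      moreover have "?n (\<lambda>\<xi>. FT (trunc R f) (- \<xi>) - g \<xi>) < e"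
        using key[of R n] elim n by (simp add: distrib_left)
      ultimately show ?case by (simp add: dist_real_def)
    qed
  qed
  then show ?thesis using f g by (simp add: fourier_L2_iff)
qed

lemma L2_series_limit:
  fixes h :: "nat \<Rightarrow> real \<Rightarrow> complex"
  assumes h: "\<And>j. L2_fun (h j)" and bd: "\<And>j. (\<integral>x. (cmod (h j x))\<^sup>2 \<partial>lborel) \<le> C * (1/4) ^ j"
  shows "L2_fun (\<lambda>x. \<Sum>j. h j x)" "(\<lambda>n. \<integral>x. (cmod ((\<Sum>j. h j x) - (\<Sum>j<n. h j x)))\<^sup>2 \<partial>lborel) \<longlonglongrightarrow> 0"
proof -
  have [measurable]: "\<And>j. h j \<in> borel_measurable borel" using h by (auto simp: L2_fun_def)
  have "\<And>j. h j \<in> borel_measurable lborel" "\<And>j. integrable lborel (\<lambda>x. (cmod (h j x))\<^sup>2)"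
    using h by (auto simp: L2_fun_def)
  from L2_series[OF this bd] obtain D where D: "integrable lborel D" "AE x in lborel. summable (\<lambda>j. cmod (h j x))"
    "\<And>n. AE x in lborel. (cmod ((\<Sum>j. h j x) - (\<Sum>j<n. h j x)))\<^sup>2 \<le> (1/2) ^ n * D x" by blast
  have i: "integrable lborel (\<lambda>x. (cmod ((\<Sum>j. h j x) - (\<Sum>j<n. h j x)))\<^sup>2)" for n
  proof (rule Bochner_Integration.integrable_bound)
    show "integrable lborel (\<lambda>x. (1/2) ^ n * D x)" using D(1) by simp
    show "AE x in lborel. norm ((cmod ((\<Sum>j. h j x) - (\<Sum>j<n. h j x)))\<^sup>2) \<le> norm ((1/2) ^ n * D x)"
      using D(3)[of n] by eventually_elim (auto intro: order_trans[OF _ abs_ge_self])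
  qed measurable
  from i[of 0] show "L2_fun (\<lambda>x. \<Sum>j. h j x)" by (simp add: L2_fun_def)
  have "(\<integral>x. (cmod ((\<Sum>j. h j x) - (\<Sum>j<n. h j x)))\<^sup>2 \<partial>lborel) \<le> (1/2) ^ n * (\<integral>x. D x \<partial>lborel)" for n
  proof -
    have "(\<integral>x. (cmod ((\<Sum>j. h j x) - (\<Sum>j<n. h j x)))\<^sup>2 \<partial>lborel) \<le> (\<integral>x. (1/2) ^ n * D x \<partial>lborel)"
      using D(1) by (intro integral_mono_AE i D(3)) auto
    then show ?thesis by simp
  qed
  then have le: "\<forall>\<^sub>F n in sequentially. (\<integral>x. (cmod ((\<Sum>j. h j x) - (\<Sum>j<n. h j x)))\<^sup>2 \<partial>lborel) \<le> (1/2) ^ n * (\<integral>x. D x \<partial>lborel)"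
    by simp
  have "(\<lambda>n. (1/2) ^ n * (\<integral>x. D x \<partial>lborel)) \<longlonglongrightarrow> 0 * (\<integral>x. D x \<partial>lborel)"
    by (intro tendsto_mult tendsto_const LIMSEQ_power_zero) auto
  then have lim: "(\<lambda>n. (1/2) ^ n * (\<integral>x. D x \<partial>lborel)) \<longlonglongrightarrow> 0"
    by simp
  show "(\<lambda>n. \<integral>x. (cmod ((\<Sum>j. h j x) - (\<Sum>j<n. h j x)))\<^sup>2 \<partial>lborel) \<longlonglongrightarrow> 0"
    by (rule tendsto_sandwich[OF _ le tendsto_const lim]) simp
qed

text \<open>The counterexample is prescribed on the frequency side; this supplies an
  \<open>f\<close> with the given transform by summing inverse transforms. The rate
  \<open>(1/4) ^ j\<close> is the one demanded by \<open>L2_series\<close>.\<close>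

lemma fourier_L2_series:
  assumes G: "\<And>j. integrable lborel (G j)" and bd: "\<And>j x. cmod (G j x) \<le> B j" and cont: "\<And>j. AE x in lborel. isCont (G j) x"
    and small: "\<And>j. (\<integral>x. (cmod (G j x))\<^sup>2 \<partial>lborel) \<le> C * (1/4) ^ j"
  obtains f where "fourier_L2 f (\<lambda>\<xi>. \<Sum>j. G j \<xi>)"
proof
  define F where "F j x = FT (G j) x / (2 * pi)" for j x
  have inv: "fourier_L2 (\<lambda>x. FT (G j) x / (2 * pi)) (G j)"
    "(\<integral>x. (cmod (FT (G j) x / (2 * pi)))\<^sup>2 \<partial>lborel) = (\<integral>x. (cmod (G j x))\<^sup>2 \<partial>lborel) / (2 * pi)" for j
    using fourier_L2_inverse_FT[where G="G j" and B="B j"] G bd cont by auto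
  have FG: "fourier_L2 (F j) (G j)" for j unfolding F_def by (rule inv(1))
  then have F: "L2_fun (F j)" and GL: "L2_fun (G j)" for j unfolding fourier_L2_iff by auto
  have smallF: "(\<integral>x. (cmod (F j x))\<^sup>2 \<partial>lborel) \<le> (C / (2 * pi)) * (1/4) ^ j" for j
    unfolding F_def inv(2) using small[of j] by (simp add: divide_right_mono)
  show "fourier_L2 (\<lambda>x. \<Sum>j. F j x) (\<lambda>\<xi>. \<Sum>j. G j \<xi>)"
    by (rule fourier_L2_limit[where F="\<lambda>n x. \<Sum>j<n. F j x" and G="\<lambda>n x. \<Sum>j<n. G j x", OF fourier_L2_sum[OF FG]])
       (intro L2_series_limit[OF F smallF] L2_series_limit[OF GL small])+
qed

section \<open>Oscillatory integrals\<close>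

text \<open>Linear coefficient \<open>a\<close>, dispersion \<open>b\<close>, damping
  \<open>c\<close>. Only positive frequencies are meant; negative ones are reflected, which replaces
  \<open>a\<close> by \<open>- a\<close>. The product with a conjugate is again of this form, as
  \<open>T T*\<close> requires.\<close>

definition osc :: "real \<Rightarrow> real \<Rightarrow> real \<Rightarrow> real \<Rightarrow> real \<Rightarrow> complex" where
  "osc m a b c \<xi> = exp (- c * \<xi> powr m) *\<^sub>R cis (a * \<xi> + b * \<xi> powr m)"

lemma norm_osc [simp]: "cmod (osc m a b c \<xi>) = exp (- c * \<xi> powr m)"
  by (simp add: osc_def)

lemma continuous_on_osc: "(\<And>x. x \<in> S \<Longrightarrow> x > 0) \<Longrightarrow> continuous_on S (osc m a b c)"
  unfolding osc_def by (intro continuous_intros) auto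

lemma exp_powr_antimono:
  fixes c m p \<xi> :: real
  assumes "0 \<le> c" "0 < m" "0 < p" "p \<le> \<xi>"
  shows "exp (- c * \<xi> powr m) \<le> exp (- c * p powr m)"
  using assms by (auto intro!: mult_left_mono powr_mono2)

text \<open>One integration by parts. Monotonicity is automatic here: the derivative
  \<open>h\<close> of the phase is \<open>a\<close> plus a multiple of a power, and the damping
  factor decreases. Of the constant 5, two units are the boundary terms, one is the variation of the
  amplitude and two are the variation of \<open>1 / h\<close>.\<close>

lemma vdc_first:
  fixes m a b c p q \<mu> :: real
  assumes m: "0 < m" "m < 1" and c: "0 \<le> c" and pq: "0 < p" "p \<le> q" and mu: "\<mu> > 0"
    and lb: "\<And>\<xi>. p \<le> \<xi> \<Longrightarrow> \<xi> \<le> q \<Longrightarrow> \<mu> \<le> \<bar>a + b * m * \<xi> powr (m - 1)\<bar>"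
  shows "cmod (integral {p..q} (osc m a b c)) \<le> 5 / \<mu> * exp (- c * p powr m)"
proof -
  define A where "A \<xi> = exp (- c * \<xi> powr m)" for \<xi>
  define A' where "A' \<xi> = - c * (m * \<xi> powr (m - 1)) * A \<xi>" for \<xi>
  define h where "h \<xi> = a + b * m * \<xi> powr (m - 1)" for \<xi>
  define h' where "h' \<xi> = b * m * ((m - 1) * \<xi> powr (m - 2))" for \<xi>
  define g where "g \<xi> = - \<i> * cis (a * \<xi> + b * \<xi> powr m)" for \<xi>
  define f' where "f' \<xi> = (A' \<xi> * h \<xi> - A \<xi> * h' \<xi>) / (h \<xi>)\<^sup>2" for \<xi>
  \<comment> \<open>\<open>s\<close> is the sign that makes \<open>s * h'\<close> nonnegative.
    \<open>B\<close> then dominates the modulus of the remaining integrand and has the explicit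
    primitive \<open>K\<close>, so the remainder is bounded by \<open>K q - K p\<close>.\<close>
  define s :: real where "s = (if b \<ge> 0 then -1 else 1)"
  define B where "B \<xi> = - A' \<xi> / \<mu> + A p * (s * h' \<xi> / (h \<xi>)\<^sup>2)" for \<xi>
  define K where "K \<xi> = - A \<xi> / \<mu> + A p * (- s / h \<xi>)" for \<xi>
  have hlb: "\<mu> \<le> \<bar>h \<xi>\<bar>" if "\<xi> \<in> {p..q}" for \<xi> using lb[of \<xi>] that by (simp add: h_def)
  have h0: "h \<xi> \<noteq> 0" if "\<xi> \<in> {p..q}" for \<xi> using hlb[OF that] mu by auto
  have dA: "(A has_real_derivative A' \<xi>) (at \<xi>)" if "\<xi> \<in> {p..q}" for \<xi>
    unfolding A_def A'_def using that pq by (auto intro!: derivative_eq_intros)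
  have dh: "(h has_real_derivative h' \<xi>) (at \<xi>)" if "\<xi> \<in> {p..q}" for \<xi>
    unfolding h_def h'_def using that pq by (auto intro!: derivative_eq_intros)
  have dg: "(g has_vector_derivative h \<xi> *\<^sub>R cis (a * \<xi> + b * \<xi> powr m)) (at \<xi>)" if "\<xi> \<in> {p..q}" for \<xi>
  proof -
    have "((\<lambda>\<xi>. a * \<xi> + b * \<xi> powr m) has_real_derivative h \<xi>) (at \<xi>)"
      unfolding h_def using that pq by (auto intro!: derivative_eq_intros)
    then have "((\<lambda>\<xi>. a * \<xi> + b * \<xi> powr m) has_derivative (\<lambda>t. t * h \<xi>)) (at \<xi>)"
      by (simp add: has_field_derivative_def mult_commute_abs)
    then have "((\<lambda>\<xi>. cis (a * \<xi> + b * \<xi> powr m)) has_vector_derivative (h \<xi> *\<^sub>R (\<i> * cis (a * \<xi> + b * \<xi> powr m)))) (at \<xi>)"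
      unfolding has_vector_derivative_def by (auto dest: has_derivative_cis)
    then have "(g has_vector_derivative - \<i> * (h \<xi> *\<^sub>R (\<i> * cis (a * \<xi> + b * \<xi> powr m)))) (at \<xi>)"
      unfolding g_def by (rule has_vector_derivative_mult_right)
    moreover have "- \<i> * (h \<xi> *\<^sub>R (\<i> * cis (a * \<xi> + b * \<xi> powr m))) = h \<xi> *\<^sub>R cis (a * \<xi> + b * \<xi> powr m)"
      by (simp add: complex_eq_iff)
    ultimately show ?thesis by simp
  qed
  have dH: "((\<lambda>\<xi>. (A \<xi> / h \<xi>) *\<^sub>R g \<xi>) has_vector_derivative (osc m a b c \<xi> + f' \<xi> *\<^sub>R g \<xi>)) (at \<xi> within {p..q})"
    if x: "\<xi> \<in> {p..q}" for \<xi>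
  proof -
    have "((\<lambda>\<xi>. A \<xi> / h \<xi>) has_real_derivative f' \<xi>) (at \<xi>)"
      using DERIV_divide[OF dA[OF x] dh[OF x] h0[OF x]] by (simp add: f'_def power2_eq_square)
    from has_vector_derivative_scaleR[OF this dg[OF x]]
    have "((\<lambda>\<xi>. (A \<xi> / h \<xi>) *\<^sub>R g \<xi>) has_vector_derivative ((A \<xi> / h \<xi>) *\<^sub>R (h \<xi> *\<^sub>R cis (a * \<xi> + b * \<xi> powr m)) + f' \<xi> *\<^sub>R g \<xi>)) (at \<xi>)" .
    moreover have "(A \<xi> / h \<xi>) *\<^sub>R (h \<xi> *\<^sub>R cis (a * \<xi> + b * \<xi> powr m)) = osc m a b c \<xi>"
      using h0[OF x] by (simp add: osc_def A_def)
    ultimately show ?thesis by (metis has_vector_derivative_at_within)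
  qed
  have "((\<lambda>\<xi>. osc m a b c \<xi> + f' \<xi> *\<^sub>R g \<xi>) has_integral (A q / h q) *\<^sub>R g q - (A p / h p) *\<^sub>R g p) {p..q}"
    by (rule fundamental_theorem_of_calculus[OF pq(2) dH])
  moreover have oi: "osc m a b c integrable_on {p..q}"
    using pq by (intro integrable_continuous_interval continuous_on_osc) auto
  moreover have Ri: "(\<lambda>\<xi>. f' \<xi> *\<^sub>R g \<xi>) integrable_on {p..q}"
    unfolding f'_def g_def A'_def h'_def A_def using h0 pq
    by (intro integrable_continuous_interval continuous_intros) (auto simp: h_def intro!: continuous_intros)
  ultimately have eq: "integral {p..q} (osc m a b c) + integral {p..q} (\<lambda>\<xi>. f' \<xi> *\<^sub>R g \<xi>) = (A q / h q) *\<^sub>R g q - (A p / h p) *\<^sub>R g p"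
    using integral_add[OF oi Ri] integral_unique by metis
  have dK: "(K has_vector_derivative B \<xi>) (at \<xi> within {p..q})" if x: "\<xi> \<in> {p..q}" for \<xi>
  proof -
    have "(K has_real_derivative B \<xi>) (at \<xi>)"
      unfolding K_def B_def using dA[OF x] dh[OF x] h0[OF x] mu
      by (auto intro!: derivative_eq_intros simp: power2_eq_square)
    then show ?thesis
      by (simp add: has_field_derivative_at_within has_real_derivative_iff_has_vector_derivative[symmetric])
  qed
  have BI: "(B has_integral K q - K p) {p..q}"
    by (rule fundamental_theorem_of_calculus[OF pq(2) dK])
  have Ap: "A \<xi> \<le> A p" if "\<xi> \<in> {p..q}" for \<xi>
    unfolding A_def using that pq c m by (intro exp_powr_antimono) auto
  have A0: "A \<xi> > 0" for \<xi> by (simp add: A_def)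
  have gn: "cmod (g \<xi>) = 1" for \<xi> by (simp add: g_def norm_mult)
  have fB: "cmod (f' \<xi> *\<^sub>R g \<xi>) \<le> B \<xi>" if x: "\<xi> \<in> {p..q}" for \<xi>
  proof -
    have sh: "s * h' \<xi> = \<bar>h' \<xi>\<bar>"
    proof -
      have "\<bar>h' \<xi>\<bar> = \<bar>b\<bar> * m * ((1 - m) * \<xi> powr (m - 2))"
        using m by (simp add: h'_def abs_mult)
      moreover have "s * h' \<xi> = (s * b) * m * ((m - 1) * \<xi> powr (m - 2))"
        by (simp add: h'_def)
      moreover have "s * b = - \<bar>b\<bar>" by (simp add: s_def)
      moreover have "- \<bar>b\<bar> * m * ((m - 1) * \<xi> powr (m - 2)) = \<bar>b\<bar> * m * ((1 - m) * \<xi> powr (m - 2))"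
        by (simp add: algebra_simps)
      ultimately show ?thesis by (simp only:)
    qed
    have A'n: "\<bar>A' \<xi>\<bar> = - A' \<xi>" using c m A0[of \<xi>] by (simp add: A'_def abs_mult)
    have "\<bar>f' \<xi>\<bar> = \<bar>A' \<xi> / h \<xi> - A \<xi> * h' \<xi> / (h \<xi>)\<^sup>2\<bar>"
      using h0[OF x] by (simp add: f'_def diff_divide_distrib power2_eq_square)
    also have "\<dots> \<le> \<bar>A' \<xi>\<bar> / \<bar>h \<xi>\<bar> + A \<xi> * (\<bar>h' \<xi>\<bar> / (h \<xi>)\<^sup>2)"
      using abs_triangle_ineq4[of "A' \<xi> / h \<xi>" "A \<xi> * h' \<xi> / (h \<xi>)\<^sup>2"] A0[of \<xi>] by (simp add: abs_mult)
    also have "\<dots> \<le> \<bar>A' \<xi>\<bar> / \<mu> + A p * (\<bar>h' \<xi>\<bar> / (h \<xi>)\<^sup>2)"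
      using hlb[OF x] mu Ap[OF x] by (intro add_mono divide_left_mono mult_right_mono) auto
    also have "\<dots> = B \<xi>" unfolding B_def sh A'n by simp
    finally show ?thesis by (simp add: gn)
  qed
  have R: "cmod (integral {p..q} (\<lambda>\<xi>. f' \<xi> *\<^sub>R g \<xi>)) \<le> K q - K p"
    using integral_norm_bound_integral[OF Ri has_integral_integrable[OF BI] fB] integral_unique[OF BI] by simp
  have p: "p \<in> {p..q}" and q: "q \<in> {p..q}" using pq by auto
  have inv: "\<bar>1 / h \<xi>\<bar> \<le> 1 / \<mu>" if "\<xi> \<in> {p..q}" for \<xi>
    using hlb[OF that] mu by (auto simp: divide_simps)
  have Kb: "K q - K p \<le> A p * (3 / \<mu>)"
  proof -
    have "K q - K p = A p / \<mu> - A q / \<mu> + A p * (s * (1 / h p) - s * (1 / h q))"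
      unfolding K_def by (simp add: algebra_simps)
    also have "\<dots> \<le> A p / \<mu> + A p * (1 / \<mu> + 1 / \<mu>)"
    proof -
      have "s * (1 / h p) \<le> 1 / \<mu>" "- (s * (1 / h q)) \<le> 1 / \<mu>"
        using abs_le_D1[OF inv[OF p]] abs_le_D2[OF inv[OF p]] abs_le_D1[OF inv[OF q]] abs_le_D2[OF inv[OF q]]
        by (simp_all add: s_def)
      then have "s * (1 / h p) - s * (1 / h q) \<le> 1 / \<mu> + 1 / \<mu>" by linarith
      then have "A p * (s * (1 / h p) - s * (1 / h q)) \<le> A p * (1 / \<mu> + 1 / \<mu>)"
        using A0[of p] by (intro mult_left_mono) auto
      moreover have "A q / \<mu> \<ge> 0" using A0[of q] mu by simp
      ultimately show ?thesis by linarith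
    qed
    finally show ?thesis using mu by (simp add: field_simps)
  qed
  have H: "cmod ((A \<xi> / h \<xi>) *\<^sub>R g \<xi>) \<le> A p * (1 / \<mu>)" if x: "\<xi> \<in> {p..q}" for \<xi>
  proof -
    have "cmod ((A \<xi> / h \<xi>) *\<^sub>R g \<xi>) = A \<xi> * \<bar>1 / h \<xi>\<bar>"
      using A0[of \<xi>] by (simp add: gn abs_mult)
    also have "\<dots> \<le> A p * (1 / \<mu>)"
      using Ap[OF x] inv[OF x] A0[of p] by (intro mult_mono) auto
    finally show ?thesis .
  qed
  have "integral {p..q} (osc m a b c) = (A q / h q) *\<^sub>R g q - (A p / h p) *\<^sub>R g p - integral {p..q} (\<lambda>\<xi>. f' \<xi> *\<^sub>R g \<xi>)"
    using eq by (simp add: algebra_simps)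
  moreover have "cmod (X - Y - Z) \<le> cmod X + cmod Y + cmod Z" for X Y Z
    using norm_triangle_ineq4[of "X - Y" Z] norm_triangle_ineq4[of X Y] by linarith
  ultimately have "cmod (integral {p..q} (osc m a b c)) \<le> cmod ((A q / h q) *\<^sub>R g q) + cmod ((A p / h p) *\<^sub>R g p) + cmod (integral {p..q} (\<lambda>\<xi>. f' \<xi> *\<^sub>R g \<xi>))"
    by (simp only:)
  also have "\<dots> \<le> A p * (1 / \<mu>) + A p * (1 / \<mu>) + A p * (3 / \<mu>)"
    using R Kb by (intro add_mono H p q) auto
  also have "\<dots> = 5 / \<mu> * A p" by (simp add: field_simps)
  finally show ?thesis by (simp add: A_def)
qed

lemma osc_integral_trivial:
  assumes m: "0 < m" and c: "0 \<le> c" and pq: "0 < p" "p \<le> r" "r \<le> q"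
  shows "cmod (integral {r..q} (osc m a b c)) \<le> (q - r) * exp (- c * p powr m)"
proof -
  have "cmod (integral {r..q} (osc m a b c)) \<le> exp (- c * p powr m) * (q - r)"
    using pq exp_powr_antimono[OF c m pq(1)]
    by (intro integral_bound continuous_on_osc) auto
  then show ?thesis by (simp add: mult.commute)
qed

lemma osc_cnj: "osc m (- a) (- b) c \<xi> = cnj (osc m a b c \<xi>)"
  by (simp add: osc_def cis_cnj minus_add_distrib del: minus_add)

text \<open>The derivative of the phase changes at rate at least \<rho>, so outside an interval of
  radius \<open>1 / sqrt \<rho>\<close> around a single point it is at least
  \<open>sqrt \<rho>\<close> in modulus. The first derivative estimate costs 5 on each side and the
  trivial bound 2 in the middle, together 12.\<close>

lemma vdc_second:
  fixes m a b c p q \<rho> :: real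
  assumes m: "0 < m" "m < 1" and c: "0 \<le> c" and pq: "0 < p" "p \<le> q" and rho: "\<rho> > 0"
    and lb: "\<rho> \<le> \<bar>b\<bar> * m * (1 - m) * q powr (m - 2)"
  shows "cmod (integral {p..q} (osc m a b c)) \<le> 12 / sqrt \<rho> * exp (- c * p powr m)"
proof -
  have main: "cmod (integral {p..q} (osc m a b c)) \<le> 12 / sqrt \<rho> * exp (- c * p powr m)"
    if b: "b > 0" and lb: "\<rho> \<le> b * m * (1 - m) * q powr (m - 2)" for a b
  proof -
    define h where "h \<xi> = a + b * m * \<xi> powr (m - 1)" for \<xi>
    have dec: "h x - h y \<ge> \<rho> * (y - x)" if "p \<le> x" "x \<le> y" "y \<le> q" for x y
    proof (cases "x = y")
      case False
      have "\<exists>z>x. z < y \<and> h y - h x = (y - x) * (b * m * ((m - 1) * z powr (m - 1 - 1)))"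
        unfolding h_def using that pq False
        by (intro MVT2) (auto intro!: derivative_eq_intros)
      then obtain z where z: "x < z" "z < y" "h y - h x = (y - x) * (b * m * ((m - 1) * z powr (m - 1 - 1)))" by blast
      have "q powr (m - 2) \<le> z powr (m - 2)"
        using z that pq m by (intro powr_mono2') auto
      then have "b * m * (1 - m) * q powr (m - 2) \<le> b * m * (1 - m) * z powr (m - 2)"
        using b m by (intro mult_left_mono) auto
      then have "\<rho> \<le> b * m * (1 - m) * z powr (m - 2)" using lb by linarith
      then have "\<rho> * (y - x) \<le> b * m * (1 - m) * z powr (m - 2) * (y - x)"
        using that by (intro mult_right_mono) auto
      also have "\<dots> = h x - h y"
      proof -
        have "m - 1 - 1 = m - 2" by simp
        then show ?thesis using z(3) by (simp only: ) (simp add: algebra_simps)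
      qed
      finally show ?thesis .
    qed simp
    have hc: "continuous_on {p..q} h" unfolding h_def using pq by (intro continuous_intros) auto
    \<comment> \<open>\<open>z\<close> is the stationary point if there is one, and otherwise the
      endpoint where the derivative is smallest in modulus; the same two linear bounds hold in all
      three cases.\<close>
    obtain z where z: "p \<le> z" "z \<le> q" and zr: "\<And>\<xi>. z < \<xi> \<Longrightarrow> \<xi> \<le> q \<Longrightarrow> h \<xi> \<le> - (\<rho> * (\<xi> - z))"
        and zl: "\<And>\<xi>. p \<le> \<xi> \<Longrightarrow> \<xi> < z \<Longrightarrow> \<rho> * (z - \<xi>) \<le> h \<xi>"
    proof -
      consider "h p \<le> 0" | "h q \<ge> 0" | "h q \<le> 0" "0 \<le> h p" by linarith
      then show thesis
      proof cases
        case 1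
        show thesis
        proof (rule that[of p])
          show "h \<xi> \<le> - (\<rho> * (\<xi> - p))" if "p < \<xi>" "\<xi> \<le> q" for \<xi>
            using dec[of p \<xi>] that 1 by simp
        qed (use pq in auto)
      next
        case 2
        show thesis
        proof (rule that[of q])
          show "\<rho> * (q - \<xi>) \<le> h \<xi>" if "p \<le> \<xi>" "\<xi> < q" for \<xi>
            using dec[of \<xi> q] that 2 by simp
        qed (use pq in auto)
      next
        case 3
        then obtain z where z: "p \<le> z" "z \<le> q" "h z = 0"
          using IVT2'[of h q 0 p] pq hc by auto
        show thesis
        proof (rule that[of z])
          show "h \<xi> \<le> - (\<rho> * (\<xi> - z))" if "z < \<xi>" "\<xi> \<le> q" for \<xi>
            using dec[of z \<xi>] that z by simp
          show "\<rho> * (z - \<xi>) \<le> h \<xi>" if "p \<le> \<xi>" "\<xi> < z" for \<xi>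
            using dec[of \<xi> z] that z by simp
        qed (use z in auto)
      qed
    qed
    define d where "d = 1 / sqrt \<rho>"
    have d: "d > 0" "\<rho> * d = sqrt \<rho>" using rho by (auto simp: d_def real_div_sqrt)
    define u where "u = max p (z - d)"
    define v where "v = min q (z + d)"
    have uv: "p \<le> u" "u \<le> v" "v \<le> q" "v - u \<le> 2 * d" using z d by (auto simp: u_def v_def)
    let ?e = "exp (- c * p powr m)"
    let ?J = "\<lambda>r s. integral {r..s} (osc m a b c)"
    have io: "osc m a b c integrable_on {r..s}" if "p \<le> r" for r s
      using pq that by (intro integrable_continuous_interval continuous_on_osc) auto
    have split: "?J p q = ?J p u + ?J u v + ?J v q"
      using uv Henstock_Kurzweil_Integration.integral_combine[of p u v "osc m a b c"]
        Henstock_Kurzweil_Integration.integral_combine[of p v q "osc m a b c"] io[of p] by simp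
    have 1: "cmod (?J p u) \<le> 5 / sqrt \<rho> * ?e"
    proof (cases "u = p")
      case False
      then have u: "u = z - d" "p < u" using uv by (auto simp: u_def)
      show ?thesis
      proof (rule vdc_first[OF m c])
        fix \<xi> assume x: "p \<le> \<xi>" "\<xi> \<le> u"
        then have "\<rho> * d \<le> \<rho> * (z - \<xi>)" using u rho by (intro mult_left_mono) auto
        also have "\<dots> \<le> h \<xi>" using zl[of \<xi>] x u d by simp
        finally show "sqrt \<rho> \<le> \<bar>a + b * m * \<xi> powr (m - 1)\<bar>" using d by (simp add: h_def)
      qed (use pq uv rho in auto)
    qed (use rho in simp)
    have 2: "cmod (?J u v) \<le> 2 / sqrt \<rho> * ?e"
    proof -
      have "cmod (?J u v) \<le> (v - u) * ?e"
        by (rule osc_integral_trivial) (use m c pq uv in auto)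
      also have "\<dots> \<le> 2 * d * ?e" using uv by (intro mult_right_mono) auto
      finally show ?thesis by (simp add: d_def)
    qed
    have 3: "cmod (?J v q) \<le> 5 / sqrt \<rho> * ?e"
    proof (cases "v = q")
      case False
      then have v: "v = z + d" "v < q" using uv by (auto simp: v_def)
      have "cmod (?J v q) \<le> 5 / sqrt \<rho> * exp (- c * v powr m)"
      proof (rule vdc_first[OF m c])
        fix \<xi> assume x: "v \<le> \<xi>" "\<xi> \<le> q"
        then have "\<rho> * d \<le> \<rho> * (\<xi> - z)" using v rho by (intro mult_left_mono) auto
        also have "\<dots> \<le> - h \<xi>" using zr[of \<xi>] x v d by simp
        finally show "sqrt \<rho> \<le> \<bar>a + b * m * \<xi> powr (m - 1)\<bar>" using d by (simp add: h_def)
      qed (use pq uv rho v in auto)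
      also have "\<dots> \<le> 5 / sqrt \<rho> * ?e"
        using rho uv pq m c by (intro mult_left_mono exp_powr_antimono) auto
      finally show ?thesis .
    qed (use rho in simp)
    have "cmod (?J p q) \<le> cmod (?J p u) + cmod (?J u v) + cmod (?J v q)"
      unfolding split using norm_triangle_ineq[of "?J p u + ?J u v" "?J v q"] norm_triangle_ineq[of "?J p u" "?J u v"] by linarith
    also have "\<dots> \<le> 5 / sqrt \<rho> * ?e + 2 / sqrt \<rho> * ?e + 5 / sqrt \<rho> * ?e"
      using 1 2 3 by linarith
    also have "\<dots> = 12 / sqrt \<rho> * ?e" by (simp add: field_simps)
    finally show ?thesis .
  qed
  have "b \<noteq> 0" using lb rho by auto
  then consider "b > 0" | "b < 0" by linarith
  then show ?thesis
  proof cases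
    case 1 then show ?thesis using main[of b a] lb by simp
  next
    case 2
    have "integral {p..q} (osc m (- a) (- b) c) = cnj (integral {p..q} (osc m a b c))"
      by (simp add: osc_cnj[abs_def] Henstock_Kurzweil_Integration.integral_cnj)
    then show ?thesis using main[of "- b" "- a"] 2 lb by simp
  qed
qed

lemma osc_mult_cnj: "osc m a b c \<xi> * cnj (osc m a' b' c' \<xi>) = osc m (a - a') (b - b') (c + c') \<xi>"
proof -
  have "cis (a * \<xi> + b * \<xi> powr m) * cnj (cis (a' * \<xi> + b' * \<xi> powr m)) = cis ((a - a') * \<xi> + (b - b') * \<xi> powr m)"
    by (simp add: cis_cnj cis_mult algebra_simps)
  moreover have "exp (- c * \<xi> powr m) * exp (- c' * \<xi> powr m) = exp (- (c + c') * \<xi> powr m)"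
    by (simp add: exp_add[symmetric] algebra_simps)
  moreover have "osc m a b c \<xi> * cnj (osc m a' b' c' \<xi>) =
     complex_of_real (exp (- c * \<xi> powr m) * exp (- c' * \<xi> powr m)) *
      (cis (a * \<xi> + b * \<xi> powr m) * cnj (cis (a' * \<xi> + b' * \<xi> powr m)))"
    by (simp add: osc_def scaleR_conv_of_real mult_ac)
  ultimately show ?thesis
    by (simp only: osc_def scaleR_conv_of_real)
qed

text \<open>Lets the damping be traded for any negative power. The constant comes from raising
  \<open>y / \<theta> \<le> exp (y / \<theta>)\<close> to the power \<theta>.\<close>

lemma exp_neg_le_powr:
  assumes "\<theta> \<ge> (0::real)"
  obtains K where "K > 0" "\<And>y. y > 0 \<Longrightarrow> exp (- y) \<le> K * y powr (- \<theta>)"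
proof (cases "\<theta> = 0")
  case True
  show ?thesis by (rule that[of 1]) (use True in auto)
next
  case False
  then have t: "\<theta> > 0" using assms by simp
  show ?thesis
  proof (rule that[of "\<theta> powr \<theta>"])
    fix y :: real assume y: "y > 0"
    have "y / \<theta> \<le> exp (y / \<theta>)" using exp_ge_add_one_self[of "y / \<theta>"] by linarith
    then have "(y / \<theta>) powr \<theta> \<le> exp (y / \<theta>) powr \<theta>"
      using t y by (intro powr_mono2) auto
    also have "\<dots> = exp y" using t by (simp add: powr_def)
    finally have "y powr \<theta> \<le> \<theta> powr \<theta> * exp y"
      using t y by (simp add: powr_divide field_simps)
    then show "exp (- y) \<le> \<theta> powr \<theta> * y powr (- \<theta>)"
      using y by (simp add: powr_minus exp_minus field_simps)
  qed (use t in auto)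
qed

text \<open>\<open>J\<close> is the product of its powers with exponents \<delta> and
  \<open>1 - \<delta>\<close>, and each factor takes one of the two bounds.\<close>

lemma min_le_powr_interp:
  fixes J L d K \<delta> :: real
  assumes "0 \<le> J" "J \<le> L" "J \<le> K / d" "0 \<le> \<delta>" "\<delta> \<le> 1" "0 < d" "0 < L" "0 < K"
  shows "J \<le> K powr (1 - \<delta>) * L powr \<delta> * d powr (- (1 - \<delta>))"
proof (cases "J = 0")
  case False
  then have "J = J powr \<delta> * J powr (1 - \<delta>)" using assms by (simp flip: powr_add)
  also have "\<dots> \<le> L powr \<delta> * (K / d) powr (1 - \<delta>)"
    using assms by (intro mult_mono powr_mono2) auto
  also have "(K / d) powr (1 - \<delta>) = K powr (1 - \<delta>) * d powr (- (1 - \<delta>))"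
    using assms by (subst powr_divide) (auto simp only: powr_minus divide_inverse less_imp_le)
  also have "L powr \<delta> * (K powr (1 - \<delta>) * d powr (- (1 - \<delta>))) = K powr (1 - \<delta>) * L powr \<delta> * d powr (- (1 - \<delta>))"
    by (simp only: mult_ac)
  finally show ?thesis .
qed (use assms in auto)

section \<open>Kernels along admissible curves\<close>

text \<open>Close points: the hypotheses give
  \<open>c \<ge> (d / D) powr (\<gamma> / \<alpha>)\<close>, so the damping supplies a factor
  \<open>L powr (- (m * \<theta>))\<close> at the price
  \<open>d powr (- (\<theta> * \<gamma> / \<alpha>))\<close>, with \<theta> at choice. The total
  power of \<open>d\<close> must stay above -1. From the trivial bound \<open>L\<close> this allows
  \<open>\<theta> < \<alpha> / \<gamma>\<close>; from van der Corput's bound, whose own price is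
  \<open>d powr (- (1 / (2 * \<alpha>)))\<close>, it allows
  \<open>\<theta> < (\<alpha> - 1/2) / \<gamma>\<close>. The resulting thresholds for \<sigma> are
  the two entries of \<open>s_crit\<close>.\<close>

lemma kernel_decay:
  fixes m \<gamma> \<alpha> \<sigma> :: real
  assumes m: "0 < m" "m < 1" and g: "0 < \<gamma>" and al: "1/2 < \<alpha>" "\<alpha> \<le> 1"
    and s0: "\<sigma> > 0" and s: "\<sigma> > s_crit m \<alpha> \<gamma>" and D: "D > 0"
  obtains C p where "C \<ge> 0" "0 \<le> p" "p < 1"
    "\<And>L a b c d. \<lbrakk>L \<ge> 1; 0 < d; d < D * \<bar>b\<bar> powr \<alpha>; \<bar>b\<bar> powr \<gamma> \<le> c\<rbrakk> \<Longrightarrow>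
       cmod (integral {L..2*L} (osc m a b c)) \<le> C * L powr (2 * \<sigma>) * d powr (- p)"
proof -
  have decay: "exp (- c * L powr m) \<le> K * (d / D) powr (- (\<theta> * \<gamma> / \<alpha>)) * L powr (- (m * \<theta>))"
    if K: "K > 0" "\<And>y. y > 0 \<Longrightarrow> exp (- y) \<le> K * y powr (- \<theta>)" and \<theta>: "\<theta> \<ge> 0"
      and h: "L \<ge> 1" "0 < d" "d < D * \<bar>b\<bar> powr \<alpha>" "\<bar>b\<bar> powr \<gamma> \<le> c" for K \<theta> L b c d
  proof -
    have dD: "0 < d / D" "d / D < \<bar>b\<bar> powr \<alpha>" using h D by (auto simp: field_simps)
    have "(d / D) powr (\<gamma> / \<alpha>) \<le> (\<bar>b\<bar> powr \<alpha>) powr (\<gamma> / \<alpha>)"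
      using dD g al by (intro powr_mono2) auto
    also have "\<dots> = \<bar>b\<bar> powr \<gamma>" using al by (simp add: powr_powr)
    also have "\<dots> \<le> c" by (rule h)
    finally have c: "(d / D) powr (\<gamma> / \<alpha>) \<le> c" .
    define y where "y = (d / D) powr (\<gamma> / \<alpha>) * L powr m"
    have y: "y > 0" using dD h unfolding y_def by (intro mult_pos_pos) auto
    have "y \<le> c * L powr m" unfolding y_def using c by (intro mult_right_mono) auto
    then have "exp (- c * L powr m) \<le> exp (- y)" by simp
    also have "\<dots> \<le> K * y powr (- \<theta>)" by (rule K(2)[OF y])
    also have "y powr (- \<theta>) = (d / D) powr (- (\<theta> * \<gamma> / \<alpha>)) * L powr (- (m * \<theta>))"
      unfolding y_def using dD h by (simp add: powr_mult powr_powr mult.commute)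
    finally show ?thesis by (simp add: mult.assoc)
  qed
  have pw: "(d / D) powr (- p) = D powr p * d powr (- p)" if "d > 0" for d p
    using that D by (simp add: powr_divide powr_minus field_simps)
  \<comment> \<open>Exceeding a minimum means exceeding one of its entries, and each entry comes
    with its own estimate.\<close>
  have "\<sigma> > 1/2 * (1 - m * \<alpha> / \<gamma>) \<or> \<sigma> > (2 - m) / 4 + m * (1 - 2 * \<alpha>) / (4 * \<gamma>)"
    using s s0 unfolding s_crit_def by (auto simp: min_def max_def split: if_splits)
  then show ?thesis
  proof
    assume B: "\<sigma> > 1/2 * (1 - m * \<alpha> / \<gamma>)"
    \<comment> \<open>The least nonnegative \<theta> with
      \<open>1 - m * \<theta> \<le> 2 * \<sigma>\<close>, so that the price in \<open>d\<close> is
      as low as possible.\<close>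
    define \<theta> where "\<theta> = max 0 ((1 - 2 * \<sigma>) / m)"
    have t0: "\<theta> \<ge> 0" by (simp add: \<theta>_def)
    obtain K where K: "K > 0" "\<And>y. y > 0 \<Longrightarrow> exp (- y) \<le> K * y powr (- \<theta>)"
      using exp_neg_le_powr[OF t0] by blast
    define p where "p = \<theta> * \<gamma> / \<alpha>"
    have p0: "0 \<le> p" using t0 g al by (simp add: p_def)
    have "\<theta> < \<alpha> / \<gamma>"
    proof -
      have "1 - 2 * \<sigma> < m * \<alpha> / \<gamma>" using B by simp
      then have "(1 - 2 * \<sigma>) / m < \<alpha> / \<gamma>" using m g by (simp add: field_simps)
      then show ?thesis using al g by (simp add: \<theta>_def)
    qed
    then have p1: "p < 1" using al g by (simp add: p_def field_simps)
    have e: "1 - m * \<theta> \<le> 2 * \<sigma>"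
    proof -
      have "m * \<theta> \<ge> m * ((1 - 2 * \<sigma>) / m)" using m by (intro mult_left_mono) (auto simp: \<theta>_def)
      then show ?thesis using m by simp
    qed
    show ?thesis
    proof (rule that[of "K * D powr p" p])
      fix L a b c d :: real assume h: "L \<ge> 1" "0 < d" "d < D * \<bar>b\<bar> powr \<alpha>" "\<bar>b\<bar> powr \<gamma> \<le> c"
      have c: "c \<ge> 0" using h(4) powr_ge_zero order_trans by blast
      have "cmod (integral {L..2*L} (osc m a b c)) \<le> L * exp (- c * L powr m)"
        using osc_integral_trivial[OF m(1) c, of L L "2 * L"] h by simp
      also have "\<dots> \<le> L * (K * (d / D) powr (- p) * L powr (- (m * \<theta>)))"
        using decay[OF K t0 h] h unfolding p_def by (intro mult_left_mono) auto
      also have "\<dots> = K * D powr p * (L powr 1 * L powr (- (m * \<theta>))) * d powr (- p)"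
        unfolding pw[OF h(2)] using h by (simp add: mult_ac)
      also have "L powr 1 * L powr (- (m * \<theta>)) = L powr (1 - m * \<theta>)"
        by (simp only: powr_add[symmetric] diff_conv_add_uminus)
      also have "K * D powr p * L powr (1 - m * \<theta>) * d powr (- p) \<le> K * D powr p * L powr (2 * \<sigma>) * d powr (- p)"
        using h e K by (intro mult_right_mono mult_left_mono powr_mono) auto
      finally show "cmod (integral {L..2*L} (osc m a b c)) \<le> K * D powr p * L powr (2 * \<sigma>) * d powr (- p)" .
    qed (use K p0 p1 in auto)
  next
    assume A: "\<sigma> > (2 - m) / 4 + m * (1 - 2 * \<alpha>) / (4 * \<gamma>)"
    \<comment> \<open>The same choice for the exponent \<open>1 - m / 2\<close> that van der
      Corput's estimate leaves.\<close>
    define \<theta> where "\<theta> = max 0 ((1 - m / 2 - 2 * \<sigma>) / m)"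
    have t0: "\<theta> \<ge> 0" by (simp add: \<theta>_def)
    obtain K where K: "K > 0" "\<And>y. y > 0 \<Longrightarrow> exp (- y) \<le> K * y powr (- \<theta>)"
      using exp_neg_le_powr[OF t0] by blast
    define p1 where "p1 = \<theta> * \<gamma> / \<alpha>"
    define p where "p = 1 / (2 * \<alpha>) + p1"
    have p0: "0 \<le> p" using t0 g al by (simp add: p_def p1_def)
    have "\<theta> < (\<alpha> - 1/2) / \<gamma>"
    proof -
      have "1 - m / 2 - 2 * \<sigma> < m * ((\<alpha> - 1/2) / \<gamma>)" using A g by (simp add: field_simps)
      then have "(1 - m / 2 - 2 * \<sigma>) / m < (\<alpha> - 1/2) / \<gamma>" using m by (subst pos_divide_less_eq) (auto simp: mult.commute)
      then show ?thesis using al g by (simp add: \<theta>_def)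
    qed
    then have "p1 < (\<alpha> - 1/2) / \<alpha>" using al g by (simp add: p1_def field_simps)
    then have plt: "p < 1" using al by (simp add: p_def field_simps)
    have e: "1 - m / 2 - m * \<theta> \<le> 2 * \<sigma>"
    proof -
      have "m * \<theta> \<ge> m * ((1 - m / 2 - 2 * \<sigma>) / m)" using m by (intro mult_left_mono) (auto simp: \<theta>_def)
      then show ?thesis using m by simp
    qed
    define c0 where "c0 = m * (1 - m) * 2 powr (m - 2)"
    have c0: "c0 > 0" using m by (simp add: c0_def)
    show ?thesis
    proof (rule that[of "12 / sqrt c0 * K * D powr p" p])
      fix L a b c d :: real assume h: "L \<ge> 1" "0 < d" "d < D * \<bar>b\<bar> powr \<alpha>" "\<bar>b\<bar> powr \<gamma> \<le> c"
      have c: "c \<ge> 0" using h(4) powr_ge_zero order_trans by blast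
      have dD: "0 < d / D" "d / D < \<bar>b\<bar> powr \<alpha>" using h D by (auto simp: field_simps)
      \<comment> \<open>A lower bound of \<open>|b|\<close> in terms of the distance. Inserted into
        the second derivative, it turns \<open>|b| powr (-1/2)\<close> into a power of
        \<open>d\<close>.\<close>
      define r where "r = (d / D) powr (1 / \<alpha>)"
      have r: "r > 0" using h D by (simp add: r_def)
      have rb: "r \<le> \<bar>b\<bar>"
      proof -
        have "r \<le> (\<bar>b\<bar> powr \<alpha>) powr (1 / \<alpha>)" unfolding r_def using dD al by (intro powr_mono2) auto
        then show ?thesis using al by (simp add: powr_powr)
      qed
      define \<rho> where "\<rho> = c0 * r * L powr (m - 2)"
      have rho: "\<rho> > 0" using c0 r h by (simp add: \<rho>_def)
      have "cmod (integral {L..2*L} (osc m a b c)) \<le> 12 / sqrt \<rho> * exp (- c * L powr m)"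
      proof (rule vdc_second[OF m c])
        have "\<rho> = r * m * (1 - m) * (2 * L) powr (m - 2)"
          using h by (simp add: \<rho>_def c0_def powr_mult)
        also have "\<dots> \<le> \<bar>b\<bar> * m * (1 - m) * (2 * L) powr (m - 2)"
          using rb m by (intro mult_right_mono) auto
        finally show "\<rho> \<le> \<bar>b\<bar> * m * (1 - m) * (2 * L) powr (m - 2)" .
      qed (use h rho in auto)
      also have "12 / sqrt \<rho> = 12 / sqrt c0 * ((d / D) powr (- (1 / (2 * \<alpha>))) * L powr (1 - m / 2))"
      proof -
        have "sqrt \<rho> = sqrt c0 * r powr (1/2) * L powr ((m - 2) / 2)"
        proof -
          have "sqrt (L powr (m - 2)) = L powr ((m - 2) / 2)"
            using powr_half_sqrt[of "L powr (m - 2)"] by (simp add: powr_powr)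
          moreover have "sqrt r = r powr (1/2)" using r by (simp add: powr_half_sqrt)
          ultimately show ?thesis by (simp only: \<rho>_def real_sqrt_mult)
        qed
        moreover have "r powr (1/2) = (d / D) powr (1 / (2 * \<alpha>))" by (simp add: r_def powr_powr mult.commute)
        ultimately have sq: "sqrt \<rho> = sqrt c0 * (d / D) powr (1 / (2 * \<alpha>)) * L powr ((m - 2) / 2)"
          by (simp only:)
        have "12 / (x * y * z) = 12 / x * (inverse y * inverse z)" for x y z :: real
          by (simp add: divide_inverse)
        from this[of "sqrt c0" "(d / D) powr (1 / (2 * \<alpha>))" "L powr ((m - 2) / 2)"]
        have "12 / sqrt \<rho> = 12 / sqrt c0 * (inverse ((d / D) powr (1 / (2 * \<alpha>))) * inverse (L powr ((m - 2) / 2)))"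
          unfolding sq .
        also have "\<dots> = 12 / sqrt c0 * ((d / D) powr (- (1 / (2 * \<alpha>))) * L powr (- ((m - 2) / 2)))"
          by (simp only: powr_minus)
        also have "- ((m - 2) / 2) = 1 - m / 2" by (simp add: field_simps)
        finally show ?thesis .
      qed
      also have "12 / sqrt c0 * ((d / D) powr (- (1 / (2 * \<alpha>))) * L powr (1 - m / 2)) * exp (- c * L powr m)
         \<le> 12 / sqrt c0 * ((d / D) powr (- (1 / (2 * \<alpha>))) * L powr (1 - m / 2)) * (K * (d / D) powr (- p1) * L powr (- (m * \<theta>)))"
        using decay[OF K t0 h] c0 unfolding p1_def by (intro mult_left_mono) auto
      also have "\<dots> = 12 / sqrt c0 * K * ((d / D) powr (- (1 / (2 * \<alpha>))) * (d / D) powr (- p1)) * (L powr (1 - m / 2) * L powr (- (m * \<theta>)))"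
        by (simp only: mult_ac)
      also have "(d / D) powr (- (1 / (2 * \<alpha>))) * (d / D) powr (- p1) = (d / D) powr (- p)"
        unfolding p_def by (simp only: powr_add[symmetric] minus_add_distrib)
      also have "L powr (1 - m / 2) * L powr (- (m * \<theta>)) = L powr (1 - m / 2 - m * \<theta>)"
        by (simp only: powr_add[symmetric] diff_conv_add_uminus)
      also have "12 / sqrt c0 * K * (d / D) powr (- p) * L powr (1 - m / 2 - m * \<theta>)
         \<le> 12 / sqrt c0 * K * (d / D) powr (- p) * L powr (2 * \<sigma>)"
        using h e K c0 by (intro mult_left_mono powr_mono) auto
      also have "\<dots> = 12 / sqrt c0 * K * D powr p * L powr (2 * \<sigma>) * d powr (- p)"
        unfolding pw[OF h(2)] by (simp only: mult_ac)
      finally show "cmod (integral {L..2*L} (osc m a b c)) \<le> 12 / sqrt c0 * K * D powr p * L powr (2 * \<sigma>) * d powr (- p)" .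
    qed (use K p0 plt c0 in auto)
  qed
qed

text \<open>Distant points: on \<open>\<xi> \<ge> 1\<close> the dispersion moves the derivative of
  the phase by at most \<open>|b|\<close>, so the derivative stays above \<open>k * d\<close>. The
  resulting \<open>1 / d\<close> just fails to be locally integrable; interpolation with the trivial
  bound \<open>L\<close> lowers the exponent to \<open>1 - \<delta>\<close> at the cost
  \<open>L powr \<delta>\<close>, which any positive \<sigma> can afford.\<close>

lemma kernel_far:
  fixes m \<sigma> :: real
  assumes m: "0 < m" "m < 1" and s0: "\<sigma> > 0" and k: "k > 0"
  obtains C p where "C \<ge> 0" "0 \<le> p" "p < 1"
    "\<And>L a b c d. \<lbrakk>L \<ge> 1; 0 < d; 0 \<le> c; k * d \<le> \<bar>a\<bar> - \<bar>b\<bar>\<rbrakk> \<Longrightarrow>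
       cmod (integral {L..2*L} (osc m a b c)) \<le> C * L powr (2 * \<sigma>) * d powr (- p)"
proof -
  define \<delta> where "\<delta> = min (2 * \<sigma>) (1/2)"
  have d: "0 < \<delta>" "\<delta> < 1" "\<delta> \<le> 2 * \<sigma>" using s0 by (auto simp: \<delta>_def)
  show ?thesis
  proof (rule that[of "(5 / k) powr (1 - \<delta>)" "1 - \<delta>"])
    fix L a b c d' :: real assume h: "L \<ge> 1" "0 < d'" "0 \<le> c" "k * d' \<le> \<bar>a\<bar> - \<bar>b\<bar>"
    let ?J = "cmod (integral {L..2*L} (osc m a b c))"
    have e1: "exp (- c * L powr m) \<le> 1" using h by simp
    have "?J \<le> L * exp (- c * L powr m)"
      using osc_integral_trivial[OF m(1) h(3), of L L "2 * L" a b] h by simp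
    also have "\<dots> \<le> L * 1" using h by (intro mult_left_mono e1) auto
    finally have 1: "?J \<le> L" by simp
    have "?J \<le> 5 / (k * d') * exp (- c * L powr m)"
    proof (rule vdc_first[OF m h(3)])
      fix \<xi> assume x: "L \<le> \<xi>" "\<xi> \<le> 2 * L"
      have "\<xi> powr (m - 1) \<le> \<xi> powr 0" using x h m by (intro powr_mono) auto
      then have "m * \<xi> powr (m - 1) \<le> 1 * 1" using m x h by (intro mult_mono) auto
      then have "\<bar>b\<bar> * (m * \<xi> powr (m - 1)) \<le> \<bar>b\<bar> * 1" by (intro mult_left_mono) auto
      moreover have "\<bar>b * m * \<xi> powr (m - 1)\<bar> = \<bar>b\<bar> * (m * \<xi> powr (m - 1))" using m by (simp add: abs_mult)
      moreover have "\<bar>a\<bar> - \<bar>b * m * \<xi> powr (m - 1)\<bar> \<le> \<bar>a + b * m * \<xi> powr (m - 1)\<bar>" by linarith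
      ultimately show "k * d' \<le> \<bar>a + b * m * \<xi> powr (m - 1)\<bar>" using h(4) by linarith
    qed (use h k in auto)
    also have "\<dots> \<le> 5 / (k * d') * 1" using h k by (intro mult_left_mono e1) auto
    also have "\<dots> = (5 / k) / d'" by simp
    finally have 2: "?J \<le> (5 / k) / d'" .
    have "?J \<le> (5 / k) powr (1 - \<delta>) * L powr \<delta> * d' powr (- (1 - \<delta>))"
      by (rule min_le_powr_interp[OF _ 1 2]) (use d h k in auto)
    also have "\<dots> \<le> (5 / k) powr (1 - \<delta>) * L powr (2 * \<sigma>) * d' powr (- (1 - \<delta>))"
      using d h by (intro mult_right_mono mult_left_mono powr_mono) auto
    finally show "?J \<le> (5 / k) powr (1 - \<delta>) * L powr (2 * \<sigma>) * d' powr (- (1 - \<delta>))" .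
  qed (use d in auto)
qed

section \<open>The kernel along an admissible curve\<close>

lemma admissible_continuous_x:
  assumes "admissible \<alpha> \<Gamma>" "t \<in> {-1..1}" shows "continuous_on UNIV (\<lambda>x. \<Gamma> x t)"
proof -
  have "continuous_on (UNIV \<times> {-1..1}) (\<lambda>p. \<Gamma> (fst p) (snd p))"
    using assms(1) unfolding admissible_def by (simp add: case_prod_beta')
  then have "continuous_on UNIV (\<lambda>x. (\<lambda>p. \<Gamma> (fst p) (snd p)) (x, t))"
    by (rule continuous_on_compose2) (use assms(2) in \<open>auto intro!: continuous_intros\<close>)
  then show ?thesis by simp
qed

lemma admissible_continuous_t:
  assumes "admissible \<alpha> \<Gamma>" shows "continuous_on {-1..1} (\<lambda>t. \<Gamma> x t)"
proof -
  have "continuous_on (UNIV \<times> {-1..1}) (\<lambda>p. \<Gamma> (fst p) (snd p))"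
    using assms(1) unfolding admissible_def by (simp add: case_prod_beta')
  then have "continuous_on {-1..1} (\<lambda>t. (\<lambda>p. \<Gamma> (fst p) (snd p)) (x, t))"
    by (rule continuous_on_compose2) (auto intro!: continuous_intros)
  then show ?thesis by simp
qed

text \<open>Every pair of points and times falls on one side of
  \<open>|x - x'| = D * |t - t'| powr \<alpha>\<close>, and the sum of two singular powers records
  both outcomes. The sign \<epsilon> serves the negative frequencies.\<close>

lemma kernel_bound:
  fixes m \<gamma> \<alpha> \<sigma> :: real
  assumes m: "0 < m" "m < 1" and g: "0 < \<gamma>" and al: "1/2 < \<alpha>" "\<alpha> \<le> 1"
    and s0: "\<sigma> > 0" and s: "\<sigma> > s_crit m \<alpha> \<gamma>" and adm: "admissible \<alpha> \<Gamma>"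
  obtains C p p' where "C \<ge> 0" "0 \<le> p" "p < 1" "0 \<le> p'" "p' < 1"
    "\<And>L x x' t t' \<epsilon>. \<lbrakk>L \<ge> 1; x \<noteq> x'; t \<in> {0..1}; t' \<in> {0..1}; \<bar>\<epsilon>\<bar> = 1\<rbrakk> \<Longrightarrow>
       cmod (integral {L..2*L} (osc m (\<epsilon> * \<Gamma> x t - \<epsilon> * \<Gamma> x' t') (t - t') (t powr \<gamma> + t' powr \<gamma>)))
         \<le> C * L powr (2 * \<sigma>) * (\<bar>x - x'\<bar> powr (- p) + \<bar>x - x'\<bar> powr (- p'))"
proof -
  obtain C1 C2 C3 where C: "C1 > 0" "C2 > 0" "C3 > 0"
     and bil0: "\<forall>t\<in>{-1..1}. \<forall>x x'. C1 * \<bar>x - x'\<bar> \<le> \<bar>\<Gamma> x t - \<Gamma> x' t\<bar> \<and> \<bar>\<Gamma> x t - \<Gamma> x' t\<bar> \<le> C2 * \<bar>x - x'\<bar>"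
     and hol0: "\<forall>x. \<forall>t\<in>{-1..1}. \<forall>t'\<in>{-1..1}. \<bar>\<Gamma> x t - \<Gamma> x t'\<bar> \<le> C3 * \<bar>t - t'\<bar> powr \<alpha>"
    using adm unfolding admissible_def by (elim conjE exE) (rule that)
  have bil: "C1 * \<bar>x - x'\<bar> \<le> \<bar>\<Gamma> x t - \<Gamma> x' t\<bar>" if "t \<in> {-1..1}" for t x x'
    using bil0 that by blast
  have hol: "\<bar>\<Gamma> x t - \<Gamma> x t'\<bar> \<le> C3 * \<bar>t - t'\<bar> powr \<alpha>" if "t \<in> {-1..1}" "t' \<in> {-1..1}" for x t t'
    using hol0 that by blast
  \<comment> \<open>Beyond this threshold the Hoelder displacement
    \<open>C3 * |t - t'| powr \<alpha>\<close> and the dispersion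
    \<open>|t - t'| \<le> |t - t'| powr \<alpha>\<close> together consume at most half of the
    bilipschitz separation \<open>C1 * |x - x'|\<close>.\<close>
  define D where "D = 2 * (C3 + 1) / C1"
  have D: "D > 0" using C by (simp add: D_def)
  obtain Ca p where Ca: "Ca \<ge> 0" "0 \<le> p" "p < 1"
    "\<And>L a b c d. \<lbrakk>L \<ge> 1; 0 < d; d < D * \<bar>b\<bar> powr \<alpha>; \<bar>b\<bar> powr \<gamma> \<le> c\<rbrakk> \<Longrightarrow>
       cmod (integral {L..2*L} (osc m a b c)) \<le> Ca * L powr (2 * \<sigma>) * d powr (- p)"
    using kernel_decay[OF m g al s0 s D] by blast
  have k: "C1 / 2 > 0" using C by simp
  obtain Cb p' where Cb: "Cb \<ge> 0" "0 \<le> p'" "p' < 1"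
    "\<And>L a b c d. \<lbrakk>L \<ge> 1; 0 < d; 0 \<le> c; C1 / 2 * d \<le> \<bar>a\<bar> - \<bar>b\<bar>\<rbrakk> \<Longrightarrow>
       cmod (integral {L..2*L} (osc m a b c)) \<le> Cb * L powr (2 * \<sigma>) * d powr (- p')"
    using kernel_far[OF m s0 k] by blast
  show ?thesis
  proof (rule that[of "max Ca Cb" p p'])
    fix L x x' t t' \<epsilon> :: real
    assume h: "L \<ge> 1" "x \<noteq> x'" "t \<in> {0..1}" "t' \<in> {0..1}" "\<bar>\<epsilon>\<bar> = 1"
    let ?d = "\<bar>x - x'\<bar>" and ?b = "t - t'" and ?c = "t powr \<gamma> + t' powr \<gamma>"
    let ?a = "\<epsilon> * \<Gamma> x t - \<epsilon> * \<Gamma> x' t'"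
    let ?J = "cmod (integral {L..2*L} (osc m ?a ?b ?c))"
    have d: "?d > 0" using h by simp
    have "?J \<le> max Ca Cb * L powr (2 * \<sigma>) * ?d powr (- p) \<or> ?J \<le> max Ca Cb * L powr (2 * \<sigma>) * ?d powr (- p')"
    proof (cases "?d < D * \<bar>?b\<bar> powr \<alpha>")
      case True
      have c: "\<bar>?b\<bar> powr \<gamma> \<le> ?c"
      proof (cases "t' \<le> t")
        case True
        then have "\<bar>?b\<bar> powr \<gamma> \<le> t powr \<gamma>" using h g by (intro powr_mono2) auto
        then show ?thesis using powr_ge_zero[of t' \<gamma>] by linarith
      next
        case False
        then have "\<bar>?b\<bar> powr \<gamma> \<le> t' powr \<gamma>" using h g by (intro powr_mono2) auto
        then show ?thesis using powr_ge_zero[of t \<gamma>] by linarith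
      qed
      have "?J \<le> Ca * L powr (2 * \<sigma>) * ?d powr (- p)" by (rule Ca(4)[OF h(1) d True c])
      also have "\<dots> \<le> max Ca Cb * L powr (2 * \<sigma>) * ?d powr (- p)" by (intro mult_right_mono) auto
      finally show ?thesis by simp
    next
      case False
      have "\<bar>?a\<bar> = \<bar>\<Gamma> x t - \<Gamma> x' t'\<bar>" using h(5) by (simp add: abs_mult flip: right_diff_distrib)
      moreover have "C1 * ?d \<le> \<bar>\<Gamma> x t - \<Gamma> x' t\<bar>" using bil h by simp
      moreover have "\<bar>\<Gamma> x' t - \<Gamma> x' t'\<bar> \<le> C3 * \<bar>?b\<bar> powr \<alpha>" using hol h by simp
      ultimately have a: "C1 * ?d - C3 * \<bar>?b\<bar> powr \<alpha> \<le> \<bar>?a\<bar>" by linarith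
      have b: "\<bar>?b\<bar> \<le> \<bar>?b\<bar> powr \<alpha>"
      proof (cases "?b = 0")
        case False
        then have "\<bar>?b\<bar> powr 1 \<le> \<bar>?b\<bar> powr \<alpha>" using h al by (intro powr_mono') auto
        then show ?thesis by simp
      qed simp
      have "(C3 + 1) * \<bar>?b\<bar> powr \<alpha> \<le> C1 / 2 * ?d"
      proof -
        have "C1 / 2 * (D * \<bar>?b\<bar> powr \<alpha>) \<le> C1 / 2 * ?d" using False C by (intro mult_left_mono) auto
        moreover have "C1 / 2 * (D * \<bar>?b\<bar> powr \<alpha>) = (C3 + 1) * \<bar>?b\<bar> powr \<alpha>" using C by (simp add: D_def)
        ultimately show ?thesis by (simp only:)
      qed
      then have "C1 / 2 * ?d \<le> \<bar>?a\<bar> - \<bar>?b\<bar>" using a b by (simp add: algebra_simps)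
      then have "?J \<le> Cb * L powr (2 * \<sigma>) * ?d powr (- p')" by (intro Cb(4) h d) auto
      also have "\<dots> \<le> max Ca Cb * L powr (2 * \<sigma>) * ?d powr (- p')" by (intro mult_right_mono) auto
      finally show ?thesis by simp
    qed
    moreover have "0 \<le> max Ca Cb * L powr (2 * \<sigma>) * ?d powr (- p)" "0 \<le> max Ca Cb * L powr (2 * \<sigma>) * ?d powr (- p')"
      using Ca by auto
    ultimately show "?J \<le> max Ca Cb * L powr (2 * \<sigma>) * (?d powr (- p) + ?d powr (- p'))"
      by (simp add: distrib_left) linarith
  qed (use Ca Cb in auto)
qed

section \<open>Maximal estimates\<close>

lemma integrable_bounded_support:
  fixes f :: "real \<Rightarrow> complex"
  assumes [measurable]: "f \<in> borel_measurable borel" "I \<in> sets borel" and I: "emeasure lborel I < \<infinity>"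
    and b: "\<And>x. cmod (f x) \<le> B" and z: "\<And>x. x \<notin> I \<Longrightarrow> f x = 0"
  shows "integrable lborel f" "integrable lborel (\<lambda>x. (cmod (f x))\<^sup>2)"
proof -
  have B: "B \<ge> 0" using b[of 0] norm_ge_zero order_trans by blast
  show "integrable lborel f"
  proof (rule Bochner_Integration.integrable_bound)
    show "integrable lborel (\<lambda>x. B * indicat_real I x)"
      using I by (intro integrable_mult_right integrable_real_indicator) auto
    show "AE x in lborel. cmod (f x) \<le> norm (B * indicat_real I x)"
      using b z B by (auto simp: indicator_def)
  qed measurable
  show "integrable lborel (\<lambda>x. (cmod (f x))\<^sup>2)"
  proof (rule Bochner_Integration.integrable_bound)
    show "integrable lborel (\<lambda>x. B\<^sup>2 * indicat_real I x)"
      using I by (intro integrable_mult_right integrable_real_indicator) auto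
    show "AE x in lborel. norm ((cmod (f x))\<^sup>2) \<le> norm (B\<^sup>2 * indicat_real I x)"
      using b z B by (auto simp: indicator_def intro!: power_mono)
  qed measurable
qed

text \<open>The maximal operator is linearised by the choice of \<open>s\<close> and estimated through the
  kernel of \<open>T T*\<close>; testing against the function itself replaces operator norms.\<close>

lemma tt_star:
  fixes s :: "real \<Rightarrow> real \<Rightarrow> complex" and G :: "real \<Rightarrow> complex"
  defines "u \<equiv> \<lambda>x. \<integral>\<xi>. s x \<xi> * G \<xi> \<partial>lborel"
  assumes s[measurable]: "(\<lambda>p. s (fst p) (snd p)) \<in> borel_measurable (borel \<Otimes>\<^sub>M borel)"
    and s1: "\<And>x \<xi>. cmod (s x \<xi>) \<le> 1" and sE: "\<And>x \<xi>. \<xi> \<notin> E \<Longrightarrow> s x \<xi> = 0"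
    and E[measurable]: "E \<in> sets borel" "emeasure lborel E < \<infinity>"
    and I[measurable]: "I \<in> sets borel" "emeasure lborel I < \<infinity>"
    and G: "integrable lborel G" "integrable lborel (\<lambda>\<xi>. (cmod (G \<xi>))\<^sup>2)"
    and bd: "\<And>x. x \<in> I \<Longrightarrow> (\<integral>\<^sup>+y. indicator I y * ennreal (cmod (\<integral>\<xi>. s x \<xi> * cnj (s y \<xi>) \<partial>lborel)) \<partial>lborel) \<le> ennreal M"
    and M: "M \<ge> 0"
  shows "(\<integral>\<^sup>+x. indicator I x * ennreal ((cmod (u x))\<^sup>2) \<partial>lborel) \<le> ennreal (M * (\<integral>\<xi>. (cmod (G \<xi>))\<^sup>2 \<partial>lborel))"
proof -
  have Gm[measurable]: "G \<in> borel_measurable borel" using G by auto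
  have sx[measurable]: "s x \<in> borel_measurable borel" for x
    using measurable_compose[OF measurable_Pair1'[of x borel borel] s] by simp
  have sp[measurable (raw)]: "(\<lambda>z. s (f z) (g z)) \<in> borel_measurable N"
    if "f \<in> borel_measurable N" "g \<in> borel_measurable N" for f g and N :: "'z measure"
    using measurable_compose[OF measurable_Pair[OF that] s] by simp
  have um[measurable]: "u \<in> borel_measurable borel" unfolding u_def by measurable
  let ?B = "\<integral>\<xi>. cmod (G \<xi>) \<partial>lborel"
  have sG: "integrable lborel (\<lambda>\<xi>. s x \<xi> * G \<xi>)" for x
    by (rule Bochner_Integration.integrable_bound[OF G(1)])
       (auto simp: norm_mult intro!: mult_left_le_one_le s1)
  have ub: "cmod (u x) \<le> ?B" for x
  proof -
    have "cmod (u x) \<le> (\<integral>\<xi>. cmod (s x \<xi> * G \<xi>) \<partial>lborel)"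
      unfolding u_def by (rule integral_norm_bound)
    also have "\<dots> \<le> ?B"
      using G(1) by (intro integral_mono integrable_norm sG) (auto simp: norm_mult intro!: mult_left_le_one_le s1)
    finally show ?thesis .
  qed
  define w where "w x = indicator I x *\<^sub>R u x" for x
  have wm[measurable]: "w \<in> borel_measurable borel" unfolding w_def by measurable
  have B0: "?B \<ge> 0" by simp
  have wb: "cmod (w x) \<le> ?B" for x using ub[of x] B0 by (auto simp: w_def indicator_def)
  have w: "integrable lborel w" "integrable lborel (\<lambda>x. (cmod (w x))\<^sup>2)"
    by (rule integrable_bounded_support[OF wm I wb]; simp add: w_def)+
  define U where "U = (\<integral>x. (cmod (w x))\<^sup>2 \<partial>lborel)"
  have U0: "U \<ge> 0" by (simp add: U_def)
  \<comment> \<open>Up to conjugation, \<open>W\<close> is the adjoint operator applied to the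
    output \<open>w\<close>. Paired with \<open>G\<close> it returns \<open>U\<close>, and its
    square norm is the quadratic form of the kernel of \<open>T T*\<close> in
    \<open>w\<close>.\<close>
  define W where "W \<xi> = (\<integral>x. cnj (w x) * s x \<xi> \<partial>lborel)" for \<xi>
  have Wm[measurable]: "W \<in> borel_measurable borel" unfolding W_def by measurable
  have ws: "integrable lborel (\<lambda>x. cnj (w x) * s x \<xi>)" for \<xi>
    by (rule Bochner_Integration.integrable_bound[OF w(1)])
       (auto simp: norm_mult intro!: mult_left_le s1)
  have Wb: "cmod (W \<xi>) \<le> (\<integral>x. cmod (w x) \<partial>lborel)" for \<xi>
  proof -
    have "cmod (W \<xi>) \<le> (\<integral>x. cmod (cnj (w x) * s x \<xi>) \<partial>lborel)"
      unfolding W_def by (rule integral_norm_bound)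
    also have "\<dots> \<le> (\<integral>x. cmod (w x) \<partial>lborel)"
      using w(1) by (intro integral_mono integrable_norm ws) (auto simp: norm_mult intro!: mult_left_le s1)
    finally show ?thesis .
  qed
  have WE: "W \<xi> = 0" if "\<xi> \<notin> E" for \<xi> using sE[OF that] by (simp add: W_def)
  have W2: "integrable lborel (\<lambda>\<xi>. (cmod (W \<xi>))\<^sup>2)"
    by (rule integrable_bounded_support(2)[OF Wm E Wb WE])
  have 1: "complex_of_real U = (\<integral>\<xi>. G \<xi> * W \<xi> \<partial>lborel)"
  proof -
    have "complex_of_real U = (\<integral>x. complex_of_real ((cmod (w x))\<^sup>2) \<partial>lborel)"
      unfolding U_def by (rule integral_complex_of_real[symmetric])
    also have "\<dots> = (\<integral>x. \<integral>\<xi>. cnj (w x) * (s x \<xi> * G \<xi>) \<partial>lborel \<partial>lborel)"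
    proof (intro Bochner_Integration.integral_cong refl)
      fix x
      have "complex_of_real ((cmod (w x))\<^sup>2) = cnj (w x) * u x"
        using complex_norm_square[of "w x"] by (auto simp: w_def indicator_def mult.commute)
      then show "complex_of_real ((cmod (w x))\<^sup>2) = (\<integral>\<xi>. cnj (w x) * (s x \<xi> * G \<xi>) \<partial>lborel)"
        by (simp add: u_def)
    qed
    also have "\<dots> = (\<integral>\<xi>. \<integral>x. cnj (w x) * (s x \<xi> * G \<xi>) \<partial>lborel \<partial>lborel)"
    proof (rule lborel_pair.Fubini_integral[symmetric])
      have "integrable (lborel \<Otimes>\<^sub>M lborel) (\<lambda>p. w (fst p) * G (snd p))"
      proof (rule lborel_pair.Fubini_integrable)
        show "integrable lborel (\<lambda>x. \<integral>y. cmod (w (fst (x, y)) * G (snd (x, y))) \<partial>lborel)"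
          using w by (simp add: norm_mult)
        show "AE x in lborel. integrable lborel (\<lambda>y. w (fst (x, y)) * G (snd (x, y)))"
          using G by (intro AE_I2) simp
      qed measurable
      then show "integrable (lborel \<Otimes>\<^sub>M lborel) (\<lambda>(x, \<xi>). cnj (w x) * (s x \<xi> * G \<xi>))"
        unfolding case_prod_beta'
        by (rule Bochner_Integration.integrable_bound)
           (auto simp: norm_mult intro!: mult_left_mono mult_left_le_one_le s1)
    qed
    also have "\<dots> = (\<integral>\<xi>. G \<xi> * W \<xi> \<partial>lborel)"
    proof -
      have "cnj (w x) * (s x \<xi> * G \<xi>) = G \<xi> * (cnj (w x) * s x \<xi>)" for x \<xi> by simp
      then show ?thesis unfolding W_def by (simp only: integral_mult_right_zero)
    qed
    finally show ?thesis .
  qed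
  have 2: "(\<integral>\<xi>. (cmod (W \<xi>))\<^sup>2 \<partial>lborel) \<le> M * U"
  proof -
    let ?K = "\<lambda>x y. \<integral>\<xi>. s x \<xi> * cnj (s y \<xi>) \<partial>lborel"
    have Km[measurable]: "(\<lambda>p. ?K (fst p) (snd p)) \<in> borel_measurable (borel \<Otimes>\<^sub>M borel)" by measurable
    have "complex_of_real (\<integral>\<xi>. (cmod (W \<xi>))\<^sup>2 \<partial>lborel) = (\<integral>\<xi>. complex_of_real ((cmod (W \<xi>))\<^sup>2) \<partial>lborel)"
      by (rule integral_complex_of_real[symmetric])
    also have "\<dots> = (\<integral>\<xi>. (\<integral>p. (cnj (w (fst p)) * s (fst p) \<xi>) * cnj (cnj (w (snd p)) * s (snd p) \<xi>) \<partial>(lborel \<Otimes>\<^sub>M lborel)) \<partial>lborel)"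
    proof (intro Bochner_Integration.integral_cong refl)
      fix \<xi>
      have "integrable (lborel \<Otimes>\<^sub>M lborel) (\<lambda>p. (cnj (w (fst p)) * s (fst p) \<xi>) * cnj (cnj (w (snd p)) * s (snd p) \<xi>))"
      proof (rule lborel_pair.Fubini_integrable)
        show "integrable lborel (\<lambda>x. \<integral>y. cmod ((cnj (w (fst (x, y))) * s (fst (x, y)) \<xi>) * cnj (cnj (w (snd (x, y))) * s (snd (x, y)) \<xi>)) \<partial>lborel)"
          using integrable_norm[OF ws[of \<xi>]] by (simp add: norm_mult)
        show "AE x in lborel. integrable lborel (\<lambda>y. (cnj (w (fst (x, y))) * s (fst (x, y)) \<xi>) * cnj (cnj (w (snd (x, y))) * s (snd (x, y)) \<xi>))"
          using ws[of \<xi>] by (intro AE_I2 integrable_mult_right) (simp del: complex_cnj_mult)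
      qed measurable
      from lborel_pair.integral_fst'[OF this]
      have "(\<integral>p. (cnj (w (fst p)) * s (fst p) \<xi>) * cnj (cnj (w (snd p)) * s (snd p) \<xi>) \<partial>(lborel \<Otimes>\<^sub>M lborel))
          = (\<integral>x. \<integral>y. (cnj (w x) * s x \<xi>) * cnj (cnj (w y) * s y \<xi>) \<partial>lborel \<partial>lborel)"
        by (simp only: fst_conv snd_conv)
      also have "\<dots> = W \<xi> * cnj (W \<xi>)"
        unfolding integral_mult_right_zero integral_mult_left_zero Bochner_Integration.integral_cnj W_def ..
      finally show "complex_of_real ((cmod (W \<xi>))\<^sup>2) = (\<integral>p. (cnj (w (fst p)) * s (fst p) \<xi>) * cnj (cnj (w (snd p)) * s (snd p) \<xi>) \<partial>(lborel \<Otimes>\<^sub>M lborel))"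
        using complex_norm_square[of "W \<xi>"] by simp
    qed
    also have "\<dots> = (\<integral>p. (\<integral>\<xi>. (cnj (w (fst p)) * s (fst p) \<xi>) * cnj (cnj (w (snd p)) * s (snd p) \<xi>) \<partial>lborel) \<partial>(lborel \<Otimes>\<^sub>M lborel))"
    proof -
      interpret Q: pair_sigma_finite "lborel \<Otimes>\<^sub>M lborel :: (real \<times> real) measure" "lborel :: real measure"
        by (simp add: lborel_prod pair_sigma_finite_def sigma_finite_lborel)
      have ww: "integrable (lborel \<Otimes>\<^sub>M lborel) (\<lambda>p. w (fst p) * w (snd p))"
      proof (rule lborel_pair.Fubini_integrable)
        show "integrable lborel (\<lambda>x. \<integral>y. cmod (w (fst (x, y)) * w (snd (x, y))) \<partial>lborel)"
          using w by (simp add: norm_mult)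
        show "AE x in lborel. integrable lborel (\<lambda>y. w (fst (x, y)) * w (snd (x, y)))"
          using w by (intro AE_I2) simp
      qed measurable
      have Ei: "integrable lborel (\<lambda>\<xi>. indicat_real E \<xi>)" using E by (intro integrable_real_indicator) auto
      have "integrable ((lborel \<Otimes>\<^sub>M lborel) \<Otimes>\<^sub>M lborel) (\<lambda>q. w (fst (fst q)) * w (snd (fst q)) * complex_of_real (indicat_real E (snd q)))"
      proof (intro Q.Fubini_integrable)
        show "integrable (lborel \<Otimes>\<^sub>M lborel) (\<lambda>x. \<integral>y. cmod (w (fst (fst (x, y))) * w (snd (fst (x, y))) * complex_of_real (indicat_real E (snd (x, y)))) \<partial>lborel)"
          using integrable_norm[OF ww] by (simp add: norm_mult)
        show "AE x in lborel \<Otimes>\<^sub>M lborel. integrable lborel (\<lambda>y. w (fst (fst (x, y))) * w (snd (fst (x, y))) * complex_of_real (indicat_real E (snd (x, y))))"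
          using Ei by (intro AE_I2 integrable_mult_right integrable_of_real) simp
      qed measurable
      then have "integrable ((lborel \<Otimes>\<^sub>M lborel) \<Otimes>\<^sub>M lborel)
         (\<lambda>(p,\<xi>). (cnj (w (fst p)) * s (fst p) \<xi>) * cnj (cnj (w (snd p)) * s (snd p) \<xi>))"
      proof (rule Bochner_Integration.integrable_bound)
        show "AE q in (lborel \<Otimes>\<^sub>M lborel) \<Otimes>\<^sub>M lborel. cmod (case q of (p, \<xi>) \<Rightarrow> (cnj (w (fst p)) * s (fst p) \<xi>) * cnj (cnj (w (snd p)) * s (snd p) \<xi>))
           \<le> cmod (w (fst (fst q)) * w (snd (fst q)) * complex_of_real (indicat_real E (snd q)))"
        proof (rule AE_I2)
          fix q :: "(real \<times> real) \<times> real"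
          obtain x y \<xi> where q: "q = ((x, y), \<xi>)" by (metis prod.collapse)
          have "cmod (s x \<xi>) * cmod (s y \<xi>) \<le> indicat_real E \<xi>"
            using s1[of x \<xi>] s1[of y \<xi>] sE[of \<xi> x] by (auto simp: indicator_def intro!: mult_le_one)
          then have "(cmod (w x) * cmod (w y)) * (cmod (s x \<xi>) * cmod (s y \<xi>)) \<le> (cmod (w x) * cmod (w y)) * indicat_real E \<xi>"
            by (intro mult_left_mono) auto
          then show "cmod (case q of (p, \<xi>) \<Rightarrow> (cnj (w (fst p)) * s (fst p) \<xi>) * cnj (cnj (w (snd p)) * s (snd p) \<xi>))
           \<le> cmod (w (fst (fst q)) * w (snd (fst q)) * complex_of_real (indicat_real E (snd q)))"
            unfolding q by (simp add: norm_mult mult_ac)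
        qed
      qed (unfold case_prod_beta', measurable)
      from Q.Fubini_integral[OF this] show ?thesis .
    qed
    also have "\<dots> = (\<integral>p. cnj (w (fst p)) * w (snd p) * ?K (fst p) (snd p) \<partial>(lborel \<Otimes>\<^sub>M lborel))"
    proof -
      have "(a * b) * cnj (cnj c * d) = (a * c) * (b * cnj d)" for a b c d :: complex by simp
      then show ?thesis by (simp only: integral_mult_right_zero)
    qed
    finally have eq: "complex_of_real (\<integral>\<xi>. (cmod (W \<xi>))\<^sup>2 \<partial>lborel) = (\<integral>p. cnj (w (fst p)) * w (snd p) * ?K (fst p) (snd p) \<partial>(lborel \<Otimes>\<^sub>M lborel))" .
    let ?Q = "\<lambda>p. cnj (w (fst p)) * w (snd p) * ?K (fst p) (snd p)"
    have "ennreal (\<integral>\<xi>. (cmod (W \<xi>))\<^sup>2 \<partial>lborel) = ennreal (cmod (complex_of_real (\<integral>\<xi>. (cmod (W \<xi>))\<^sup>2 \<partial>lborel)))"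
      by simp
    also have "\<dots> \<le> (\<integral>\<^sup>+p. ennreal (cmod (?Q p)) \<partial>(lborel \<Otimes>\<^sub>M lborel))"
      unfolding eq
    proof (cases "integrable (lborel \<Otimes>\<^sub>M lborel) ?Q")
      case True then show "ennreal (cmod (\<integral>p. ?Q p \<partial>(lborel \<Otimes>\<^sub>M lborel))) \<le> (\<integral>\<^sup>+p. ennreal (cmod (?Q p)) \<partial>(lborel \<Otimes>\<^sub>M lborel))"
        by (rule integral_norm_bound_ennreal)
    next
      case False
      then have "(\<integral>p. ?Q p \<partial>(lborel \<Otimes>\<^sub>M lborel)) = 0" by (rule not_integrable_integral_eq)
      then show "ennreal (cmod (\<integral>p. ?Q p \<partial>(lborel \<Otimes>\<^sub>M lborel))) \<le> (\<integral>\<^sup>+p. ennreal (cmod (?Q p)) \<partial>(lborel \<Otimes>\<^sub>M lborel))"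
        by (simp only: norm_zero ennreal_0 zero_le)
    qed
    also have "\<dots> = (\<integral>\<^sup>+x. \<integral>\<^sup>+y. ennreal (cmod (?Q (x, y))) \<partial>lborel \<partial>lborel)"
      by (rule lborel.nn_integral_fst[symmetric]) measurable
    also have "\<dots> = (\<integral>\<^sup>+x. \<integral>\<^sup>+y. ennreal (cmod (w x) * cmod (w y)) * (indicator I x * indicator I y * ennreal (cmod (?K x y))) \<partial>lborel \<partial>lborel)"
    proof (intro nn_integral_cong)
      fix x y
      show "ennreal (cmod (?Q (x, y))) = ennreal (cmod (w x) * cmod (w y)) * (indicator I x * indicator I y * ennreal (cmod (?K x y)))"
      proof (cases "x \<in> I \<and> y \<in> I")
        case True
        have "cmod (?Q (x, y)) = (cmod (w x) * cmod (w y)) * cmod (?K x y)"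
          by (simp only: norm_mult fst_conv snd_conv complex_mod_cnj)
        then show ?thesis using True by (simp add: ennreal_mult)
      next
        case False
        then show ?thesis by (auto simp: w_def)
      qed
    qed
    also have "\<dots> \<le> ennreal M * (\<integral>\<^sup>+x. ennreal ((cmod (w x))\<^sup>2) \<partial>lborel)"
    proof (rule schur_test)
      show "(\<lambda>p. indicator I (fst p) * indicator I (snd p) * ennreal (cmod (?K (fst p) (snd p)))) \<in> borel_measurable (borel \<Otimes>\<^sub>M borel)"
        by measurable
      show "indicator I x * indicator I y * ennreal (cmod (?K x y)) = indicator I y * indicator I x * ennreal (cmod (?K y x))" for x y
      proof -
        have "?K y x = (\<integral>\<xi>. cnj (s x \<xi> * cnj (s y \<xi>)) \<partial>lborel)" by (simp add: mult.commute)
        also have "\<dots> = cnj (?K x y)" by (rule Bochner_Integration.integral_cnj)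
        finally show ?thesis by (simp add: mult.commute)
      qed
      show "(\<integral>\<^sup>+y. indicator I x * indicator I y * ennreal (cmod (?K x y)) \<partial>lborel) \<le> ennreal M" for x
        using bd[of x] by (cases "x \<in> I") auto
    qed auto
    also have "(\<integral>\<^sup>+x. ennreal ((cmod (w x))\<^sup>2) \<partial>lborel) = ennreal U"
      unfolding U_def by (rule nn_integral_eq_integral[OF w(2)]) simp
    finally have "ennreal (\<integral>\<xi>. (cmod (W \<xi>))\<^sup>2 \<partial>lborel) \<le> ennreal (M * U)"
      using M U0 by (simp add: ennreal_mult)
    then show ?thesis using M U0 by (subst (asm) ennreal_le_iff) auto
  qed
  have "U\<^sup>2 \<le> (\<integral>\<xi>. (cmod (G \<xi>))\<^sup>2 \<partial>lborel) * (\<integral>\<xi>. (cmod (W \<xi>))\<^sup>2 \<partial>lborel)"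
  proof -
    have "U = cmod (\<integral>\<xi>. G \<xi> * W \<xi> \<partial>lborel)" using U0 by (simp flip: 1)
    also have "\<dots> \<le> (\<integral>\<xi>. cmod (G \<xi>) * cmod (W \<xi>) \<partial>lborel)"
      by (rule order_trans[OF integral_norm_bound]) (simp add: norm_mult)
    finally have "U\<^sup>2 \<le> (\<integral>\<xi>. cmod (G \<xi>) * cmod (W \<xi>) \<partial>lborel)\<^sup>2"
      using U0 by (intro power_mono) auto
    also have "\<dots> \<le> (\<integral>\<xi>. (cmod (G \<xi>))\<^sup>2 \<partial>lborel) * (\<integral>\<xi>. (cmod (W \<xi>))\<^sup>2 \<partial>lborel)"
      by (rule integral_Cauchy_Schwarz) (use G W2 in auto)
    finally show ?thesis .
  qed
  also have "\<dots> \<le> (\<integral>\<xi>. (cmod (G \<xi>))\<^sup>2 \<partial>lborel) * (M * U)"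
    by (intro mult_left_mono 2) auto
  \<comment> \<open>The bound for \<open>W\<close> contains \<open>U\<close> again, so one factor
    \<open>U\<close> cancels. \<open>U\<close> is a genuine integral because \<open>w\<close> is
    bounded and lives on a set of finite measure.\<close>
  finally have "U * U \<le> (M * (\<integral>\<xi>. (cmod (G \<xi>))\<^sup>2 \<partial>lborel)) * U" by (simp add: power2_eq_square mult_ac)
  then have "U \<le> M * (\<integral>\<xi>. (cmod (G \<xi>))\<^sup>2 \<partial>lborel)"
    using U0 M by (cases "U = 0") (auto simp: mult_le_cancel_right)
  moreover have "(\<integral>\<^sup>+x. indicator I x * ennreal ((cmod (u x))\<^sup>2) \<partial>lborel) = ennreal U"
  proof -
    have "indicator I x * ennreal ((cmod (u x))\<^sup>2) = ennreal ((cmod (w x))\<^sup>2)" for x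
      by (auto simp: w_def indicator_def)
    then show ?thesis unfolding U_def using nn_integral_eq_integral[OF w(2)] by simp
  qed
  ultimately show ?thesis by (simp add: ennreal_leI)
qed

section \<open>Maximal functions of one frequency block\<close>

definition piece :: "real \<Rightarrow> (real \<Rightarrow> complex) \<Rightarrow> real \<Rightarrow> real \<Rightarrow> real \<Rightarrow> real \<Rightarrow> complex" where
  "piece m G L a b c = (\<integral>\<xi>. (indicator {L..2*L} \<xi> *\<^sub>R osc m a b c \<xi>) * G \<xi> \<partial>lborel)"

lemma osc_measurable [measurable (raw)]:
  assumes [measurable]: "a \<in> borel_measurable M" "b \<in> borel_measurable M" "c \<in> borel_measurable M" "f \<in> borel_measurable M"
  shows "(\<lambda>x. osc m (a x) (b x) (c x) (f x)) \<in> borel_measurable M"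
  unfolding osc_def by measurable

lemma osc_le_1: "c \<ge> 0 \<Longrightarrow> cmod (osc m a b c \<xi>) \<le> 1"
  by simp

lemma integral_osc_lborel:
  assumes "L > 0"
  shows "(\<integral>\<xi>. indicator {L..2*L} \<xi> *\<^sub>R osc m a b c \<xi> \<partial>lborel) = integral {L..2*L} (osc m a b c)"
proof -
  have "set_integrable lborel {L..2*L} (osc m a b c)"
    using assms by (intro borel_integrable_atLeastAtMost' continuous_on_osc) auto
  from set_borel_integral_eq_integral(2)[OF this] show ?thesis
    by (simp add: set_lebesgue_integral_def)
qed

text \<open>One time per point: \<open>\<tau>\<close> selects the index of the maximum.\<close>

lemma maximal_finite:
  fixes a :: "nat \<Rightarrow> real \<Rightarrow> real" and b c :: "nat \<Rightarrow> real" and G :: "real \<Rightarrow> complex"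
  assumes a[measurable]: "\<And>i. a i \<in> borel_measurable borel" and c: "\<And>i. c i \<ge> 0" and L: "L > 0"
    and I[measurable]: "I \<in> sets borel" "emeasure lborel I < \<infinity>"
    and G: "integrable lborel G" "integrable lborel (\<lambda>\<xi>. (cmod (G \<xi>))\<^sup>2)"
    and K: "\<And>i j x y. x \<noteq> y \<Longrightarrow> cmod (integral {L..2*L} (osc m (a i x - a j y) (b i - b j) (c i + c j))) \<le> \<kappa> x y"
    and bd: "\<And>x. x \<in> I \<Longrightarrow> (\<integral>\<^sup>+y. indicator I y * ennreal (\<kappa> x y) \<partial>lborel) \<le> ennreal M"
    and M: "M \<ge> 0"
  shows "(\<integral>\<^sup>+x. indicator I x * (SUP i\<in>{..<N}. ennreal ((cmod (piece m G L (a i x) (b i) (c i)))\<^sup>2)) \<partial>lborel) \<le> ennreal (M * (\<integral>\<xi>. (cmod (G \<xi>))\<^sup>2 \<partial>lborel))"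
proof (cases "N = 0")
  case True
  then show ?thesis by (simp add: bot_ennreal)
next
  case False
  have Gm[measurable]: "G \<in> borel_measurable borel" using G by auto
  define v where "v i x = cmod (piece m G L (a i x) (b i) (c i))" for i x
  have vm[measurable]: "v i \<in> borel_measurable borel" for i
    unfolding v_def piece_def by measurable
  \<comment> \<open>Taking the least dominating index makes the selection measurable, since its
    level sets are built from comparisons of measurable functions. The index only has to dominate
    the first \<open>N\<close> values, not to be one of them.\<close>
  define \<tau> where "\<tau> x = (LEAST i. \<forall>j\<in>{..<N}. v j x \<le> v i x)" for x
  have \<tau>m[measurable]: "\<tau> \<in> measurable borel (count_space UNIV)"
    unfolding \<tau>_def by measurable
  have \<tau>: "v j x \<le> v (\<tau> x) x" if "j < N" for j x
  proof -
    have "finite ((\<lambda>i. v i x) ` {..<N})" "(\<lambda>i. v i x) ` {..<N} \<noteq> {}" using False by auto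
    from Max_in[OF this] obtain i where i: "i < N" "v i x = Max ((\<lambda>i. v i x) ` {..<N})" by auto
    then have "\<forall>j\<in>{..<N}. v j x \<le> v i x" by simp
    from LeastI[of "\<lambda>i. \<forall>j\<in>{..<N}. v j x \<le> v i x", OF this] show ?thesis
      unfolding \<tau>_def using that by blast
  qed
  define s where "s x \<xi> = indicator {L..2*L} \<xi> *\<^sub>R osc m (a (\<tau> x) x) (b (\<tau> x)) (c (\<tau> x)) \<xi>" for x \<xi>
  have sm: "(\<lambda>p. s (fst p) (snd p)) \<in> borel_measurable (borel \<Otimes>\<^sub>M borel)"
  proof -
    have [measurable]: "(\<lambda>p. \<tau> (fst p)) \<in> measurable (borel \<Otimes>\<^sub>M (borel :: real measure)) (count_space UNIV)"
      by measurable
    have "(\<lambda>p. (\<lambda>i p. indicator {L..2*L} (snd p) *\<^sub>R osc m (a i (fst p)) (b i) (c i) (snd p)) (\<tau> (fst p)) p) \<in> borel_measurable (borel \<Otimes>\<^sub>M borel)"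
      by (rule measurable_compose_countable) measurable
    then show ?thesis unfolding s_def .
  qed
  have "(\<integral>\<^sup>+x. indicator I x * ennreal ((cmod (\<integral>\<xi>. s x \<xi> * G \<xi> \<partial>lborel))\<^sup>2) \<partial>lborel) \<le> ennreal (M * (\<integral>\<xi>. (cmod (G \<xi>))\<^sup>2 \<partial>lborel))"
  proof (rule tt_star[OF sm, where E="{L..2*L}"])
    show "cmod (s x \<xi>) \<le> 1" for x \<xi>
      using osc_le_1[OF c] by (auto simp: s_def indicator_def)
    show "s x \<xi> = 0" if "\<xi> \<notin> {L..2*L}" for x \<xi> using that by (simp add: s_def)
    show "emeasure lborel {L..2*L} < \<infinity>" by (simp add: emeasure_lborel_Icc_eq)
    fix x assume x: "x \<in> I"
    have "AE y in lborel. indicator I y * ennreal (cmod (\<integral>\<xi>. s x \<xi> * cnj (s y \<xi>) \<partial>lborel)) \<le> indicator I y * ennreal (\<kappa> x y)"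
    proof -
      have "AE y in lborel. y \<noteq> x" by (rule AE_lborel_singleton)
      then show ?thesis
      proof eventually_elim
        case (elim y)
        have "s x \<xi> * cnj (s y \<xi>) = indicator {L..2*L} \<xi> *\<^sub>R osc m (a (\<tau> x) x - a (\<tau> y) y) (b (\<tau> x) - b (\<tau> y)) (c (\<tau> x) + c (\<tau> y)) \<xi>" for \<xi>
          by (auto simp: s_def indicator_def osc_mult_cnj)
        then have "(\<integral>\<xi>. s x \<xi> * cnj (s y \<xi>) \<partial>lborel) = integral {L..2*L} (osc m (a (\<tau> x) x - a (\<tau> y) y) (b (\<tau> x) - b (\<tau> y)) (c (\<tau> x) + c (\<tau> y)))"
          using integral_osc_lborel[OF L] by simp
        then show ?case using K[of x y] elim by (auto intro!: mult_left_mono ennreal_leI)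
      qed
    qed
    then have "(\<integral>\<^sup>+y. indicator I y * ennreal (cmod (\<integral>\<xi>. s x \<xi> * cnj (s y \<xi>) \<partial>lborel)) \<partial>lborel) \<le> (\<integral>\<^sup>+y. indicator I y * ennreal (\<kappa> x y) \<partial>lborel)"
      by (rule nn_integral_mono_AE)
    also have "\<dots> \<le> ennreal M" by (rule bd[OF x])
    finally show "(\<integral>\<^sup>+y. indicator I y * ennreal (cmod (\<integral>\<xi>. s x \<xi> * cnj (s y \<xi>) \<partial>lborel)) \<partial>lborel) \<le> ennreal M" .
  qed (use I G M in auto)
  moreover have "indicator I x * (SUP i\<in>{..<N}. ennreal ((cmod (piece m G L (a i x) (b i) (c i)))\<^sup>2))
     \<le> indicator I x * ennreal ((cmod (\<integral>\<xi>. s x \<xi> * G \<xi> \<partial>lborel))\<^sup>2)" for x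
  proof (intro mult_left_mono SUP_least ennreal_leI)
    fix i assume "i \<in> {..<N}"
    then have "v i x \<le> v (\<tau> x) x" by (intro \<tau>) auto
    moreover have "v (\<tau> x) x = cmod (\<integral>\<xi>. s x \<xi> * G \<xi> \<partial>lborel)" by (simp add: v_def piece_def s_def)
    ultimately show "(cmod (piece m G L (a i x) (b i) (c i)))\<^sup>2 \<le> (cmod (\<integral>\<xi>. s x \<xi> * G \<xi> \<partial>lborel))\<^sup>2"
      by (intro power_mono) (auto simp: v_def)
  qed simp
  then have "(\<integral>\<^sup>+x. indicator I x * (SUP i\<in>{..<N}. ennreal ((cmod (piece m G L (a i x) (b i) (c i)))\<^sup>2)) \<partial>lborel)
     \<le> (\<integral>\<^sup>+x. indicator I x * ennreal ((cmod (\<integral>\<xi>. s x \<xi> * G \<xi> \<partial>lborel))\<^sup>2) \<partial>lborel)"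
    by (intro nn_integral_mono)
  ultimately show ?thesis by (rule order_trans[rotated])
qed

text \<open>The bound for finitely many times does not depend on their number, so monotone
  convergence passes to the supremum over a sequence.\<close>

lemma maximal_countable:
  fixes a :: "nat \<Rightarrow> real \<Rightarrow> real" and b c :: "nat \<Rightarrow> real" and G :: "real \<Rightarrow> complex"
  assumes a[measurable]: "\<And>i. a i \<in> borel_measurable borel" and c: "\<And>i. c i \<ge> 0" and L: "L > 0"
    and I[measurable]: "I \<in> sets borel" "emeasure lborel I < \<infinity>"
    and G: "integrable lborel G" "integrable lborel (\<lambda>\<xi>. (cmod (G \<xi>))\<^sup>2)"
    and K: "\<And>i j x y. x \<noteq> y \<Longrightarrow> cmod (integral {L..2*L} (osc m (a i x - a j y) (b i - b j) (c i + c j))) \<le> \<kappa> x y"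
    and bd: "\<And>x. x \<in> I \<Longrightarrow> (\<integral>\<^sup>+y. indicator I y * ennreal (\<kappa> x y) \<partial>lborel) \<le> ennreal M"
    and M: "M \<ge> 0"
  shows "(\<integral>\<^sup>+x. indicator I x * (SUP i. ennreal ((cmod (piece m G L (a i x) (b i) (c i)))\<^sup>2)) \<partial>lborel) \<le> ennreal (M * (\<integral>\<xi>. (cmod (G \<xi>))\<^sup>2 \<partial>lborel))"
proof -
  have Gm[measurable]: "G \<in> borel_measurable borel" using G by auto
  define v where "v i x = ennreal ((cmod (piece m G L (a i x) (b i) (c i)))\<^sup>2)" for i x
  have vm[measurable]: "v i \<in> borel_measurable borel" for i
    unfolding v_def piece_def by measurable
  define V where "V N x = indicator I x * (SUP i\<in>{..<N}. v i x)" for N :: nat and x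
  have eq: "indicator I x * (SUP i. v i x) = (SUP N. V N x)" for x
  proof -
    have "(SUP i. v i x) = (SUP N. SUP i\<in>{..<N}. v i x)"
    proof (rule antisym)
      show "(SUP i. v i x) \<le> (SUP N. SUP i\<in>{..<N}. v i x)"
      proof (rule SUP_least)
        fix i
        have "v i x \<le> (SUP j\<in>{..<Suc i}. v j x)" by (rule SUP_upper) simp
        also have "\<dots> \<le> (SUP N. SUP i\<in>{..<N}. v i x)" by (rule SUP_upper) simp
        finally show "v i x \<le> (SUP N. SUP i\<in>{..<N}. v i x)" .
      qed
      show "(SUP N. SUP i\<in>{..<N}. v i x) \<le> (SUP i. v i x)"
        by (intro SUP_least SUP_upper) auto
    qed
    then show ?thesis unfolding V_def by (simp add: SUP_mult_left_ennreal)
  qed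
  have "(\<integral>\<^sup>+x. (SUP N. V N x) \<partial>lborel) = (SUP N. \<integral>\<^sup>+x. V N x \<partial>lborel)"
  proof (rule nn_integral_monotone_convergence_SUP)
    show "incseq V"
      unfolding V_def by (intro incseq_SucI le_funI mult_left_mono SUP_subset_mono) auto
    show "V N \<in> borel_measurable lborel" for N unfolding V_def by measurable
  qed
  also have "\<dots> \<le> ennreal (M * (\<integral>\<xi>. (cmod (G \<xi>))\<^sup>2 \<partial>lborel))"
    unfolding V_def v_def by (intro SUP_least maximal_finite[OF a c L I G K bd M])
  finally show ?thesis unfolding eq[symmetric] v_def .
qed

text \<open>Powers above -1 are integrable at 0, and distances inside the interval are at most
  \<open>2 * n\<close>; hence one constant serves all centres. It is the row bound for Schur's
  test.\<close>

lemma powr_kernel_finite: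
  fixes p n :: real
  assumes p: "0 \<le> p" "p < 1" and n: "n > 0"
  obtains M where "M \<ge> 0" "\<And>x. x \<in> {-n..n} \<Longrightarrow> (\<integral>\<^sup>+y. indicator {-n..n} y * ennreal (\<bar>x - y\<bar> powr (- p)) \<partial>lborel) \<le> ennreal M"
proof -
  define Q where "Q = (2 * n) powr (1 - p) / (1 - p)"
  have Q0: "Q \<ge> 0" using p n by (simp add: Q_def)
  let ?f = "\<lambda>v::real. indicator {0..2*n} v * ennreal (\<bar>v\<bar> powr (- p))"
  have f: "(\<integral>\<^sup>+v. ?f v \<partial>lborel) = ennreal Q"
  proof -
    have "((\<lambda>x. x powr (- p)) has_integral (2 * n) powr (- p + 1) / (- p + 1)) {0..2*n}"
      using p n by (intro has_integral_powr_from_0) auto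
    then have hi: "((\<lambda>x. x powr (- p)) has_integral Q) {0..2*n}" by (simp add: Q_def)
    have "(\<integral>\<^sup>+v. ?f v \<partial>lborel) = (\<integral>\<^sup>+v. ennreal (v powr (- p)) * indicator {0..2*n} v \<partial>lborel)"
      by (intro nn_integral_cong) (auto simp: indicator_def)
    also have "\<dots> = ennreal Q"
      by (rule nn_integral_has_integral_lebesgue'[OF _ hi]) auto
    finally show ?thesis .
  qed
  show ?thesis
  proof (rule that[of "Q + Q"])
    fix x assume x: "x \<in> {-n..n}"
    have "(\<integral>\<^sup>+y. indicator {-n..n} y * ennreal (\<bar>x - y\<bar> powr (- p)) \<partial>lborel) \<le> (\<integral>\<^sup>+y. ?f (x - y) + ?f (y - x) \<partial>lborel)"
      using x by (intro nn_integral_mono) (auto simp: indicator_def abs_minus_commute)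
    also have "\<dots> = (\<integral>\<^sup>+y. ?f (x - y) \<partial>lborel) + (\<integral>\<^sup>+y. ?f (y - x) \<partial>lborel)"
      by (rule nn_integral_add) measurable
    also have "(\<integral>\<^sup>+y. ?f (x - y) \<partial>lborel) = (\<integral>\<^sup>+v. ?f v \<partial>lborel)"
      by (subst (2) nn_integral_real_affine[where c="-1" and t=x]) auto
    also have "(\<integral>\<^sup>+y. ?f (y - x) \<partial>lborel) = (\<integral>\<^sup>+v. ?f v \<partial>lborel)"
      by (subst (2) nn_integral_real_affine[where c="1" and t="-x"]) auto
    finally show "(\<integral>\<^sup>+y. indicator {-n..n} y * ennreal (\<bar>x - y\<bar> powr (- p)) \<partial>lborel) \<le> ennreal (Q + Q)"
      unfolding f ennreal_plus[OF Q0 Q0] .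
  qed (use Q0 in simp)
qed

section \<open>Summation over dyadic frequencies\<close>

lemma isCont_cis: "isCont cis x"
proof -
  have "continuous_on UNIV cis" by (intro continuous_intros)
  then show ?thesis by (simp add: continuous_on_eq_continuous_at)
qed

lemma piece_restrict:
  "piece m (\<lambda>\<xi>. indicator {L..2*L} \<xi> *\<^sub>R G \<xi>) L a b c = piece m G L a b c"
  unfolding piece_def by (intro Bochner_Integration.integral_cong) (auto simp: indicator_def)

text \<open>The maximal estimate controls countably many times only; continuity in time extends it
  to the whole interval.\<close>

lemma continuous_on_piece:
  fixes a b c :: "real \<Rightarrow> real"
  assumes ab: "continuous_on S a" "continuous_on S b" "continuous_on S c" and c0: "\<And>t. t \<in> S \<Longrightarrow> c t \<ge> 0"
    and G: "integrable lborel (\<lambda>\<xi>. indicator {L..2*L} \<xi> *\<^sub>R G \<xi>)"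
  shows "continuous_on S (\<lambda>t. piece m G L (a t) (b t) (c t))"
  unfolding continuous_on_sequentially comp_def
proof (intro allI ballI impI, elim conjE)
  fix x t assume t: "t \<in> S" "\<forall>n. x n \<in> S" "x \<longlonglongrightarrow> t"
  let ?G = "\<lambda>\<xi>. indicator {L..2*L} \<xi> *\<^sub>R G \<xi>"
  have [measurable]: "?G \<in> borel_measurable borel" using G by auto
  have lims: "(\<lambda>n. a (x n)) \<longlonglongrightarrow> a t" "(\<lambda>n. b (x n)) \<longlonglongrightarrow> b t" "(\<lambda>n. c (x n)) \<longlonglongrightarrow> c t"
    using ab t unfolding continuous_on_sequentially comp_def by blast+
  have "(\<lambda>n. \<integral>\<xi>. osc m (a (x n)) (b (x n)) (c (x n)) \<xi> * ?G \<xi> \<partial>lborel) \<longlonglongrightarrow> (\<integral>\<xi>. osc m (a t) (b t) (c t) \<xi> * ?G \<xi> \<partial>lborel)"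
  proof (rule integral_dominated_convergence[where w="\<lambda>\<xi>. cmod (?G \<xi>)"])
    show "AE \<xi> in lborel. (\<lambda>n. osc m (a (x n)) (b (x n)) (c (x n)) \<xi> * ?G \<xi>) \<longlonglongrightarrow> osc m (a t) (b t) (c t) \<xi> * ?G \<xi>"
    proof (rule AE_I2)
      fix \<xi>
      have "(\<lambda>n. cis (a (x n) * \<xi> + b (x n) * \<xi> powr m)) \<longlonglongrightarrow> cis (a t * \<xi> + b t * \<xi> powr m)"
        by (rule isCont_tendsto_compose[OF isCont_cis]) (intro tendsto_intros lims)
      then show "(\<lambda>n. osc m (a (x n)) (b (x n)) (c (x n)) \<xi> * ?G \<xi>) \<longlonglongrightarrow> osc m (a t) (b t) (c t) \<xi> * ?G \<xi>"
        unfolding osc_def by (intro tendsto_intros lims)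
    qed
    show "AE \<xi> in lborel. cmod (osc m (a (x n)) (b (x n)) (c (x n)) \<xi> * ?G \<xi>) \<le> cmod (?G \<xi>)" for n
    proof (rule AE_I2)
      fix \<xi>
      have "cmod (osc m (a (x n)) (b (x n)) (c (x n)) \<xi>) * cmod (?G \<xi>) \<le> 1 * cmod (?G \<xi>)"
        using t c0 by (intro mult_right_mono osc_le_1) auto
      then show "cmod (osc m (a (x n)) (b (x n)) (c (x n)) \<xi> * ?G \<xi>) \<le> cmod (?G \<xi>)"
        by (simp only: norm_mult mult_1)
    qed
    show "integrable lborel (\<lambda>\<xi>. cmod (?G \<xi>))" by (rule integrable_norm[OF G])
  qed measurable
  moreover have "piece m G L a b c = (\<integral>\<xi>. osc m a b c \<xi> * ?G \<xi> \<partial>lborel)" for a b c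
    unfolding piece_def by (intro Bochner_Integration.integral_cong) (auto simp: indicator_def)
  ultimately show "(\<lambda>n. piece m G L (a (x n)) (b (x n)) (c (x n))) \<longlonglongrightarrow> piece m G L (a t) (b t) (c t)" by simp
qed

lemma restrict_L2:
  assumes G: "L2_fun G" and E[measurable]: "E \<in> sets borel" "emeasure lborel E < \<infinity>"
  shows "integrable lborel (\<lambda>\<xi>. indicator E \<xi> *\<^sub>R G \<xi>)" "integrable lborel (\<lambda>\<xi>. (cmod (indicator E \<xi> *\<^sub>R G \<xi>))\<^sup>2)"
proof -
  have [measurable]: "G \<in> borel_measurable borel" by (rule L2_fun_measurable[OF G])
  have i: "integrable lborel (\<lambda>x. (cmod (G x))\<^sup>2)" using G by (simp add: L2_fun_def)
  show "integrable lborel (\<lambda>\<xi>. (cmod (indicator E \<xi> *\<^sub>R G \<xi>))\<^sup>2)"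
    by (rule Bochner_Integration.integrable_bound[OF i]) (auto split: split_indicator)
  have "integrable lborel (\<lambda>x. indicator E x * G x)"
  proof (rule integrable_mult_L2)
    have "(\<lambda>x. (cmod (indicator E x :: complex))\<^sup>2) = indicat_real E"
      by (auto simp: fun_eq_iff split: split_indicator)
    then show "integrable lborel (\<lambda>x. (cmod (indicator E x :: complex))\<^sup>2)"
      using E by (auto intro!: integrable_real_indicator)
  qed (use i in auto)
  then show "integrable lborel (\<lambda>\<xi>. indicator E \<xi> *\<^sub>R G \<xi>)"
    by (rule Bochner_Integration.integrable_cong[THEN iffD1, rotated 2]) (auto split: split_indicator)
qed

text \<open>The maximal estimate loses \<open>L powr (2 * \<sigma>)\<close>, the Sobolev weight
  gains \<open>L powr (- (2 * s))\<close>. Half of the surplus makes the weighted sum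
  \<open>W\<close> of all blocks integrable; finiteness of \<open>W x\<close> turns the other half
  into geometric decay of the blocks at \<open>x\<close>, uniformly in time.\<close>

lemma dyadic_bound_interval:
  fixes a :: "real \<Rightarrow> real \<Rightarrow> real" and b c :: "real \<Rightarrow> real" and s \<sigma> :: real
  assumes acx: "\<And>t. t \<in> {0..1} \<Longrightarrow> continuous_on UNIV (\<lambda>x. a x t)" and act: "\<And>x. continuous_on {0..1} (a x)"
    and bc: "continuous_on {0..1} b" "continuous_on {0..1} c" and c0: "\<And>t. t \<in> {0..1} \<Longrightarrow> c t \<ge> 0"
    and K: "\<And>L x y t t'. \<lbrakk>L \<ge> 1; x \<noteq> y; t \<in> {0..1}; t' \<in> {0..1}\<rbrakk> \<Longrightarrow>
       cmod (integral {L..2*L} (osc m (a x t - a y t') (b t - b t') (c t + c t')))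
         \<le> C * L powr (2 * \<sigma>) * (\<bar>x - y\<bar> powr (- p) + \<bar>x - y\<bar> powr (- p'))"
    and C: "C \<ge> 0" "0 \<le> p" "p < 1" "0 \<le> p'" "p' < 1"
    and G: "L2_fun G" "integrable lborel (\<lambda>\<xi>. (1 + \<xi>\<^sup>2) powr s * (cmod (G \<xi>))\<^sup>2)" and s: "\<sigma> < s" "0 \<le> s"
    and n: "n > 0"
  shows "AE x in lborel. x \<in> {-n..n} \<longrightarrow> (\<exists>D\<ge>0. \<forall>k. \<forall>t\<in>{0..1}. cmod (piece m G (2 ^ k) (a x t) (b t) (c t)) \<le> D * (2 powr (- (s - \<sigma>) / 2)) ^ k)"
proof -
  have Gm[measurable]: "G \<in> borel_measurable borel" by (rule L2_fun_measurable[OF G(1)])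
  define I where "I = {-n..n}"
  have I[measurable]: "I \<in> sets borel" "emeasure lborel I < \<infinity>" by (auto simp: I_def emeasure_lborel_Icc_eq)
  obtain M1 where M1: "M1 \<ge> 0" "\<And>x. x \<in> I \<Longrightarrow> (\<integral>\<^sup>+y. indicator I y * ennreal (\<bar>x - y\<bar> powr (- p)) \<partial>lborel) \<le> ennreal M1"
    using powr_kernel_finite[OF C(2,3) n] unfolding I_def by blast
  obtain M2 where M2: "M2 \<ge> 0" "\<And>x. x \<in> I \<Longrightarrow> (\<integral>\<^sup>+y. indicator I y * ennreal (\<bar>x - y\<bar> powr (- p')) \<partial>lborel) \<le> ennreal M2"
    using powr_kernel_finite[OF C(4,5) n] unfolding I_def by blast
  define M where "M = M1 + M2"
  have M: "M \<ge> 0" using M1 M2 by (simp add: M_def)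
  \<comment> \<open>Rationals in the open unit interval are countable with closure
    \<open>{0..1}\<close>; openness is what the closure rule requires.\<close>
  define T where "T = ({0<..<1} \<inter> \<rat> :: real set)"
  have clT: "closure T = {0..1}"
    unfolding T_def by (subst closure_open_Int_superset) (auto simp: Rats_closure_real)
  have T: "countable T" "T \<noteq> {}" "T \<subseteq> {0..1}"
  proof -
    show "countable T" unfolding T_def by (intro countable_Int2 countable_rat)
    show "T \<noteq> {}" using clT by auto
    show "T \<subseteq> {0..1}" by (auto simp: T_def)
  qed
  define \<tau> where "\<tau> = from_nat_into T"
  have \<tau>: "range \<tau> = T" unfolding \<tau>_def using T by (simp add: range_from_nat_into)
  have \<tau>i: "\<tau> i \<in> {0..1}" for i using rangeI[of \<tau> i] T(3) unfolding \<tau> by blast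
  define H where "H = (\<integral>\<xi>. (1 + \<xi>\<^sup>2) powr s * (cmod (G \<xi>))\<^sup>2 \<partial>lborel)"
  have H: "H \<ge> 0" by (simp add: H_def)
  define Gk where "Gk k \<xi> = indicator {2 ^ k..2 * 2 ^ k} \<xi> *\<^sub>R G \<xi>" for k :: nat and \<xi> :: real
  have Gk: "integrable lborel (Gk k)" "integrable lborel (\<lambda>\<xi>. (cmod (Gk k \<xi>))\<^sup>2)" for k
    unfolding Gk_def by (intro restrict_L2 G(1); simp add: emeasure_lborel_Icc_eq)+
  have Gk_eq: "Gk k = (\<lambda>\<xi>. indicator {2 ^ k..2 * 2 ^ k} \<xi> *\<^sub>R G \<xi>)" for k
    by (rule ext) (rule Gk_def)
  have piece_Gk: "piece m (Gk k) (2 ^ k) a b c = piece m G (2 ^ k) a b c" for k a b c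
    unfolding Gk_eq by (rule piece_restrict)
  have GkH: "(\<integral>\<xi>. (cmod (Gk k \<xi>))\<^sup>2 \<partial>lborel) \<le> H * (2 ^ k) powr (- (2 * s))" for k
  proof -
    have "(\<integral>\<xi>. (cmod (Gk k \<xi>))\<^sup>2 \<partial>lborel) \<le> (\<integral>\<xi>. (2 ^ k) powr (- (2 * s)) * ((1 + \<xi>\<^sup>2) powr s * (cmod (G \<xi>))\<^sup>2) \<partial>lborel)"
    proof (rule integral_mono)
      fix \<xi> :: real
      show "(cmod (Gk k \<xi>))\<^sup>2 \<le> (2 ^ k) powr (- (2 * s)) * ((1 + \<xi>\<^sup>2) powr s * (cmod (G \<xi>))\<^sup>2)"
      proof (cases "\<xi> \<in> {2 ^ k..2 * 2 ^ k}")
        case True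
        have pos: "(0::real) \<le> 2 ^ k" by simp
        have "(2 ^ k) powr (2 * s) = ((2 ^ k) powr 2) powr s" by (simp only: powr_powr)
        also have "\<dots> \<le> (1 + \<xi>\<^sup>2) powr s"
        proof (rule powr_mono2)
          have "(2 ^ k)\<^sup>2 \<le> \<xi>\<^sup>2" using True by (intro power_mono) auto
          moreover have "(2 ^ k) powr 2 = ((2::real) ^ k)\<^sup>2" using powr_numeral[OF pos, of "num.Bit0 num.One"] by simp
          ultimately show "(2 ^ k) powr 2 \<le> 1 + \<xi>\<^sup>2" by linarith
        qed (use s in auto)
        finally have "(2 ^ k) powr (2 * s) \<le> (1 + \<xi>\<^sup>2) powr s" .
        then have "1 \<le> (2 ^ k) powr (- (2 * s)) * (1 + \<xi>\<^sup>2) powr s"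
          by (simp add: powr_minus field_simps)
        then have "1 * (cmod (G \<xi>))\<^sup>2 \<le> ((2 ^ k) powr (- (2 * s)) * (1 + \<xi>\<^sup>2) powr s) * (cmod (G \<xi>))\<^sup>2"
          by (intro mult_right_mono) auto
        then show ?thesis using True by (simp add: Gk_def mult.assoc)
      qed (simp add: Gk_def)
    qed (use Gk G in auto)
    then show ?thesis by (simp add: H_def mult.commute)
  qed
  define S where "S k x = indicator I x * (SUP i. ennreal ((cmod (piece m (Gk k) (2 ^ k) (a x (\<tau> i)) (b (\<tau> i)) (c (\<tau> i))))\<^sup>2))" for k x
  have am[measurable]: "(\<lambda>x. a x (\<tau> i)) \<in> borel_measurable borel" for i
    by (rule borel_measurable_continuous_onI[OF acx[OF \<tau>i]])
  have Gkm[measurable]: "Gk k \<in> borel_measurable borel" for k unfolding Gk_def by measurable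
  have Sm[measurable]: "S k \<in> borel_measurable borel" for k
    unfolding S_def piece_def by measurable
  define \<delta> where "\<delta> = s - \<sigma>"
  have \<delta>: "\<delta> > 0" using s by (simp add: \<delta>_def)
  \<comment> \<open>\<open>q ^ k\<close> is the square root of the surplus
    \<open>2 powr (2 * k * \<delta>)\<close> of block \<open>k\<close>.\<close>
  define q where "q = (2::real) powr \<delta>"
  have q: "q > 1" using \<delta> by (simp add: q_def)
  have SI: "(\<integral>\<^sup>+x. S k x \<partial>lborel) \<le> ennreal (C * M * H * inverse q ^ (2 * k))" for k
  proof -
    have "(\<integral>\<^sup>+x. S k x \<partial>lborel) \<le> ennreal ((C * (2 ^ k) powr (2 * \<sigma>) * M) * (\<integral>\<xi>. (cmod (Gk k \<xi>))\<^sup>2 \<partial>lborel))"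
      unfolding S_def
    proof (rule maximal_countable[OF am _ _ I Gk])
      show "c (\<tau> i) \<ge> 0" for i by (rule c0[OF \<tau>i])
      show "cmod (integral {2 ^ k..2 * 2 ^ k} (osc m (a x (\<tau> i) - a y (\<tau> j)) (b (\<tau> i) - b (\<tau> j)) (c (\<tau> i) + c (\<tau> j))))
         \<le> C * (2 ^ k) powr (2 * \<sigma>) * (\<bar>x - y\<bar> powr (- p) + \<bar>x - y\<bar> powr (- p'))" if "x \<noteq> y" for i j x y
        by (rule K[OF _ that \<tau>i \<tau>i]) simp
      show "(\<integral>\<^sup>+y. indicator I y * ennreal (C * (2 ^ k) powr (2 * \<sigma>) * (\<bar>x - y\<bar> powr (- p) + \<bar>x - y\<bar> powr (- p'))) \<partial>lborel)
         \<le> ennreal (C * (2 ^ k) powr (2 * \<sigma>) * M)" if x: "x \<in> I" for x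
      proof -
        have "(\<integral>\<^sup>+y. indicator I y * ennreal (C * (2 ^ k) powr (2 * \<sigma>) * (\<bar>x - y\<bar> powr (- p) + \<bar>x - y\<bar> powr (- p'))) \<partial>lborel)
          = (\<integral>\<^sup>+y. ennreal (C * (2 ^ k) powr (2 * \<sigma>)) * (indicator I y * ennreal (\<bar>x - y\<bar> powr (- p)) + indicator I y * ennreal (\<bar>x - y\<bar> powr (- p'))) \<partial>lborel)"
          using C by (intro nn_integral_cong) (auto simp: indicator_def ennreal_mult ennreal_plus)
        also have "\<dots> = ennreal (C * (2 ^ k) powr (2 * \<sigma>)) * (\<integral>\<^sup>+y. indicator I y * ennreal (\<bar>x - y\<bar> powr (- p)) + indicator I y * ennreal (\<bar>x - y\<bar> powr (- p')) \<partial>lborel)"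
          by (rule nn_integral_cmult) measurable
        also have "(\<integral>\<^sup>+y. indicator I y * ennreal (\<bar>x - y\<bar> powr (- p)) + indicator I y * ennreal (\<bar>x - y\<bar> powr (- p')) \<partial>lborel)
          = (\<integral>\<^sup>+y. indicator I y * ennreal (\<bar>x - y\<bar> powr (- p)) \<partial>lborel) + (\<integral>\<^sup>+y. indicator I y * ennreal (\<bar>x - y\<bar> powr (- p')) \<partial>lborel)"
          by (rule nn_integral_add) measurable
        also have "ennreal (C * (2 ^ k) powr (2 * \<sigma>)) * ((\<integral>\<^sup>+y. indicator I y * ennreal (\<bar>x - y\<bar> powr (- p)) \<partial>lborel) + (\<integral>\<^sup>+y. indicator I y * ennreal (\<bar>x - y\<bar> powr (- p')) \<partial>lborel))
           \<le> ennreal (C * (2 ^ k) powr (2 * \<sigma>)) * (ennreal M1 + ennreal M2)"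
          by (intro mult_left_mono add_mono M1(2)[OF x] M2(2)[OF x]) auto
        also have "\<dots> = ennreal (C * (2 ^ k) powr (2 * \<sigma>) * M)"
          using C M1 M2 by (simp add: M_def ennreal_mult ennreal_plus)
        finally show ?thesis .
      qed
    qed (use C M in auto)
    also have "(C * (2 ^ k) powr (2 * \<sigma>) * M) * (\<integral>\<xi>. (cmod (Gk k \<xi>))\<^sup>2 \<partial>lborel) \<le> (C * (2 ^ k) powr (2 * \<sigma>) * M) * (H * (2 ^ k) powr (- (2 * s)))"
      using C M by (intro mult_left_mono GkH) auto
    also have "\<dots> = C * M * H * ((2 ^ k) powr (2 * \<sigma>) * (2 ^ k) powr (- (2 * s)))" by (simp only: mult_ac)
    also have "(2 ^ k) powr (2 * \<sigma>) * (2 ^ k) powr (- (2 * s)) = inverse q ^ (2 * k)"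
    proof -
      have "(2 ^ k) powr (2 * \<sigma>) * (2 ^ k) powr (- (2 * s)) = (2 ^ k :: real) powr (2 * \<sigma> + - (2 * s))"
        by (simp only: powr_add)
      also have "2 * \<sigma> + - (2 * s) = - (2 * \<delta>)" by (simp add: \<delta>_def)
      also have "(2 ^ k :: real) powr (- (2 * \<delta>)) = (2 powr real k) powr (- (2 * \<delta>))"
        by (simp add: powr_realpow)
      also have "\<dots> = (2 powr (- \<delta>)) powr (real (2 * k))" by (simp add: powr_powr mult_ac)
      also have "\<dots> = (2 powr (- \<delta>)) ^ (2 * k)" by (rule powr_realpow) simp
      finally show ?thesis by (simp add: q_def powr_minus)
    qed
    finally show ?thesis by (simp add: ennreal_leI)
  qed
  define W where "W x = (\<Sum>k. ennreal (q ^ k) * S k x)" for x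
  have Wm[measurable]: "W \<in> borel_measurable borel" unfolding W_def by measurable
  have "(\<integral>\<^sup>+x. W x \<partial>lborel) = (\<Sum>k. ennreal (q ^ k) * (\<integral>\<^sup>+x. S k x \<partial>lborel))"
    unfolding W_def by (subst nn_integral_suminf) (auto simp: nn_integral_cmult)
  also have "\<dots> \<le> (\<Sum>k. ennreal (C * M * H * inverse q ^ k))"
  proof (intro suminf_le summableI)
    fix k
    have "ennreal (q ^ k) * (\<integral>\<^sup>+x. S k x \<partial>lborel) \<le> ennreal (q ^ k) * ennreal (C * M * H * inverse q ^ (2 * k))"
      by (intro mult_left_mono SI) auto
    also have "\<dots> = ennreal (q ^ k * (C * M * H * inverse q ^ (2 * k)))"
      using q C M H by (subst ennreal_mult) auto
    also have "q ^ k * (C * M * H * inverse q ^ (2 * k)) = C * M * H * ((q * inverse q) ^ k * inverse q ^ k)"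
    proof -
      have "inverse q ^ (2 * k) = inverse q ^ k * inverse q ^ k" by (simp only: mult_2 power_add)
      then show ?thesis by (simp only: power_mult_distrib mult_ac)
    qed
    also have "\<dots> = C * M * H * inverse q ^ k" using q by simp
    finally show "ennreal (q ^ k) * (\<integral>\<^sup>+x. S k x \<partial>lborel) \<le> ennreal (C * M * H * inverse q ^ k)" .
  qed
  also have "\<dots> < \<infinity>"
  proof -
    have "summable (\<lambda>k. C * M * H * inverse q ^ k)"
      using q by (intro summable_mult summable_geometric) (auto simp: inverse_less_1_iff)
    then have "(\<Sum>k. ennreal (C * M * H * inverse q ^ k)) = ennreal (\<Sum>k. C * M * H * inverse q ^ k)"
      using C M H q by (intro suminf_ennreal2) auto
    then show ?thesis by simp
  qed
  finally have "(\<integral>\<^sup>+x. W x \<partial>lborel) \<noteq> \<infinity>" by simp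
  then have "AE x in lborel. W x \<noteq> \<infinity>" by (intro nn_integral_noteq_infinite) auto
  then show ?thesis
  proof eventually_elim
    case (elim x)
    show ?case
    proof
      assume xI: "x \<in> {-n..n}"
      define D where "D = sqrt (enn2real (W x))"
      have Wx: "W x = ennreal (D\<^sup>2)" using elim by (simp add: D_def ennreal_enn2real_if)
      have "cmod (piece m G (2 ^ k) (a x t) (b t) (c t)) \<le> D * (2 powr (- (s - \<sigma>) / 2)) ^ k" if t: "t \<in> {0..1}" for k t
      proof -
        have tau: "cmod (piece m G (2 ^ k) (a x (\<tau> i)) (b (\<tau> i)) (c (\<tau> i))) \<le> D * (2 powr (- (s - \<sigma>) / 2)) ^ k" for i
        proof (rule power2_le_imp_le)
          have "ennreal (q ^ k) * ennreal ((cmod (piece m (Gk k) (2 ^ k) (a x (\<tau> i)) (b (\<tau> i)) (c (\<tau> i))))\<^sup>2) \<le> ennreal (q ^ k) * S k x"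
            unfolding S_def using xI by (intro mult_left_mono) (auto simp: I_def intro!: SUP_upper)
          also have "\<dots> \<le> W x"
            unfolding W_def using sum_le_suminf[of "\<lambda>k. ennreal (q ^ k) * S k x" "{k}"] by simp
          finally have "ennreal (q ^ k * (cmod (piece m (Gk k) (2 ^ k) (a x (\<tau> i)) (b (\<tau> i)) (c (\<tau> i))))\<^sup>2) \<le> ennreal (D\<^sup>2)"
            unfolding Wx using q by (simp add: ennreal_mult)
          then have "q ^ k * (cmod (piece m (Gk k) (2 ^ k) (a x (\<tau> i)) (b (\<tau> i)) (c (\<tau> i))))\<^sup>2 \<le> D\<^sup>2"
            by (subst (asm) ennreal_le_iff) auto
          then have "(cmod (piece m G (2 ^ k) (a x (\<tau> i)) (b (\<tau> i)) (c (\<tau> i))))\<^sup>2 \<le> D\<^sup>2 * inverse (q ^ k)"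
            using q unfolding piece_Gk by (simp add: field_simps)
          also have "inverse (q ^ k) = ((2 powr (- (s - \<sigma>) / 2)) ^ k)\<^sup>2"
          proof -
            have "(2 powr (- (s - \<sigma>) / 2))\<^sup>2 = (2::real) powr (- (s - \<sigma>))"
              by (simp add: power2_eq_square flip: powr_add)
            then have "((2 powr (- (s - \<sigma>) / 2)) ^ k)\<^sup>2 = (2 powr (- \<delta>)) ^ k"
              by (metis \<delta>_def power_even_eq power_mult mult.commute)
            then show ?thesis by (simp add: q_def powr_minus power_inverse)
          qed
          finally show "(cmod (piece m G (2 ^ k) (a x (\<tau> i)) (b (\<tau> i)) (c (\<tau> i))))\<^sup>2 \<le> (D * (2 powr (- (s - \<sigma>) / 2)) ^ k)\<^sup>2"
            by (simp add: power_mult_distrib)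
          show "0 \<le> D * (2 powr (- (s - \<sigma>) / 2)) ^ k" by (simp add: D_def)
        qed
        have cont: "continuous_on (closure T) (\<lambda>t. piece m G (2 ^ k) (a x t) (b t) (c t))"
          unfolding clT using Gk(1)[of k] unfolding Gk_eq by (intro continuous_on_piece act bc c0)
        show ?thesis
        proof (rule continuous_on_closure_norm_le[OF cont])
          show "\<forall>t\<in>T. cmod (piece m G (2 ^ k) (a x t) (b t) (c t)) \<le> D * (2 powr (- (s - \<sigma>) / 2)) ^ k"
            using tau \<tau> by auto
          show "t \<in> closure T" using t clT by simp
        qed
      qed
      then show "\<exists>D\<ge>0. \<forall>k. \<forall>t\<in>{0..1}. cmod (piece m G (2 ^ k) (a x t) (b t) (c t)) \<le> D * (2 powr (- (s - \<sigma>) / 2)) ^ k"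
        by (intro exI[of _ D]) (auto simp: D_def)
    qed
  qed
qed

lemma AE_lborel_from_intervals:
  assumes "\<And>n::nat. AE x in lborel. x \<in> {- real (Suc n)..real (Suc n)} \<longrightarrow> P x"
  shows "AE x in lborel. P x"
proof -
  have "AE x in lborel. \<forall>n::nat. x \<in> {- real (Suc n)..real (Suc n)} \<longrightarrow> P x"
    using assms by (subst AE_all_countable) auto
  then show ?thesis
  proof eventually_elim
    case (elim x)
    obtain n :: nat where "\<bar>x\<bar> \<le> real n" using real_arch_simple by blast
    then have "x \<in> {- real (Suc n)..real (Suc n)}" by auto
    then show ?case using elim by blast
  qed
qed

lemma dyadic_bound:
  fixes a :: "real \<Rightarrow> real \<Rightarrow> real" and b c :: "real \<Rightarrow> real" and s \<sigma> :: real
  assumes acx: "\<And>t. t \<in> {0..1} \<Longrightarrow> continuous_on UNIV (\<lambda>x. a x t)" and act: "\<And>x. continuous_on {0..1} (a x)"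
    and bc: "continuous_on {0..1} b" "continuous_on {0..1} c" and c0: "\<And>t. t \<in> {0..1} \<Longrightarrow> c t \<ge> 0"
    and K: "\<And>L x y t t'. \<lbrakk>L \<ge> 1; x \<noteq> y; t \<in> {0..1}; t' \<in> {0..1}\<rbrakk> \<Longrightarrow>
       cmod (integral {L..2*L} (osc m (a x t - a y t') (b t - b t') (c t + c t')))
         \<le> C * L powr (2 * \<sigma>) * (\<bar>x - y\<bar> powr (- p) + \<bar>x - y\<bar> powr (- p'))"
    and C: "C \<ge> 0" "0 \<le> p" "p < 1" "0 \<le> p'" "p' < 1"
    and G: "L2_fun G" "integrable lborel (\<lambda>\<xi>. (1 + \<xi>\<^sup>2) powr s * (cmod (G \<xi>))\<^sup>2)" and s: "\<sigma> < s" "0 \<le> s"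
  shows "AE x in lborel. \<exists>D\<ge>0. \<forall>k. \<forall>t\<in>{0..1}. cmod (piece m G (2 ^ k) (a x t) (b t) (c t)) \<le> D * (2 powr (- (s - \<sigma>) / 2)) ^ k"
  by (rule AE_lborel_from_intervals, rule dyadic_bound_interval[OF acx act bc c0 K C G s]) simp_all

lemma integrable_exp_powr:
  fixes c m :: real
  assumes "c > 0" "m > 0"
  shows "integrable lborel (\<lambda>\<xi>. exp (- c * \<bar>\<xi>\<bar> powr m))"
proof -
  have "0 \<le> 2 / m" using assms by simp
  then obtain K where K: "K > 0" "\<And>y. y > 0 \<Longrightarrow> exp (- y) \<le> K * y powr (- (2 / m))"
    using exp_neg_le_powr by blast
  \<comment> \<open>The first summand covers \<open>|\<xi>| \<le> 1\<close>, the second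
    \<open>|\<xi>| > 1\<close>, where the exponent \<open>2 / m\<close> turns the exponential into
    an inverse square.\<close>
  define K' where "K' = 2 + 2 * K * c powr (- (2 / m))"
  have K'0: "2 * K * c powr (- (2 / m)) \<ge> 0" using K by simp
  show ?thesis
  proof (rule Bochner_Integration.integrable_bound)
    have "set_integrable lborel (einterval (-\<infinity>) \<infinity>) (\<lambda>x. inverse (1 + x^2))"
      by (rule integrable_inverse_1_plus_square)
    then have "integrable lborel (\<lambda>x::real. inverse (1 + x\<^sup>2))"
      by (simp add: set_integrable_def)
    then show "integrable lborel (\<lambda>x::real. K' * inverse (1 + x\<^sup>2))" by simp
    show "AE \<xi> in lborel. norm (exp (- c * \<bar>\<xi>\<bar> powr m)) \<le> norm (K' * inverse (1 + \<xi>\<^sup>2))"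
    proof (rule AE_I2)
      fix \<xi> :: real
      have p: "1 + \<xi>\<^sup>2 > 0" by (simp add: add_pos_nonneg)
      have "exp (- c * \<bar>\<xi>\<bar> powr m) * (1 + \<xi>\<^sup>2) \<le> K'"
      proof (cases "\<bar>\<xi>\<bar> \<le> 1")
        case True
        then have "\<xi>\<^sup>2 \<le> 1" by (simp add: abs_square_le_1)
        moreover have "exp (- c * \<bar>\<xi>\<bar> powr m) \<le> 1" using assms by simp
        ultimately have "exp (- c * \<bar>\<xi>\<bar> powr m) * (1 + \<xi>\<^sup>2) \<le> 1 * 2"
          by (intro mult_mono) auto
        then show ?thesis using K'0 by (simp add: K'_def)
      next
        case False
        then have x: "\<bar>\<xi>\<bar> > 0" by auto
        have "exp (- (c * \<bar>\<xi>\<bar> powr m)) \<le> K * (c * \<bar>\<xi>\<bar> powr m) powr (- (2 / m))"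
          using x assms by (intro K(2)) auto
        also have "\<dots> = K * c powr (- (2 / m)) * \<bar>\<xi>\<bar> powr (- 2)"
        proof -
          have "(\<bar>\<xi>\<bar> powr m) powr (- (2 / m)) = \<bar>\<xi>\<bar> powr (- 2)" using assms by (simp add: powr_powr)
          then show ?thesis using assms by (subst powr_mult) auto
        qed
        also have "\<bar>\<xi>\<bar> powr (- 2) = inverse (\<xi>\<^sup>2)"
        proof -
          have "\<bar>\<xi>\<bar> powr 2 = \<bar>\<xi>\<bar> ^ 2" using x by (intro powr_numeral) auto
          then show ?thesis by (simp add: powr_minus)
        qed
        finally have "exp (- (c * \<bar>\<xi>\<bar> powr m)) * (1 + \<xi>\<^sup>2) \<le> K * c powr (- (2 / m)) * inverse (\<xi>\<^sup>2) * (1 + \<xi>\<^sup>2)"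
          using p by (intro mult_right_mono) auto
        also have "\<dots> = K * c powr (- (2 / m)) * (inverse (\<xi>\<^sup>2) * (1 + \<xi>\<^sup>2))" by simp
        also have "inverse (\<xi>\<^sup>2) * (1 + \<xi>\<^sup>2) \<le> 2"
        proof -
          have "1 \<le> \<xi>\<^sup>2" using False by (metis abs_square_le_1 linear)
          then have "inverse (\<xi>\<^sup>2) \<le> 1" by (intro inverse_le_1_iff[THEN iffD2]) auto
          moreover have "inverse (\<xi>\<^sup>2) * (1 + \<xi>\<^sup>2) = inverse (\<xi>\<^sup>2) + 1" using x by (simp add: distrib_left)
          ultimately show ?thesis by linarith
        qed
        finally have "exp (- (c * \<bar>\<xi>\<bar> powr m)) * (1 + \<xi>\<^sup>2) \<le> K * c powr (- (2 / m)) * 2"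
          using K by (simp add: mult_left_mono)
        then show ?thesis by (simp add: K'_def)
      qed
      then have "exp (- c * \<bar>\<xi>\<bar> powr m) \<le> K' * inverse (1 + \<xi>\<^sup>2)"
        using p by (simp add: field_simps)
      then show "norm (exp (- c * \<bar>\<xi>\<bar> powr m)) \<le> norm (K' * inverse (1 + \<xi>\<^sup>2))"
        by simp
    qed
  qed measurable
qed

section \<open>The damped kernel\<close>

lemma vector_derivative_bound:
  fixes f :: "real \<Rightarrow> complex"
  assumes d: "\<And>x. a \<le> x \<Longrightarrow> x \<le> b \<Longrightarrow> (f has_vector_derivative f' x) (at x)"
    and B: "\<And>x. a \<le> x \<Longrightarrow> x \<le> b \<Longrightarrow> cmod (f' x) \<le> B" and ab: "a \<le> b"
  shows "cmod (f b - f a) \<le> B * (b - a)"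
proof -
  have "(f' has_integral (f b - f a)) {a..b}"
    by (rule fundamental_theorem_of_calculus[OF ab]) (auto intro: has_vector_derivative_at_within d)
  moreover have "B \<ge> 0" using B[of a] ab norm_ge_zero order_trans by blast
  ultimately have "cmod (f b - f a) \<le> B * measure lborel {a..b}"
    by (intro has_integral_bound_real[of B "{}" f']) (auto intro: B)
  then show ?thesis using ab by simp
qed

text \<open>The multiplier at unit scale: for \<open>t > 0\<close>, dilation by
  \<open>t powr (\<gamma> / m)\<close> turns it into the damping at time \<open>t\<close> times the
  dispersive phase, with \<open>\<theta> = t powr (1 - \<gamma>)\<close>. The value
  \<open>\<theta> = 0\<close> is the dissipative flow. The bounds below are uniform in
  \<open>0 \<le> \<theta> \<le> 1\<close>.\<close>

definition symb :: "real \<Rightarrow> real \<Rightarrow> real \<Rightarrow> complex" where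
  "symb m \<theta> \<eta> = exp (Complex (-1) \<theta> * complex_of_real (\<bar>\<eta>\<bar> powr m))"

lemma symb_osc: "symb m \<theta> \<eta> = osc m 0 \<theta> 1 \<bar>\<eta>\<bar>"
  by (simp add: symb_def osc_def exp_eq_polar Re_exp scaleR_conv_of_real)

lemma norm_symb: "cmod (symb m \<theta> \<eta>) = exp (- (\<bar>\<eta>\<bar> powr m))"
  by (simp add: symb_osc)

lemma symb_measurable [measurable]: "symb m \<theta> \<in> borel_measurable borel"
  unfolding symb_osc by measurable

lemma integrable_symb: "m > 0 \<Longrightarrow> integrable lborel (symb m \<theta>)"
  by (rule Bochner_Integration.integrable_bound[OF integrable_exp_powr[of 1 m]]) (auto simp: norm_symb)

lemma symb_even: "symb m \<theta> (- \<eta>) = symb m \<theta> \<eta>"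
  by (simp add: symb_def)

lemma cmod_Complex_le: "\<bar>a\<bar> \<le> 1 \<Longrightarrow> \<bar>b\<bar> \<le> 1 \<Longrightarrow> cmod (Complex a b) \<le> 2"
  using cmod_le[of "Complex a b"] by simp

lemma symb_diff_one:
  assumes "0 \<le> \<theta>" "\<theta> \<le> 1"
  shows "cmod (symb m \<theta> \<eta> - 1) \<le> 2 * \<bar>\<eta>\<bar> powr m"
proof -
  define y where "y = \<bar>\<eta>\<bar> powr m"
  have y: "y \<ge> 0" by (simp add: y_def)
  have e: "symb m \<theta> \<eta> - 1 = (exp (- y) *\<^sub>R (cis (\<theta> * y) - 1)) + complex_of_real (exp (- y) - 1)"
    by (simp add: symb_osc osc_def y_def scaleR_conv_of_real algebra_simps)
  have "cmod (cis (\<theta> * y) - 1) \<le> \<bar>\<theta> * y\<bar>"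
    using iexp_approx1[of "\<theta> * y" 0] by (simp add: cis_conv_exp)
  also have "\<dots> \<le> y" using assms y by (simp add: mult_left_le_one_le)
  finally have 1: "cmod (cis (\<theta> * y) - 1) \<le> y" .
  have 2: "cmod (exp (- y) *\<^sub>R (cis (\<theta> * y) - 1)) \<le> 1 * y"
    unfolding norm_scaleR using 1 y by (intro mult_mono) auto
  have 3: "cmod (complex_of_real (exp (- y) - 1)) \<le> y"
    using exp_ge_add_one_self[of "- y"] y by (simp only: norm_of_real) auto
  have "cmod (symb m \<theta> \<eta> - 1) \<le> 1 * y + y"
    unfolding e by (rule order_trans[OF norm_triangle_ineq add_mono[OF 2 3]])
  then show ?thesis by (simp add: y_def)
qed

text \<open>The second derivative of \<open>exp (w * \<zeta> powr m)\<close> is at most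
  \<open>6 * \<zeta> powr (m - 2)\<close>: 2 from the derivative of the exponent's derivative, 4
  from its square, where a factor \<open>\<zeta> powr m\<close> is absorbed by the exponential.
  Since \<open>\<zeta> \<ge> \<eta> / 2\<close>, passing to \<eta> costs at most a factor 4.\<close>

lemma symb_second_difference:
  assumes m: "0 < m" "m < 1" and th: "0 \<le> \<theta>" "\<theta> \<le> 1" and d: "0 < \<delta>" "2 * \<delta> \<le> \<eta>"
  shows "cmod (symb m \<theta> (\<eta> + \<delta>) + symb m \<theta> (\<eta> - \<delta>) - 2 * symb m \<theta> \<eta>) \<le> 24 * \<delta>\<^sup>2 * \<eta> powr (m - 2)"
proof -
  define w where "w = Complex (-1) \<theta>"
  have w: "cmod w \<le> 2" unfolding w_def using th by (intro cmod_Complex_le) auto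
  define q where "q \<zeta> = exp (w * complex_of_real (\<zeta> powr m))" for \<zeta>
  define p where "p \<zeta> = w * complex_of_real (m * \<zeta> powr (m - 1))" for \<zeta>
  define p' where "p' \<zeta> = w * complex_of_real (m * ((m - 1) * \<zeta> powr (m - 2)))" for \<zeta>
  define q1 where "q1 \<zeta> = p \<zeta> * q \<zeta>" for \<zeta>
  define q2 where "q2 \<zeta> = p' \<zeta> * q \<zeta> + p \<zeta> * (p \<zeta> * q \<zeta>)" for \<zeta>
  have sq: "symb m \<theta> \<zeta> = q \<zeta>" if "\<zeta> > 0" for \<zeta> using that by (simp add: symb_def q_def w_def)
  have dpw: "((\<lambda>\<zeta>. w * complex_of_real (\<zeta> powr m)) has_vector_derivative p \<zeta>) (at \<zeta>)" if "\<zeta> > 0" for \<zeta>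
    unfolding p_def by (intro has_vector_derivative_mult_right has_vector_derivative_of_real has_real_derivative_powr that)
  have dp: "(p has_vector_derivative p' \<zeta>) (at \<zeta>)" if z: "\<zeta> > 0" for \<zeta>
  proof -
    have "((\<lambda>\<zeta>. m * \<zeta> powr (m - 1)) has_real_derivative m * ((m - 1) * \<zeta> powr (m - 1 - 1))) (at \<zeta>)"
      by (intro DERIV_cmult has_real_derivative_powr z)
    then have "((\<lambda>\<zeta>. m * \<zeta> powr (m - 1)) has_real_derivative m * ((m - 1) * \<zeta> powr (m - 2))) (at \<zeta>)"
      by simp
    then show ?thesis
      unfolding p_def p'_def by (intro has_vector_derivative_mult_right has_vector_derivative_of_real)
  qed
  have dq: "(q has_vector_derivative q1 \<zeta>) (at \<zeta>)" if z: "\<zeta> > 0" for \<zeta>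
  proof -
    have "(exp has_field_derivative exp (w * complex_of_real (\<zeta> powr m))) (at (w * complex_of_real (\<zeta> powr m)))"
      by (rule DERIV_exp)
    from field_vector_diff_chain_at[OF dpw[OF z] this]
    show ?thesis by (simp add: q_def[abs_def] q1_def o_def mult.commute)
  qed
  have dq1: "(q1 has_vector_derivative q2 \<zeta>) (at \<zeta>)" if z: "\<zeta> > 0" for \<zeta>
    using has_vector_derivative_mult[OF dp[OF z] dq[OF z]]
    by (simp add: q1_def[abs_def] q2_def add.commute)
  have q2b: "cmod (q2 \<zeta>) \<le> 6 * \<zeta> powr (m - 2)" if z: "\<zeta> > 0" for \<zeta>
  proof -
    have qn: "cmod (q \<zeta>) = exp (- (\<zeta> powr m))" by (simp add: q_def w_def)
    have pn: "cmod (p \<zeta>) \<le> 2 * \<zeta> powr (m - 1)"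
    proof -
      have "cmod (p \<zeta>) = cmod w * (m * \<zeta> powr (m - 1))" using m by (simp add: p_def norm_mult)
      also have "\<dots> \<le> 2 * (1 * \<zeta> powr (m - 1))" using m w by (intro mult_mono) auto
      finally show ?thesis by simp
    qed
    have p'n: "cmod (p' \<zeta>) \<le> 2 * \<zeta> powr (m - 2)"
    proof -
      have "\<bar>m * ((m - 1) * \<zeta> powr (m - 2))\<bar> = m * ((1 - m) * \<zeta> powr (m - 2))" using m by (simp add: abs_mult)
      then have "cmod (p' \<zeta>) = cmod w * (m * ((1 - m) * \<zeta> powr (m - 2)))"
        unfolding p'_def by (simp only: norm_mult norm_of_real)
      also have "\<dots> \<le> 2 * (1 * (1 * \<zeta> powr (m - 2)))" using m w by (intro mult_mono) auto
      finally show ?thesis by simp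
    qed
    have a: "cmod (p' \<zeta> * q \<zeta>) \<le> 2 * \<zeta> powr (m - 2) * 1"
      unfolding norm_mult using p'n qn by (intro mult_mono) auto
    have "cmod (p \<zeta> * (p \<zeta> * q \<zeta>)) \<le> (2 * \<zeta> powr (m - 1)) * ((2 * \<zeta> powr (m - 1)) * exp (- (\<zeta> powr m)))"
      unfolding norm_mult using pn qn by (intro mult_mono) auto
    also have "\<dots> = 4 * (\<zeta> powr (m - 1) * \<zeta> powr (m - 1)) * exp (- (\<zeta> powr m))" by simp
    also have "\<zeta> powr (m - 1) * \<zeta> powr (m - 1) = \<zeta> powr (m - 2) * \<zeta> powr m"
      by (simp add: algebra_simps flip: powr_add)
    also have "4 * (\<zeta> powr (m - 2) * \<zeta> powr m) * exp (- (\<zeta> powr m)) = 4 * \<zeta> powr (m - 2) * (\<zeta> powr m * exp (- (\<zeta> powr m)))" by simp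
    also have "\<dots> \<le> 4 * \<zeta> powr (m - 2) * 1"
    proof (intro mult_left_mono)
      have "\<zeta> powr m \<le> exp (\<zeta> powr m)" using exp_ge_add_one_self[of "\<zeta> powr m"] by linarith
      then show "\<zeta> powr m * exp (- (\<zeta> powr m)) \<le> 1" by (simp add: exp_minus field_simps)
    qed auto
    finally have b: "cmod (p \<zeta> * (p \<zeta> * q \<zeta>)) \<le> 4 * \<zeta> powr (m - 2)" by simp
    have "cmod (q2 \<zeta>) \<le> 2 * \<zeta> powr (m - 2) * 1 + 4 * \<zeta> powr (m - 2)"
      unfolding q2_def by (rule order_trans[OF norm_triangle_ineq add_mono[OF a b]])
    then show ?thesis by simp
  qed
  have eta: "\<eta> > 0" using d by simp
  define r where "r \<zeta> = q (\<zeta> + \<delta>) - q \<zeta>" for \<zeta>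
  have q2c: "cmod (q2 \<zeta>) \<le> 24 * \<eta> powr (m - 2)" if "\<eta> - \<delta> \<le> \<zeta>" for \<zeta>
  proof -
    have z: "\<eta> / 2 \<le> \<zeta>" "\<zeta> > 0" using that d by auto
    have "\<zeta> powr (m - 2) \<le> (\<eta> / 2) powr (m - 2)" using z eta m by (intro powr_mono2') auto
    also have "(\<eta> / 2) powr (m - 2) = 2 powr (2 - m) * \<eta> powr (m - 2)"
      using eta by (simp add: powr_divide powr_diff field_simps)
    also have "\<dots> \<le> 2 powr 2 * \<eta> powr (m - 2)"
      using m by (intro mult_right_mono powr_mono) auto
    finally show ?thesis using q2b[OF z(2)] by simp
  qed
  have r': "cmod (q1 (\<zeta> + \<delta>) - q1 \<zeta>) \<le> 24 * \<eta> powr (m - 2) * \<delta>" if "\<eta> - \<delta> \<le> \<zeta>" for \<zeta>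
  proof -
    have "cmod (q1 (\<zeta> + \<delta>) - q1 \<zeta>) \<le> 24 * \<eta> powr (m - 2) * ((\<zeta> + \<delta>) - \<zeta>)"
      by (rule vector_derivative_bound[where f'=q2]) (use that d in \<open>auto intro!: dq1 q2c\<close>)
    then show ?thesis by simp
  qed
  have "cmod (r \<eta> - r (\<eta> - \<delta>)) \<le> 24 * \<eta> powr (m - 2) * \<delta> * (\<eta> - (\<eta> - \<delta>))"
  proof (rule vector_derivative_bound[where f'="\<lambda>\<zeta>. q1 (\<zeta> + \<delta>) - q1 \<zeta>"])
    fix \<zeta> assume z: "\<eta> - \<delta> \<le> \<zeta>" "\<zeta> \<le> \<eta>"
    have "((\<lambda>\<zeta>. \<zeta> + \<delta>) has_vector_derivative 1) (at \<zeta>)" by (auto intro!: derivative_eq_intros)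
    from vector_diff_chain_at[OF this, of q "q1 (\<zeta> + \<delta>)"] dq[of "\<zeta> + \<delta>"]
    have "((\<lambda>\<zeta>. q (\<zeta> + \<delta>)) has_vector_derivative q1 (\<zeta> + \<delta>)) (at \<zeta>)" using z d by (simp add: o_def)
    then show "(r has_vector_derivative q1 (\<zeta> + \<delta>) - q1 \<zeta>) (at \<zeta>)"
      unfolding r_def using z d by (intro has_vector_derivative_diff dq) auto
    show "cmod (q1 (\<zeta> + \<delta>) - q1 \<zeta>) \<le> 24 * \<eta> powr (m - 2) * \<delta>" by (rule r'[OF z(1)])
  qed (use d in auto)
  moreover have "symb m \<theta> (\<eta> + \<delta>) + symb m \<theta> (\<eta> - \<delta>) - 2 * symb m \<theta> \<eta> = r \<eta> - r (\<eta> - \<delta>)"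
    using d by (simp add: r_def sq)
  ultimately show ?thesis by (simp add: power2_eq_square mult_ac)
qed

lemma nn_integral_powr_tail:
  fixes e R :: real
  assumes "e < -1" "R > 0"
  shows "(\<integral>\<^sup>+\<eta>. ennreal (indicator {\<eta>. R \<le> \<bar>\<eta>\<bar>} \<eta> * \<bar>\<eta>\<bar> powr e) \<partial>lborel) \<le> ennreal (2 * (- (R powr (e + 1)) / (e + 1)))"
proof -
  define Q where "Q = - (R powr (e + 1)) / (e + 1)"
  have Q: "Q \<ge> 0" using assms by (simp add: Q_def field_simps)
  let ?f = "\<lambda>v::real. indicator {R..} v * ennreal (\<bar>v\<bar> powr e)"
  have f: "(\<integral>\<^sup>+v. ?f v \<partial>lborel) = ennreal Q"
  proof -
    have hi: "((\<lambda>x. x powr e) has_integral Q) {R..}"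
      unfolding Q_def by (rule has_integral_powr_to_inf[OF assms])
    have "(\<integral>\<^sup>+v. ?f v \<partial>lborel) = (\<integral>\<^sup>+v. ennreal (v powr e) * indicator {R..} v \<partial>lborel)"
      using assms by (intro nn_integral_cong) (auto simp: indicator_def)
    also have "\<dots> = ennreal Q"
      by (rule nn_integral_has_integral_lebesgue'[OF _ hi]) auto
    finally show ?thesis .
  qed
  have "(\<integral>\<^sup>+\<eta>. ennreal (indicator {\<eta>. R \<le> \<bar>\<eta>\<bar>} \<eta> * \<bar>\<eta>\<bar> powr e) \<partial>lborel) \<le> (\<integral>\<^sup>+y. ?f y + ?f (- y) \<partial>lborel)"
    by (intro nn_integral_mono) (auto simp: indicator_def)
  also have "\<dots> = (\<integral>\<^sup>+y. ?f y \<partial>lborel) + (\<integral>\<^sup>+y. ?f (- y) \<partial>lborel)"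
    by (rule nn_integral_add) measurable
  also have "(\<integral>\<^sup>+y. ?f (- y) \<partial>lborel) = (\<integral>\<^sup>+v. ?f v \<partial>lborel)"
    by (subst (2) nn_integral_real_affine[where c="-1" and t=0]) auto
  finally have "(\<integral>\<^sup>+\<eta>. ennreal (indicator {\<eta>. R \<le> \<bar>\<eta>\<bar>} \<eta> * \<bar>\<eta>\<bar> powr e) \<partial>lborel) \<le> ennreal Q + ennreal Q"
    unfolding f .
  also have "\<dots> = ennreal (2 * Q)" using Q by (subst ennreal_plus[symmetric]) auto
  finally show ?thesis by (simp add: Q_def)
qed

text \<open>Half-period shifts turn the oscillation into a second difference of the symbol.\<close>

lemma FT_symb_decay:
  assumes m: "0 < m" "m < 1"
  obtains C where "C > 0" "\<And>\<theta> z. \<lbrakk>0 \<le> \<theta>; \<theta> \<le> 1\<rbrakk> \<Longrightarrow> cmod (FT (symb m \<theta>) z) \<le> C"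
    "\<And>\<theta> z. \<lbrakk>0 \<le> \<theta>; \<theta> \<le> 1; z \<noteq> 0\<rbrakk> \<Longrightarrow> cmod (FT (symb m \<theta>) z) \<le> C * \<bar>z\<bar> powr (- 1 - m)"
proof -
  define A where "A = (\<integral>\<xi>. exp (- (\<bar>\<xi>\<bar> powr m)) \<partial>lborel)"
  \<comment> \<open>Bounds for the integral of the second difference in units of
    \<open>\<delta> powr (1 + m)\<close>: height \<open>24 * \<delta> powr m\<close> on an interval
    of length \<open>4 * \<delta>\<close> gives 96, and the two tails of
    \<open>24 * \<delta>^2 * |\<eta>| powr (m - 2)\<close> give at most
    \<open>48 / (1 - m)\<close>.\<close>
  define K where "K = 96 + 48 / (1 - m)"
  have K: "K > 0" using m by (simp add: K_def add_pos_nonneg)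
  define C where "C = \<bar>A\<bar> + K * pi powr (1 + m) + 1"
  have KC: "K * pi powr (1 + m) \<le> C" by (simp add: C_def)
  show ?thesis
  proof (rule that[of C])
    show "C > 0" using K by (simp add: C_def add_nonneg_pos)
    fix \<theta> z :: real assume th: "0 \<le> \<theta>" "\<theta> \<le> 1"
    have "cmod (FT (symb m \<theta>) z) \<le> A"
      using FT_bound[OF integrable_symb[OF m(1)], of \<theta> z] by (simp add: norm_symb A_def)
    moreover have "K * pi powr (1 + m) \<ge> 0" using K by simp
    ultimately show "cmod (FT (symb m \<theta>) z) \<le> C" by (simp add: C_def)
    assume z: "z \<noteq> 0"
    \<comment> \<open>Shifting by this amount in either direction multiplies the transform by -1, so
      the second difference has the transform \<open>- 4 * FT ?q z\<close>.\<close>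
    define \<delta> where "\<delta> = pi / \<bar>z\<bar>"
    have d: "\<delta> > 0" using z by (simp add: \<delta>_def)
    let ?q = "symb m \<theta>"
    have qi: "integrable lborel ?q" by (rule integrable_symb[OF m(1)])
    have shift: "integrable lborel (\<lambda>\<eta>. ?q (\<eta> + s))" "(\<integral>\<eta>. cis (z * \<eta>) * ?q (\<eta> + s) \<partial>lborel) = cis (- (z * s)) * FT ?q z" for s
    proof -
      show "integrable lborel (\<lambda>\<eta>. ?q (\<eta> + s))"
        using lborel_integrable_real_affine[OF qi, of 1 s] by (simp add: add.commute)
      have "FT ?q z = (\<integral>\<eta>. cis (z * (s + 1 * \<eta>)) * ?q (s + 1 * \<eta>) \<partial>lborel)"
        unfolding FT_def by (subst lborel_integral_real_affine[of 1 _ s]) auto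
      also have "\<dots> = (\<integral>\<eta>. cis (z * s) * (cis (z * \<eta>) * ?q (\<eta> + s)) \<partial>lborel)"
        by (intro Bochner_Integration.integral_cong) (auto simp: cis_mult algebra_simps simp flip: mult.assoc)
      also have "\<dots> = cis (z * s) * (\<integral>\<eta>. cis (z * \<eta>) * ?q (\<eta> + s) \<partial>lborel)" by simp
      finally show "(\<integral>\<eta>. cis (z * \<eta>) * ?q (\<eta> + s) \<partial>lborel) = cis (- (z * s)) * FT ?q z"
        by (simp add: cis_mult flip: mult.assoc)
    qed
    have cz: "cis (- (z * \<delta>)) = -1" "cis (- (z * - \<delta>)) = -1"
      using z by (cases "z > 0"; simp add: \<delta>_def cis_cnj[symmetric])+
    define \<Delta> where "\<Delta> \<eta> = ?q (\<eta> + \<delta>) + ?q (\<eta> - \<delta>) - 2 * ?q \<eta>" for \<eta>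
    have ci: "integrable lborel (\<lambda>\<eta>. cis (z * \<eta>) * ?q (\<eta> + s))" for s
      by (rule integrable_cis_mult[OF shift(1)]) measurable
    have "(\<integral>\<eta>. cis (z * \<eta>) * \<Delta> \<eta> \<partial>lborel) = (\<integral>\<eta>. (cis (z * \<eta>) * ?q (\<eta> + \<delta>) + cis (z * \<eta>) * ?q (\<eta> + - \<delta>)) - 2 * (cis (z * \<eta>) * ?q (\<eta> + 0)) \<partial>lborel)"
      by (simp add: \<Delta>_def algebra_simps)
    also have "\<dots> = (cis (- (z * \<delta>)) * FT ?q z + cis (- (z * - \<delta>)) * FT ?q z) - 2 * (cis (- (z * 0)) * FT ?q z)"
      by (subst Bochner_Integration.integral_diff[OF Bochner_Integration.integrable_add[OF ci ci] integrable_mult_right[OF ci]],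
          subst Bochner_Integration.integral_add[OF ci ci], subst integral_mult_right_zero)
         (simp only: shift)
    also have "\<dots> = - 4 * FT ?q z" unfolding cz by simp
    finally have eq: "- 4 * FT ?q z = (\<integral>\<eta>. cis (z * \<eta>) * \<Delta> \<eta> \<partial>lborel)" by simp
    have \<Delta>m[measurable]: "\<Delta> \<in> borel_measurable borel" unfolding \<Delta>_def by measurable
    have \<Delta>i: "integrable lborel \<Delta>"
      unfolding \<Delta>_def using shift(1)[of \<delta>] shift(1)[of "- \<delta>"] qi by auto
    have small: "cmod (\<Delta> \<eta>) \<le> 24 * \<delta> powr m" if "\<bar>\<eta>\<bar> \<le> 2 * \<delta>" for \<eta>
    proof -
      have b: "cmod (?q \<zeta> - 1) \<le> 6 * \<delta> powr m" if "\<bar>\<zeta>\<bar> \<le> 3 * \<delta>" for \<zeta>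
      proof -
        have "\<bar>\<zeta>\<bar> powr m \<le> (3 * \<delta>) powr m" using that m by (intro powr_mono2) auto
        also have "(3 * \<delta>) powr m = 3 powr m * \<delta> powr m" using d by (simp add: powr_mult)
        also have "\<dots> \<le> 3 powr 1 * \<delta> powr m" using m by (intro mult_right_mono powr_mono) auto
        finally show ?thesis using symb_diff_one[OF th, of m \<zeta>] by simp
      qed
      have "\<Delta> \<eta> = (?q (\<eta> + \<delta>) - 1) + (?q (\<eta> - \<delta>) - 1) - 2 * (?q \<eta> - 1)" by (simp add: \<Delta>_def)
      moreover have "cmod (a + b - 2 * c) \<le> cmod a + cmod b + 2 * cmod c" for a b c
        using norm_triangle_ineq4[of "a + b" "2 * c"] norm_triangle_ineq[of a b] by (simp add: norm_mult)
      ultimately have "cmod (\<Delta> \<eta>) \<le> cmod (?q (\<eta> + \<delta>) - 1) + cmod (?q (\<eta> - \<delta>) - 1) + 2 * cmod (?q \<eta> - 1)"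
        by (simp only:)
      also have "\<dots> \<le> 6 * \<delta> powr m + 6 * \<delta> powr m + 2 * (6 * \<delta> powr m)"
        using that d by (intro add_mono mult_left_mono b) auto
      finally show ?thesis by simp
    qed
    have large: "cmod (\<Delta> \<eta>) \<le> 24 * \<delta>\<^sup>2 * \<bar>\<eta>\<bar> powr (m - 2)" if "2 * \<delta> \<le> \<bar>\<eta>\<bar>" for \<eta>
    proof -
      have "\<Delta> \<eta> = ?q (\<bar>\<eta>\<bar> + \<delta>) + ?q (\<bar>\<eta>\<bar> - \<delta>) - 2 * ?q \<bar>\<eta>\<bar>"
      proof (cases "\<eta> \<ge> 0")
        case False
        have "- \<eta> + \<delta> = - (\<eta> - \<delta>)" "- \<eta> - \<delta> = - (\<eta> + \<delta>)" by simp_all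
        then have "?q (- \<eta> + \<delta>) = ?q (\<eta> - \<delta>)" "?q (- \<eta> - \<delta>) = ?q (\<eta> + \<delta>)" by (simp_all only: symb_even)
        then show ?thesis using False symb_even[of m \<theta> \<eta>] by (simp add: \<Delta>_def)
      qed (simp add: \<Delta>_def)
      then show ?thesis using symb_second_difference[OF m th d that] by simp
    qed
    have "ennreal (\<integral>\<eta>. cmod (\<Delta> \<eta>) \<partial>lborel) = (\<integral>\<^sup>+\<eta>. ennreal (cmod (\<Delta> \<eta>)) \<partial>lborel)"
      using \<Delta>i by (intro nn_integral_eq_integral[symmetric]) auto
    also have "\<dots> \<le> (\<integral>\<^sup>+\<eta>. ennreal (24 * \<delta> powr m) * indicator {- (2 * \<delta>)..2 * \<delta>} \<eta> + ennreal (24 * \<delta>\<^sup>2) * ennreal (indicator {\<eta>. 2 * \<delta> \<le> \<bar>\<eta>\<bar>} \<eta> * \<bar>\<eta>\<bar> powr (m - 2)) \<partial>lborel)"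
    proof (intro nn_integral_mono)
      fix \<eta>
      show "ennreal (cmod (\<Delta> \<eta>)) \<le> ennreal (24 * \<delta> powr m) * indicator {- (2 * \<delta>)..2 * \<delta>} \<eta> + ennreal (24 * \<delta>\<^sup>2) * ennreal (indicator {\<eta>. 2 * \<delta> \<le> \<bar>\<eta>\<bar>} \<eta> * \<bar>\<eta>\<bar> powr (m - 2))"
      proof (cases "\<bar>\<eta>\<bar> \<le> 2 * \<delta>")
        case True
        then have "\<eta> \<in> {- (2 * \<delta>)..2 * \<delta>}" by auto
        then show ?thesis using ennreal_leI[OF small[OF True]] by (auto intro: add_increasing2)
      next
        case False
        then show ?thesis using large[of \<eta>] by (auto simp: ennreal_mult[symmetric] intro!: add_increasing ennreal_leI)
      qed
    qed
    also have "\<dots> = ennreal (24 * \<delta> powr m) * ennreal (4 * \<delta>) + ennreal (24 * \<delta>\<^sup>2) * (\<integral>\<^sup>+\<eta>. ennreal (indicator {\<eta>. 2 * \<delta> \<le> \<bar>\<eta>\<bar>} \<eta> * \<bar>\<eta>\<bar> powr (m - 2)) \<partial>lborel)"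
      using d by (subst nn_integral_add, measurable, subst nn_integral_cmult, measurable, subst nn_integral_cmult_indicator)
         (auto simp: emeasure_lborel_Icc_eq)
    also have "\<dots> \<le> ennreal (24 * \<delta> powr m) * ennreal (4 * \<delta>) + ennreal (24 * \<delta>\<^sup>2) * ennreal (2 * (- ((2 * \<delta>) powr (m - 2 + 1)) / (m - 2 + 1)))"
      using m d by (intro add_left_mono mult_left_mono nn_integral_powr_tail) auto
    also have "\<dots> = ennreal (24 * \<delta> powr m * (4 * \<delta>) + 24 * \<delta>\<^sup>2 * (2 * ((2 * \<delta>) powr (m - 1) / (1 - m))))"
    proof -
      have "2 * (- ((2 * \<delta>) powr (m - 2 + 1)) / (m - 2 + 1)) = 2 * ((2 * \<delta>) powr (m - 1) / (1 - m))"
        using m by (simp add: field_simps)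
      then show ?thesis
        using d m by (simp only:) (subst ennreal_mult[symmetric]; (subst ennreal_mult[symmetric])?; (subst ennreal_plus[symmetric])?; simp)
    qed
    also have "\<dots> \<le> ennreal (K * \<delta> powr (1 + m))"
    proof (rule ennreal_leI)
      have 1: "24 * \<delta> powr m * (4 * \<delta>) = 96 * \<delta> powr (1 + m)" using d by (simp add: powr_add)
      have "(2 * \<delta>) powr (m - 1) \<le> \<delta> powr (m - 1)" using d m by (intro powr_mono2') auto
      then have "24 * \<delta>\<^sup>2 * (2 * ((2 * \<delta>) powr (m - 1) / (1 - m))) \<le> 24 * \<delta>\<^sup>2 * (2 * (\<delta> powr (m - 1) / (1 - m)))"
        using m by (intro mult_left_mono divide_right_mono) auto
      also have "\<dots> = 48 / (1 - m) * (\<delta> powr 2 * \<delta> powr (m - 1))" using d by simp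
      also have "\<delta> powr 2 * \<delta> powr (m - 1) = \<delta> powr (1 + m)" by (simp flip: powr_add)
      finally show "24 * \<delta> powr m * (4 * \<delta>) + 24 * \<delta>\<^sup>2 * (2 * ((2 * \<delta>) powr (m - 1) / (1 - m))) \<le> K * \<delta> powr (1 + m)"
        unfolding 1 K_def by (simp add: distrib_right)
    qed
    finally have I: "(\<integral>\<eta>. cmod (\<Delta> \<eta>) \<partial>lborel) \<le> K * \<delta> powr (1 + m)"
      using K by (subst (asm) ennreal_le_iff) auto
    have "4 * cmod (FT ?q z) = cmod (- 4 * FT ?q z)" by (simp add: norm_mult)
    also have "\<dots> \<le> (\<integral>\<eta>. cmod (cis (z * \<eta>) * \<Delta> \<eta>) \<partial>lborel)" unfolding eq by (rule integral_norm_bound)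
    also have "\<dots> \<le> K * \<delta> powr (1 + m)" using I by (simp add: norm_mult)
    also have "\<dots> = K * pi powr (1 + m) * \<bar>z\<bar> powr (- 1 - m)"
    proof -
      have "\<delta> powr (1 + m) = pi powr (1 + m) * inverse (\<bar>z\<bar> powr (1 + m))"
        unfolding \<delta>_def by (subst powr_divide) (auto simp: divide_inverse)
      also have "inverse (\<bar>z\<bar> powr (1 + m)) = \<bar>z\<bar> powr (- (1 + m))" by (rule powr_minus[symmetric])
      also have "- (1 + m) = - 1 - m" by simp
      finally show ?thesis by simp
    qed
    also have "\<dots> \<le> C * \<bar>z\<bar> powr (- 1 - m)" by (intro mult_right_mono KC) auto
    finally have "4 * cmod (FT ?q z) \<le> C * \<bar>z\<bar> powr (- 1 - m)" .
    then show "cmod (FT ?q z) \<le> C * \<bar>z\<bar> powr (- 1 - m)" using norm_ge_zero[of "FT ?q z"] by linarith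
  qed
qed

section \<open>Integrability and total mass of the kernel\<close>

lemma integrable_FT_symb:
  assumes m: "0 < m" "m < 1" and th: "0 \<le> \<theta>" "\<theta> \<le> 1"
  shows "integrable lborel (FT (symb m \<theta>))"
proof -
  obtain C where C: "C > 0" "\<And>\<theta> z. \<lbrakk>0 \<le> \<theta>; \<theta> \<le> 1\<rbrakk> \<Longrightarrow> cmod (FT (symb m \<theta>) z) \<le> C"
    "\<And>\<theta> z. \<lbrakk>0 \<le> \<theta>; \<theta> \<le> 1; z \<noteq> 0\<rbrakk> \<Longrightarrow> cmod (FT (symb m \<theta>) z) \<le> C * \<bar>z\<bar> powr (- 1 - m)"
    using FT_symb_decay[OF m] by metis
  have [measurable]: "FT (symb m \<theta>) \<in> borel_measurable borel"
    using FT_measurable[of "symb m \<theta>"] by simp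
  show ?thesis
  proof (rule integrableI_bounded)
    have "(\<integral>\<^sup>+z. ennreal (cmod (FT (symb m \<theta>) z)) \<partial>lborel)
      \<le> (\<integral>\<^sup>+z. ennreal C * indicator {-1..1} z + ennreal C * ennreal (indicator {z. 1 \<le> \<bar>z\<bar>} z * \<bar>z\<bar> powr (- 1 - m)) \<partial>lborel)"
    proof (intro nn_integral_mono)
      fix z :: real
      show "ennreal (cmod (FT (symb m \<theta>) z)) \<le> ennreal C * indicator {-1..1} z + ennreal C * ennreal (indicator {z. 1 \<le> \<bar>z\<bar>} z * \<bar>z\<bar> powr (- 1 - m))"
      proof (cases "\<bar>z\<bar> \<le> 1")
        case True
        then have "z \<in> {-1..1}" by auto
        then show ?thesis using ennreal_leI[OF C(2)[OF th, of z]] by (auto intro: add_increasing2)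
      next
        case False
        then show ?thesis using C(3)[OF th, of z] C(1) by (auto simp: ennreal_mult[symmetric] intro!: add_increasing ennreal_leI)
      qed
    qed
    also have "\<dots> = ennreal C * 2 + ennreal C * (\<integral>\<^sup>+z. ennreal (indicator {z. 1 \<le> \<bar>z\<bar>} z * \<bar>z\<bar> powr (- 1 - m)) \<partial>lborel)"
      by (subst nn_integral_add, measurable, subst nn_integral_cmult, measurable, subst nn_integral_cmult_indicator)
         (auto simp: emeasure_lborel_Icc_eq)
    also have "\<dots> \<le> ennreal C * 2 + ennreal C * ennreal (2 * (- (1 powr (- 1 - m + 1)) / (- 1 - m + 1)))"
      using m by (intro add_left_mono mult_left_mono nn_integral_powr_tail) auto
    also have "\<dots> < \<infinity>" by (simp add: ennreal_mult_less_top)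
    finally show "(\<integral>\<^sup>+z. ennreal (cmod (FT (symb m \<theta>) z)) \<partial>lborel) < \<infinity>" .
  qed measurable
qed

text \<open>Inversion at one point. The multiplication formula moves Gaussian weights onto
  \<open>G\<close>, where they concentrate at 0, and both sides pass to the limit by domination.
  This fixes the mass of the convolution kernel.\<close>

lemma integral_FT_at_0:
  fixes G :: "real \<Rightarrow> complex"
  assumes G: "integrable lborel G" and bd: "\<And>x. cmod (G x) \<le> B" and cont: "isCont G 0"
    and FI: "integrable lborel (FT G)"
  shows "(\<integral>z. FT G z \<partial>lborel) = 2 * pi * G 0"
proof -
  have [measurable]: "G \<in> borel_measurable borel" using G by auto
  define k where "k u = complex_of_real (sqrt (2 * pi) * exp (- u\<^sup>2 / 2))" for u :: real
  have [measurable]: "k \<in> borel_measurable borel" unfolding k_def by measurable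
  have kr: "integrable lborel (\<lambda>u::real. sqrt (2 * pi) * exp (- u\<^sup>2 / 2))" "(\<integral>u. sqrt (2 * pi) * exp (- u\<^sup>2 / 2) \<partial>lborel) = 2 * pi"
    using integrable_gauss[of 1] gauss_integral[of 1] by auto
  have k: "integrable lborel k" "(\<integral>u. k u \<partial>lborel) = 2 * pi"
  proof -
    show "integrable lborel k" unfolding k_def by (rule integrable_of_real[OF kr(1)])
    show "(\<integral>u. k u \<partial>lborel) = 2 * pi" unfolding k_def integral_complex_of_real kr(2) by simp
  qed
  let ?w = "\<lambda>n x. complex_of_real (exp (- (x / real (Suc n))\<^sup>2 / 2))"
  have wi: "integrable lborel (?w n)" for n
    using integrable_gauss[of "1 / real (Suc n)"] by (auto intro!: integrable_of_real)
  have L: "(\<lambda>n. \<integral>z. FT G z * ?w n z \<partial>lborel) \<longlonglongrightarrow> (\<integral>z. FT G z * 1 \<partial>lborel)"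
  proof (rule integral_dominated_convergence[where w="\<lambda>z. cmod (FT G z)"])
    show "AE z in lborel. (\<lambda>n. FT G z * ?w n z) \<longlonglongrightarrow> FT G z * 1"
      using tendsto_of_real[OF gauss_seq_tendsto, where 'a=complex]
      by (intro AE_I2 tendsto_mult tendsto_const) simp
    show "AE z in lborel. cmod (FT G z * ?w n z) \<le> cmod (FT G z)" for n
      by (intro AE_I2) (simp add: norm_mult mult_left_le)
  qed (use FI in auto)
  have eq: "(\<integral>z. FT G z * ?w n z \<partial>lborel) = (\<integral>u. G (u / real (Suc n)) * k u \<partial>lborel)" for n
  proof -
    define N where "N = real (Suc n)"
    have N: "N > 0" by (simp add: N_def)
    have FTw: "FT (?w n) x = complex_of_real (sqrt (2 * pi) * N * exp (- (N * x)\<^sup>2 / 2))" for x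
      using gauss_fourier[of "1 / N" x] N unfolding FT_def N_def[symmetric] by (simp add: mult.commute)
    have "(\<integral>z. FT G z * ?w n z \<partial>lborel) = (\<integral>x. G x * FT (?w n) x \<partial>lborel)"
      by (rule FT_multiplication[OF G wi])
    also have "\<dots> = \<bar>1 / N\<bar> *\<^sub>R (\<integral>u. G (0 + (1 / N) * u) * FT (?w n) (0 + (1 / N) * u) \<partial>lborel)"
      using N by (intro lborel_integral_real_affine) auto
    also have "\<dots> = (\<integral>u. \<bar>1 / N\<bar> *\<^sub>R (G (0 + (1 / N) * u) * FT (?w n) (0 + (1 / N) * u)) \<partial>lborel)" by simp
    also have "\<dots> = (\<integral>u. G (u / N) * k u \<partial>lborel)"
      unfolding FTw k_def using N by (intro Bochner_Integration.integral_cong) (auto simp: scaleR_conv_of_real)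
    finally show ?thesis by (simp add: N_def)
  qed
  have R: "(\<lambda>n. \<integral>u. G (u / real (Suc n)) * k u \<partial>lborel) \<longlonglongrightarrow> (\<integral>u. G 0 * k u \<partial>lborel)"
  proof (rule integral_dominated_convergence[where w="\<lambda>u. B * cmod (k u)"])
    show "AE u in lborel. (\<lambda>n. G (u / real (Suc n)) * k u) \<longlonglongrightarrow> G 0 * k u"
    proof (intro AE_I2 tendsto_mult tendsto_const)
      fix u
      have "(\<lambda>n. u / real (Suc n)) \<longlonglongrightarrow> 0" by (rule LIMSEQ_Suc[OF lim_const_over_n])
      then show "(\<lambda>n. G (u / real (Suc n))) \<longlonglongrightarrow> G 0" by (rule isCont_tendsto_compose[OF cont])
    qed
    show "integrable lborel (\<lambda>u. B * cmod (k u))" using k by simp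
    show "AE u in lborel. cmod (G (u / real (Suc n)) * k u) \<le> B * cmod (k u)" for n
      using bd by (intro AE_I2) (auto simp: norm_mult intro!: mult_right_mono)
  qed measurable
  have "(\<integral>z. FT G z * 1 \<partial>lborel) = (\<integral>u. G 0 * k u \<partial>lborel)"
    using LIMSEQ_unique[OF L[unfolded eq] R] .
  then show ?thesis using k by simp
qed

lemma isCont_symb_0:
  assumes "m > 0" shows "isCont (symb m \<theta>) 0"
proof -
  have "isCont (\<lambda>\<eta>::real. \<bar>\<eta>\<bar> powr m) 0"
  proof -
    have "continuous_on UNIV (\<lambda>\<eta>::real. \<bar>\<eta>\<bar> powr m)"
      using assms by (intro continuous_on_powr' continuous_intros) auto
    then show ?thesis by (simp add: continuous_on_eq_continuous_at)
  qed
  then have "isCont (\<lambda>\<eta>. (\<lambda>y. exp (Complex (-1) \<theta> * complex_of_real y)) (\<bar>\<eta>\<bar> powr m)) 0"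
    by (rule isCont_o2) (intro continuous_intros)
  then show ?thesis by (simp add: symb_def[abs_def])
qed

lemma integral_FT_symb:
  assumes m: "0 < m" "m < 1" and th: "0 \<le> \<theta>" "\<theta> \<le> 1"
  shows "(\<integral>z. FT (symb m \<theta>) z \<partial>lborel) = 2 * pi"
proof -
  have "(\<integral>z. FT (symb m \<theta>) z \<partial>lborel) = 2 * pi * symb m \<theta> 0"
    by (rule integral_FT_at_0[where B=1, OF integrable_symb _ isCont_symb_0 integrable_FT_symb])
       (use m th in \<open>auto simp: norm_symb\<close>)
  then show ?thesis using m by (simp add: symb_def)
qed

section \<open>Convergence at Lebesgue points\<close>

lemma lebesgue_differentiation_right:
  fixes f :: "real \<Rightarrow> real"
  assumes "\<And>a b. f integrable_on {a..b}"
  shows "AE x in lborel. ((\<lambda>h. integral {x..x+h} f / h) \<longlongrightarrow> f x) (at_right 0)"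
proof -
  obtain N where N: "negligible N"
    "\<And>x e. \<lbrakk>x \<notin> N; 0 < e\<rbrakk> \<Longrightarrow> \<exists>d>0. \<forall>h. 0 < h \<and> h < d \<longrightarrow>
         norm (integral (cbox x (x + h *\<^sub>R One)) f /\<^sub>R h ^ DIM(real) - f x) < e"
    using integrable_ccontinuous_explicit[of f] assms by (metis cbox_interval)
  have "AE x in lebesgue. x \<notin> N"
    using N(1) by (intro AE_not_in) (simp add: negligible_iff_null_sets)
  then have "AE x in lborel. x \<notin> N" by (simp add: AE_completion_iff)
  then show ?thesis
  proof eventually_elim
    case (elim x)
    show ?case
    proof (rule tendstoI)
      fix e :: real assume "e > 0"
      from N(2)[OF elim this] obtain d where d: "d > 0"
        "\<And>h. 0 < h \<Longrightarrow> h < d \<Longrightarrow> norm (integral {x..x+h} f /\<^sub>R h - f x) < e" by auto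
      have "\<forall>\<^sub>F h in at_right 0. h \<in> {0<..<d}" using d(1) by (rule eventually_at_right_real)
      then show "\<forall>\<^sub>F h in at_right 0. dist (integral {x..x+h} f / h) (f x) < e"
        by eventually_elim (use d(2) in \<open>auto simp: dist_norm divide_inverse mult.commute\<close>)
    qed
  qed
qed

lemma AE_lborel_uminus:
  assumes "AE x::real in lborel. P x" shows "AE x in lborel. P (- x)"
proof -
  obtain N where N: "{x \<in> space lborel. \<not> P x} \<subseteq> N" "emeasure lborel N = 0" "N \<in> sets lborel"
    using assms by (rule AE_E)
  have [measurable]: "N \<in> sets borel" using N by simp
  have "AE x in lborel. x \<notin> N" using N by (intro AE_not_in) (auto simp: null_sets_def)
  then have "AE x in lborel. 0 + (-1) * x \<notin> N"
    by (intro AE_borel_affine) auto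
  then show ?thesis by eventually_elim (use N(1) in auto)
qed

lemma lebesgue_differentiation_left:
  fixes f :: "real \<Rightarrow> real"
  assumes i: "\<And>a b. f integrable_on {a..b}"
  shows "AE x in lborel. ((\<lambda>h. integral {x-h..x} f / h) \<longlongrightarrow> f x) (at_right 0)"
proof -
  have "(\<lambda>x. f (- x)) integrable_on {a..b}" for a b
    using i[of "- b" "- a"] by (subst (asm) Henstock_Kurzweil_Integration.integrable_reflect_real[symmetric]) simp
  from AE_lborel_uminus[OF lebesgue_differentiation_right[OF this]] show ?thesis
  proof eventually_elim
    case (elim x)
    have "integral {- x..- x + h} (\<lambda>x. f (- x)) = integral {x - h..x} f" for h
      using Henstock_Kurzweil_Integration.integral_reflect_real[of "x" "x - h" f] by simp
    with elim show ?case by simp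
  qed
qed

text \<open>For \<open>r > 0\<close>, twice the mean deviation of \<open>f\<close> from
  \<open>f x\<close> on the interval of radius \<open>r\<close>.\<close>

definition osc_avg :: "(real \<Rightarrow> complex) \<Rightarrow> real \<Rightarrow> real \<Rightarrow> real" where
  "osc_avg f x r = (\<integral>y. indicator {x-r..x+r} y * cmod (f y - f x) \<partial>lborel) / r"

lemma L2_diff_set_integrable:
  assumes f: "L2_fun f"
  shows "set_integrable lborel {a..b} (\<lambda>y. cmod (f y - q))"
proof -
  have [measurable]: "f \<in> borel_measurable borel" by (rule L2_fun_measurable[OF f])
  have i: "integrable lborel (\<lambda>y. cmod (indicator {a..b} y *\<^sub>R f y))"
    by (intro integrable_norm restrict_L2(1)[OF f]) (auto simp: emeasure_lborel_Icc_eq)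
  have j: "integrable lborel (\<lambda>y. indicat_real {a..b} y * cmod q)"
    by (intro integrable_mult_left integrable_real_indicator) (auto simp: emeasure_lborel_Icc_eq)
  show ?thesis
    unfolding set_integrable_def
  proof (rule Bochner_Integration.integrable_bound[OF Bochner_Integration.integrable_add[OF i j]])
    show "AE y in lborel. norm (indicat_real {a..b} y *\<^sub>R cmod (f y - q)) \<le> norm (cmod (indicat_real {a..b} y *\<^sub>R f y) + indicat_real {a..b} y * cmod q)"
      by (intro AE_I2) (auto simp: indicator_def norm_triangle_ineq4)
  qed measurable
qed

text \<open>Differentiation is applied to \<open>|f - q|\<close> for all \<open>q\<close> in a
  countable dense set, which excludes a single null set; at the remaining points \<open>f x\<close>
  is approximated by such a \<open>q\<close>.\<close>

lemma lebesgue_point: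
  assumes f: "L2_fun f"
  shows "AE x in lborel. (osc_avg f x \<longlongrightarrow> 0) (at_right 0)"
proof -
  have [measurable]: "f \<in> borel_measurable borel" by (rule L2_fun_measurable[OF f])
  obtain D :: "complex set" where D: "countable D" "\<And>X. open X \<Longrightarrow> X \<noteq> {} \<Longrightarrow> \<exists>d\<in>D. d \<in> X"
    using countable_dense_exists by metis
  have HK: "(\<lambda>y. cmod (f y - q)) integrable_on {a..b}" for q a b
    by (rule set_borel_integral_eq_integral(1)[OF L2_diff_set_integrable[OF f]])
  have "AE x in lborel. \<forall>q\<in>D. ((\<lambda>h. integral {x..x+h} (\<lambda>y. cmod (f y - q)) / h) \<longlongrightarrow> cmod (f x - q)) (at_right 0)
      \<and> ((\<lambda>h. integral {x-h..x} (\<lambda>y. cmod (f y - q)) / h) \<longlongrightarrow> cmod (f x - q)) (at_right 0)"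
    using D(1) by (subst AE_ball_countable) (auto intro!: AE_conjI lebesgue_differentiation_right lebesgue_differentiation_left HK)
  then show ?thesis
  proof eventually_elim
    case (elim x)
    show ?case
    proof (rule tendstoI)
      fix e :: real assume e: "e > 0"
      obtain q where q: "q \<in> D" "q \<in> ball (f x) (e / 8)" using D(2)[of "ball (f x) (e / 8)"] e by auto
      then have q': "cmod (f x - q) < e / 8" by (simp add: dist_norm)
      have "\<forall>\<^sub>F h in at_right 0. integral {x..x+h} (\<lambda>y. cmod (f y - q)) / h < e / 8"
           "\<forall>\<^sub>F h in at_right 0. integral {x-h..x} (\<lambda>y. cmod (f y - q)) / h < e / 8"
        using order_tendstoD(2)[OF conjunct1[OF bspec[OF elim q(1)]] q'] order_tendstoD(2)[OF conjunct2[OF bspec[OF elim q(1)]] q'] by auto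
      moreover have "\<forall>\<^sub>F h in at_right 0. (0::real) < h" by (rule eventually_at_right_less)
      ultimately show "\<forall>\<^sub>F r in at_right 0. dist (osc_avg f x r) 0 < e"
      proof eventually_elim
        case (elim r)
        have ir: "integrable lborel (\<lambda>y. indicator {x-r..x+r} y * cmod (f y - p))" for p
          using L2_diff_set_integrable[OF f, of "x-r" "x+r" p] by (simp add: set_integrable_def)
        have c: "integrable lborel (\<lambda>y. indicator {x-r..x+r} y * cmod (q - f x))"
          by (intro integrable_mult_left integrable_real_indicator) (auto simp: emeasure_lborel_Icc_eq)
        have "(\<integral>y. indicator {x-r..x+r} y * cmod (f y - f x) \<partial>lborel)
          \<le> (\<integral>y. indicator {x-r..x+r} y * cmod (f y - q) + indicator {x-r..x+r} y * cmod (q - f x) \<partial>lborel)"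
        proof (rule integral_mono[OF ir Bochner_Integration.integrable_add[OF ir c]])
          fix y
          have "cmod (f y - f x) \<le> cmod (f y - q) + cmod (q - f x)"
            using norm_triangle_ineq[of "f y - q" "q - f x"] by simp
          then show "indicator {x-r..x+r} y * cmod (f y - f x) \<le> indicator {x-r..x+r} y * cmod (f y - q) + indicator {x-r..x+r} y * cmod (q - f x)"
            by (auto simp: indicator_def)
        qed
        also have "\<dots> = (\<integral>y. indicator {x-r..x+r} y * cmod (f y - q) \<partial>lborel) + 2 * r * cmod (q - f x)"
          using elim by (subst Bochner_Integration.integral_add[OF ir c]) simp
        also have "(\<integral>y. indicator {x-r..x+r} y * cmod (f y - q) \<partial>lborel) = integral {x-r..x+r} (\<lambda>y. cmod (f y - q))"
          using set_borel_integral_eq_integral(2)[OF L2_diff_set_integrable[OF f, of "x-r" "x+r" q]]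
          by (simp add: set_lebesgue_integral_def)
        also have "\<dots> = integral {x-r..x} (\<lambda>y. cmod (f y - q)) + integral {x..x+r} (\<lambda>y. cmod (f y - q))"
          using elim HK by (intro Henstock_Kurzweil_Integration.integral_combine[symmetric]) auto
        finally have "osc_avg f x r \<le> (integral {x-r..x} (\<lambda>y. cmod (f y - q)) + integral {x..x+r} (\<lambda>y. cmod (f y - q)) + 2 * r * cmod (q - f x)) / r"
          unfolding osc_avg_def using elim by (intro divide_right_mono) auto
        also have "\<dots> = integral {x-r..x} (\<lambda>y. cmod (f y - q)) / r + integral {x..x+r} (\<lambda>y. cmod (f y - q)) / r + 2 * cmod (q - f x)"
          using elim by (simp add: field_simps)
        also have "\<dots> < e" using elim(1,2) q' norm_minus_commute[of q "f x"] norm_ge_zero[of "f x - q"] by linarith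
        finally have "osc_avg f x r < e" .
        moreover have "osc_avg f x r \<ge> 0"
          unfolding osc_avg_def using elim by (intro divide_nonneg_pos integral_nonneg) auto
        ultimately show ?case by (simp add: dist_real_def)
      qed
    qed
  qed
qed

lemma osc_avg_nonneg: "r > 0 \<Longrightarrow> osc_avg f x r \<ge> 0"
  unfolding osc_avg_def by (intro divide_nonneg_pos integral_nonneg) auto

text \<open>Supplies the dominating constant for sums over all dyadic radii. Small radii are covered
  by the Lebesgue point, large ones by \<open>|f| \<le> 1 + |f|^2\<close>.\<close>

lemma osc_avg_bounded:
  assumes f: "L2_fun f" and lim: "(osc_avg f x \<longlongrightarrow> 0) (at_right 0)"
  obtains B where "B \<ge> 0" "\<And>r. r > 0 \<Longrightarrow> osc_avg f x r \<le> B"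
proof -
  have [measurable]: "f \<in> borel_measurable borel" by (rule L2_fun_measurable[OF f])
  have "\<forall>\<^sub>F r in at_right 0. osc_avg f x r < 1" using lim by (rule order_tendstoD) simp
  then obtain r0 where r0: "r0 > 0" "\<And>r. 0 < r \<Longrightarrow> r < r0 \<Longrightarrow> osc_avg f x r < 1"
    unfolding eventually_at_right_field by auto
  let ?n = "\<integral>y. (cmod (f y))\<^sup>2 \<partial>lborel"
  have n2: "integrable lborel (\<lambda>y. (cmod (f y))\<^sup>2)" using f by (simp add: L2_fun_def)
  have n0: "?n \<ge> 0" by simp
  show ?thesis
  proof (rule that[of "1 + 2 * (1 + cmod (f x)) + ?n / r0"])
    fix r :: real assume r: "r > 0"
    show "osc_avg f x r \<le> 1 + 2 * (1 + cmod (f x)) + ?n / r0"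
    proof (cases "r < r0")
      case True
      moreover have "0 \<le> 2 * (1 + cmod (f x)) + ?n / r0" using r0 n0 by simp
      ultimately show ?thesis using r0(2)[OF r True] by linarith
    next
      case False
      have c: "integrable lborel (\<lambda>y. indicator {x-r..x+r} y * (1 + cmod (f x)))"
        by (intro integrable_mult_left integrable_real_indicator) (auto simp: emeasure_lborel_Icc_eq)
      have "(\<integral>y. indicator {x-r..x+r} y * cmod (f y - f x) \<partial>lborel) \<le> (\<integral>y. indicator {x-r..x+r} y * (1 + cmod (f x)) + (cmod (f y))\<^sup>2 \<partial>lborel)"
      proof (rule integral_mono)
        show "integrable lborel (\<lambda>y. indicator {x-r..x+r} y * cmod (f y - f x))"
          using L2_diff_set_integrable[OF f, of "x-r" "x+r" "f x"] by (simp add: set_integrable_def)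
        show "integrable lborel (\<lambda>y. indicator {x-r..x+r} y * (1 + cmod (f x)) + (cmod (f y))\<^sup>2)"
          using c n2 by simp
        fix y
        have "cmod (f y - f x) \<le> cmod (f y) + cmod (f x)" by (rule norm_triangle_ineq4)
        moreover have "cmod (f y) \<le> 1 + (cmod (f y))\<^sup>2"
          using sum_squares_bound[of "cmod (f y)" 1] norm_ge_zero[of "f y"] by (simp only: mult_1_right power_one)
        ultimately show "indicator {x-r..x+r} y * cmod (f y - f x) \<le> indicator {x-r..x+r} y * (1 + cmod (f x)) + (cmod (f y))\<^sup>2"
          by (auto simp: indicator_def)
      qed
      also have "\<dots> = 2 * r * (1 + cmod (f x)) + ?n"
        using r by (subst Bochner_Integration.integral_add[OF c n2]) simp
      finally have "osc_avg f x r \<le> (2 * r * (1 + cmod (f x)) + ?n) / r"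
        unfolding osc_avg_def using r by (intro divide_right_mono) auto
      also have "\<dots> = 2 * (1 + cmod (f x)) + ?n / r" using r by (simp add: field_simps)
      also have "?n / r \<le> ?n / r0" using False r0 n0 by (intro divide_left_mono) auto
      finally show ?thesis by simp
    qed
  qed (use r0 n0 in simp)
qed

text \<open>Replaces a decaying majorant by indicator functions of dyadic intervals: rounding
  \<open>log 2 v\<close> up loses at most \<open>2 powr (1 + m) \<le> 4\<close>.\<close>

lemma dyadic_majorant:
  fixes v m C A :: real
  assumes m: "0 < m" "m < 1" and C: "C \<ge> 0" and v: "v \<ge> 0" and k1: "k \<le> C" and k2: "v > 0 \<Longrightarrow> k \<le> C * v powr (- 1 - m)"
  shows "\<exists>i::nat. v \<le> 2 ^ i \<and> k \<le> 4 * C * (2 powr (- 1 - m)) ^ i"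
proof (cases "v \<le> 1")
  case True
  then show ?thesis using k1 C by (intro exI[of _ 0]) simp
next
  case False
  define i where "i = nat \<lceil>log 2 v\<rceil>"
  have l: "log 2 v > 0" using False by simp
  have i1: "log 2 v \<le> real i" "real i - 1 \<le> log 2 v" using l unfolding i_def by linarith+
  have "v = 2 powr (log 2 v)" using False by simp
  also have "\<dots> \<le> 2 powr (real i)" using i1 by (intro powr_mono) auto
  finally have a: "v \<le> 2 ^ i" by (simp add: powr_realpow)
  have "2 powr (real i - 1) \<le> 2 powr (log 2 v)" using i1 by (intro powr_mono) auto
  then have "2 powr (real i - 1) \<le> v" using False by simp
  then have "v powr (- 1 - m) \<le> (2 powr (real i - 1)) powr (- 1 - m)" using m by (intro powr_mono2') auto
  also have "\<dots> = 2 powr (1 + m) * (2 powr (- 1 - m)) powr real i"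
    by (simp add: powr_powr algebra_simps flip: powr_add)
  also have "\<dots> \<le> 2 powr 2 * (2 powr (- 1 - m)) powr real i" using m by (intro mult_right_mono powr_mono) auto
  also have "\<dots> = 4 * (2 powr (- 1 - m)) ^ i" by (simp add: powr_realpow)
  finally have "C * v powr (- 1 - m) \<le> C * (4 * (2 powr (- 1 - m)) ^ i)" using C by (intro mult_left_mono)
  then show ?thesis using a k2 False by (intro exI[of _ i]) auto
qed

text \<open>The bound for convolution with a kernel of width \<open>h\<close> and tail exponent
  \<open>- 1 - m\<close>: the ratio \<open>2 powr (- m)\<close> is the tail factor
  \<open>2 powr (- 1 - m)\<close> times the doubling of the interval's length.\<close>

definition mean_sum :: "real \<Rightarrow> (real \<Rightarrow> complex) \<Rightarrow> real \<Rightarrow> real \<Rightarrow> real" where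
  "mean_sum m f x h = (\<Sum>i. (2 powr (- m)) ^ i * osc_avg f x (2 ^ i * h))"

lemma mean_sum_summable:
  assumes m: "m > 0" and B: "\<And>r. r > 0 \<Longrightarrow> osc_avg f x r \<le> B" and h: "h > 0"
  shows "summable (\<lambda>i. (2 powr (- m)) ^ i * osc_avg f x (2 ^ i * h))"
proof (rule summable_comparison_test')
  show "summable (\<lambda>i. (2 powr (- m)) ^ i * B)"
    using m by (intro summable_mult2 summable_geometric) (auto simp: powr_less_one)
  show "norm ((2 powr (- m)) ^ i * osc_avg f x (2 ^ i * h)) \<le> (2 powr (- m)) ^ i * B" if "i \<ge> 0" for i
    using B[of "2 ^ i * h"] osc_avg_nonneg[of "2 ^ i * h" f x] h by (auto simp: abs_mult intro!: mult_left_mono)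
qed

text \<open>Tannery's theorem: each term tends to 0 at a Lebesgue point, and the geometric weights
  dominate.\<close>

lemma mean_sum_tendsto:
  assumes m: "m > 0" and f: "L2_fun f" and lim: "(osc_avg f x \<longlongrightarrow> 0) (at_right 0)"
  shows "(mean_sum m f x \<longlongrightarrow> 0) (at_right 0)"
proof -
  obtain B where B: "B \<ge> 0" "\<And>r. r > 0 \<Longrightarrow> osc_avg f x r \<le> B" using osc_avg_bounded[OF f lim] by blast
  have "((\<lambda>h. \<Sum>i. (2 powr (- m)) ^ i * osc_avg f x (2 ^ i * h)) \<longlongrightarrow> (\<Sum>i::nat. 0 :: real)) (at_right 0)"
  proof (rule tannerys_theorem[THEN conjunct2, THEN conjunct2])
    show "((\<lambda>h. (2 powr (- m)) ^ i * osc_avg f x (2 ^ i * h)) \<longlongrightarrow> 0) (at_right 0)" for i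
    proof -
      have "filterlim (\<lambda>h::real. 2 ^ i * h) (at_right 0) (at_right 0)"
        unfolding filterlim_at
      proof
        show "\<forall>\<^sub>F h in at_right 0. 2 ^ i * h \<in> {0<..} \<and> 2 ^ i * h \<noteq> (0::real)"
          using eventually_at_right_less[of "0::real"] by eventually_elim simp
        show "((\<lambda>h::real. 2 ^ i * h) \<longlongrightarrow> 0) (at_right 0)" by (auto intro!: tendsto_eq_intros)
      qed
      from tendsto_mult_right_zero[OF filterlim_compose[OF lim this]] show ?thesis .
    qed
    have "\<forall>\<^sub>F h in at_right (0::real). 0 < h" by (rule eventually_at_right_less)
    from eventually_prodI[OF eventually_True this]
    show "\<forall>\<^sub>F (i, h) in at_top \<times>\<^sub>F at_right (0::real). norm ((2 powr (- m)) ^ i * osc_avg f x (2 ^ i * h)) \<le> (2 powr (- m)) ^ i * B"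
    proof eventually_elim
      case (elim p)
      then show ?case using B(2)[of "2 ^ fst p * snd p"] osc_avg_nonneg[of "2 ^ fst p * snd p" f x]
        by (cases p) (auto simp: abs_mult intro!: mult_left_mono)
    qed
    show "summable (\<lambda>i. (2 powr (- m)) ^ i * B)"
      using m by (intro summable_mult2 summable_geometric) (auto simp: powr_less_one)
  qed simp
  then show ?thesis by (simp add: mean_sum_def[abs_def])
qed

text \<open>The frequency integral is \<open>f\<close> against a kernel of mass
  \<open>2 * pi\<close> and width \<open>h\<close>, so its error is an average of
  \<open>f - f x0\<close>. A displacement of the evaluation point by at most \<open>A * h\<close>
  stays within that width and enters only through \<open>M\<close>, which is uniform in all other
  data. This is what allows the curve to move.\<close>

lemma pointwise_estimate:
  assumes m: "0 < m" "m < 1" and A: "A \<ge> 0"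
  obtains M where "M \<ge> 0"
    "\<And>f g x0 h y \<theta>. \<lbrakk>fourier_L2 f g; (osc_avg f x0 \<longlongrightarrow> 0) (at_right 0); h > 0; \<bar>y - x0\<bar> \<le> A * h; 0 \<le> \<theta>; \<theta> \<le> 1\<rbrakk>
      \<Longrightarrow> cmod ((\<integral>\<xi>. cis (y * \<xi>) * symb m \<theta> (h * \<xi>) * g \<xi> \<partial>lborel) - complex_of_real (2 * pi) * f x0) \<le> M * mean_sum m f x0 h"
proof -
  obtain C where C: "C > 0" "\<And>\<theta> z. \<lbrakk>0 \<le> \<theta>; \<theta> \<le> 1\<rbrakk> \<Longrightarrow> cmod (FT (symb m \<theta>) z) \<le> C"
    "\<And>\<theta> z. \<lbrakk>0 \<le> \<theta>; \<theta> \<le> 1; z \<noteq> 0\<rbrakk> \<Longrightarrow> cmod (FT (symb m \<theta>) z) \<le> C * \<bar>z\<bar> powr (- 1 - m)"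
    using FT_symb_decay[OF m] by metis
  \<comment> \<open>Decay has to be measured from \<open>x0\<close> instead of \<open>y\<close>. If
    \<open>|x - x0| > 2 * A * h\<close>, then \<open>|x - y|\<close> is at least half of
    \<open>|x - x0|\<close>, which costs \<open>2 powr (1 + m) \<le> 4\<close>; otherwise the
    uniform bound is enough at the cost \<open>(2 * A) powr (1 + m)\<close>.\<close>
  define C' where "C' = C * (4 + (2 * A) powr (1 + m))"
  have C': "C' \<ge> C" "C' \<ge> C * 4" "C' \<ge> C * (2 * A) powr (1 + m)" "C' \<ge> 0"
    using C(1) by (auto simp: C'_def distrib_left add_nonneg_nonneg)
  show ?thesis
  proof (rule that[of "4 * C'"])
    fix f g :: "real \<Rightarrow> complex" and x0 h y \<theta> :: real
    assume fg: "fourier_L2 f g" and lim: "(osc_avg f x0 \<longlongrightarrow> 0) (at_right 0)" and h: "h > 0"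
      and y: "\<bar>y - x0\<bar> \<le> A * h" and th: "0 \<le> \<theta>" "\<theta> \<le> 1"
    have f: "L2_fun f" using fg by (simp add: fourier_L2_iff)
    have fm[measurable]: "f \<in> borel_measurable borel" by (rule L2_fun_measurable[OF f])
    let ?\<kappa> = "FT (symb m \<theta>)"
    have \<kappa>m[measurable]: "?\<kappa> \<in> borel_measurable borel" using FT_measurable[of "symb m \<theta>"] by simp
    define \<phi> where "\<phi> \<xi> = cis (y * \<xi>) * symb m \<theta> (h * \<xi>)" for \<xi>
    have \<phi>m[measurable]: "\<phi> \<in> borel_measurable borel" unfolding \<phi>_def by measurable
    have sh: "integrable lborel (\<lambda>\<xi>. symb m \<theta> (h * \<xi>))"
      using lborel_integrable_real_affine[OF integrable_symb[OF m(1), of \<theta>], of h 0] h by simp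
    have \<phi>1: "integrable lborel \<phi>"
      unfolding \<phi>_def by (rule integrable_cis_mult[OF sh]) measurable
    have \<phi>b: "cmod (\<phi> \<xi>) \<le> 1" for \<xi> by (simp add: \<phi>_def norm_mult norm_symb)
    have \<phi>2: "integrable lborel (\<lambda>\<xi>. (cmod (\<phi> \<xi>))\<^sup>2)"
    proof (rule Bochner_Integration.integrable_bound[OF \<phi>1])
      show "AE \<xi> in lborel. norm ((cmod (\<phi> \<xi>))\<^sup>2) \<le> cmod (\<phi> \<xi>)"
        using \<phi>b by (intro AE_I2) (simp add: power2_eq_square mult_left_le)
    qed measurable
    define k where "k x = ?\<kappa> ((y - x) / h) / complex_of_real h" for x
    have km[measurable]: "k \<in> borel_measurable borel" unfolding k_def by measurable
    have FT\<phi>: "FT \<phi> (- x) = k x" for x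
    proof -
      have "FT \<phi> (- x) = (\<integral>\<xi>. cis ((y - x) * \<xi>) * symb m \<theta> (h * \<xi>) \<partial>lborel)"
        unfolding FT_def \<phi>_def
        by (intro Bochner_Integration.integral_cong refl) (simp add: cis_mult algebra_simps flip: mult.assoc)
      also have "\<dots> = \<bar>1 / h\<bar> *\<^sub>R (\<integral>u. cis ((y - x) * (0 + (1 / h) * u)) * symb m \<theta> (h * (0 + (1 / h) * u)) \<partial>lborel)"
        using h by (intro lborel_integral_real_affine) auto
      also have "\<dots> = k x"
        using h by (simp add: k_def FT_def scaleR_conv_of_real)
      finally show ?thesis .
    qed
    have "integrable lborel (\<lambda>x. ?\<kappa> (y / h + (- 1 / h) * x))"
      using h by (intro lborel_integrable_real_affine integrable_FT_symb m th) auto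
    then have ki: "integrable lborel k"
      unfolding k_def by (simp add: diff_divide_distrib)
    have kI: "(\<integral>x. k x \<partial>lborel) = 2 * pi"
    proof -
      have "2 * pi = (\<integral>z. ?\<kappa> z \<partial>lborel)" by (rule integral_FT_symb[OF m th, symmetric])
      also have "\<dots> = \<bar>- 1 / h\<bar> *\<^sub>R (\<integral>x. ?\<kappa> (y / h + (- 1 / h) * x) \<partial>lborel)"
        using h by (intro lborel_integral_real_affine) auto
      also have "\<dots> = (\<integral>x. k x \<partial>lborel)"
        unfolding k_def using h by (simp add: diff_divide_distrib scaleR_conv_of_real)
      finally show ?thesis by simp
    qed
    have k2: "integrable lborel (\<lambda>x. (cmod (k x))\<^sup>2)"
      using integrable_neg[OF plancherel_le(1)[OF \<phi>1 \<phi>2]] by (simp add: FT\<phi>)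
    have fk: "integrable lborel (\<lambda>x. f x * k x)"
      using f k2 by (intro integrable_mult_L2) (auto simp: L2_fun_def)
    have ck: "integrable lborel (\<lambda>x. f x0 * k x)" using ki by simp
    have "(\<integral>\<xi>. cis (y * \<xi>) * symb m \<theta> (h * \<xi>) * g \<xi> \<partial>lborel) = (\<integral>x. f x * k x \<partial>lborel)"
      using fourier_L2_test[OF fg \<phi>1 \<phi>2] unfolding FT\<phi> by (simp add: \<phi>_def mult.commute)
    moreover have "complex_of_real (2 * pi) * f x0 = (\<integral>x. f x0 * k x \<partial>lborel)" using kI by simp
    ultimately have D: "(\<integral>\<xi>. cis (y * \<xi>) * symb m \<theta> (h * \<xi>) * g \<xi> \<partial>lborel) - complex_of_real (2 * pi) * f x0 = (\<integral>x. (f x - f x0) * k x \<partial>lborel)"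
      by (simp only: Bochner_Integration.integral_diff[OF fk ck, symmetric] left_diff_distrib)
    let ?r = "2 powr (- 1 - m)"
    have kb: "cmod (k x) \<le> (\<Sum>i. (4 * C' / h) * ?r ^ i * indicator {x0 - 2 ^ i * h..x0 + 2 ^ i * h} x)"
      and ks: "summable (\<lambda>i. (4 * C' / h) * ?r ^ i * indicator {x0 - 2 ^ i * h..x0 + 2 ^ i * h} x)" for x
    proof -
      have r1: "?r < 1" using m by (intro powr_less_one) auto
      show s: "summable (\<lambda>i. (4 * C' / h) * ?r ^ i * indicator {x0 - 2 ^ i * h..x0 + 2 ^ i * h} x)"
      proof (rule summable_comparison_test')
        show "summable (\<lambda>i. (4 * C' / h) * ?r ^ i)" using r1 by (intro summable_mult summable_geometric) auto
        show "norm ((4 * C' / h) * ?r ^ i * indicator {x0 - 2 ^ i * h..x0 + 2 ^ i * h} x) \<le> (4 * C' / h) * ?r ^ i" if "i \<ge> 0" for i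
          using C' h by (auto simp: indicator_def)
      qed
      define v where "v = \<bar>x - x0\<bar> / h"
      have v: "v \<ge> 0" using h by (simp add: v_def)
      let ?k = "cmod (?\<kappa> ((y - x) / h))"
      have k1: "?k \<le> C'" using C(2)[OF th] C'(1) order_trans by blast
      have k2: "?k \<le> C' * v powr (- 1 - m)" if "v > 0"
      proof (cases "v \<le> 2 * A")
        case True
        have "(2 * A) powr (1 + m) * v powr (- 1 - m) \<ge> v powr (1 + m) * v powr (- 1 - m)"
          using True that m by (intro mult_right_mono powr_mono2) auto
        moreover have "v powr (1 + m) * v powr (- 1 - m) = 1" using that by (simp flip: powr_add)
        ultimately have "C * 1 \<le> C * ((2 * A) powr (1 + m) * v powr (- 1 - m))" using C(1) by (intro mult_left_mono) auto
        also have "\<dots> = (C * (2 * A) powr (1 + m)) * v powr (- 1 - m)" by simp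
        also have "\<dots> \<le> C' * v powr (- 1 - m)" using C' by (intro mult_right_mono) auto
        finally show ?thesis using C(2)[OF th, of "(y - x) / h"] by simp
      next
        case False
        have "\<bar>x - x0\<bar> \<le> \<bar>y - x\<bar> + \<bar>y - x0\<bar>" by simp
        then have "\<bar>x - x0\<bar> / h \<le> (\<bar>y - x\<bar> + A * h) / h" using y h by (intro divide_right_mono) auto
        then have "v \<le> \<bar>(y - x) / h\<bar> + A" using h by (simp add: v_def add_divide_distrib)
        then have z: "v / 2 \<le> \<bar>(y - x) / h\<bar>" using False by linarith
        then have nz: "(y - x) / h \<noteq> 0" using that by auto
        have "?k \<le> C * \<bar>(y - x) / h\<bar> powr (- 1 - m)" by (rule C(3)[OF th nz])
        also have "\<dots> \<le> C * (v / 2) powr (- 1 - m)"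
          using z that m C(1) by (intro mult_left_mono powr_mono2') auto
        also have "(v / 2) powr (- 1 - m) = 2 powr (1 + m) * v powr (- 1 - m)"
        proof -
          have "(v / 2) powr (- 1 - m) = v powr (- 1 - m) * inverse (2 powr (- 1 - m))"
            using that by (subst powr_divide) (auto simp: divide_inverse)
          also have "inverse (2 powr (- 1 - m)) = (2::real) powr (- (- 1 - m))" by (rule powr_minus[symmetric])
          also have "- (- 1 - m) = 1 + m" by simp
          finally show ?thesis by (simp only: mult.commute)
        qed
        also have "C * (2 powr (1 + m) * v powr (- 1 - m)) \<le> C * (2 powr 2 * v powr (- 1 - m))"
          using C(1) m by (intro mult_left_mono mult_right_mono powr_mono) auto
        also have "\<dots> = C * 4 * v powr (- 1 - m)" by simp
        also have "\<dots> \<le> C' * v powr (- 1 - m)" using C' by (intro mult_right_mono) auto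
        finally show ?thesis .
      qed
      obtain i where i: "v \<le> 2 ^ i" "?k \<le> 4 * C' * ?r ^ i"
        using dyadic_majorant[OF m C'(4) v k1 k2] by blast
      have xi: "x \<in> {x0 - 2 ^ i * h..x0 + 2 ^ i * h}"
      proof -
        have "\<bar>x - x0\<bar> \<le> 2 ^ i * h" using i(1) h by (simp add: v_def field_simps)
        then show ?thesis by auto
      qed
      have "cmod (k x) = ?k / h" using h by (simp add: k_def norm_divide)
      also have "\<dots> \<le> (4 * C' * ?r ^ i) / h" using i(2) h by (intro divide_right_mono) auto
      also have "\<dots> = (\<Sum>i\<in>{i}. (4 * C' / h) * ?r ^ i * indicator {x0 - 2 ^ i * h..x0 + 2 ^ i * h} x)"
        using xi by simp
      also have "\<dots> \<le> (\<Sum>i. (4 * C' / h) * ?r ^ i * indicator {x0 - 2 ^ i * h..x0 + 2 ^ i * h} x)"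
        using C' h by (intro sum_le_suminf s) auto
      finally show "cmod (k x) \<le> (\<Sum>i. (4 * C' / h) * ?r ^ i * indicator {x0 - 2 ^ i * h..x0 + 2 ^ i * h} x)" .
    qed
    obtain B where B: "B \<ge> 0" "\<And>r. r > 0 \<Longrightarrow> osc_avg f x0 r \<le> B" using osc_avg_bounded[OF f lim] by blast
    have b0: "(4 * C' / h) * ?r ^ i \<ge> 0" for i using C' h by simp
    have "ennreal (cmod (\<integral>x. (f x - f x0) * k x \<partial>lborel)) \<le> (\<integral>\<^sup>+x. ennreal (cmod ((f x - f x0) * k x)) \<partial>lborel)"
      using fk ck by (intro integral_norm_bound_ennreal) (simp add: left_diff_distrib)
    also have "\<dots> \<le> (\<integral>\<^sup>+x. (\<Sum>i. ennreal ((4 * C' / h) * ?r ^ i * (indicator {x0 - 2 ^ i * h..x0 + 2 ^ i * h} x * cmod (f x - f x0)))) \<partial>lborel)"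
    proof (intro nn_integral_mono)
      fix x
      have "cmod ((f x - f x0) * k x) \<le> cmod (f x - f x0) * (\<Sum>i. (4 * C' / h) * ?r ^ i * indicator {x0 - 2 ^ i * h..x0 + 2 ^ i * h} x)"
        unfolding norm_mult by (intro mult_left_mono kb) auto
      also have "\<dots> = (\<Sum>i. cmod (f x - f x0) * ((4 * C' / h) * ?r ^ i * indicator {x0 - 2 ^ i * h..x0 + 2 ^ i * h} x))"
        by (rule suminf_mult[OF ks, symmetric])
      also have "\<dots> = (\<Sum>i. (4 * C' / h) * ?r ^ i * (indicator {x0 - 2 ^ i * h..x0 + 2 ^ i * h} x * cmod (f x - f x0)))"
        by (simp only: mult_ac)
      finally have le: "cmod ((f x - f x0) * k x) \<le> (\<Sum>i. (4 * C' / h) * ?r ^ i * (indicator {x0 - 2 ^ i * h..x0 + 2 ^ i * h} x * cmod (f x - f x0)))" .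
      have "summable (\<lambda>i. cmod (f x - f x0) * ((4 * C' / h) * ?r ^ i * indicator {x0 - 2 ^ i * h..x0 + 2 ^ i * h} x))"
        by (rule summable_mult[OF ks])
      then have s: "summable (\<lambda>i. (4 * C' / h) * ?r ^ i * (indicator {x0 - 2 ^ i * h..x0 + 2 ^ i * h} x * cmod (f x - f x0)))"
        by (simp only: mult_ac)
      show "ennreal (cmod ((f x - f x0) * k x)) \<le> (\<Sum>i. ennreal ((4 * C' / h) * ?r ^ i * (indicator {x0 - 2 ^ i * h..x0 + 2 ^ i * h} x * cmod (f x - f x0))))"
      proof (subst suminf_ennreal2[OF _ s])
        show "0 \<le> (4 * C' / h) * ?r ^ i * (indicator {x0 - 2 ^ i * h..x0 + 2 ^ i * h} x * cmod (f x - f x0))" for i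
          by (rule mult_nonneg_nonneg[OF b0]) simp
      qed (rule ennreal_leI[OF le])
    qed
    also have "\<dots> = (\<Sum>i. \<integral>\<^sup>+x. ennreal ((4 * C' / h) * ?r ^ i * (indicator {x0 - 2 ^ i * h..x0 + 2 ^ i * h} x * cmod (f x - f x0))) \<partial>lborel)"
      by (rule nn_integral_suminf) measurable
    also have "\<dots> = (\<Sum>i. ennreal (4 * C' * ((2 powr (- m)) ^ i * osc_avg f x0 (2 ^ i * h))))"
    proof (intro suminf_cong)
      fix i
      let ?u = "\<lambda>x. indicator {x0 - 2 ^ i * h..x0 + 2 ^ i * h} x * cmod (f x - f x0)"
      have ui: "integrable lborel ?u"
        using L2_diff_set_integrable[OF f, of "x0 - 2 ^ i * h" "x0 + 2 ^ i * h" "f x0"] by (simp add: set_integrable_def)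
      have "(\<integral>\<^sup>+x. ennreal ((4 * C' / h) * ?r ^ i * ?u x) \<partial>lborel) = ennreal (\<integral>x. (4 * C' / h) * ?r ^ i * ?u x \<partial>lborel)"
      proof (intro nn_integral_eq_integral integrable_mult_right ui AE_I2)
        show "0 \<le> (4 * C' / h) * ?r ^ i * ?u x" for x
          by (rule mult_nonneg_nonneg[OF b0]) simp
      qed
      also have "(\<integral>x. (4 * C' / h) * ?r ^ i * ?u x \<partial>lborel) = (4 * C' / h) * ?r ^ i * (\<integral>x. ?u x \<partial>lborel)"
        by (rule integral_mult_right_zero)
      also have "(\<integral>x. ?u x \<partial>lborel) = 2 ^ i * h * osc_avg f x0 (2 ^ i * h)"
        using h by (simp add: osc_avg_def)
      also have "(4 * C' / h) * ?r ^ i * (2 ^ i * h * osc_avg f x0 (2 ^ i * h)) = 4 * C' * ((?r * 2) ^ i * osc_avg f x0 (2 ^ i * h))"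
        using h by (simp add: power_mult_distrib)
      also have "?r * 2 = 2 powr (- m)"
      proof -
        have "?r * 2 = 2 powr (- 1 - m) * 2 powr 1" by simp
        also have "\<dots> = 2 powr (- 1 - m + 1)" by (rule powr_add[symmetric])
        finally show ?thesis by simp
      qed
      finally show "(\<integral>\<^sup>+x. ennreal ((4 * C' / h) * ?r ^ i * ?u x) \<partial>lborel) = ennreal (4 * C' * ((2 powr (- m)) ^ i * osc_avg f x0 (2 ^ i * h)))" .
    qed
    also have "\<dots> = ennreal (4 * C' * mean_sum m f x0 h)"
    proof -
      have s: "summable (\<lambda>i. (2 powr (- m)) ^ i * osc_avg f x0 (2 ^ i * h))"
        by (rule mean_sum_summable[OF m(1) B(2) h])
      have nn: "0 \<le> 4 * C' * ((2 powr (- m)) ^ i * osc_avg f x0 (2 ^ i * h))" for i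
        using C' h by (intro mult_nonneg_nonneg osc_avg_nonneg) auto
      show ?thesis
        unfolding mean_sum_def suminf_mult[OF s, symmetric]
        by (rule suminf_ennreal2[OF nn summable_mult[OF s]])
    qed
    finally have "ennreal (cmod (\<integral>x. (f x - f x0) * k x \<partial>lborel)) \<le> ennreal (4 * C' * mean_sum m f x0 h)" .
    moreover have "4 * C' * mean_sum m f x0 h \<ge> 0"
      unfolding mean_sum_def using C' h
      by (intro mult_nonneg_nonneg suminf_nonneg mean_sum_summable[OF m(1) B(2) h] osc_avg_nonneg) auto
    ultimately show "cmod ((\<integral>\<xi>. cis (y * \<xi>) * symb m \<theta> (h * \<xi>) * g \<xi> \<partial>lborel) - complex_of_real (2 * pi) * f x0) \<le> 4 * C' * mean_sum m f x0 h"
      unfolding D by (subst (asm) ennreal_le_iff) auto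
  qed (use C' in simp)
qed

lemma pointwise_convergence:
  fixes h y \<theta> :: "real \<Rightarrow> real"
  assumes m: "0 < m" "m < 1" and A: "A \<ge> 0" and fg: "fourier_L2 f g" and lim: "(osc_avg f x0 \<longlongrightarrow> 0) (at_right 0)"
    and h: "filterlim h (at_right 0) (at_right 0)"
    and ev: "\<forall>\<^sub>F t in at_right 0. \<bar>y t - x0\<bar> \<le> A * h t \<and> 0 \<le> \<theta> t \<and> \<theta> t \<le> 1"
  shows "((\<lambda>t. complex_of_real (1 / (2 * pi)) * (\<integral>\<xi>. cis (y t * \<xi>) * symb m (\<theta> t) (h t * \<xi>) * g \<xi> \<partial>lborel)) \<longlongrightarrow> f x0) (at_right 0)"
proof -
  have f: "L2_fun f" using fg by (simp add: fourier_L2_iff)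
  obtain M where M: "M \<ge> 0"
    "\<And>f g x0 h y \<theta>. \<lbrakk>fourier_L2 f g; (osc_avg f x0 \<longlongrightarrow> 0) (at_right 0); h > 0; \<bar>y - x0\<bar> \<le> A * h; 0 \<le> \<theta>; \<theta> \<le> 1\<rbrakk>
      \<Longrightarrow> cmod ((\<integral>\<xi>. cis (y * \<xi>) * symb m \<theta> (h * \<xi>) * g \<xi> \<partial>lborel) - complex_of_real (2 * pi) * f x0) \<le> M * mean_sum m f x0 h"
    using pointwise_estimate[OF m A] by blast
  let ?I = "\<lambda>t. \<integral>\<xi>. cis (y t * \<xi>) * symb m (\<theta> t) (h t * \<xi>) * g \<xi> \<partial>lborel"
  have "((\<lambda>t. ?I t - complex_of_real (2 * pi) * f x0) \<longlongrightarrow> 0) (at_right 0)"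
  proof (rule Lim_null_comparison)
    have "\<forall>\<^sub>F t in at_right 0. h t > 0" using h by (auto simp: filterlim_at elim: eventually_mono)
    with ev show "\<forall>\<^sub>F t in at_right 0. cmod (?I t - complex_of_real (2 * pi) * f x0) \<le> M * mean_sum m f x0 (h t)"
      by eventually_elim (use M(2)[OF fg lim] in auto)
    show "((\<lambda>t. M * mean_sum m f x0 (h t)) \<longlongrightarrow> 0) (at_right 0)"
      by (rule tendsto_mult_right_zero[OF filterlim_compose[OF mean_sum_tendsto[OF m(1) f lim] h]])
  qed
  then have "(?I \<longlongrightarrow> complex_of_real (2 * pi) * f x0) (at_right 0)" by (rule Lim_null[THEN iffD2])
  then have "((\<lambda>t. complex_of_real (1 / (2 * pi)) * ?I t) \<longlongrightarrow> complex_of_real (1 / (2 * pi)) * (complex_of_real (2 * pi) * f x0)) (at_right 0)"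
    by (intro tendsto_intros)
  then show ?thesis by simp
qed

lemma filterlim_powr_at_right_0:
  assumes "p > (0::real)" shows "filterlim (\<lambda>t. t powr p) (at_right 0) (at_right 0)"
  unfolding filterlim_at
proof
  show "\<forall>\<^sub>F t in at_right 0. t powr p \<in> {0<..} \<and> t powr p \<noteq> 0"
    using eventually_at_right_less[of "0::real"] by eventually_elim simp
  show "((\<lambda>t. t powr p) \<longlongrightarrow> 0) (at_right 0)"
    using assms by (intro tendsto_zero_powrI[OF tendsto_ident_at tendsto_const]) (auto intro!: eventually_at_right_less[THEN eventually_mono])
qed

lemma symb_dilate:
  assumes "t > 0" "\<gamma> > 0" "m > 0"
  shows "symb m \<theta> (t powr (\<gamma> / m) * \<xi>) = exp (- (t powr \<gamma>) * \<bar>\<xi>\<bar> powr m) *\<^sub>R cis (\<theta> * t powr \<gamma> * \<bar>\<xi>\<bar> powr m)"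
proof -
  have "\<bar>t powr (\<gamma> / m) * \<xi>\<bar> powr m = t powr \<gamma> * \<bar>\<xi>\<bar> powr m"
    using assms by (simp add: abs_mult powr_mult powr_powr)
  then show ?thesis by (simp add: symb_osc osc_def mult.assoc)
qed

text \<open>The reference family of the frequency-localised argument: no curve and no dispersion.\<close>

lemma dissipative_convergence:
  assumes m: "0 < m" "m < 1" and g: "0 < \<gamma>" and fg: "fourier_L2 f g"
  shows "AE x in lborel. ((\<lambda>t. complex_of_real (1 / (2 * pi)) * (\<integral>\<xi>. cis (x * \<xi>) * complex_of_real (exp (- (t powr \<gamma>) * \<bar>\<xi>\<bar> powr m)) * g \<xi> \<partial>lborel)) \<longlongrightarrow> f x) (at_right 0)"
proof -
  have "L2_fun f" using fg by (simp add: fourier_L2_iff)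
  from lebesgue_point[OF this] show ?thesis
  proof eventually_elim
    case (elim x)
    have p: "\<gamma> / m > 0" using m g by simp
    have "\<forall>\<^sub>F t in at_right 0. \<bar>x - x\<bar> \<le> 0 * (t powr (\<gamma> / m)) \<and> 0 \<le> (0::real) \<and> 0 \<le> (1::real)" by simp
    then have "((\<lambda>t. complex_of_real (1 / (2 * pi)) * (\<integral>\<xi>. cis (x * \<xi>) * symb m 0 (t powr (\<gamma> / m) * \<xi>) * g \<xi> \<partial>lborel)) \<longlongrightarrow> f x) (at_right 0)"
      by (intro pointwise_convergence[OF m order_refl fg elim filterlim_powr_at_right_0[OF p]]) simp
    then show ?case
    proof (rule Lim_transform_eventually)
      show "\<forall>\<^sub>F t in at_right 0. complex_of_real (1 / (2 * pi)) * (\<integral>\<xi>. cis (x * \<xi>) * symb m 0 (t powr (\<gamma> / m) * \<xi>) * g \<xi> \<partial>lborel)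
         = complex_of_real (1 / (2 * pi)) * (\<integral>\<xi>. cis (x * \<xi>) * complex_of_real (exp (- (t powr \<gamma>) * \<bar>\<xi>\<bar> powr m)) * g \<xi> \<partial>lborel)"
        using eventually_at_right_less[of "0::real"]
        by eventually_elim (use m g in \<open>simp add: symb_dilate scaleR_conv_of_real\<close>)
    qed
  qed
qed

text \<open>\<open>fourier_hat f\<close> may be any transform of \<open>f\<close>; all of them agree
  almost everywhere, so the integral can be computed with the transform at hand.\<close>

lemma Pop_eq:
  assumes fg: "fourier_L2 f g"
  shows "Pop m \<gamma> f y t = complex_of_real (1 / (2 * pi)) * (\<integral>\<xi>. cis (y * \<xi> + t * \<bar>\<xi>\<bar> powr m) * complex_of_real (exp (- (t powr \<gamma>) * \<bar>\<xi>\<bar> powr m)) * g \<xi> \<partial>lborel)"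
proof -
  have [measurable]: "g \<in> borel_measurable borel" "fourier_hat f \<in> borel_measurable borel"
    using fg fourier_hat_AE(2)[OF fg] by (auto simp: fourier_L2_iff L2_fun_def)
  have "(\<integral>\<xi>. exp (\<i> * complex_of_real (y * \<xi> + t * \<bar>\<xi>\<bar> powr m)) * complex_of_real (exp (- (t powr \<gamma>) * \<bar>\<xi>\<bar> powr m)) * fourier_hat f \<xi> \<partial>lborel)
     = (\<integral>\<xi>. cis (y * \<xi> + t * \<bar>\<xi>\<bar> powr m) * complex_of_real (exp (- (t powr \<gamma>) * \<bar>\<xi>\<bar> powr m)) * g \<xi> \<partial>lborel)"
  proof (rule integral_cong_AE)
    show "AE \<xi> in lborel. exp (\<i> * complex_of_real (y * \<xi> + t * \<bar>\<xi>\<bar> powr m)) * complex_of_real (exp (- (t powr \<gamma>) * \<bar>\<xi>\<bar> powr m)) * fourier_hat f \<xi>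
       = cis (y * \<xi> + t * \<bar>\<xi>\<bar> powr m) * complex_of_real (exp (- (t powr \<gamma>) * \<bar>\<xi>\<bar> powr m)) * g \<xi>"
      using fourier_hat_AE(1)[OF fg] by eventually_elim (simp add: cis_conv_exp)
  qed measurable
  then show ?thesis unfolding Pop_def by simp
qed

text \<open>For \<open>t < 1\<close> the inequality \<open>\<gamma> / m \<le> \<alpha>\<close> gives
  \<open>t powr \<alpha> \<le> t powr (\<gamma> / m)\<close>, so the estimate at Lebesgue points
  applies with \<open>A = C3\<close>. The same assumption forces \<open>\<gamma> \<le> 1\<close>,
  which keeps the dispersion parameter \<open>t powr (1 - \<gamma>)\<close> in the unit
  interval.\<close>

lemma convergence_small_\<gamma>:
  assumes m: "0 < m" "m < 1" and g: "0 < \<gamma>" "\<gamma> \<le> m * \<alpha>" and al: "0 < \<alpha>" "\<alpha> \<le> 1"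
    and adm: "admissible \<alpha> \<Gamma>" and fg: "fourier_L2 f g"
  shows "converges_ae m \<gamma> \<Gamma> f"
proof -
  obtain C1 C2 C3 where C: "C1 > 0" "C2 > 0" "C3 > 0"
     and bil0: "\<forall>t\<in>{-1..1}. \<forall>x x'. C1 * \<bar>x - x'\<bar> \<le> \<bar>\<Gamma> x t - \<Gamma> x' t\<bar> \<and> \<bar>\<Gamma> x t - \<Gamma> x' t\<bar> \<le> C2 * \<bar>x - x'\<bar>"
     and hol0: "\<forall>x. \<forall>t\<in>{-1..1}. \<forall>t'\<in>{-1..1}. \<bar>\<Gamma> x t - \<Gamma> x t'\<bar> \<le> C3 * \<bar>t - t'\<bar> powr \<alpha>"
    using adm unfolding admissible_def by (elim conjE exE) (rule that)
  have G0: "\<Gamma> x 0 = x" for x using adm by (simp add: admissible_def)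
  have g1: "\<gamma> \<le> 1" using g m al mult_le_one[of m \<alpha>] by simp
  have "L2_fun f" using fg by (simp add: fourier_L2_iff)
  from lebesgue_point[OF this] show ?thesis
    unfolding converges_ae_def
  proof eventually_elim
    case (elim x)
    have p: "\<gamma> / m > 0" using m g by simp
    have small: "\<forall>\<^sub>F t in at_right 0. t \<in> {0<..<1::real}" by (rule eventually_at_right_real) simp
    then have "\<forall>\<^sub>F t in at_right 0. \<bar>\<Gamma> x t - x\<bar> \<le> C3 * (t powr (\<gamma> / m)) \<and> 0 \<le> t powr (1 - \<gamma>) \<and> t powr (1 - \<gamma>) \<le> 1"
    proof eventually_elim
      case (elim t)
      have "\<bar>\<Gamma> x t - \<Gamma> x 0\<bar> \<le> C3 * \<bar>t - 0\<bar> powr \<alpha>"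
        using bspec[OF bspec[OF spec[OF hol0, of x], of t], of 0] elim by simp
      also have "\<dots> \<le> C3 * (t powr (\<gamma> / m))"
        using C elim g m by (intro mult_left_mono) (auto intro!: powr_mono' simp: field_simps)
      finally show ?case using elim g1 by (auto simp: G0 intro!: powr_le1)
    qed
    then have "((\<lambda>t. complex_of_real (1 / (2 * pi)) * (\<integral>\<xi>. cis (\<Gamma> x t * \<xi>) * symb m (t powr (1 - \<gamma>)) (t powr (\<gamma> / m) * \<xi>) * g \<xi> \<partial>lborel)) \<longlongrightarrow> f x) (at_right 0)"
      using C by (intro pointwise_convergence[OF m _ fg elim filterlim_powr_at_right_0[OF p], where A=C3]) auto
    then show ?case
    proof (rule Lim_transform_eventually)
      show "\<forall>\<^sub>F t in at_right 0. complex_of_real (1 / (2 * pi)) * (\<integral>\<xi>. cis (\<Gamma> x t * \<xi>) * symb m (t powr (1 - \<gamma>)) (t powr (\<gamma> / m) * \<xi>) * g \<xi> \<partial>lborel) = Pop m \<gamma> f (\<Gamma> x t) t"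
        using small
      proof eventually_elim
        case (elim t)
        have "t powr (1 - \<gamma>) * t powr \<gamma> = t" using elim by (simp flip: powr_add)
        then have "cis (\<Gamma> x t * \<xi>) * symb m (t powr (1 - \<gamma>)) (t powr (\<gamma> / m) * \<xi>) * g \<xi>
          = cis (\<Gamma> x t * \<xi> + t * \<bar>\<xi>\<bar> powr m) * complex_of_real (exp (- (t powr \<gamma>) * \<bar>\<xi>\<bar> powr m)) * g \<xi>" for \<xi>
          using symb_dilate[of t \<gamma> m "t powr (1 - \<gamma>)" \<xi>] elim m g by (simp add: scaleR_conv_of_real mult_ac flip: cis_mult)
        then show ?case unfolding Pop_eq[OF fg] by (simp only:)
      qed
    qed
  qed
qed

section \<open>Convergence above the critical regularity\<close>

text \<open>Guarantees a positive \<sigma> between \<open>s_crit\<close> and \<open>s\<close>, as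
  the kernel estimates demand. By \<open>m * \<alpha> < \<gamma>\<close> the subtracted term
  \<open>m * (2 * \<alpha> - 1) / \<gamma>\<close> is at most
  \<open>2 - 1 / \<alpha> \<le> 1\<close>, so the first entry is at least
  \<open>(1 - m) / 4\<close>.\<close>

lemma s_crit_pos:
  assumes m: "0 < m" "m < 1" and al: "1/2 < \<alpha>" "\<alpha> \<le> 1" and g: "m * \<alpha> < \<gamma>"
  shows "s_crit m \<alpha> \<gamma> > 0"
proof -
  have ma: "m * \<alpha> > 0" using m al by simp
  then have g0: "\<gamma> > 0" using g by simp
  have "m * (2 * \<alpha> - 1) / \<gamma> \<le> m * (2 * \<alpha> - 1) / (m * \<alpha>)"
    by (rule divide_left_mono[OF less_imp_le[OF g] _ mult_pos_pos[OF g0 ma]]) (use m al in auto)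
  also have "\<dots> = 2 - 1 / \<alpha>" using m al by (simp add: field_simps)
  also have "\<dots> \<le> 1" using al by (simp add: field_simps)
  finally have "m * (2 * \<alpha> - 1) / \<gamma> \<le> 1" .
  moreover have "(2 - m) / 4 + m * (1 - 2 * \<alpha>) / (4 * \<gamma>) = (2 - m - m * (2 * \<alpha> - 1) / \<gamma>) / 4"
    using g0 by (simp add: field_simps)
  moreover have "(2 - m - X) / 4 > 0" if "X \<le> 1" for X using that m by simp
  ultimately have "(2 - m) / 4 + m * (1 - 2 * \<alpha>) / (4 * \<gamma>) > 0" by (simp only:)
  moreover have "m * \<alpha> / \<gamma> < 1" using g g0 by simp
  ultimately show ?thesis by (simp add: s_crit_def)
qed

section \<open>Frequency truncation of the two flows\<close>

definition psymb :: "real \<Rightarrow> real \<Rightarrow> real \<Rightarrow> real \<Rightarrow> real \<Rightarrow> complex" where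
  "psymb m y b c \<xi> = exp (- c * \<bar>\<xi>\<bar> powr m) *\<^sub>R cis (y * \<xi> + b * \<bar>\<xi>\<bar> powr m)"

lemma psymb_measurable [measurable (raw)]:
  assumes [measurable]: "f \<in> borel_measurable M"
  shows "(\<lambda>x. psymb m y b c (f x)) \<in> borel_measurable M"
  unfolding psymb_def by measurable

lemma psymb_le_1: "c \<ge> 0 \<Longrightarrow> cmod (psymb m y b c \<xi>) \<le> 1"
  by (simp add: psymb_def)

lemma psymb_osc: "\<xi> \<ge> 0 \<Longrightarrow> psymb m y b c \<xi> = osc m y b c \<xi>" "\<xi> \<ge> 0 \<Longrightarrow> psymb m y b c (- \<xi>) = osc m (- y) b c \<xi>"
  by (simp_all add: psymb_def osc_def)

lemma integrable_psymb_mult: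
  assumes m: "m > 0" and c: "c > 0" and g: "L2_fun g"
  shows "integrable lborel (\<lambda>\<xi>. psymb m y b c \<xi> * g \<xi>)"
proof (rule integrable_mult_L2)
  have "(cmod (psymb m y b c \<xi>))\<^sup>2 = exp (- (2 * c) * \<bar>\<xi>\<bar> powr m)" for \<xi>
    by (simp add: psymb_def power2_eq_square flip: exp_add)
  then show "integrable lborel (\<lambda>\<xi>. (cmod (psymb m y b c \<xi>))\<^sup>2)"
    using integrable_exp_powr[of "2 * c" m] m c by simp
qed (use g in \<open>auto simp: L2_fun_def\<close>)

definition cutoff :: "real \<Rightarrow> (real \<Rightarrow> complex) \<Rightarrow> real \<Rightarrow> real \<Rightarrow> real \<Rightarrow> nat \<Rightarrow> complex" where
  "cutoff m g y b c N = (\<integral>\<xi>. indicator {- (2 ^ N)..2 ^ N} \<xi> *\<^sub>R (psymb m y b c \<xi> * g \<xi>) \<partial>lborel)"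

text \<open>Doubling the cutoff adds two frequency blocks, of which the negative one is reflected to
  the positive side. Frequencies below 1 never form a block: they stay inside the cutoff.\<close>

lemma cutoff_step:
  assumes m: "m > 0" and c: "c > 0" and g: "L2_fun g"
  shows "cutoff m g y b c (Suc N) - cutoff m g y b c N = piece m g (2 ^ N) y b c + piece m (\<lambda>\<xi>. g (- \<xi>)) (2 ^ N) (- y) b c"
proof -
  have [measurable]: "g \<in> borel_measurable borel" by (rule L2_fun_measurable[OF g])
  let ?F = "\<lambda>\<xi>. psymb m y b c \<xi> * g \<xi>"
  have F: "integrable lborel ?F" by (rule integrable_psymb_mult[OF m c g])
  have iF: "integrable lborel (\<lambda>\<xi>. indicator S \<xi> *\<^sub>R ?F \<xi>)" if "S \<in> sets borel" for S
    using F that by (intro integrable_mult_indicator) auto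
  let ?L = "2 ^ N :: real"
  have L: "?L > 0" by simp
  have "cutoff m g y b c (Suc N) - cutoff m g y b c N = (\<integral>\<xi>. indicator {- (2 ^ Suc N)..2 ^ Suc N} \<xi> *\<^sub>R ?F \<xi> - indicator {- ?L..?L} \<xi> *\<^sub>R ?F \<xi> \<partial>lborel)"
    unfolding cutoff_def by (rule Bochner_Integration.integral_diff[OF iF iF, symmetric]) auto
  also have "\<dots> = (\<integral>\<xi>. indicator {?L..2 * ?L} \<xi> *\<^sub>R ?F \<xi> + indicator {- (2 * ?L)..- ?L} \<xi> *\<^sub>R ?F \<xi> \<partial>lborel)"
  proof (rule integral_cong_AE)
    \<comment> \<open>The closed blocks overlap the old cutoff in exactly these two points.\<close>
    have "AE \<xi> in lborel. \<xi> \<noteq> ?L" "AE \<xi> in lborel. \<xi> \<noteq> - ?L" by (rule AE_lborel_singleton)+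
    then show "AE \<xi> in lborel. indicator {- (2 ^ Suc N)..2 ^ Suc N} \<xi> *\<^sub>R ?F \<xi> - indicator {- ?L..?L} \<xi> *\<^sub>R ?F \<xi>
       = indicator {?L..2 * ?L} \<xi> *\<^sub>R ?F \<xi> + indicator {- (2 * ?L)..- ?L} \<xi> *\<^sub>R ?F \<xi>"
    proof eventually_elim
      case (elim \<xi>)
      have "(indicat_real {- (2 ^ Suc N)..2 ^ Suc N} \<xi> - indicator {- ?L..?L} \<xi>) = indicator {?L..2 * ?L} \<xi> + indicator {- (2 * ?L)..- ?L} \<xi>"
        using elim L by (auto simp: indicator_def)
      then show ?case by (simp only: scaleR_left_diff_distrib[symmetric] scaleR_left_distrib[symmetric])
    qed
  qed measurable
  also have "\<dots> = (\<integral>\<xi>. indicator {?L..2 * ?L} \<xi> *\<^sub>R ?F \<xi> \<partial>lborel) + (\<integral>\<xi>. indicator {- (2 * ?L)..- ?L} \<xi> *\<^sub>R ?F \<xi> \<partial>lborel)"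
    by (rule Bochner_Integration.integral_add[OF iF iF]) auto
  also have "(\<integral>\<xi>. indicator {?L..2 * ?L} \<xi> *\<^sub>R ?F \<xi> \<partial>lborel) = piece m g ?L y b c"
    unfolding piece_def using L by (intro Bochner_Integration.integral_cong) (auto simp: indicator_def psymb_osc)
  also have "(\<integral>\<xi>. indicator {- (2 * ?L)..- ?L} \<xi> *\<^sub>R ?F \<xi> \<partial>lborel) = (\<integral>\<xi>. indicator {- (2 * ?L)..- ?L} (- \<xi>) *\<^sub>R ?F (- \<xi>) \<partial>lborel)"
    by (rule integral_neg[symmetric])
  also have "\<dots> = piece m (\<lambda>\<xi>. g (- \<xi>)) ?L (- y) b c"
    unfolding piece_def
  proof (intro Bochner_Integration.integral_cong refl)
    fix \<xi> :: real
    show "indicator {- (2 * ?L)..- ?L} (- \<xi>) *\<^sub>R ?F (- \<xi>) = indicator {?L..2 * ?L} \<xi> *\<^sub>R osc m (- y) b c \<xi> * g (- \<xi>)"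
    proof (cases "\<xi> \<in> {?L..2 * ?L}")
      case True
      then have "\<xi> \<ge> 0" using L by (meson atLeastAtMost_iff less_imp_le order_trans)
      then show ?thesis using True by (simp add: psymb_osc)
    qed (auto simp: indicator_def)
  qed
  finally show ?thesis .
qed

text \<open>Telescoping and a geometric series. The blocks enter only through \<open>D\<close> and
  \<open>r\<close>, so the bound is uniform in time whenever these are.\<close>

lemma cutoff_tail:
  assumes m: "m > 0" and c: "c > 0" and g: "L2_fun g" and r: "0 \<le> r" "r < 1"
    and b1: "\<And>k. cmod (piece m g (2 ^ k) y b c) \<le> D * r ^ k"
    and b2: "\<And>k. cmod (piece m (\<lambda>\<xi>. g (- \<xi>)) (2 ^ k) (- y) b c) \<le> D * r ^ k"
  shows "cmod ((\<integral>\<xi>. psymb m y b c \<xi> * g \<xi> \<partial>lborel) - cutoff m g y b c N) \<le> 2 * D * r ^ N / (1 - r)"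
proof -
  have [measurable]: "g \<in> borel_measurable borel" by (rule L2_fun_measurable[OF g])
  let ?J = "cutoff m g y b c"
  have D: "D \<ge> 0" using b1[of 0] norm_ge_zero order_trans by (metis mult_1_right power_0)
  \<comment> \<open>The exact partial geometric sum is carried along, since the weaker final bound
    would not reproduce itself in the induction.\<close>
  have step: "cmod (?J (N + j) - ?J N) \<le> 2 * D * r ^ N * (1 - r ^ j) / (1 - r)" for j
  proof (induction j)
    case (Suc j)
    have "cmod (?J (Suc (N + j)) - ?J (N + j)) \<le> D * r ^ (N + j) + D * r ^ (N + j)"
      unfolding cutoff_step[OF m c g] by (rule order_trans[OF norm_triangle_ineq add_mono[OF b1 b2]])
    then have "cmod (?J (N + Suc j) - ?J N) \<le> 2 * D * r ^ N * r ^ j + 2 * D * r ^ N * (1 - r ^ j) / (1 - r)"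
      using Suc norm_triangle_ineq[of "?J (Suc (N + j)) - ?J (N + j)" "?J (N + j) - ?J N"] by (simp add: power_add)
    also have "\<dots> = 2 * D * r ^ N * (1 - r ^ Suc j) / (1 - r)" using r by (simp add: field_simps)
    finally show ?case .
  qed simp
  have le: "cmod (?J (N + j) - ?J N) \<le> 2 * D * r ^ N / (1 - r)" for j
  proof -
    have "2 * D * r ^ N * (1 - r ^ j) / (1 - r) \<le> 2 * D * r ^ N * 1 / (1 - r)"
      using D r by (intro divide_right_mono mult_left_mono) auto
    then show ?thesis using step[of j] by simp
  qed
  have F: "integrable lborel (\<lambda>\<xi>. psymb m y b c \<xi> * g \<xi>)" by (rule integrable_psymb_mult[OF m c g])
  have "?J \<longlonglongrightarrow> (\<integral>\<xi>. psymb m y b c \<xi> * g \<xi> \<partial>lborel)"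
    unfolding cutoff_def
  proof (rule integral_dominated_convergence[where w="\<lambda>\<xi>. cmod (psymb m y b c \<xi> * g \<xi>)"])
    show "AE \<xi> in lborel. (\<lambda>N. indicator {- (2 ^ N)..2 ^ N} \<xi> *\<^sub>R (psymb m y b c \<xi> * g \<xi>)) \<longlonglongrightarrow> psymb m y b c \<xi> * g \<xi>"
    proof (rule AE_I2)
      fix \<xi> :: real
      obtain n where n: "\<bar>\<xi>\<bar> < 2 ^ n" using real_arch_pow[of 2 "\<bar>\<xi>\<bar>"] by auto
      have "\<forall>\<^sub>F N in sequentially. indicator {- (2 ^ N)..2 ^ N} \<xi> *\<^sub>R (psymb m y b c \<xi> * g \<xi>) = psymb m y b c \<xi> * g \<xi>"
        using eventually_ge_at_top[of n]
      proof eventually_elim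
        case (elim N)
        have "(2::real) ^ n \<le> 2 ^ N" using elim by (intro power_increasing) auto
        then have "\<bar>\<xi>\<bar> \<le> 2 ^ N" using n by linarith
        then have "\<xi> \<in> {- (2 ^ N)..2 ^ N}" by (simp add: abs_le_iff)
        then show ?case by simp
      qed
      then show "(\<lambda>N. indicator {- (2 ^ N)..2 ^ N} \<xi> *\<^sub>R (psymb m y b c \<xi> * g \<xi>)) \<longlonglongrightarrow> psymb m y b c \<xi> * g \<xi>"
        by (rule tendsto_eventually)
    qed
    show "integrable lborel (\<lambda>\<xi>. cmod (psymb m y b c \<xi> * g \<xi>))" by (rule integrable_norm[OF F])
    show "AE \<xi> in lborel. cmod (indicator {- (2 ^ N)..2 ^ N} \<xi> *\<^sub>R (psymb m y b c \<xi> * g \<xi>)) \<le> cmod (psymb m y b c \<xi> * g \<xi>)" for N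
      by (intro AE_I2) (auto simp: indicator_def)
  qed measurable
  then have "(\<lambda>j. ?J (j + N)) \<longlonglongrightarrow> (\<integral>\<xi>. psymb m y b c \<xi> * g \<xi> \<partial>lborel)" by (rule LIMSEQ_ignore_initial_segment)
  then have "(\<lambda>j. cmod (?J (j + N) - ?J N)) \<longlonglongrightarrow> cmod ((\<integral>\<xi>. psymb m y b c \<xi> * g \<xi> \<partial>lborel) - ?J N)"
    by (intro tendsto_intros)
  then show ?thesis by (rule LIMSEQ_le_const2) (use le in \<open>auto simp: add.commute\<close>)
qed

text \<open>Dominated convergence on a bounded frequency band. The limit is the truncated inversion
  integral at \<open>x\<close>, the same for the flow along the curve and for the dissipative one,
  so it cancels in their difference.\<close>

lemma cutoff_difference_tendsto:
  fixes y b c :: "real \<Rightarrow> real"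
  assumes g: "L2_fun g" and y: "(y \<longlongrightarrow> x) (at_right 0)" and b: "(b \<longlongrightarrow> 0) (at_right 0)" and c: "(c \<longlongrightarrow> 0) (at_right 0)"
    and c0: "\<And>t. c t \<ge> 0"
  shows "((\<lambda>t. cutoff m g (y t) (b t) (c t) N) \<longlongrightarrow> cutoff m g x 0 0 N) (at_right 0)"
  unfolding tendsto_at_iff_sequentially comp_def
proof (intro allI impI)
  fix X assume X: "\<forall>i. X i \<in> {0<..} - {0::real}" "X \<longlonglongrightarrow> 0"
  have [measurable]: "g \<in> borel_measurable borel" by (rule L2_fun_measurable[OF g])
  have XL: "filterlim X (at_right 0) sequentially" proof -
    have "X i > 0" "X i \<noteq> 0" for i using X(1) by (auto dest: spec[of _ i])
    then show ?thesis using X(2) by (simp add: filterlim_at)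
  qed
  have lims: "(\<lambda>n. y (X n)) \<longlonglongrightarrow> x" "(\<lambda>n. b (X n)) \<longlonglongrightarrow> 0" "(\<lambda>n. c (X n)) \<longlonglongrightarrow> 0"
    by (rule filterlim_compose[OF y XL] filterlim_compose[OF b XL] filterlim_compose[OF c XL])+
  let ?E = "{- (2 ^ N)..2 ^ N :: real}"
  have gi: "integrable lborel (\<lambda>\<xi>. indicator ?E \<xi> *\<^sub>R g \<xi>)"
    by (rule restrict_L2[OF g]) (auto simp: emeasure_lborel_Icc_eq)
  show "(\<lambda>n. cutoff m g (y (X n)) (b (X n)) (c (X n)) N) \<longlonglongrightarrow> cutoff m g x 0 0 N"
    unfolding cutoff_def
  proof (rule integral_dominated_convergence[where w="\<lambda>\<xi>. cmod (indicator ?E \<xi> *\<^sub>R g \<xi>)"])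
    show "AE \<xi> in lborel. (\<lambda>n. indicator ?E \<xi> *\<^sub>R (psymb m (y (X n)) (b (X n)) (c (X n)) \<xi> * g \<xi>)) \<longlonglongrightarrow> indicator ?E \<xi> *\<^sub>R (psymb m x 0 0 \<xi> * g \<xi>)"
    proof (rule AE_I2)
      fix \<xi> :: real
      have "(\<lambda>n. cis (y (X n) * \<xi> + b (X n) * \<bar>\<xi>\<bar> powr m)) \<longlonglongrightarrow> cis (x * \<xi> + 0 * \<bar>\<xi>\<bar> powr m)"
        by (rule isCont_tendsto_compose[OF isCont_cis]) (intro tendsto_intros lims)
      then show "(\<lambda>n. indicator ?E \<xi> *\<^sub>R (psymb m (y (X n)) (b (X n)) (c (X n)) \<xi> * g \<xi>)) \<longlonglongrightarrow> indicator ?E \<xi> *\<^sub>R (psymb m x 0 0 \<xi> * g \<xi>)"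
        unfolding psymb_def by (intro tendsto_intros lims)
    qed
    show "integrable lborel (\<lambda>\<xi>. cmod (indicator ?E \<xi> *\<^sub>R g \<xi>))" by (rule integrable_norm[OF gi])
    show "AE \<xi> in lborel. cmod (indicator ?E \<xi> *\<^sub>R (psymb m (y (X n)) (b (X n)) (c (X n)) \<xi> * g \<xi>)) \<le> cmod (indicator ?E \<xi> *\<^sub>R g \<xi>)" for n
    proof (rule AE_I2)
      fix \<xi> :: real
      have "cmod (psymb m (y (X n)) (b (X n)) (c (X n)) \<xi>) * cmod (g \<xi>) \<le> 1 * cmod (g \<xi>)"
        by (intro mult_right_mono psymb_le_1 c0) auto
      then show "cmod (indicator ?E \<xi> *\<^sub>R (psymb m (y (X n)) (b (X n)) (c (X n)) \<xi> * g \<xi>)) \<le> cmod (indicator ?E \<xi> *\<^sub>R g \<xi>)"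
        by (auto simp: indicator_def norm_mult)
    qed
  qed measurable
qed

text \<open>Both flows have tails that are small uniformly in time, and their truncations share a
  limit. Hence their difference tends to 0, and the flow along the curve inherits the limit of the
  dissipative one. The gap between \<sigma> and \<open>s\<close> pays for the geometric ratio
  \<open>r\<close>.\<close>

lemma convergence_large_\<gamma>:
  assumes m: "0 < m" "m < 1" and g: "m * \<alpha> < \<gamma>" and al: "1/2 < \<alpha>" "\<alpha> \<le> 1"
    and adm: "admissible \<alpha> \<Gamma>" and s: "s > s_crit m \<alpha> \<gamma>" and fg: "fourier_L2 f g"
    and w: "integrable lborel (\<lambda>\<xi>. (1 + \<xi>\<^sup>2) powr s * (cmod (g \<xi>))\<^sup>2)"
  shows "converges_ae m \<gamma> \<Gamma> f"
proof -
  have g0: "\<gamma> > 0" using g m al mult_pos_pos[of m \<alpha>] by linarith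
  have sc: "s_crit m \<alpha> \<gamma> > 0" by (rule s_crit_pos[OF m al g])
  obtain \<sigma> where \<sigma>: "s_crit m \<alpha> \<gamma> < \<sigma>" "\<sigma> < s" using dense[OF s] by blast
  have \<sigma>0: "\<sigma> > 0" using sc \<sigma> by simp
  have s0: "s \<ge> 0" using \<sigma> \<sigma>0 by simp
  define r where "r = (2::real) powr (- (s - \<sigma>) / 2)"
  have r: "0 \<le> r" "r < 1" using \<sigma> by (auto simp: r_def intro: powr_less_one)
  have gL: "L2_fun g" using fg by (simp add: fourier_L2_iff)
  have [measurable]: "g \<in> borel_measurable borel" by (rule L2_fun_measurable[OF gL])
  let ?gn = "\<lambda>\<xi>. g (- \<xi>)"
  have gnL: "L2_fun ?gn" using integrable_neg[of "\<lambda>\<xi>. (cmod (g \<xi>))\<^sup>2"] gL by (simp add: L2_fun_def)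
  have wn: "integrable lborel (\<lambda>\<xi>. (1 + \<xi>\<^sup>2) powr s * (cmod (?gn \<xi>))\<^sup>2)" using integrable_neg[OF w] by simp
  obtain C p p' where C: "C \<ge> 0" "0 \<le> p" "p < 1" "0 \<le> p'" "p' < 1" and
    K: "\<And>L x x' t t' \<epsilon>. \<lbrakk>L \<ge> 1; x \<noteq> x'; t \<in> {0..1}; t' \<in> {0..1}; \<bar>\<epsilon>\<bar> = 1\<rbrakk> \<Longrightarrow>
       cmod (integral {L..2*L} (osc m (\<epsilon> * \<Gamma> x t - \<epsilon> * \<Gamma> x' t') (t - t') (t powr \<gamma> + t' powr \<gamma>)))
         \<le> C * L powr (2 * \<sigma>) * (\<bar>x - x'\<bar> powr (- p) + \<bar>x - x'\<bar> powr (- p'))"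
    using kernel_bound[OF m g0 al \<sigma>0 \<sigma>(1) adm] by blast
  obtain C0 q where C0: "C0 \<ge> 0" "0 \<le> q" "q < 1" and
    K0: "\<And>L a b c d. \<lbrakk>L \<ge> 1; 0 < d; 0 \<le> c; 1 * d \<le> \<bar>a\<bar> - \<bar>b\<bar>\<rbrakk> \<Longrightarrow>
       cmod (integral {L..2*L} (osc m a b c)) \<le> C0 * L powr (2 * \<sigma>) * d powr (- q)"
    using kernel_far[OF m \<sigma>0, of 1] by auto
  have ct: "continuous_on {0..1} (\<lambda>t::real. t powr \<gamma>)"
    using g0 by (intro continuous_on_powr' continuous_intros) auto
  have acx: "continuous_on UNIV (\<lambda>x. \<epsilon> * \<Gamma> x t)" if "t \<in> {0..1}" for t \<epsilon> :: real
    using that by (intro continuous_intros admissible_continuous_x[OF adm]) auto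
  have act: "continuous_on {0..1} (\<lambda>t. \<epsilon> * \<Gamma> x t)" for x \<epsilon> :: real
    by (intro continuous_intros continuous_on_subset[OF admissible_continuous_t[OF adm]]) auto
  have bound1: "AE x in lborel. \<exists>D\<ge>0. \<forall>k. \<forall>t\<in>{0..1}. cmod (piece m G (2 ^ k) (\<epsilon> * \<Gamma> x t) t (t powr \<gamma>)) \<le> D * r ^ k"
    if "\<bar>\<epsilon>\<bar> = 1" "L2_fun G" "integrable lborel (\<lambda>\<xi>. (1 + \<xi>\<^sup>2) powr s * (cmod (G \<xi>))\<^sup>2)" for \<epsilon> G
    unfolding r_def
    by (rule dyadic_bound[where C=C and p=p and p'=p', OF acx act continuous_on_id ct _ _ C that(2,3) \<sigma>(2) s0])
       (use K that(1) in auto)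
  \<comment> \<open>Without dispersion and curve the linear coefficients differ by exactly
    \<open>|x - y|\<close>, so the far estimate with \<open>k = 1\<close> applies to all pairs of
    points.\<close>
  have bound0: "AE x in lborel. \<exists>D\<ge>0. \<forall>k. \<forall>t\<in>{0..1}. cmod (piece m G (2 ^ k) (\<epsilon> * x) 0 (t powr \<gamma>)) \<le> D * r ^ k"
    if e: "\<bar>\<epsilon>\<bar> = 1" and "L2_fun G" "integrable lborel (\<lambda>\<xi>. (1 + \<xi>\<^sup>2) powr s * (cmod (G \<xi>))\<^sup>2)" for \<epsilon> G
    unfolding r_def
  proof (rule dyadic_bound[where C=C0 and p=q and p'=q, OF _ _ continuous_on_const ct _ _ C0(1) C0(2,3) C0(2,3) that(2,3) \<sigma>(2) s0])
    show "continuous_on UNIV (\<lambda>x. \<epsilon> * x)" "continuous_on {0..1} (\<lambda>t. \<epsilon> * x)" for x by (intro continuous_intros)+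
    fix L x y t t' :: real assume h: "L \<ge> 1" "x \<noteq> y" "t \<in> {0..1}" "t' \<in> {0..1}"
    have "cmod (integral {L..2 * L} (osc m (\<epsilon> * x - \<epsilon> * y) (0 - 0) (t powr \<gamma> + t' powr \<gamma>))) \<le> C0 * L powr (2 * \<sigma>) * \<bar>x - y\<bar> powr (- q)"
    proof (rule K0)
      show "1 * \<bar>x - y\<bar> \<le> \<bar>\<epsilon> * x - \<epsilon> * y\<bar> - \<bar>0 - 0\<bar>" using e by (simp add: abs_mult flip: right_diff_distrib)
    qed (use h in auto)
    also have "\<dots> \<le> C0 * L powr (2 * \<sigma>) * (\<bar>x - y\<bar> powr (- q) + \<bar>x - y\<bar> powr (- q))"
      using C0 by (intro mult_left_mono) auto
    finally show "cmod (integral {L..2 * L} (osc m (\<epsilon> * x - \<epsilon> * y) (0 - 0) (t powr \<gamma> + t' powr \<gamma>)))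
       \<le> C0 * L powr (2 * \<sigma>) * (\<bar>x - y\<bar> powr (- q) + \<bar>x - y\<bar> powr (- q))" .
  qed auto
  have em: "\<bar>- 1 :: real\<bar> = 1" by simp
  show ?thesis
    unfolding converges_ae_def
    using bound1[OF abs_one gL w] bound1[OF em gnL wn] bound0[OF abs_one gL w] bound0[OF em gnL wn]
      dissipative_convergence[OF m g0 fg]
  proof eventually_elim
    case (elim x)
    obtain D1 where D1: "D1 \<ge> 0" "\<And>k t. t \<in> {0..1} \<Longrightarrow> cmod (piece m g (2 ^ k) (\<Gamma> x t) t (t powr \<gamma>)) \<le> D1 * r ^ k" using elim(1) by auto
    obtain D2 where D2: "D2 \<ge> 0" "\<And>k t. t \<in> {0..1} \<Longrightarrow> cmod (piece m ?gn (2 ^ k) (- \<Gamma> x t) t (t powr \<gamma>)) \<le> D2 * r ^ k" using elim(2) by auto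
    obtain D3 where D3: "D3 \<ge> 0" "\<And>k t. t \<in> {0..1} \<Longrightarrow> cmod (piece m g (2 ^ k) x 0 (t powr \<gamma>)) \<le> D3 * r ^ k" using elim(3) by auto
    obtain D4 where D4: "D4 \<ge> 0" "\<And>k t. t \<in> {0..1} \<Longrightarrow> cmod (piece m ?gn (2 ^ k) (- x) 0 (t powr \<gamma>)) \<le> D4 * r ^ k" using elim(4) by auto
    define D where "D = D1 + D2 + D3 + D4"
    have up: "X \<le> D * r ^ k" if "X \<le> D' * r ^ k" "D' \<le> D" for X D' k
      using that r by (meson mult_right_mono order_trans zero_le_power)
    have Dle: "D1 \<le> D" "D2 \<le> D" "D3 \<le> D" "D4 \<le> D" using D1(1) D2(1) D3(1) D4(1) by (auto simp: D_def)
    let ?P1 = "\<lambda>t. \<integral>\<xi>. psymb m (\<Gamma> x t) t (t powr \<gamma>) \<xi> * g \<xi> \<partial>lborel"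
    let ?P0 = "\<lambda>t. \<integral>\<xi>. psymb m x 0 (t powr \<gamma>) \<xi> * g \<xi> \<partial>lborel"
    let ?J1 = "\<lambda>N t. cutoff m g (\<Gamma> x t) t (t powr \<gamma>) N"
    let ?J0 = "\<lambda>N t. cutoff m g x 0 (t powr \<gamma>) N"
    have t1: "cmod (?P1 t - ?J1 N t) \<le> 2 * D * r ^ N / (1 - r)" and t0: "cmod (?P0 t - ?J0 N t) \<le> 2 * D * r ^ N / (1 - r)"
      if t: "t \<in> {0<..1}" for t N
    proof -
      have t': "t \<in> {0..1}" "t powr \<gamma> > 0" using t by auto
      show "cmod (?P1 t - ?J1 N t) \<le> 2 * D * r ^ N / (1 - r)"
        by (rule cutoff_tail[OF m(1) t'(2) gL r up[OF D1(2)[OF t'(1)] Dle(1)] up[OF D2(2)[OF t'(1)] Dle(2)]])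
      show "cmod (?P0 t - ?J0 N t) \<le> 2 * D * r ^ N / (1 - r)"
        by (rule cutoff_tail[OF m(1) t'(2) gL r up[OF D3(2)[OF t'(1)] Dle(3)] up[OF D4(2)[OF t'(1)] Dle(4)]])
    qed
    have \<Gamma>0: "((\<lambda>t. \<Gamma> x t) \<longlongrightarrow> x) (at_right 0)"
    proof -
      have "((\<lambda>t. \<Gamma> x t) \<longlongrightarrow> \<Gamma> x 0) (at 0 within {-1..1})"
        using admissible_continuous_t[OF adm, of x] by (auto simp: continuous_on_def)
      then have "((\<lambda>t. \<Gamma> x t) \<longlongrightarrow> \<Gamma> x 0) (at 0 within {0..1})" by (rule tendsto_within_subset) auto
      moreover have "at 0 within {0..1} = at_right (0::real)" by (rule at_within_Icc_at_right) simp
      moreover have "\<Gamma> x 0 = x" using adm by (simp add: admissible_def)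
      ultimately show ?thesis by simp
    qed
    have tg: "((\<lambda>t. t powr \<gamma>) \<longlongrightarrow> 0) (at_right 0)"
      using filterlim_powr_at_right_0[OF g0] by (simp add: filterlim_at)
    have Jlim: "((\<lambda>t. ?J1 N t - ?J0 N t) \<longlongrightarrow> 0) (at_right 0)" for N
    proof -
      have "((\<lambda>t. ?J1 N t - ?J0 N t) \<longlongrightarrow> cutoff m g x 0 0 N - cutoff m g x 0 0 N) (at_right 0)"
        by (intro tendsto_diff cutoff_difference_tendsto[OF gL] \<Gamma>0 tg tendsto_const tendsto_ident_at) auto
      then show ?thesis by simp
    qed
    have small: "\<forall>\<^sub>F t in at_right 0. t \<in> {0<..<1::real}" by (rule eventually_at_right_real) simp
    have "((\<lambda>t. ?P1 t - ?P0 t) \<longlongrightarrow> 0) (at_right 0)"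
    proof (rule tendstoI)
      fix e :: real assume e: "e > 0"
      have "(\<lambda>N. 2 * D * r ^ N / (1 - r)) \<longlonglongrightarrow> 2 * D * 0 / (1 - r)"
        using r by (intro tendsto_intros LIMSEQ_power_zero) auto
      then have "\<forall>\<^sub>F N in sequentially. 2 * D * r ^ N / (1 - r) < e / 3" using e by (intro order_tendstoD(2)) auto
      then obtain N where N: "2 * D * r ^ N / (1 - r) < e / 3" by (auto dest: eventually_happens)
      have "\<forall>\<^sub>F t in at_right 0. dist (?J1 N t - ?J0 N t) 0 < e / 3" using Jlim[of N] e by (intro tendstoD) auto
      with small show "\<forall>\<^sub>F t in at_right 0. dist (?P1 t - ?P0 t) 0 < e"
      proof eventually_elim
        case (elim t)
        then have t: "t \<in> {0<..1}" by auto
        have "cmod (a - b) \<le> cmod (a - a') + cmod (a' - b') + cmod (b - b')" for a b a' b'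
          using norm_triangle_ineq[of "(a - a') + (a' - b')" "b' - b"] norm_triangle_ineq[of "a - a'" "a' - b'"] by (simp add: norm_minus_commute)
        from this[of "?P1 t" "?P0 t" "?J1 N t" "?J0 N t"]
        have "cmod (?P1 t - ?P0 t) < e / 3 + e / 3 + e / 3"
          using t1[OF t, of N] t0[OF t, of N] N elim by (simp only: dist_norm diff_zero)
        then show ?case by (simp add: dist_norm)
      qed
    qed
    then have "((\<lambda>t. complex_of_real (1 / (2 * pi)) * (?P1 t - ?P0 t)) \<longlongrightarrow> complex_of_real (1 / (2 * pi)) * 0) (at_right 0)"
      by (intro tendsto_intros)
    moreover have "((\<lambda>t. complex_of_real (1 / (2 * pi)) * ?P0 t) \<longlongrightarrow> f x) (at_right 0)"
    proof -
      have "cis (x * \<xi>) * complex_of_real (exp (- (t powr \<gamma>) * \<bar>\<xi>\<bar> powr m)) * g \<xi> = psymb m x 0 (t powr \<gamma>) \<xi> * g \<xi>" for \<xi> t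
        by (simp add: psymb_def scaleR_conv_of_real)
      then show ?thesis using elim(5) by (simp only:)
    qed
    ultimately have "((\<lambda>t. complex_of_real (1 / (2 * pi)) * (?P1 t - ?P0 t) + complex_of_real (1 / (2 * pi)) * ?P0 t) \<longlongrightarrow> complex_of_real (1 / (2 * pi)) * 0 + f x) (at_right 0)"
      by (rule tendsto_add)
    moreover have "complex_of_real (1 / (2 * pi)) * (?P1 t - ?P0 t) + complex_of_real (1 / (2 * pi)) * ?P0 t = Pop m \<gamma> f (\<Gamma> x t) t" for t
    proof -
      have "cis (\<Gamma> x t * \<xi> + t * \<bar>\<xi>\<bar> powr m) * complex_of_real (exp (- (t powr \<gamma>) * \<bar>\<xi>\<bar> powr m)) * g \<xi> = psymb m (\<Gamma> x t) t (t powr \<gamma>) \<xi> * g \<xi>" for \<xi>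
        by (simp add: psymb_def scaleR_conv_of_real)
      then show ?thesis unfolding Pop_eq[OF fg] by (simp only: right_diff_distrib diff_add_cancel)
    qed
    ultimately show ?case by simp
  qed
qed

theorem convergence:
  assumes m: "0 < m" "m < 1" and g: "0 < \<gamma>" and al: "1/2 < \<alpha>" "\<alpha> \<le> 1"
    and adm: "admissible \<alpha> \<Gamma>" and s: "s > s_crit m \<alpha> \<gamma>" and f: "sobolev s f"
  shows "converges_ae m \<gamma> \<Gamma> f"
proof -
  obtain g where fg: "fourier_L2 f g" and w: "integrable lborel (\<lambda>\<xi>. (1 + \<xi>\<^sup>2) powr s * (cmod (g \<xi>))\<^sup>2)"
    using f by (auto simp: sobolev_def)
  show ?thesis
  proof (cases "\<gamma> \<le> m * \<alpha>")
    case True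
    then show ?thesis using convergence_small_\<gamma>[OF m assms(3) True _ al(2) adm fg] al by simp
  next
    case False
    then show ?thesis using convergence_large_\<gamma>[OF m _ al adm s fg w] by simp
  qed
qed

section \<open>Focusing data\<close>

text \<open>Two mean value inequalities replace a Taylor formula. The constant is 1 because
  \<open>m * (1 - m) \<le> 1 / 4\<close> compensates the factor
  \<open>2 powr (2 - m) \<le> 4\<close> lost in passing from points above \<open>L / 2\<close> to
  \<open>L\<close>.\<close>

lemma powr_taylor_bound:
  fixes m L w \<xi> :: real
  assumes m: "0 < m" "m < 1" and L: "L > 0" and w: "0 < w" "w \<le> L / 2" and x: "\<bar>\<xi> - L\<bar> \<le> w"
  shows "\<bar>\<xi> powr m - L powr m - m * L powr (m - 1) * (\<xi> - L)\<bar> \<le> L powr (m - 2) * w\<^sup>2"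
proof -
  let ?S = "{L - w..L + w}"
  have pos: "z \<ge> L / 2" "z > 0" if "z \<in> ?S" for z using that w L by auto
  have half: "z powr (m - 2) \<le> 4 * L powr (m - 2)" if z: "z \<in> ?S" for z
  proof -
    have "z powr (m - 2) \<le> (L / 2) powr (m - 2)" using pos[OF z] L m by (intro powr_mono2') auto
    also have "(L / 2) powr (m - 2) = 2 powr (2 - m) * L powr (m - 2)"
      using L by (simp add: powr_divide powr_diff field_simps)
    also have "\<dots> \<le> 2 powr 2 * L powr (m - 2)" using m by (intro mult_right_mono powr_mono) auto
    finally show ?thesis by simp
  qed
  have mm: "m * (1 - m) \<le> 1 / 4"
    using zero_le_power2[of "m - 1/2"] by (simp add: power2_eq_square algebra_simps)
  have 1: "\<bar>m * z powr (m - 1) - m * L powr (m - 1)\<bar> \<le> L powr (m - 2) * w" if z: "z \<in> ?S" for z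
  proof -
    have "norm (m * z powr (m - 1) - m * L powr (m - 1)) \<le> L powr (m - 2) * norm (z - L)"
    proof (rule field_differentiable_bound[where S="?S"])
      fix \<zeta> assume \<zeta>: "\<zeta> \<in> ?S"
      show "((\<lambda>z. m * z powr (m - 1)) has_field_derivative m * ((m - 1) * \<zeta> powr (m - 1 - 1))) (at \<zeta> within ?S)"
        by (rule has_field_derivative_at_within) (intro DERIV_cmult has_real_derivative_powr pos[OF \<zeta>])
      have "norm (m * ((m - 1) * \<zeta> powr (m - 1 - 1))) = (m * (1 - m)) * \<zeta> powr (m - 2)"
        using m by (simp add: abs_mult)
      also have "\<dots> \<le> 1 / 4 * (4 * L powr (m - 2))"
        using m by (intro mult_mono mm half[OF \<zeta>]) auto
      finally show "norm (m * ((m - 1) * \<zeta> powr (m - 1 - 1))) \<le> L powr (m - 2)" by simp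
    qed (use z w in auto)
    also have "\<dots> \<le> L powr (m - 2) * w" using z by (intro mult_left_mono) auto
    finally show ?thesis by simp
  qed
  let ?f = "\<lambda>z. z powr m - L powr m - m * L powr (m - 1) * (z - L)"
  have "norm (?f \<xi> - ?f L) \<le> (L powr (m - 2) * w) * norm (\<xi> - L)"
  proof (rule field_differentiable_bound[where S="?S"])
    fix \<zeta> assume \<zeta>: "\<zeta> \<in> ?S"
    show "(?f has_field_derivative m * \<zeta> powr (m - 1) - m * L powr (m - 1)) (at \<zeta> within ?S)"
      by (rule has_field_derivative_at_within) (use pos[OF \<zeta>] in \<open>auto intro!: derivative_eq_intros\<close>)
    show "norm (m * \<zeta> powr (m - 1) - m * L powr (m - 1)) \<le> L powr (m - 2) * w" using 1[OF \<zeta>] by simp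
  qed (use x w in auto)
  also have "\<dots> \<le> (L powr (m - 2) * w) * w" using x w by (intro mult_left_mono) auto
  finally show ?thesis by (simp add: power2_eq_square mult.assoc)
qed

text \<open>The linear coefficient cancels the group velocity at \<open>L\<close>, so the phase
  differs from its value at \<open>L\<close> by at most 1/4 and the cosine of the difference is at
  least 1/2. On the window \<open>\<xi> \<le> 2 * L\<close>, hence the damping is at least
  \<open>exp (-2)\<close>. A real part of at least \<open>exp (-2) / 2\<close> is integrated over
  length \<open>2 * w\<close>.\<close>

lemma focused_lower_bound:
  fixes m L w t c :: real
  assumes m: "0 < m" "m < 1" and L: "L > 0" and w: "0 < w" "w \<le> L / 2" and t: "t \<ge> 0" "t * (L powr (m - 2) * w\<^sup>2) \<le> 1 / 4"
    and c: "c \<ge> 0" "c * L powr m \<le> 1"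
  shows "exp (-2) * w \<le> cmod (integral {L - w..L + w} (osc m (- (t * (m * L powr (m - 1)))) t c))"
proof -
  let ?a = "- (t * (m * L powr (m - 1)))"
  let ?f = "osc m ?a t c"
  define \<phi> where "\<phi> \<xi> = ?a * \<xi> + t * \<xi> powr m" for \<xi>
  have fi: "?f integrable_on {L - w..L + w}"
    using w L by (intro integrable_continuous_interval continuous_on_osc) auto
  have bl: "bounded_linear (\<lambda>z. Re (cis (- \<phi> L) * z))"
    by (intro bounded_linear_compose[OF bounded_linear_Re bounded_linear_mult_right])
  have lin: "integral {L - w..L + w} (\<lambda>\<xi>. Re (cis (- \<phi> L) * ?f \<xi>)) = Re (cis (- \<phi> L) * integral {L - w..L + w} ?f)"
    "(\<lambda>\<xi>. Re (cis (- \<phi> L) * ?f \<xi>)) integrable_on {L - w..L + w}"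
    using integral_linear[OF fi bl] integrable_linear[OF fi bl] by (auto simp: o_def)
  have low: "exp (-2) / 2 \<le> Re (cis (- \<phi> L) * ?f \<xi>)" if x: "\<xi> \<in> {L - w..L + w}" for \<xi>
  proof -
    have xi: "\<bar>\<xi> - L\<bar> \<le> w" using x by auto
    have "\<phi> \<xi> - \<phi> L = t * (\<xi> powr m - L powr m - m * L powr (m - 1) * (\<xi> - L))"
      by (simp add: \<phi>_def algebra_simps)
    then have "\<bar>\<phi> \<xi> - \<phi> L\<bar> = t * \<bar>\<xi> powr m - L powr m - m * L powr (m - 1) * (\<xi> - L)\<bar>" using t by (simp add: abs_mult)
    also have "\<dots> \<le> t * (L powr (m - 2) * w\<^sup>2)" using t by (intro mult_left_mono powr_taylor_bound m L w xi) auto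
    also have "\<dots> \<le> 1 / 4" by (rule t)
    finally have d: "\<bar>\<phi> \<xi> - \<phi> L\<bar> \<le> 1 / 4" .
    have "cos (pi / 3) \<le> cos \<bar>\<phi> \<xi> - \<phi> L\<bar>" using d pi_gt3 by (intro cos_monotone_0_pi_le) auto
    then have cs: "1 / 2 \<le> cos (\<phi> \<xi> - \<phi> L)" by (simp add: cos_60)
    have "\<xi> powr m \<le> (2 * L) powr m" using x w L m by (intro powr_mono2) auto
    also have "\<dots> = 2 powr m * L powr m" using L by (simp add: powr_mult)
    also have "\<dots> \<le> 2 powr 1 * L powr m" using m by (intro mult_right_mono powr_mono) auto
    finally have "c * \<xi> powr m \<le> c * (2 powr 1 * L powr m)" using c by (intro mult_left_mono) auto
    also have "\<dots> \<le> 2" using c by simp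
    finally have ex: "exp (-2) \<le> exp (- c * \<xi> powr m)" by simp
    have "cis (- \<phi> L) * ?f \<xi> = exp (- c * \<xi> powr m) *\<^sub>R (cis (- \<phi> L) * cis (\<phi> \<xi>))"
      by (simp add: osc_def \<phi>_def)
    also have "cis (- \<phi> L) * cis (\<phi> \<xi>) = cis (\<phi> \<xi> - \<phi> L)" by (simp add: cis_mult)
    finally have e: "Re (cis (- \<phi> L) * ?f \<xi>) = exp (- c * \<xi> powr m) * cos (\<phi> \<xi> - \<phi> L)" by simp
    have "exp (-2) * (1 / 2) \<le> exp (- c * \<xi> powr m) * cos (\<phi> \<xi> - \<phi> L)" using ex cs by (intro mult_mono) auto
    then show ?thesis unfolding e by simp
  qed
  have "exp (-2) * w = integral {L - w..L + w} (\<lambda>\<xi>. exp (-2) / 2)" using w by simp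
  also have "\<dots> \<le> integral {L - w..L + w} (\<lambda>\<xi>. Re (cis (- \<phi> L) * ?f \<xi>))"
    by (rule integral_le) (use lin(2) low in auto)
  also have "\<dots> \<le> cmod (cis (- \<phi> L) * integral {L - w..L + w} ?f)" unfolding lin(1) by (rule complex_Re_le_cmod)
  also have "\<dots> = cmod (integral {L - w..L + w} ?f)" by (simp add: norm_mult)
  finally show ?thesis .
qed

section \<open>Superposition of focusing wave packets\<close>

lemma sum_inverse_dist_le_harm:
  assumes "l0 < N"
  shows "(\<Sum>l\<in>{..<N} - {l0}. 1 / \<bar>real l - real l0\<bar>) \<le> 2 * harm N"
proof -
  have split: "{..<N} - {l0} = {..<l0} \<union> {l0<..<N}" using assms by auto
  have "(\<Sum>l\<in>{..<N} - {l0}. 1 / \<bar>real l - real l0\<bar>) = (\<Sum>l<l0. 1 / \<bar>real l - real l0\<bar>) + (\<Sum>l\<in>{l0<..<N}. 1 / \<bar>real l - real l0\<bar>)"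
    unfolding split by (rule sum.union_disjoint) auto
  also have "(\<Sum>l<l0. 1 / \<bar>real l - real l0\<bar>) = (\<Sum>j=1..l0. inverse (real j))"
    by (rule sum.reindex_bij_witness[where i="\<lambda>j. l0 - j" and j="\<lambda>l. l0 - l"]) (auto simp: of_nat_diff inverse_eq_divide)
  also have "\<dots> \<le> harm N" unfolding harm_def using assms by (intro sum_mono2) auto
  also have "(\<Sum>l\<in>{l0<..<N}. 1 / \<bar>real l - real l0\<bar>) = (\<Sum>j\<in>{1..<N - l0}. inverse (real j))"
    by (rule sum.reindex_bij_witness[where i="\<lambda>j. l0 + j" and j="\<lambda>l. l - l0"]) (auto simp: of_nat_diff inverse_eq_divide)
  also have "\<dots> \<le> harm N" unfolding harm_def using assms by (intro sum_mono2) auto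
  finally show ?thesis by simp
qed

text \<open>The Fourier transform of \<open>N\<close> unit point masses at \<open>0\<close>,
  \<open>\<rho>\<close>, \<open>2 * \<rho>\<close> and so on.\<close>

definition comb :: "real \<Rightarrow> nat \<Rightarrow> real \<Rightarrow> complex" where
  "comb \<rho> N \<xi> = (\<Sum>l<N. cis (- (real l * \<rho> * \<xi>)))"

lemma comb_measurable [measurable]: "comb \<rho> N \<in> borel_measurable borel"
  unfolding comb_def by measurable

lemma norm_comb_le: "cmod (comb \<rho> N \<xi>) \<le> real N"
  unfolding comb_def by (rule order_trans[OF norm_sum]) simp

lemma continuous_on_comb: "continuous_on S (comb \<rho> N)"
  unfolding comb_def by (intro continuous_intros)

lemma osc_cis: "osc m a b c \<xi> * cis (- (s * \<xi>)) = osc m (a - s) b c \<xi>"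
  by (simp add: osc_def cis_mult algebra_simps)

lemma osc_comb_integral:
  assumes "0 < p"
  shows "integral {p..q} (\<lambda>\<xi>. osc m a b c \<xi> * comb \<rho> N \<xi>) = (\<Sum>l<N. integral {p..q} (osc m (a - real l * \<rho>) b c))"
proof -
  have "(\<lambda>\<xi>. osc m a b c \<xi> * comb \<rho> N \<xi>) = (\<lambda>\<xi>. \<Sum>l<N. osc m (a - real l * \<rho>) b c \<xi>)"
    by (rule ext) (simp only: comb_def sum_distrib_left osc_cis)
  moreover have "osc m a b c integrable_on {p..q}" for a
    using assms by (intro integrable_continuous_interval continuous_on_osc) auto
  ultimately show ?thesis by (simp add: Henstock_Kurzweil_Integration.integral_sum)
qed

text \<open>Only the tooth \<open>l0\<close> is in focus. For the others the phase derivative is at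
  least \<open>|l - l0| * \<rho> / 2\<close>, because the group velocity varies by at most
  \<open>\<rho> / 2\<close> over the window; their contributions sum to at most
  \<open>20 * harm N / \<rho>\<close>. The constant \<open>40 * exp 2\<close> makes this at most
  half of the main term.\<close>

lemma comb_focus:
  fixes m L w t c \<rho> :: real
  assumes m: "0 < m" "m < 1" and L: "L > 0" and w: "0 < w" "w \<le> L / 2" and t: "t \<ge> 0" "t * (L powr (m - 2) * w\<^sup>2) \<le> 1 / 4"
    and c: "c \<ge> 0" "c * L powr m \<le> 1" and l0: "l0 < N" and a: "a - real l0 * \<rho> = - (t * (m * L powr (m - 1)))"
    and rho: "\<rho> > 0" "4 * (t * L powr (m - 1)) \<le> \<rho>" and N: "40 * exp 2 * harm N \<le> \<rho> * w"
  shows "exp (-2) * w / 2 \<le> cmod (integral {L - w..L + w} (\<lambda>\<xi>. osc m a t c \<xi> * comb \<rho> N \<xi>))"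
proof -
  let ?J = "\<lambda>l. integral {L - w..L + w} (osc m (a - real l * \<rho>) t c)"
  have p0: "0 < L - w" using w L by simp
  have main: "exp (-2) * w \<le> cmod (?J l0)"
    unfolding a by (rule focused_lower_bound[OF m L w t c])
  have other: "cmod (?J l) \<le> 10 / \<rho> * (1 / \<bar>real l - real l0\<bar>)" if l: "l \<noteq> l0" for l
  proof -
    have d: "\<bar>real l - real l0\<bar> \<ge> 1" using l by linarith
    define \<mu> where "\<mu> = \<bar>real l - real l0\<bar> * \<rho> / 2"
    have mu: "\<mu> > 0" using d rho by (simp add: \<mu>_def)
    have "cmod (?J l) \<le> 5 / \<mu> * exp (- c * (L - w) powr m)"
    proof (rule vdc_first[OF m c(1) p0 _ mu])
      fix \<xi> assume x: "L - w \<le> \<xi>" "\<xi> \<le> L + w"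
      have xL: "L / 2 \<le> \<xi>" using x w by linarith
      have "\<xi> powr (m - 1) \<le> (L / 2) powr (m - 1)" using xL L m by (intro powr_mono2') auto
      also have "(L / 2) powr (m - 1) = 2 powr (1 - m) * L powr (m - 1)"
        using L by (simp add: powr_divide powr_diff field_simps)
      also have "\<dots> \<le> 2 powr 1 * L powr (m - 1)" using m by (intro mult_right_mono powr_mono) auto
      also have "\<dots> = 2 * L powr (m - 1)" by simp
      finally have "\<bar>\<xi> powr (m - 1) - L powr (m - 1)\<bar> \<le> 2 * L powr (m - 1)"
        using powr_ge_zero[of \<xi> "m - 1"] powr_ge_zero[of L "m - 1"] by linarith
      then have "t * m * \<bar>\<xi> powr (m - 1) - L powr (m - 1)\<bar> \<le> t * 1 * (2 * L powr (m - 1))"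
        using t m by (intro mult_mono) auto
      then have small: "\<bar>t * m * (\<xi> powr (m - 1) - L powr (m - 1))\<bar> \<le> \<rho> / 2"
        using rho t m by (simp add: abs_mult)
      have "a - real l * \<rho> = - (t * (m * L powr (m - 1))) - (real l - real l0) * \<rho>"
        using a by (simp add: algebra_simps)
      then have "a - real l * \<rho> + t * m * \<xi> powr (m - 1) = t * m * (\<xi> powr (m - 1) - L powr (m - 1)) - (real l - real l0) * \<rho>"
        by (simp add: algebra_simps)
      moreover have "\<bar>(real l - real l0) * \<rho>\<bar> = \<bar>real l - real l0\<bar> * \<rho>" using rho by (simp add: abs_mult)
      moreover have "\<rho> / 2 \<le> \<bar>real l - real l0\<bar> * \<rho> / 2" using d rho by simp
      ultimately show "\<mu> \<le> \<bar>a - real l * \<rho> + t * m * \<xi> powr (m - 1)\<bar>"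
        using small unfolding \<mu>_def by linarith
    qed (use w in simp)
    also have "\<dots> \<le> 5 / \<mu> * 1" using mu c by (intro mult_left_mono) auto
    also have "\<dots> = 10 / \<rho> * (1 / \<bar>real l - real l0\<bar>)" by (simp add: \<mu>_def)
    finally show ?thesis .
  qed
  have "cmod (\<Sum>l\<in>{..<N} - {l0}. ?J l) \<le> (\<Sum>l\<in>{..<N} - {l0}. 10 / \<rho> * (1 / \<bar>real l - real l0\<bar>))"
    by (rule order_trans[OF norm_sum]) (intro sum_mono other, auto)
  also have "\<dots> = 10 / \<rho> * (\<Sum>l\<in>{..<N} - {l0}. 1 / \<bar>real l - real l0\<bar>)" by (rule sum_distrib_left[symmetric])
  also have "\<dots> \<le> 10 / \<rho> * (2 * harm N)"
    using rho by (intro mult_left_mono sum_inverse_dist_le_harm l0) auto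
  also have "\<dots> \<le> exp (-2) * w / 2"
  proof -
    have "20 * harm N * 2 * exp 2 = 40 * exp 2 * (harm N :: real)" by simp
    with N have "20 * harm N * 2 * exp 2 \<le> \<rho> * w" by linarith
    then have "20 * harm N \<le> \<rho> * w / (2 * exp 2)" by (simp add: field_simps)
    also have "\<dots> = \<rho> * (exp (-2) * w / 2)" by (simp add: exp_minus field_simps)
    finally have "20 * harm N / \<rho> \<le> exp (-2) * w / 2" using rho by (simp add: divide_le_eq mult.commute)
    then show ?thesis by simp
  qed
  finally have rest: "cmod (\<Sum>l\<in>{..<N} - {l0}. ?J l) \<le> exp (-2) * w / 2" .
  have "integral {L - w..L + w} (\<lambda>\<xi>. osc m a t c \<xi> * comb \<rho> N \<xi>) = (\<Sum>l<N. ?J l)" by (rule osc_comb_integral[OF p0])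
  also have "\<dots> = ?J l0 + (\<Sum>l\<in>{..<N} - {l0}. ?J l)" using l0 by (intro sum.remove) auto
  finally have e: "integral {L - w..L + w} (\<lambda>\<xi>. osc m a t c \<xi> * comb \<rho> N \<xi>) = ?J l0 + (\<Sum>l\<in>{..<N} - {l0}. ?J l)" .
  show ?thesis unfolding e using main rest norm_diff_ineq[of "?J l0" "\<Sum>l\<in>{..<N} - {l0}. ?J l"] by linarith
qed

text \<open>Near-orthogonality of the teeth: in each row the diagonal contributes the length of the
  interval, and the first derivative estimate bounds the rest by
  \<open>10 * harm N / \<rho> \<le> W\<close>.\<close>

lemma comb_L2:
  fixes p q \<rho> :: real
  assumes pq: "0 < p" "p \<le> q" and rho: "\<rho> > 0" and N: "10 * harm N \<le> \<rho> * W"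
  shows "integral {p..q} (\<lambda>\<xi>. (cmod (comb \<rho> N \<xi>))\<^sup>2) \<le> real N * (q - p + W)"
proof -
  have half: "(0::real) < 1/2" "(1/2::real) < 1" by auto
  \<comment> \<open>Pure exponentials are the case without dispersion and damping; the exponent 1/2
    is an arbitrary value in the open unit interval.\<close>
  have oc: "osc (1/2) s 0 0 = (\<lambda>\<xi>. cis (s * \<xi>))" for s by (rule ext) (simp add: osc_def)
  have ii: "(\<lambda>\<xi>. cis (s * \<xi>)) integrable_on {p..q}" for s
    by (intro integrable_continuous_interval continuous_intros)
  have eq: "complex_of_real ((cmod (comb \<rho> N \<xi>))\<^sup>2) = (\<Sum>l<N. \<Sum>l'<N. cis ((real l' - real l) * \<rho> * \<xi>))" for \<xi>
    unfolding complex_norm_square comb_def cnj_sum sum_product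
    by (intro sum.cong refl) (simp add: cis_cnj cis_mult algebra_simps)
  have off: "cmod (integral {p..q} (\<lambda>\<xi>. cis ((real l' - real l) * \<rho> * \<xi>))) \<le> 5 / \<rho> * (1 / \<bar>real l' - real l\<bar>)" if "l' \<noteq> l" for l l'
  proof -
    have d: "\<bar>(real l' - real l) * \<rho>\<bar> > 0" using that rho by simp
    have "cmod (integral {p..q} (osc (1/2) ((real l' - real l) * \<rho>) 0 0)) \<le> 5 / \<bar>(real l' - real l) * \<rho>\<bar> * exp (- 0 * p powr (1/2))"
      by (rule vdc_first[OF half _ pq d]) auto
    then show ?thesis unfolding oc using rho by (simp add: abs_mult mult.commute)
  qed
  have row: "cmod (\<Sum>l'<N. integral {p..q} (\<lambda>\<xi>. cis ((real l' - real l) * \<rho> * \<xi>))) \<le> q - p + W" if l: "l < N" for l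
  proof -
    let ?I = "\<lambda>l'. integral {p..q} (\<lambda>\<xi>. cis ((real l' - real l) * \<rho> * \<xi>))"
    have sp: "(\<Sum>l'<N. ?I l') = ?I l + (\<Sum>l'\<in>{..<N} - {l}. ?I l')" using l by (intro sum.remove) auto
    have dg: "cmod (?I l) = q - p" using pq by (simp add: scaleR_conv_of_real flip: of_real_diff)
    have "cmod (\<Sum>l'\<in>{..<N} - {l}. ?I l') \<le> (\<Sum>l'\<in>{..<N} - {l}. 5 / \<rho> * (1 / \<bar>real l' - real l\<bar>))"
      by (rule order_trans[OF norm_sum]) (intro sum_mono off, auto)
    also have "\<dots> = 5 / \<rho> * (\<Sum>l'\<in>{..<N} - {l}. 1 / \<bar>real l' - real l\<bar>)" by (rule sum_distrib_left[symmetric])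
    also have "\<dots> \<le> 5 / \<rho> * (2 * harm N)" using rho by (intro mult_left_mono sum_inverse_dist_le_harm l) auto
    also have "\<dots> \<le> W" using N rho by (simp add: field_simps)
    finally have "cmod (\<Sum>l'\<in>{..<N} - {l}. ?I l') \<le> W" .
    then show ?thesis unfolding sp using dg norm_triangle_ineq[of "?I l" "\<Sum>l'\<in>{..<N} - {l}. ?I l'"] by linarith
  qed
  have "((\<lambda>\<xi>. (cmod (comb \<rho> N \<xi>))\<^sup>2) has_integral integral {p..q} (\<lambda>\<xi>. (cmod (comb \<rho> N \<xi>))\<^sup>2)) {p..q}"
    by (intro integrable_integral integrable_continuous_interval continuous_intros continuous_on_comb)
  then have "((\<lambda>\<xi>. complex_of_real ((cmod (comb \<rho> N \<xi>))\<^sup>2)) has_integral complex_of_real (integral {p..q} (\<lambda>\<xi>. (cmod (comb \<rho> N \<xi>))\<^sup>2))) {p..q}"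
    by (rule has_integral_of_real)
  then have "complex_of_real (integral {p..q} (\<lambda>\<xi>. (cmod (comb \<rho> N \<xi>))\<^sup>2)) = integral {p..q} (\<lambda>\<xi>. \<Sum>l<N. \<Sum>l'<N. cis ((real l' - real l) * \<rho> * \<xi>))"
    unfolding eq by (rule integral_unique[symmetric])
  also have "\<dots> = (\<Sum>l<N. \<Sum>l'<N. integral {p..q} (\<lambda>\<xi>. cis ((real l' - real l) * \<rho> * \<xi>)))"
    by (subst Henstock_Kurzweil_Integration.integral_sum) (auto intro!: integrable_sum ii sum.cong Henstock_Kurzweil_Integration.integral_sum)
  finally have "integral {p..q} (\<lambda>\<xi>. (cmod (comb \<rho> N \<xi>))\<^sup>2) \<le> cmod (\<Sum>l<N. \<Sum>l'<N. integral {p..q} (\<lambda>\<xi>. cis ((real l' - real l) * \<rho> * \<xi>)))"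
    by (metis abs_ge_self norm_of_real)
  also have "\<dots> \<le> (\<Sum>l<N. q - p + W)" by (rule order_trans[OF norm_sum]) (intro sum_mono row, auto)
  finally show ?thesis by simp
qed

lemma harm_le_ln: "n > 0 \<Longrightarrow> harm n \<le> 1 + ln (real n)"
proof (induction n)
  case (Suc n)
  show ?case
  proof (cases "n = 0")
    case False
    have "ln (real n / real (Suc n)) \<le> real n / real (Suc n) - 1" using False by (intro ln_le_minus_one) auto
    also have "\<dots> = - inverse (real (Suc n))" by (simp add: field_simps)
    finally have "ln (real n) - ln (real (Suc n)) \<le> - inverse (real (Suc n))"
      using False by (simp add: ln_div)
    then show ?thesis using Suc False by (simp add: harm_Suc)
  qed (simp add: harm_Suc harm_def)
qed simp

lemma harm_le_powr:
  assumes "n > 0" "\<delta> > 0"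
  shows "harm n \<le> (1 + 1 / \<delta>) * real n powr \<delta>"
proof -
  have "1 \<le> real n powr \<delta>" using assms by (intro ge_one_powr_ge_zero) auto
  moreover have "ln (real n) \<le> real n powr \<delta> / \<delta>" using assms by (intro ln_powr_bound) auto
  moreover have "(1 + 1 / \<delta>) * real n powr \<delta> = real n powr \<delta> + real n powr \<delta> / \<delta>" by (simp add: distrib_right)
  ultimately show ?thesis using harm_le_ln[OF assms(1)] by linarith
qed

lemma eventually_powr_ge:
  assumes "p > (0::real)" shows "\<forall>\<^sub>F L in at_top. K \<le> L powr p"
  using eventually_ge_at_top[of "max 1 K powr (1 / p)"]
proof eventually_elim
  case (elim L)
  have "max 1 K = (max 1 K powr (1 / p)) powr p" using assms by (simp add: powr_powr)
  also have "\<dots> \<le> L powr p" using elim assms by (intro powr_mono2) auto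
  finally show ?case by simp
qed

section \<open>Data concentrated near a single frequency\<close>

locale hump =
  fixes m \<alpha> \<gamma> s :: real
  assumes m: "0 < m" "m < 1" and al: "1/2 < \<alpha>" "\<alpha> \<le> 1" and g: "m * \<alpha> < \<gamma>"
    and s: "0 \<le> s" "s < s_crit m \<alpha> \<gamma>"
begin

lemma g0: "\<gamma> > 0" using g m al mult_pos_pos[of m \<alpha>] by linarith

text \<open>\<open>T L\<close> is the time scale on which the damping becomes of order one at frequency \<open>L\<close>, \<open>\<rho> L\<close> is the
  spacing of the points at which the comb focuses, and \<open>w L\<close> is (half) the largest half-width of a
  frequency window at \<open>L\<close> on which \<open>T L * \<bar>\<xi>\<bar> powr m\<close> stays within \<open>O(1)\<close> of its linearisation.\<close>

definition b where "b = m * \<alpha> / \<gamma>"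
definition \<kappa> where "\<kappa> = min 1 (1 - m / 2 + m / (2 * \<gamma>))"
definition \<epsilon> where "\<epsilon> = s_crit m \<alpha> \<gamma> - s"
definition T where "T L = L powr (- m / \<gamma>)"
definition \<rho> where "\<rho> L = (1 - m) / 2 * L powr (- b)"
definition w where "w L = L powr \<kappa> / 2"
definition N where "N L = nat \<lceil>2 / \<rho> L\<rceil>"
text \<open>Normalised so that the focused value is at least of order
  \<open>L powr (\<epsilon> / 2)\<close> while the squared Sobolev norm is at most of order
  \<open>L powr (- \<epsilon>)\<close>: the gap to the critical index is split between growth and
  summability.\<close>

definition amp where "amp L = L powr (\<epsilon> / 2) / w L"
definition G where "G L \<xi> = complex_of_real (amp L) * (complex_of_real (indicator {L - w L..L + w L} \<xi>) * comb (\<rho> L) (N L) \<xi>)"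
text \<open>The second condition keeps the drift by the group velocity below a quarter of the
  spacing up to time \<open>T L\<close>; the third is the condition under which one tooth dominates
  all others.\<close>

definition good where "good L \<longleftrightarrow> 1 \<le> L \<and> 8 * L powr (m - 1) \<le> 1 - m \<and> 40 * exp 2 * harm (N L) \<le> \<rho> L * w L"
definition Q where "Q L = 12 / (1 - m) * L powr (b + \<epsilon> / 2)"
definition E where "E L = 36 * 4 powr s / (1 - m) * L powr (- \<epsilon>)"
text \<open>Solving \<open>t powr \<alpha> \<ge> \<rho> L\<close> gives
  \<open>t \<ge> c1 * T L\<close>; thus focusing times are comparable with \<open>T L\<close> from
  below as well.\<close>

definition c1 where "c1 = ((1 - m) / 2) powr (1 / \<alpha>)"

lemma b: "0 < b" "b < 1"
  using m al g g0 by (auto simp: b_def)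

lemma eps: "\<epsilon> > 0" using s by (simp add: \<epsilon>_def)

text \<open>This identity makes the example sharp. The entry 1 of \<kappa>, a window comparable with
  the frequency, matches \<open>(1 - b) / 2\<close>; the entry limited by dispersion matches the
  other half of \<open>s_crit\<close>.\<close>

lemma kappa_b: "\<kappa> - b = 2 * s_crit m \<alpha> \<gamma>"
proof -
  have "1 - m / 2 + m / (2 * \<gamma>) - b = 2 * ((2 - m) / 4 + m * (1 - 2 * \<alpha>) / (4 * \<gamma>))"
    using g0 by (simp add: b_def field_simps)
  moreover have "max (1 - m * \<alpha> / \<gamma>) 0 = 1 - b" using b by (simp add: b_def)
  moreover have "min 1 X - b = 2 * min Y (1 / 2 * Z)" if "X - b = 2 * Y" "Z = 1 - b" for X Y Z :: real
    using that by (auto simp: min_def)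
  ultimately show ?thesis unfolding \<kappa>_def s_crit_def by blast
qed

lemma kappa: "0 < \<kappa>" "\<kappa> \<le> 1" "2 * \<kappa> \<le> 2 - m + m / \<gamma>"
proof -
  show "0 < \<kappa>" using kappa_b b s by simp
  show "\<kappa> \<le> 1" by (simp add: \<kappa>_def)
  have "\<kappa> \<le> 1 - m / 2 + m / (2 * \<gamma>)" by (simp add: \<kappa>_def)
  then show "2 * \<kappa> \<le> 2 - m + m / \<gamma>" by simp
qed

lemma rho_pos: "L > 0 \<Longrightarrow> \<rho> L > 0" using m by (simp add: \<rho>_def)
lemma w_pos: "L > 0 \<Longrightarrow> w L > 0" by (simp add: w_def)
lemma amp_pos: "L > 0 \<Longrightarrow> amp L > 0" using w_pos by (simp add: amp_def)

lemma w_le: "L \<ge> 1 \<Longrightarrow> w L \<le> L / 2"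
  using powr_mono[of \<kappa> 1 L] kappa by (simp add: w_def)

lemma T_powr: "L > 0 \<Longrightarrow> T L powr \<alpha> = L powr (- b)"
  by (simp add: T_def b_def powr_powr)

lemma N_bounds:
  assumes L: "L \<ge> 1"
  shows "2 / \<rho> L \<le> real (N L)" "real (N L) \<le> 6 / (1 - m) * L powr b" "N L > 0"
proof -
  have r: "\<rho> L > 0" using rho_pos L by simp
  have "L powr (- b) \<le> L powr 0" using L b by (intro powr_mono) auto
  then have "(1 - m) / 2 * L powr (- b) \<le> 1 * 1" using m L by (intro mult_mono) auto
  then have r1: "\<rho> L \<le> 1" by (simp add: \<rho>_def)
  show a: "2 / \<rho> L \<le> real (N L)" unfolding N_def by linarith
  have "0 < 2 / \<rho> L" using r by simp
  with a have "real (N L) > 0" by linarith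
  then show "N L > 0" by simp
  have "real (N L) \<le> 2 / \<rho> L + 1" unfolding N_def using \<open>0 < 2 / \<rho> L\<close> by linarith
  also have "\<dots> \<le> 3 / \<rho> L" using r r1 by (simp add: field_simps)
  also have "\<dots> = 6 / (1 - m) * L powr b" using m L by (simp add: \<rho>_def powr_minus field_simps)
  finally show "real (N L) \<le> 6 / (1 - m) * L powr b" .
qed

text \<open>\<open>harm (N L)\<close> is below any positive power of \<open>L\<close>, whereas
  \<open>\<rho> L * w L\<close> grows like \<open>L powr (\<kappa> - b)\<close>, a positive power by
  \<open>kappa_b\<close>. The choice of \<delta> spends half of that exponent on the harmonic sum
  and leaves the other half to absorb constants.\<close>

lemma eventually_good: "\<forall>\<^sub>F L in at_top. good L"
proof -
  define p where "p = \<kappa> - b"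
  have p: "p > 0" using kappa_b s by (simp add: p_def)
  define \<delta> where "\<delta> = p / (2 * b)"
  have d: "\<delta> > 0" "b * \<delta> = p / 2" using p b by (auto simp: \<delta>_def)
  define K where "K = 40 * exp 2 * (1 + 1 / \<delta>) * (6 / (1 - m)) powr \<delta> * (4 / (1 - m))"
  have e1: "\<forall>\<^sub>F L in at_top. 1 \<le> (L::real)" by (rule eventually_ge_at_top)
  have e2: "\<forall>\<^sub>F L in at_top. K \<le> L powr (p / 2)" using p by (intro eventually_powr_ge) simp
  have e3: "\<forall>\<^sub>F L in at_top. 8 / (1 - m) \<le> L powr (1 - m)" using m by (intro eventually_powr_ge) simp
  from e1 e2 e3 show ?thesis
  proof eventually_elim
    case (elim L)
    have "L powr (m - 1) = inverse (L powr (1 - m))" by (simp flip: powr_minus)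
    moreover have "inverse (L powr (1 - m)) \<le> inverse (8 / (1 - m))" using elim m by (intro le_imp_inverse_le) auto
    ultimately have 1: "8 * L powr (m - 1) \<le> 1 - m" by simp
    have "harm (N L) \<le> (1 + 1 / \<delta>) * real (N L) powr \<delta>" using N_bounds(3)[OF elim(1)] d by (intro harm_le_powr) auto
    also have "\<dots> \<le> (1 + 1 / \<delta>) * (6 / (1 - m) * L powr b) powr \<delta>"
      using d N_bounds(2)[OF elim(1)] by (intro mult_left_mono powr_mono2) auto
    also have "(6 / (1 - m) * L powr b) powr \<delta> = (6 / (1 - m)) powr \<delta> * L powr (p / 2)"
      using m elim by (subst powr_mult) (auto simp: powr_powr d)
    finally have h: "harm (N L) \<le> (1 + 1 / \<delta>) * ((6 / (1 - m)) powr \<delta> * L powr (p / 2))" .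
    have "40 * exp 2 * harm (N L) \<le> 40 * exp 2 * ((1 + 1 / \<delta>) * ((6 / (1 - m)) powr \<delta> * L powr (p / 2)))"
      by (intro mult_left_mono h) auto
    also have "\<dots> = (1 - m) / 4 * (K * L powr (p / 2))" using m by (simp add: K_def field_simps)
    also have "\<dots> \<le> (1 - m) / 4 * (L powr (p / 2) * L powr (p / 2))"
      using elim m by (intro mult_left_mono mult_right_mono) auto
    also have "L powr (p / 2) * L powr (p / 2) = L powr (- b) * L powr \<kappa>"
      by (simp add: p_def flip: powr_add)
    also have "(1 - m) / 4 * (L powr (- b) * L powr \<kappa>) = \<rho> L * w L" by (simp add: \<rho>_def w_def)
    finally show ?case using 1 elim by (simp add: good_def)
  qed
qed

lemma G_measurable [measurable]: "G L \<in> borel_measurable borel"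
  unfolding G_def by measurable

lemma G_bound: "L > 0 \<Longrightarrow> cmod (G L \<xi>) \<le> amp L * real (N L) * indicator {L - w L..L + w L} \<xi>"
  using norm_comb_le[of "\<rho> L" "N L" \<xi>] amp_pos[of L]
  by (auto simp: G_def norm_mult indicator_def intro!: mult_left_mono)

lemma G_bound': "L > 0 \<Longrightarrow> cmod (G L \<xi>) \<le> amp L * real (N L)"
  by (rule order_trans[OF G_bound]) (use amp_pos[of L] in \<open>auto simp: indicator_def\<close>)

lemma G_integrable:
  assumes "L > 0" shows "integrable lborel (G L)" "integrable lborel (\<lambda>\<xi>. (cmod (G L \<xi>))\<^sup>2)"
proof -
  have "G L \<xi> = 0" if "\<xi> \<notin> {L - w L..L + w L}" for \<xi> using that by (simp add: G_def)
  note * = integrable_bounded_support[of "G L" "{L - w L..L + w L}", OF _ _ _ G_bound'[OF assms] this]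
  show "integrable lborel (G L)" by (rule *(1)) (auto simp: emeasure_lborel_Icc_eq)
  show "integrable lborel (\<lambda>\<xi>. (cmod (G L \<xi>))\<^sup>2)" by (rule *(2)) (auto simp: emeasure_lborel_Icc_eq)
qed

lemma G_support: "L \<ge> 1 \<Longrightarrow> G L \<xi> \<noteq> 0 \<Longrightarrow> L / 2 \<le> \<xi> \<and> \<xi> \<le> 3 / 2 * L"
  using w_le[of L] by (auto simp: G_def indicator_def split: if_splits)

lemma G_isCont: "AE \<xi> in lborel. isCont (G L) \<xi>"
proof -
  have "AE \<xi> in lborel. \<xi> \<noteq> L - w L" "AE \<xi> in lborel. \<xi> \<noteq> L + w L" by (rule AE_lborel_singleton)+
  then show ?thesis
  proof eventually_elim
    case (elim \<xi>)
    have c: "isCont (comb (\<rho> L) (N L)) \<xi>"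
      using continuous_on_comb[of UNIV "\<rho> L" "N L"] by (simp add: continuous_on_eq_continuous_at)
    have "frontier {L - w L..L + w L} \<subseteq> {L - w L, L + w L}" by (auto simp: frontier_def)
    then have "\<xi> \<notin> frontier {L - w L..L + w L}" using elim by auto
    then have "isCont (indicat_real {L - w L..L + w L}) \<xi>" by (simp add: isCont_indicator)
    then show ?case unfolding G_def[abs_def] by (intro continuous_intros c)
  qed
qed

lemma G_L1:
  assumes L: "L \<ge> 1" shows "(\<integral>\<xi>. cmod (G L \<xi>) \<partial>lborel) \<le> Q L"
proof -
  have L0: "L > 0" using L by simp
  have i: "integrable lborel (\<lambda>\<xi>. amp L * real (N L) * indicator {L - w L..L + w L} \<xi>)"
    by (intro integrable_mult_right integrable_real_indicator) (auto simp: emeasure_lborel_Icc_eq)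
  have "(\<integral>\<xi>. cmod (G L \<xi>) \<partial>lborel) \<le> (\<integral>\<xi>. amp L * real (N L) * indicator {L - w L..L + w L} \<xi> \<partial>lborel)"
    by (rule integral_mono[OF integrable_norm[OF G_integrable(1)[OF L0]] i]) (rule G_bound[OF L0])
  also have "\<dots> = amp L * real (N L) * (2 * w L)" using w_pos[OF L0] by simp
  also have "\<dots> = 2 * L powr (\<epsilon> / 2) * real (N L)" using w_pos[OF L0] by (simp add: amp_def)
  also have "\<dots> \<le> 2 * L powr (\<epsilon> / 2) * (6 / (1 - m) * L powr b)" by (intro mult_left_mono N_bounds(2)[OF L]) auto
  also have "\<dots> = Q L" by (simp add: Q_def powr_add)
  finally show ?thesis .
qed

text \<open>Count of exponents: the weight contributes \<open>2 * s\<close>, amplitude and window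
  \<open>\<epsilon> - \<kappa>\<close>, and near-orthogonality of the \<open>N L\<close> teeth
  \<open>b\<close>; by \<open>kappa_b\<close> the total is \<open>- \<epsilon>\<close>.\<close>

lemma G_weighted:
  assumes L: "good L"
  shows "integrable lborel (\<lambda>\<xi>. (1 + \<xi>\<^sup>2) powr s * (cmod (G L \<xi>))\<^sup>2)"
    "(\<integral>\<xi>. (1 + \<xi>\<^sup>2) powr s * (cmod (G L \<xi>))\<^sup>2 \<partial>lborel) \<le> E L"
proof -
  have L1: "L \<ge> 1" and L0: "L > 0" using L by (auto simp: good_def)
  have wt: "(1 + \<xi>\<^sup>2) powr s * (cmod (G L \<xi>))\<^sup>2 \<le> 4 powr s * L powr (2 * s) * (cmod (G L \<xi>))\<^sup>2" for \<xi>
  proof (cases "G L \<xi> = 0")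
    case False
    have x: "L / 2 \<le> \<xi>" "\<xi> \<le> 3 / 2 * L" using G_support[OF L1 False] by auto
    have "\<xi>\<^sup>2 \<le> (3 / 2 * L)\<^sup>2" using x L0 by (intro power_mono) auto
    moreover have "1 \<le> L\<^sup>2" using L1 by simp
    moreover have "(3 / 2 * L)\<^sup>2 = 9 / 4 * L\<^sup>2" by (simp add: power2_eq_square)
    ultimately have "1 + \<xi>\<^sup>2 \<le> 4 * L\<^sup>2" by linarith
    then have "(1 + \<xi>\<^sup>2) powr s \<le> (4 * L\<^sup>2) powr s" using s by (intro powr_mono2) (auto simp: add_nonneg_nonneg)
    also have "\<dots> = 4 powr s * (L powr 2) powr s" using L0 by (simp add: powr_mult)
    also have "\<dots> = 4 powr s * L powr (2 * s)" by (simp add: powr_powr)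
    finally show ?thesis by (intro mult_right_mono) auto
  qed simp
  have i2: "integrable lborel (\<lambda>\<xi>. 4 powr s * L powr (2 * s) * (cmod (G L \<xi>))\<^sup>2)"
    using G_integrable(2)[OF L0] by simp
  show i: "integrable lborel (\<lambda>\<xi>. (1 + \<xi>\<^sup>2) powr s * (cmod (G L \<xi>))\<^sup>2)"
    by (rule Bochner_Integration.integrable_bound[OF i2]) (use wt in auto)
  have sq: "(\<integral>\<xi>. (cmod (G L \<xi>))\<^sup>2 \<partial>lborel) = (amp L)\<^sup>2 * integral {L - w L..L + w L} (\<lambda>\<xi>. (cmod (comb (\<rho> L) (N L) \<xi>))\<^sup>2)"
  proof -
    have si: "set_integrable lborel {L - w L..L + w L} (\<lambda>\<xi>. (cmod (comb (\<rho> L) (N L) \<xi>))\<^sup>2)"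
      by (intro borel_integrable_atLeastAtMost' continuous_intros continuous_on_comb)
    have "(\<integral>\<xi>. (cmod (G L \<xi>))\<^sup>2 \<partial>lborel) = (\<integral>\<xi>. (amp L)\<^sup>2 * (indicator {L - w L..L + w L} \<xi> *\<^sub>R (cmod (comb (\<rho> L) (N L) \<xi>))\<^sup>2) \<partial>lborel)"
      by (intro Bochner_Integration.integral_cong) (auto simp: G_def norm_mult power_mult_distrib indicator_def)
    also have "\<dots> = (amp L)\<^sup>2 * (LINT \<xi>:{L - w L..L + w L}|lborel. (cmod (comb (\<rho> L) (N L) \<xi>))\<^sup>2)"
      by (simp add: set_lebesgue_integral_def)
    finally show ?thesis using set_borel_integral_eq_integral(2)[OF si] by simp
  qed
  have hN: "10 * harm (N L) \<le> \<rho> L * w L"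
  proof -
    have "1 \<le> exp (2::real)" by simp
    then have "10 * 1 * (harm (N L) :: real) \<le> 40 * exp 2 * harm (N L)" by (intro mult_mono harm_nonneg) auto
    then show ?thesis using L by (simp add: good_def)
  qed
  have "integral {L - w L..L + w L} (\<lambda>\<xi>. (cmod (comb (\<rho> L) (N L) \<xi>))\<^sup>2) \<le> real (N L) * (L + w L - (L - w L) + w L)"
    by (rule comb_L2[OF _ _ rho_pos[OF L0] hN]) (use w_le[OF L1] w_pos[OF L0] L0 in auto)
  then have "(\<integral>\<xi>. (cmod (G L \<xi>))\<^sup>2 \<partial>lborel) \<le> (amp L)\<^sup>2 * (real (N L) * (3 * w L))"
    unfolding sq by (intro mult_left_mono) auto
  also have "\<dots> = 6 * (L powr (\<epsilon> / 2))\<^sup>2 * L powr (- \<kappa>) * real (N L)"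
    using L0 by (simp add: amp_def w_def powr_minus field_simps power2_eq_square)
  also have "\<dots> \<le> 6 * (L powr (\<epsilon> / 2))\<^sup>2 * L powr (- \<kappa>) * (6 / (1 - m) * L powr b)"
    by (intro mult_left_mono N_bounds(2)[OF L1]) auto
  finally have n: "(\<integral>\<xi>. (cmod (G L \<xi>))\<^sup>2 \<partial>lborel) \<le> 6 * (L powr (\<epsilon> / 2))\<^sup>2 * L powr (- \<kappa>) * (6 / (1 - m) * L powr b)" .
  have "(\<integral>\<xi>. (1 + \<xi>\<^sup>2) powr s * (cmod (G L \<xi>))\<^sup>2 \<partial>lborel) \<le> (\<integral>\<xi>. 4 powr s * L powr (2 * s) * (cmod (G L \<xi>))\<^sup>2 \<partial>lborel)"
    by (rule integral_mono[OF i i2 wt])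
  also have "\<dots> = 4 powr s * L powr (2 * s) * (\<integral>\<xi>. (cmod (G L \<xi>))\<^sup>2 \<partial>lborel)" by simp
  also have "\<dots> \<le> 4 powr s * L powr (2 * s) * (6 * (L powr (\<epsilon> / 2))\<^sup>2 * L powr (- \<kappa>) * (6 / (1 - m) * L powr b))"
    by (intro mult_left_mono n) auto
  also have "\<dots> = 36 * 4 powr s / (1 - m) * (L powr (2 * s) * (L powr (\<epsilon> / 2) * L powr (\<epsilon> / 2)) * L powr (- \<kappa>) * L powr b)"
    by (simp add: power2_eq_square)
  also have "L powr (2 * s) * (L powr (\<epsilon> / 2) * L powr (\<epsilon> / 2)) * L powr (- \<kappa>) * L powr b = L powr (2 * s + (\<epsilon> / 2 + \<epsilon> / 2) + - \<kappa> + b)"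
    by (simp only: powr_add)
  also have "2 * s + (\<epsilon> / 2 + \<epsilon> / 2) + - \<kappa> + b = - \<epsilon>" using kappa_b by (simp add: \<epsilon>_def)
  finally show "(\<integral>\<xi>. (1 + \<xi>\<^sup>2) powr s * (cmod (G L \<xi>))\<^sup>2 \<partial>lborel) \<le> E L" by (simp add: E_def)
qed

lemma T_bounds: "L \<ge> 1 \<Longrightarrow> 0 < T L \<and> T L \<le> 1 \<and> T L \<le> T L powr \<alpha>"
proof -
  assume L: "L \<ge> 1"
  have n: "- m / \<gamma> \<le> 0" using m g0 by simp
  have p: "0 < T L" using L by (simp add: T_def)
  have "L powr (- m / \<gamma>) \<le> L powr 0" by (rule powr_mono[OF n L])
  then have 1: "T L \<le> 1" using L by (simp add: T_def)
  have "T L powr 1 \<le> T L powr \<alpha>" using p 1 al by (intro powr_mono') auto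
  then show ?thesis using p 1 by simp
qed

lemma c1: "0 < c1" using m by (simp add: c1_def)

text \<open>The time is chosen so that the curve compensates the group velocity at frequency \<open>L\<close>
  and the point \<open>x\<close> is carried to a tooth of the comb.\<close>

lemma hump_large:
  assumes L: "good L" and x: "1 \<le> x" "x \<le> 2"
  obtains t where "c1 * T L \<le> t" "t \<le> T L"
    "exp (-2) / 2 * L powr (\<epsilon> / 2) \<le> cmod (\<integral>\<xi>. psymb m (x - t powr \<alpha>) t (t powr \<gamma>) \<xi> * G L \<xi> \<partial>lborel)"
proof -
  have L1: "L \<ge> 1" and L0: "L > 0" and L8: "8 * L powr (m - 1) \<le> 1 - m" and hN: "40 * exp 2 * harm (N L) \<le> \<rho> L * w L"
    using L by (auto simp: good_def)
  have T0: "0 < T L" "T L \<le> 1" "T L \<le> T L powr \<alpha>" using T_bounds[OF L1] by auto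
  have r: "\<rho> L > 0" by (rule rho_pos[OF L0])
  have rT: "\<rho> L = (1 - m) / 2 * T L powr \<alpha>" by (simp add: \<rho>_def T_powr[OF L0])
  have r1: "\<rho> L \<le> 1"
  proof -
    have "T L powr \<alpha> \<le> 1" using T0 al by (intro powr_le1) auto
    then have "(1 - m) / 2 * T L powr \<alpha> \<le> 1 * 1" using m by (intro mult_mono) auto
    then show ?thesis by (simp add: rT)
  qed
  \<comment> \<open>Going one tooth further down than the nearest puts the displacement
    \<open>y\<close> between \<open>\<rho> L\<close> and \<open>2 * \<rho> L\<close>, away from 0,
    so that the time found below cannot be much smaller than \<open>T L\<close>.\<close>
  define l0 where "l0 = nat (\<lfloor>x / \<rho> L\<rfloor> - 1)"
  have "1 \<le> x / \<rho> L" using x r r1 by (simp add: field_simps)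
  then have "1 \<le> \<lfloor>x / \<rho> L\<rfloor>" by simp
  then have l0: "real l0 = \<lfloor>x / \<rho> L\<rfloor> - 1" by (simp add: l0_def)
  have l0b: "real l0 \<le> x / \<rho> L - 1" "x / \<rho> L - 2 < real l0" unfolding l0 by linarith+
  have "x / \<rho> L \<le> 2 / \<rho> L" using x r by (intro divide_right_mono) auto
  then have "real l0 < real (N L)" using l0b N_bounds(1)[OF L1] by linarith
  then have lN: "l0 < N L" by simp
  define y where "y = x - real l0 * \<rho> L"
  have "real l0 * \<rho> L \<le> (x / \<rho> L - 1) * \<rho> L" using l0b r by (intro mult_right_mono) auto
  then have y1: "\<rho> L \<le> y" using r by (simp add: y_def left_diff_distrib)
  have "(x / \<rho> L - 2) * \<rho> L \<le> real l0 * \<rho> L" using l0b r by (intro mult_right_mono) auto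
  then have y2: "y \<le> 2 * \<rho> L" using r by (simp add: y_def left_diff_distrib)
  \<comment> \<open>The displacement by the curve, corrected by the group velocity at
    \<open>L\<close>. It is 0 at time 0 and at least \<open>2 * \<rho> L\<close> at time
    \<open>T L\<close>; the factor \<open>(1 - m) / 2\<close> in the definition of
    \<open>\<rho>\<close> is made for this.\<close>
  define \<theta> where "\<theta> t = t powr \<alpha> - t * (m * L powr (m - 1))" for t
  have "L powr (m - 1) \<le> L powr 0" using L1 m by (intro powr_mono) auto
  then have Lm: "L powr (m - 1) \<le> 1" using L1 by simp
  have "T L * (m * L powr (m - 1)) \<le> T L powr \<alpha> * (m * 1)"
    using T0 m Lm by (intro mult_mono) auto
  moreover have "2 * \<rho> L = T L powr \<alpha> - T L powr \<alpha> * (m * 1)" by (simp add: rT field_simps)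
  ultimately have "2 * \<rho> L \<le> \<theta> (T L)" by (simp add: \<theta>_def)
  then have yT: "y \<le> \<theta> (T L)" using y2 by linarith
  have cont: "continuous_on {0..T L} \<theta>"
    unfolding \<theta>_def using al by (intro continuous_intros continuous_on_powr') auto
  have "\<theta> 0 \<le> y" using y1 r by (simp add: \<theta>_def)
  then obtain t where t: "0 \<le> t" "t \<le> T L" "\<theta> t = y" using IVT'[OF _ yT _ cont] T0 by auto
  have tb: "c1 * T L \<le> t"
  proof -
    have "0 \<le> t * (m * L powr (m - 1))" using t m by simp
    then have "\<rho> L \<le> t powr \<alpha>" using t(3) y1 by (simp add: \<theta>_def)
    then have "\<rho> L powr (1 / \<alpha>) \<le> (t powr \<alpha>) powr (1 / \<alpha>)" using r al by (intro powr_mono2) auto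
    also have "\<dots> = t" using t al by (simp add: powr_powr)
    also have "\<rho> L powr (1 / \<alpha>) = c1 * T L"
      unfolding rT c1_def using m T0 al by (subst powr_mult) (auto simp: powr_powr)
    finally show ?thesis .
  qed
  have t0: "t > 0" using tb c1 T0 mult_pos_pos[of c1 "T L"] by linarith
  \<comment> \<open>The powers of \<open>L\<close> cancel by
    \<open>2 * \<kappa> \<le> 2 - m + m / \<gamma>\<close>; the 1/4 is the squared factor 1/2 in
    \<open>w\<close>.\<close>
  have tw: "t * (L powr (m - 2) * (w L)\<^sup>2) \<le> 1 / 4"
  proof -
    have "t * (L powr (m - 2) * (w L)\<^sup>2) \<le> T L * (L powr (m - 2) * (w L)\<^sup>2)" using t by (intro mult_right_mono) auto
    also have "\<dots> = 1 / 4 * (L powr (- m / \<gamma>) * L powr (m - 2) * (L powr \<kappa> * L powr \<kappa>))"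
      by (simp add: T_def w_def power2_eq_square)
    also have "L powr (- m / \<gamma>) * L powr (m - 2) * (L powr \<kappa> * L powr \<kappa>) = L powr (- m / \<gamma> + (m - 2) + (\<kappa> + \<kappa>))"
      by (simp only: powr_add)
    also have "\<dots> \<le> L powr 0" using kappa(3) L1 by (intro powr_mono) auto
    finally show ?thesis using L1 by simp
  qed
  have tc: "t powr \<gamma> * L powr m \<le> 1"
  proof -
    have "t powr \<gamma> \<le> T L powr \<gamma>" using t g0 by (intro powr_mono2) auto
    also have "\<dots> = L powr (- m)" using g0 by (simp add: T_def powr_powr)
    finally have "t powr \<gamma> * L powr m \<le> L powr (- m) * L powr m" by (intro mult_right_mono) auto
    also have "\<dots> = 1" using L0 by (simp flip: powr_add)
    finally show ?thesis .
  qed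
  have t4: "4 * (t * L powr (m - 1)) \<le> \<rho> L"
  proof -
    have "t * L powr (m - 1) \<le> T L powr \<alpha> * ((1 - m) / 8)"
      using t T0 L8 by (intro mult_mono) auto
    moreover have "\<rho> L = 4 * (T L powr \<alpha> * ((1 - m) / 8))" by (simp add: rT)
    ultimately show ?thesis by linarith
  qed
  have aeq: "x - t powr \<alpha> - real l0 * \<rho> L = - (t * (m * L powr (m - 1)))"
    using t(3) by (simp add: \<theta>_def y_def)
  let ?a = "x - t powr \<alpha>"
  have foc: "exp (-2) * w L / 2 \<le> cmod (integral {L - w L..L + w L} (\<lambda>\<xi>. osc m ?a t (t powr \<gamma>) \<xi> * comb (\<rho> L) (N L) \<xi>))"
    by (rule comb_focus[OF m L0 w_pos[OF L0] w_le[OF L1] t(1) tw _ tc lN aeq r t4 hN]) simp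
  have p0: "0 < L - w L" using w_le[OF L1] L0 by simp
  have si: "set_integrable lborel {L - w L..L + w L} (\<lambda>\<xi>. osc m ?a t (t powr \<gamma>) \<xi> * comb (\<rho> L) (N L) \<xi>)"
    using p0 by (intro borel_integrable_atLeastAtMost' continuous_intros continuous_on_osc continuous_on_comb) auto
  have "(\<integral>\<xi>. psymb m ?a t (t powr \<gamma>) \<xi> * G L \<xi> \<partial>lborel) =
     (\<integral>\<xi>. complex_of_real (amp L) * (indicator {L - w L..L + w L} \<xi> *\<^sub>R (osc m ?a t (t powr \<gamma>) \<xi> * comb (\<rho> L) (N L) \<xi>)) \<partial>lborel)"
    using p0 by (intro Bochner_Integration.integral_cong) (auto simp: G_def indicator_def psymb_osc)
  also have "\<dots> = complex_of_real (amp L) * (LINT \<xi>:{L - w L..L + w L}|lborel. osc m ?a t (t powr \<gamma>) \<xi> * comb (\<rho> L) (N L) \<xi>)"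
    unfolding set_lebesgue_integral_def by (rule integral_mult_right_zero)
  also have "\<dots> = complex_of_real (amp L) * integral {L - w L..L + w L} (\<lambda>\<xi>. osc m ?a t (t powr \<gamma>) \<xi> * comb (\<rho> L) (N L) \<xi>)"
    using set_borel_integral_eq_integral(2)[OF si] by simp
  finally have eq: "cmod (\<integral>\<xi>. psymb m ?a t (t powr \<gamma>) \<xi> * G L \<xi> \<partial>lborel) =
     amp L * cmod (integral {L - w L..L + w L} (\<lambda>\<xi>. osc m ?a t (t powr \<gamma>) \<xi> * comb (\<rho> L) (N L) \<xi>))"
    using amp_pos[OF L0] by (simp add: norm_mult)
  have "exp (-2) / 2 * L powr (\<epsilon> / 2) = amp L * (exp (-2) * w L / 2)" using w_pos[OF L0] by (simp add: amp_def)
  also have "\<dots> \<le> amp L * cmod (integral {L - w L..L + w L} (\<lambda>\<xi>. osc m ?a t (t powr \<gamma>) \<xi> * comb (\<rho> L) (N L) \<xi>))"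
    using amp_pos[OF L0] by (intro mult_left_mono foc) auto
  finally show thesis using that[OF tb t(2)] eq by simp
qed

end

section \<open>Divergence below the critical regularity\<close>

text \<open>Subadditivity of concave powers: measured in units of \<open>b\<close>, each of the two
  parts of \<open>b\<close> lies below its power, and the parts add up to 1.\<close>

lemma powr_diff_le:
  fixes a b p :: real
  assumes "0 \<le> a" "a \<le> b" "0 < p" "p \<le> 1"
  shows "b powr p - a powr p \<le> (b - a) powr p"
proof (cases "b = 0")
  case False
  then have b: "b > 0" using assms by simp
  have le: "x / b * b powr p \<le> x powr p" if "0 \<le> x" "x \<le> b" for x
  proof -
    have "(x / b) powr 1 \<le> (x / b) powr p" using that assms b by (intro powr_mono') auto
    then have "x / b * b powr p \<le> (x / b) powr p * b powr p" using that b by (intro mult_right_mono) auto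
    also have "\<dots> = x powr p" using that b by (simp add: powr_divide)
    finally show ?thesis .
  qed
  have "b powr p = a / b * b powr p + (b - a) / b * b powr p"
    using b by (simp add: field_simps)
  also have "\<dots> \<le> a powr p + (b - a) powr p" using assms by (intro add_mono le) auto
  finally show ?thesis by simp
qed (use assms in auto)

lemma admissible_power_curve:
  assumes al: "0 < \<alpha>" "\<alpha> \<le> 1"
  shows "admissible \<alpha> (\<lambda>x t. x - \<bar>t\<bar> powr \<alpha>)"
proof -
  have d: "\<bar>\<bar>t\<bar> powr \<alpha> - \<bar>t'\<bar> powr \<alpha>\<bar> \<le> \<bar>t - t'\<bar> powr \<alpha>" if "\<bar>t'\<bar> \<le> \<bar>t\<bar>" for t t' :: real
  proof -
    have "\<bar>t'\<bar> powr \<alpha> \<le> \<bar>t\<bar> powr \<alpha>" using that al by (intro powr_mono2) auto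
    then have "\<bar>\<bar>t\<bar> powr \<alpha> - \<bar>t'\<bar> powr \<alpha>\<bar> = \<bar>t\<bar> powr \<alpha> - \<bar>t'\<bar> powr \<alpha>" by simp
    also have "\<dots> \<le> (\<bar>t\<bar> - \<bar>t'\<bar>) powr \<alpha>" using that al by (intro powr_diff_le) auto
    also have "\<dots> \<le> \<bar>t - t'\<bar> powr \<alpha>" using that al by (intro powr_mono2) auto
    finally show ?thesis .
  qed
  have "\<bar>(x - \<bar>t\<bar> powr \<alpha>) - (x - \<bar>t'\<bar> powr \<alpha>)\<bar> \<le> 1 * \<bar>t - t'\<bar> powr \<alpha>" for x t t' :: real
    using d[of t t'] d[of t' t] by (cases "\<bar>t'\<bar> \<le> \<bar>t\<bar>") (auto simp: abs_minus_commute)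
  moreover have "1 * \<bar>x - x'\<bar> \<le> \<bar>(x - \<bar>t\<bar> powr \<alpha>) - (x' - \<bar>t\<bar> powr \<alpha>)\<bar> \<and>
      \<bar>(x - \<bar>t\<bar> powr \<alpha>) - (x' - \<bar>t\<bar> powr \<alpha>)\<bar> \<le> 1 * \<bar>x - x'\<bar>" for x x' t :: real by simp
  moreover have "continuous_on (UNIV \<times> {-1..1}) (\<lambda>(x, t). x - \<bar>t\<bar> powr \<alpha>)"
    unfolding case_prod_beta' using al by (intro continuous_intros continuous_on_powr') auto
  moreover have "x - \<bar>0\<bar> powr \<alpha> = x" for x :: real by simp
  ultimately show ?thesis unfolding admissible_def using zero_less_one by blast
qed

text \<open>Bookkeeping for the gliding hump: the \<open>n + 1\<close> terms before the dominant one
  cost at most \<open>q\<close> each, and those after it sum to at most 2.\<close>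

lemma norm_suminf_ge_dominant:
  fixes a :: "nat \<Rightarrow> complex"
  assumes q: "\<And>i. i \<le> n \<Longrightarrow> cmod (a i) \<le> q" and tail: "\<And>i. i > n + 1 \<Longrightarrow> cmod (a i) \<le> (1/2) ^ (i - (n + 2))"
  shows "summable (\<lambda>i. cmod (a i))" "cmod (a (n + 1)) - (real n + 1) * q - 2 \<le> cmod (\<Sum>i. a i)"
proof -
  have tl: "cmod (a (i + (n + 2))) \<le> (1/2) ^ i" for i using tail[of "i + (n + 2)"] by simp
  have st: "summable (\<lambda>i. cmod (a (i + (n + 2))))"
    by (rule summable_comparison_test'[where g = "\<lambda>i. (1/2) ^ i" and N = 0]) (use tl in \<open>auto intro: summable_geometric\<close>)
  then show s: "summable (\<lambda>i. cmod (a i))" using summable_iff_shift[of "\<lambda>i. cmod (a i)" "n + 2"] by blast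
  have "cmod (\<Sum>i. a (i + (n + 2))) \<le> (\<Sum>i. (1/2) ^ i)"
    by (rule order_trans[OF summable_norm[OF st] suminf_le[OF tl st]]) (simp add: summable_geometric)
  also have "\<dots> = 2" by (simp add: suminf_geometric)
  finally have 1: "cmod (\<Sum>i. a (i + (n + 2))) \<le> 2" .
  have "cmod (\<Sum>i\<le>n. a i) \<le> (\<Sum>i\<le>n. q)" by (rule order_trans[OF norm_sum sum_mono]) (use q in auto)
  then have 2: "cmod (\<Sum>i\<le>n. a i) \<le> (real n + 1) * q" by (simp add: algebra_simps)
  have "(\<Sum>i. a i) = (\<Sum>i. a (i + (n + 2))) + (\<Sum>i<n + 2. a i)"
    by (rule suminf_split_initial_segment[OF summable_norm_cancel[OF s]])
  also have "(\<Sum>i<n + 2. a i) = (\<Sum>i\<le>n. a i) + a (n + 1)" by (simp add: lessThan_Suc_atMost)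
  finally have "a (n + 1) = (\<Sum>i. a i) - (\<Sum>i. a (i + (n + 2))) - (\<Sum>i\<le>n. a i)" by simp
  then have "cmod (a (n + 1)) \<le> cmod (\<Sum>i. a i) + cmod (\<Sum>i. a (i + (n + 2))) + cmod (\<Sum>i\<le>n. a i)"
    using norm_triangle_ineq4[of "(\<Sum>i. a i) - (\<Sum>i. a (i + (n + 2)))" "\<Sum>i\<le>n. a i"]
      norm_triangle_ineq4[of "\<Sum>i. a i" "\<Sum>i. a (i + (n + 2))"] by simp
  with 1 2 show "cmod (a (n + 1)) - (real n + 1) * q - 2 \<le> cmod (\<Sum>i. a i)" by simp
qed

lemma eventually_powr_neg_le:
  assumes "p > (0::real)" "\<eta> > 0" shows "\<forall>\<^sub>F L in at_top. C * L powr (- p) \<le> \<eta>"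
  using eventually_powr_ge[OF assms(1), of "C / \<eta>"] eventually_gt_at_top[of 0]
proof eventually_elim
  case (elim L)
  have "C \<le> \<eta> * L powr p" using elim(1) assms by (simp add: field_simps)
  then have "C * L powr (- p) \<le> \<eta> * L powr p * L powr (- p)" by (intro mult_right_mono) auto
  also have "\<dots> = \<eta>" using elim by (simp add: powr_minus)
  finally show ?case .
qed

lemma eventually_exp_powr_le:
  fixes a C p m \<eta> :: real
  assumes "a > 0" "C \<ge> 0" "p > 0" "m > 0" "\<eta> > 0"
  shows "\<forall>\<^sub>F L in at_top. C * L powr p * exp (- a * (L / 2) powr m) \<le> \<eta>"
proof -
  \<comment> \<open>The relation \<open>m * \<theta> = p + 1\<close> makes the exponential beat
    \<open>L powr p\<close> with a factor \<open>L powr (- 1)\<close> to spare.\<close>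
  define \<theta> where "\<theta> = (p + 1) / m"
  have mt: "m * \<theta> = p + 1" "\<theta> \<ge> 0" using assms by (auto simp: \<theta>_def)
  obtain K where K: "K > 0" "\<And>y. y > 0 \<Longrightarrow> exp (- y) \<le> K * y powr (- \<theta>)" using exp_neg_le_powr[OF mt(2)] by blast
  define C' where "C' = C * K * a powr (- \<theta>) * 2 powr (p + 1)"
  have "\<forall>\<^sub>F L in at_top. C' * L powr (- 1) \<le> \<eta>" by (rule eventually_powr_neg_le) (use assms in auto)
  then show ?thesis using eventually_gt_at_top[of 0]
  proof eventually_elim
    case (elim L)
    have "exp (- (a * (L / 2) powr m)) \<le> K * (a * (L / 2) powr m) powr (- \<theta>)" using K(2) assms elim by simp
    also have "\<dots> = K * (a powr (- \<theta>) * (L / 2) powr (- (p + 1)))"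
      using assms elim by (simp add: powr_mult powr_powr mt)
    also have "(L / 2) powr (- (p + 1)) = 2 powr (p + 1) * L powr (- (p + 1))"
      using elim powr_divide[of L 2 "- (p + 1)"] by (simp only: powr_minus[of 2] divide_inverse inverse_inverse_eq mult.commute)
    finally have "C * L powr p * exp (- (a * (L / 2) powr m)) \<le> C * L powr p * (K * (a powr (- \<theta>) * (2 powr (p + 1) * L powr (- (p + 1)))))"
      using assms by (intro mult_left_mono) auto
    also have "\<dots> = C' * (L powr p * L powr (- (p + 1)))" by (simp add: C'_def)
    also have "L powr p * L powr (- (p + 1)) = L powr (- 1)" by (simp flip: powr_add)
    finally show ?case using elim by simp
  qed
qed

lemma summable_geometric_bound:
  fixes A :: "nat \<Rightarrow> real"
  assumes "0 \<le> r" "r < 1" "\<And>j. 0 \<le> A j" "\<And>j. A j \<le> r ^ j"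
  shows "summable A"
proof (rule summable_comparison_test')
  show "summable (\<lambda>j. r ^ j)" using assms by (intro summable_geometric) simp
  show "norm (A j) \<le> r ^ j" for j using assms by simp
qed

text \<open>At each frequency at most one hump is present; \<open>F 0 = 0\<close> then collapses any
  series of expressions in the humps to one term.\<close>

lemma suminf_single:
  fixes F :: "'a::zero \<Rightarrow> 'b::real_normed_vector"
  assumes "\<forall>i. i \<noteq> k \<longrightarrow> a i = 0" "F 0 = 0"
  shows "summable (\<lambda>j. F (a j)) \<and> (\<Sum>j. F (a j)) = F (a (k::nat))"
proof -
  have "(\<lambda>j. F (a j)) sums (\<Sum>j\<in>{k}. F (a j))" by (rule sums_finite) (use assms in auto)
  then show ?thesis by (auto simp: sums_iff)
qed

section \<open>The gliding hump\<close>

context hump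
begin

text \<open>Each condition ties a frequency only to its predecessor, so dependent choice applies.
  The factor 4 makes supports disjoint. The fourth condition lets the next hump outweigh all earlier
  ones, the tail of later ones and a growing margin. By the fifth, at any time from
  \<open>c1 * T (l n)\<close> on, the damping has suppressed the next hump. The last makes the
  focusing times tend to 0.\<close>

lemma hump_sequence:
  obtains l where "\<And>n. good (l n)" "\<And>n. E (l n) \<le> (1/4) ^ n" "\<And>n. 4 * l n \<le> l (Suc n)"
    "\<And>n. (real n + 1) * Q (l n) + real n + 5 \<le> exp (-2) / 2 * l (Suc n) powr (\<epsilon> / 2)"
    "\<And>n. Q (l (Suc n)) * exp (- ((c1 * T (l n)) powr \<gamma>) * (l (Suc n) / 2) powr m) \<le> (1/2) ^ n"
    "\<And>n. T (l (Suc n)) \<le> 1 / (real n + 1)"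
proof -
  have evE: "\<forall>\<^sub>F L in at_top. E L \<le> \<eta>" if "\<eta> > 0" for \<eta>
    unfolding E_def by (rule eventually_powr_neg_le[OF eps that])
  have evT: "\<forall>\<^sub>F L in at_top. T L \<le> \<eta>" if "\<eta> > 0" for \<eta>
    using eventually_powr_neg_le[of "m / \<gamma>" \<eta> 1] m g0 that by (simp add: T_def)
  have evK: "\<forall>\<^sub>F L in at_top. K \<le> exp (-2) / 2 * L powr (\<epsilon> / 2)" for K
    using eventually_powr_ge[of "\<epsilon> / 2" "K * 2 * exp 2"] eps
    by (simp add: exp_minus field_simps)
  have evQ: "\<forall>\<^sub>F L in at_top. Q L * exp (- (\<tau> powr \<gamma>) * (L / 2) powr m) \<le> \<eta>" if "\<tau> > 0" "\<eta> > 0" for \<tau> \<eta>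
    unfolding Q_def by (rule eventually_exp_powr_le) (use that m b eps in auto)
  let ?P = "\<lambda>n L. good L \<and> E L \<le> (1/4) ^ n"
  let ?Q = "\<lambda>n L L'. 4 * L \<le> L' \<and> (real n + 1) * Q L + real n + 5 \<le> exp (-2) / 2 * L' powr (\<epsilon> / 2)
    \<and> Q L' * exp (- ((c1 * T L) powr \<gamma>) * (L' / 2) powr m) \<le> (1/2) ^ n \<and> T L' \<le> 1 / (real n + 1)"
  have "\<exists>l. \<forall>n. ?P n (l n) \<and> ?Q n (l n) (l (Suc n))"
  proof (rule dependent_nat_choice)
    have "\<forall>\<^sub>F L in at_top. ?P 0 L" by (intro eventually_conj eventually_good evE) auto
    then show "\<exists>L. ?P 0 L" by (rule eventually_happens'[OF trivial_limit_at_top_linorder])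
  next
    fix L n assume "?P n L"
    then have "L \<ge> 1" by (simp add: good_def)
    then have "c1 * T L > 0" using c1 T_bounds by simp
    then have "\<forall>\<^sub>F L' in at_top. ?P (Suc n) L' \<and> ?Q n L L'"
      by (intro eventually_conj eventually_good evE evT evQ evK eventually_ge_at_top) auto
    then show "\<exists>L'. ?P (Suc n) L' \<and> ?Q n L L'" by (rule eventually_happens'[OF trivial_limit_at_top_linorder])
  qed
  then show thesis using that by blast
qed

lemma divergent_example:
  "\<exists>f. sobolev s f \<and> \<not> converges_ae m \<gamma> (\<lambda>x t. x - \<bar>t\<bar> powr \<alpha>) f"
proof -
  obtain l where l: "\<And>n. good (l n)" "\<And>n. E (l n) \<le> (1/4) ^ n" "\<And>n. 4 * l n \<le> l (Suc n)"
    "\<And>n. (real n + 1) * Q (l n) + real n + 5 \<le> exp (-2) / 2 * l (Suc n) powr (\<epsilon> / 2)"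
    "\<And>n. Q (l (Suc n)) * exp (- ((c1 * T (l n)) powr \<gamma>) * (l (Suc n) / 2) powr m) \<le> (1/2) ^ n"
    "\<And>n. T (l (Suc n)) \<le> 1 / (real n + 1)" using hump_sequence by blast
  have l1: "l n \<ge> 1" for n using l(1)[of n] by (simp add: good_def)
  have l0: "l n > 0" for n using l1[of n] by simp
  have mono: "i \<le> j \<Longrightarrow> l i \<le> l j" for i j
    by (rule lift_Suc_mono_le[of l]) (use l(3) l0 in \<open>smt (verit)\<close>)
  have sep: "4 * l i \<le> l j" if "i < j" for i j using mono[of "Suc i" j] l(3)[of i] that by simp
  have Qm: "Q (l i) \<le> Q (l j)" if "i \<le> j" for i j
    unfolding Q_def using mono[OF that] l0[of i] m b eps by (intro mult_left_mono powr_mono2) auto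
  have Tm: "T (l j) \<le> T (l i)" if "i \<le> j" for i j
    unfolding T_def using mono[OF that] l0[of i] m g0 by (intro powr_mono2') auto
  \<comment> \<open>A hump at \<open>L\<close> is supported between \<open>L / 2\<close> and
    \<open>3 / 2 * L\<close>; a factor 4 between frequencies separates these intervals.\<close>
  have single: "\<exists>j. \<forall>i. i \<noteq> j \<longrightarrow> G (l i) \<xi> = 0" for \<xi>
  proof (rule ccontr)
    assume c: "\<not> ?thesis"
    then obtain i where i: "G (l i) \<xi> \<noteq> 0" by blast
    from c obtain j where j: "j \<noteq> i" "G (l j) \<xi> \<noteq> 0" by blast
    have "\<not> (4 * l i \<le> l j)" "\<not> (4 * l j \<le> l i)"
      using G_support[OF l1 i] G_support[OF l1 j(2)] l0[of i] l0[of j] by auto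
    with sep[of i j] sep[of j i] j(1) show False by linarith
  qed

  define h where "h \<xi> = (\<Sum>j. G (l j) \<xi>)" for \<xi>
  have small: "(\<integral>\<xi>. (cmod (G (l j) \<xi>))\<^sup>2 \<partial>lborel) \<le> 1 * (1/4) ^ j" for j
  proof -
    have "(\<integral>\<xi>. (cmod (G (l j) \<xi>))\<^sup>2 \<partial>lborel) \<le> (\<integral>\<xi>. (1 + \<xi>\<^sup>2) powr s * (cmod (G (l j) \<xi>))\<^sup>2 \<partial>lborel)"
    proof (rule integral_mono[OF G_integrable(2)[OF l0] G_weighted(1)[OF l(1)]])
      fix \<xi> :: real
      have "1 \<le> (1 + \<xi>\<^sup>2) powr s" using s by (intro ge_one_powr_ge_zero) auto
      then show "(cmod (G (l j) \<xi>))\<^sup>2 \<le> (1 + \<xi>\<^sup>2) powr s * (cmod (G (l j) \<xi>))\<^sup>2"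
        using mult_right_mono[of 1 "(1 + \<xi>\<^sup>2) powr s" "(cmod (G (l j) \<xi>))\<^sup>2"] by simp
    qed
    also have "\<dots> \<le> 1 * (1/4) ^ j" using G_weighted(2)[OF l(1), of j] l(2)[of j] by simp
    finally show ?thesis .
  qed
  obtain f where f: "fourier_L2 f (\<lambda>\<xi>. \<Sum>j. G (l j) \<xi>)"
    by (rule fourier_L2_series[of "\<lambda>j. G (l j)", OF G_integrable(1)[OF l0] G_bound'[OF l0] G_isCont small])
  then have fh: "fourier_L2 f h" by (simp add: h_def[abs_def])
  then have hL2: "L2_fun h" by (simp add: fourier_L2_iff)
  \<comment> \<open>Supports being disjoint, the square of the series is the series of the squares,
    and the weighted norms are summable by the choice of the frequencies.\<close>
  have "integrable lborel (\<lambda>\<xi>. (1 + \<xi>\<^sup>2) powr s * (cmod (h \<xi>))\<^sup>2)"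
  proof -
    have eq: "(1 + \<xi>\<^sup>2) powr s * (cmod (h \<xi>))\<^sup>2 = (\<Sum>j. (1 + \<xi>\<^sup>2) powr s * (cmod (G (l j) \<xi>))\<^sup>2)" for \<xi>
    proof -
      obtain k where k: "\<forall>i. i \<noteq> k \<longrightarrow> G (l i) \<xi> = 0" using single by blast
      have "h \<xi> = G (l k) \<xi>" using suminf_single[OF k, of "\<lambda>z. z"] by (simp add: h_def)
      moreover have "(\<Sum>j. (1 + \<xi>\<^sup>2) powr s * (cmod (G (l j) \<xi>))\<^sup>2) = (1 + \<xi>\<^sup>2) powr s * (cmod (G (l k) \<xi>))\<^sup>2"
        using suminf_single[OF k, of "\<lambda>z. (1 + \<xi>\<^sup>2) powr s * (cmod z)\<^sup>2"] by simp
      ultimately show ?thesis by simp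
    qed
    have sm: "summable (\<lambda>j. norm ((1 + \<xi>\<^sup>2) powr s * (cmod (G (l j) \<xi>))\<^sup>2))" for \<xi>
    proof -
      obtain k where k: "\<forall>i. i \<noteq> k \<longrightarrow> G (l i) \<xi> = 0" using single by blast
      show ?thesis using suminf_single[OF k, of "\<lambda>z. norm ((1 + \<xi>\<^sup>2) powr s * (cmod z)\<^sup>2)"] by simp
    qed
    have "(\<integral>\<xi>. norm ((1 + \<xi>\<^sup>2) powr s * (cmod (G (l j) \<xi>))\<^sup>2) \<partial>lborel) \<le> (1/4) ^ j" for j
      using G_weighted(2)[OF l(1), of j] l(2)[of j] by (simp add: abs_mult)
    then have si: "summable (\<lambda>j. \<integral>\<xi>. norm ((1 + \<xi>\<^sup>2) powr s * (cmod (G (l j) \<xi>))\<^sup>2) \<partial>lborel)"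
      by (rule summable_geometric_bound[of "1/4", rotated 3]) (auto intro!: Bochner_Integration.integral_nonneg)
    show ?thesis unfolding eq
      by (rule integrable_suminf[OF G_weighted(1)[OF l(1)] _ si]) (use sm in auto)
  qed
  with fh have "sobolev s f" unfolding sobolev_def fourier_L2_def by blast
  moreover have "\<not> converges_ae m \<gamma> (\<lambda>x t. x - \<bar>t\<bar> powr \<alpha>) f"
  proof
    assume conv: "converges_ae m \<gamma> (\<lambda>x t. x - \<bar>t\<bar> powr \<alpha>) f"
    have no: "\<not> ((\<lambda>t. Pop m \<gamma> f (x - \<bar>t\<bar> powr \<alpha>) t) \<longlongrightarrow> f x) (at_right 0)" if x: "1 \<le> x" "x \<le> 2" for x
    proof
      assume lim: "((\<lambda>t. Pop m \<gamma> f (x - \<bar>t\<bar> powr \<alpha>) t) \<longlongrightarrow> f x) (at_right 0)"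
      let ?u = "\<lambda>t j. \<integral>\<xi>. psymb m (x - t powr \<alpha>) t (t powr \<gamma>) \<xi> * G (l j) \<xi> \<partial>lborel"
      \<comment> \<open>The \<open>n\<close>-th time focuses hump \<open>Suc n\<close>, so hump
        \<open>n\<close> and its predecessors count as the past.\<close>
      have "\<forall>n. \<exists>t. c1 * T (l (Suc n)) \<le> t \<and> t \<le> T (l (Suc n)) \<and> exp (-2) / 2 * l (Suc n) powr (\<epsilon> / 2) \<le> cmod (?u t (Suc n))"
      proof
        fix n show "\<exists>t. c1 * T (l (Suc n)) \<le> t \<and> t \<le> T (l (Suc n)) \<and> exp (-2) / 2 * l (Suc n) powr (\<epsilon> / 2) \<le> cmod (?u t (Suc n))"
          by (rule hump_large[OF l(1)[of "Suc n"] x]) blast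
      qed
      from choice[OF this] obtain t where t: "\<And>n. c1 * T (l (Suc n)) \<le> t n" "\<And>n. t n \<le> T (l (Suc n))"
        "\<And>n. exp (-2) / 2 * l (Suc n) powr (\<epsilon> / 2) \<le> cmod (?u (t n) (Suc n))" by blast
      have cT: "0 < c1 * T (l j)" for j using c1 T_bounds[OF l1[of j]] by simp
      have t0: "t n > 0" for n using t(1)[of n] cT[of "Suc n"] by linarith
      have "t \<longlonglongrightarrow> 0"
      proof (rule tendsto_sandwich)
        show "\<forall>\<^sub>F n in sequentially. 0 \<le> t n" by (rule always_eventually) (use t0 less_imp_le in blast)
        show "\<forall>\<^sub>F n in sequentially. t n \<le> inverse (real (Suc n))"
          by (rule always_eventually) (use order_trans[OF t(2) l(6)] in \<open>simp add: inverse_eq_divide add.commute\<close>)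
        show "(\<lambda>n. inverse (real (Suc n))) \<longlonglongrightarrow> 0" by (rule LIMSEQ_inverse_real_of_nat)
      qed simp
      then have "filterlim t (at_right 0) sequentially" using t0 by (auto simp: filterlim_at intro!: always_eventually less_imp_neq[THEN not_sym])
      from filterlim_compose[OF lim this] have "(\<lambda>n. Pop m \<gamma> f (x - \<bar>t n\<bar> powr \<alpha>) (t n)) \<longlonglongrightarrow> f x" .
      then have "Bseq (\<lambda>n. Pop m \<gamma> f (x - \<bar>t n\<bar> powr \<alpha>) (t n))" by (intro convergent_imp_Bseq convergentI)
      then obtain B where B: "\<And>n. cmod (Pop m \<gamma> f (x - \<bar>t n\<bar> powr \<alpha>) (t n)) \<le> B" by (auto simp: Bseq_def)
      have big: "real n \<le> 2 * pi * B" for n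
      proof -
        define \<psi> where "\<psi> = psymb m (x - t n powr \<alpha>) (t n) (t n powr \<gamma>)"
        define a where "a j = (\<integral>\<xi>. \<psi> \<xi> * G (l j) \<xi> \<partial>lborel)" for j
        have c0: "t n powr \<gamma> > 0" using t0[of n] by simp
        have L2G: "L2_fun (G (l j))" for j using G_integrable(2)[OF l0] by (simp add: L2_fun_def)
        have i: "integrable lborel (\<lambda>\<xi>. \<psi> \<xi> * G (l j) \<xi>)" for j
          unfolding \<psi>_def by (rule integrable_psymb_mult[OF m(1) c0 L2G])
        have n1: "(\<integral>\<xi>. cmod (\<psi> \<xi> * G (l j) \<xi>) \<partial>lborel) \<le> Q (l j)" for j
        proof -
          have "(\<integral>\<xi>. cmod (\<psi> \<xi> * G (l j) \<xi>) \<partial>lborel) \<le> (\<integral>\<xi>. cmod (G (l j) \<xi>) \<partial>lborel)"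
            by (rule integral_mono[OF integrable_norm[OF i] integrable_norm[OF G_integrable(1)[OF l0]]])
              (use psymb_le_1[of "t n powr \<gamma>" m] in \<open>auto simp: norm_mult \<psi>_def intro!: mult_left_le_one_le\<close>)
          then show ?thesis using G_L1[OF l1, of j] by linarith
        qed
        \<comment> \<open>For the later humps \<open>t n\<close> is a long time: it is at least
          \<open>c1 * T (l k)\<close> for the frequency \<open>l k\<close> just before
          \<open>l j\<close>, and by then the damping has made hump \<open>j\<close> geometrically
          small.\<close>
        have n2: "(\<integral>\<xi>. cmod (\<psi> \<xi> * G (l j) \<xi>) \<partial>lborel) \<le> (1/2) ^ (j - (n + 2))" if j: "j > n + 1" for j
        proof -
          obtain k where k: "j = Suc k" "k \<ge> Suc n" using j by (cases j) auto
          have "c1 * T (l k) \<le> t n" using mult_left_mono[OF Tm[OF k(2)], of c1] c1 t(1)[of n] by linarith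
          then have tk: "(c1 * T (l k)) powr \<gamma> \<le> t n powr \<gamma>" using cT[of k] g0 by (intro powr_mono2) auto
          let ?e = "exp (- ((c1 * T (l k)) powr \<gamma>) * (l j / 2) powr m)"
          have pt: "cmod (\<psi> \<xi> * G (l j) \<xi>) \<le> ?e * cmod (G (l j) \<xi>)" for \<xi>
          proof (cases "G (l j) \<xi> = 0")
            case False
            then have \<xi>: "l j / 2 \<le> \<xi>" using G_support[OF l1] by blast
            have "(l j / 2) powr m \<le> \<bar>\<xi>\<bar> powr m" using \<xi> l0[of j] m by (intro powr_mono2) auto
            then have "(c1 * T (l k)) powr \<gamma> * (l j / 2) powr m \<le> t n powr \<gamma> * \<bar>\<xi>\<bar> powr m" by (intro mult_mono tk) auto
            then show ?thesis by (auto simp: norm_mult \<psi>_def psymb_def intro!: mult_right_mono)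
          qed simp
          have "(\<integral>\<xi>. cmod (\<psi> \<xi> * G (l j) \<xi>) \<partial>lborel) \<le> (\<integral>\<xi>. ?e * cmod (G (l j) \<xi>) \<partial>lborel)"
            by (rule integral_mono[OF integrable_norm[OF i] integrable_mult_right[OF integrable_norm[OF G_integrable(1)[OF l0]]] pt])
          also have "\<dots> = (\<integral>\<xi>. cmod (G (l j) \<xi>) \<partial>lborel) * ?e" by simp
          also have "\<dots> \<le> Q (l j) * ?e" by (intro mult_right_mono G_L1 l1) auto
          also have "\<dots> \<le> (1/2) ^ k" using l(5)[of k] by (simp add: k)
          also have "\<dots> \<le> (1/2) ^ (j - (n + 2))" using k by (intro power_decreasing) auto
          finally show ?thesis .
        qed
        have a1: "cmod (a j) \<le> Q (l n)" if "j \<le> n" for j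
          unfolding a_def by (rule order_trans[OF integral_norm_bound order_trans[OF n1 Qm[OF that]]])
        have a2: "cmod (a j) \<le> (1/2) ^ (j - (n + 2))" if "j > n + 1" for j
          unfolding a_def by (rule order_trans[OF integral_norm_bound n2[OF that]])
        have "summable (\<lambda>j. cmod (complex_of_real (\<integral>\<xi>. cmod (\<psi> \<xi> * G (l j) \<xi>) \<partial>lborel)))"
          by (rule norm_suminf_ge_dominant(1)[of n _ "Q (l n)"]) (use order_trans[OF n1 Qm] n2 in auto)
        then have si: "summable (\<lambda>j. \<integral>\<xi>. cmod (\<psi> \<xi> * G (l j) \<xi>) \<partial>lborel)" by simp
        have pw: "\<psi> \<xi> * h \<xi> = (\<Sum>j. \<psi> \<xi> * G (l j) \<xi>) \<and> summable (\<lambda>j. cmod (\<psi> \<xi> * G (l j) \<xi>))" for \<xi>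
        proof -
          obtain k where k: "\<forall>i. i \<noteq> k \<longrightarrow> G (l i) \<xi> = 0" using single by blast
          show ?thesis using suminf_single[OF k, of "\<lambda>z. z"] suminf_single[OF k, of "\<lambda>z. \<psi> \<xi> * z"]
              suminf_single[OF k, of "\<lambda>z. cmod (\<psi> \<xi> * z)"] by (simp add: h_def)
        qed
        have "(\<integral>\<xi>. \<psi> \<xi> * h \<xi> \<partial>lborel) = (\<integral>\<xi>. (\<Sum>j. \<psi> \<xi> * G (l j) \<xi>) \<partial>lborel)" using pw by simp
        also have "\<dots> = (\<Sum>j. a j)" unfolding a_def
          by (rule integral_suminf[OF i _ si]) (use pw in auto)
        finally have int: "(\<integral>\<xi>. \<psi> \<xi> * h \<xi> \<partial>lborel) = (\<Sum>j. a j)" .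
        have "real n \<le> cmod (a (n + 1)) - (real n + 1) * Q (l n) - 2"
          using t(3)[of n] l(4)[of n] by (simp add: a_def \<psi>_def)
        also have "\<dots> \<le> cmod (\<Sum>j. a j)" by (rule norm_suminf_ge_dominant(2)[OF a1 a2])
        also have "\<dots> = 2 * pi * cmod (Pop m \<gamma> f (x - \<bar>t n\<bar> powr \<alpha>) (t n))"
          unfolding Pop_eq[OF fh] int[symmetric] using t0[of n]
          by (simp add: norm_mult norm_divide \<psi>_def psymb_def scaleR_conv_of_real mult.commute mult.left_commute)
        also have "\<dots> \<le> 2 * pi * B" using B by (intro mult_left_mono) auto
        finally show ?thesis .
      qed
      obtain n where "2 * pi * B < real n" using reals_Archimedean2 by blast
      with big[of n] show False by simp
    qed
    from conv have "AE x in lborel. x \<notin> {1..2::real}"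
      unfolding converges_ae_def by eventually_elim (use no in auto)
    then have "{1..2::real} \<in> null_sets lborel" by (subst AE_iff_null_sets) auto
    then show False by (auto simp: null_sets_def emeasure_lborel_Icc_eq)
  qed
  ultimately show ?thesis by blast
qed

end

theorem theorem4p2:
  fixes m \<gamma> \<alpha> :: real
  assumes "0 < m" "m < 1" "0 < \<gamma>" "1/2 < \<alpha>" "\<alpha> \<le> 1"
  shows "(\<forall>\<Gamma>. admissible \<alpha> \<Gamma> \<longrightarrow>
            (\<forall>s f. s > s_crit m \<alpha> \<gamma> \<longrightarrow> sobolev s f \<longrightarrow> converges_ae m \<gamma> \<Gamma> f))
       \<and> (\<exists>\<Gamma>. admissible \<alpha> \<Gamma> \<and>
            (\<forall>s. 0 \<le> s \<longrightarrow> s < s_crit m \<alpha> \<gamma> \<longrightarrow>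
                 (\<exists>f. sobolev s f \<and> \<not> converges_ae m \<gamma> \<Gamma> f)))"
proof (intro conjI exI[of _ "\<lambda>x t. x - \<bar>t\<bar> powr \<alpha>"] allI impI)
  show "converges_ae m \<gamma> \<Gamma> f" if "admissible \<alpha> \<Gamma>" "s_crit m \<alpha> \<gamma> < s" "sobolev s f" for \<Gamma> s f
    using convergence[OF assms that] .
  show "admissible \<alpha> (\<lambda>x t. x - \<bar>t\<bar> powr \<alpha>)" using admissible_power_curve assms by simp
  show "\<exists>f. sobolev s f \<and> \<not> converges_ae m \<gamma> (\<lambda>x t. x - \<bar>t\<bar> powr \<alpha>) f" if s: "0 \<le> s" "s < s_crit m \<alpha> \<gamma>" for s
  proof -
    \<comment> \<open>A nonnegative \<open>s\<close> below \<open>s_crit\<close> forces the second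
      entry of the minimum to be positive, which is the locale's assumption
      \<open>m * \<alpha> < \<gamma>\<close>; for smaller \<gamma> the claim is vacuous.\<close>
    have "0 < max (1 - m * \<alpha> / \<gamma>) 0" using s by (simp add: s_crit_def)
    then have "m * \<alpha> < \<gamma>" using assms by (simp add: less_max_iff_disj)
    then interpret hump m \<alpha> \<gamma> s using assms s by unfold_locales auto
    show ?thesis by (rule divergent_example)
  qed
qed

end
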